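(* Let $\hbar\in\mathbb{R}_{>0}\setminus\mathbb{Q}$, let $\Gamma^{(0)}$ be a $\mathcal{D}$-seed of rank $n$ with exchange matrix $\varepsilon^{(0)}$, and let $i,j\in\{1,\dots,n\}$ satisfy $\varepsilon^{(0)}_{ij}=-3\,\varepsilon^{(0)}_{ji}$ and $|\varepsilon^{(0)}_{ij}|=3$. Put $$\Gamma^{(1)}=\mu_i(\Gamma^{(0)}),\ \Gamma^{(2)}=\mu_j(\Gamma^{(1)}),\ \Gamma^{(3)}=\mu_i(\Gamma^{(2)}),\ \Gamma^{(4)}=\mu_j(\Gamma^{(3)}),$$ $$\Gamma^{(5)}=\mu_j(\Gamma^{(0)}),\ \Gamma^{(6)}=\mu_i(\Gamma^{(5)}),\ \Gamma^{(7)}=\mu_j(\Gamma^{(6)}),$$ so that $\Gamma^{(4)}=\mu_i(\Gamma^{(7)})$. Let $c_{G_2}\in\mathrm{U}(1)\subset\mathbb{C}^\times$ be the constant such that $$\mathbf{K}^\hbar_{\Gamma^{(0)}\stackrel{i}{\to}\Gamma^{(1)}}\,\mathbf{K}^\hbar_{\Gamma^{(1)}\stackrel{j}{\to}\Gamma^{(2)}}\,\mathbf{K}^\hbar_{\Gamma^{(2)}\stackrel{i}{\to}\Gamma^{(3)}}\,\mathbf{K}^\hbar_{\Gamma^{(3)}\stackrel{j}{\to}\Gamma^{(4)}}=c_{G_2}\cdot\mathbf{K}^\hbar_{\Gamma^{(0)}\stackrel{j}{\to}\Gamma^{(5)}}\,\mathbf{K}^\hbar_{\Gamma^{(5)}\stackrel{i}{\to}\Gamma^{(6)}}\,\mathbf{K}^\hbar_{\Gamma^{(6)}\stackrel{j}{\to}\Gamma^{(7)}}\,\mathbf{K}^\hbar_{\Gamma^{(7)}\stackrel{i}{\to}\Gamma^{(4)}}$$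 (such a constant exists by a theorem of Fock and Goncharov). Then $c_{G_2}=1$.
   Context: **Seeds and mutations.** Fix $n\ge1$; $[a]_+=\max(a,0)$. A $\mathcal{D}$-seed $\Gamma$ has an exchange matrix $\varepsilon=(\varepsilon_{ij})\in\mathbb{Z}^{n\times n}$ and a skew-symmetrizer $d=(d_1,\dots,d_n)$ of positive integers such that $\varepsilon_{ij}d_j^{-1}=-\varepsilon_{ji}d_i^{-1}$ for all $i,j$. (It also carries $2n$ formal cluster variables $B_i,X_i$, which play no role in the operators below; all operators depend only on $(\varepsilon,d)$.) The mutated seed $\Gamma'=\mu_k(\Gamma)$ has data $(\varepsilon',d')$ with $d'=d$, $\varepsilon'_{ij}=-\varepsilon_{ij}$ if $i=k$ or $j=k$, and $\varepsilon'_{ij}=\varepsilon_{ij}+\frac12(|\varepsilon_{ik}|\varepsilon_{kj}+\varepsilon_{ik}|\varepsilon_{kj}|)$ otherwise. **Hilbert space and operators.** $\hbar_k:=\hbar/d_k$. To each seed is attached $\mathscr{H}_\Gamma=L^2(\mathbb{R}^n,da_1\cdots da_n)$ and the dense subspace $D_\Gamma$ spanned by the functions $e^{-\sum_i(\alpha_ia_i^2+\beta_ia_i)}P(a_1,\dots,a_n)$ with $\alpha_i,\beta_i\in\mathbb{C}$, $\mathrm{Re}(\alpha_i)>0$, $P$ a complex polynomial. On $D_\Gamma$ put $\widehat{\mathbf q}_i^\hbar=a_i$ (multiplication), $\widehat{\mathbf p}_i^\hbar=2\pi\sqrt{-1}\,\hbar\,\frac{\partial}{\partial a_i}$, and $$\widehat{\mathbf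 x}^\hbar_{\Gamma;i}=\tfrac12d_i^{-1}\widehat{\mathbf p}_i^\hbar-\sum_{j}\varepsilon_{ij}\widehat{\mathbf q}_j^\hbar,\qquad \widehat{\widetilde{\mathbf x}}{}^\hbar_{\Gamma;i}=\tfrac12d_i^{-1}\widehat{\mathbf p}_i^\hbar+\sum_{j}\varepsilon_{ij}\widehat{\mathbf q}_j^\hbar .$$ These are essentially self-adjoint on $D_\Gamma$; the same symbols denote the unique self-adjoint extensions inside functional calculus. **Quantum dilogarithm.** For real $h>0$ and real $z$, $$\Phi^h(z)=\exp\left(-\frac14\int_\Omega\frac{e^{-\sqrt{-1}\,pz}}{\sinh(\pi p)\sinh(\pi hp)}\frac{dp}{p}\right),$$ where $\Omega$ is the real line (oriented left to right) avoiding the origin by a small half circle above it. One has $|\Phi^h(z)|=1$ for real $z$. **Intertwiner.** For $\Gamma'=\mu_k(\Gamma)$, $\mathbf{K}^\hbar_{\Gamma\stackrel{k}{\to}\Gamma'}:\mathscr{H}_{\Gamma'}\to\mathscr{H}_\Gamma$ is the unitary map $$\mathbf{K}^\hbar_{\Gamma\stackrel{k}{\to}\Gamma'}=\Phi^{\hbar_k}(\widehat{\mathbf x}^\hbar_{\Gamma;k})\,\bigl(\Phi^{\hbar_k}(\widehat{\widetilde{\mathbf x}}{}^\hbar_{\Gamma;k})\bigr)^{-1}\circ\mathbf{K}'_{\Gamma\stackrel{k}{\to}\Gamma'},$$ where the first two factors are defined by functional calculus and $(\mathbf{K}'_{\Gamma\stackrel{k}{\to}\Gamma'}f)(a_1,\dots,a_n)=f(a_1',\dots,a_n')$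 with $a'_i=a_i$ for $i\ne k$ and $a'_k=-a_k+\sum_{j=1}^n[-\varepsilon_{kj}]_+a_j$. *)

theory Defs
  imports "HOL-Complex_Analysis.Contour_Integration"
begin

section \<open>The Hilbert space of square-integrable functions\<close>

definition square_integrable :: "('a::euclidean_space \<Rightarrow> complex) \<Rightarrow> bool" where
  "square_integrable f \<longleftrightarrow>
     f \<in> borel_measurable lborel \<and> integrable lborel (\<lambda>x. (cmod (f x))\<^sup>2)"

definition L2_eq :: "('a::euclidean_space \<Rightarrow> complex) \<Rightarrow> ('a \<Rightarrow> complex) \<Rightarrow> bool" where
  "L2_eq f g \<longleftrightarrow> square_integrable f \<and> square_integrable g \<and> (AE x in lborel. f x = g x)"

lemma square_integrable_zero: "square_integrable (\<lambda>_. 0)"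
  by (simp add: square_integrable_def)

lemma square_integrable_add:
  assumes "square_integrable f" "square_integrable g"
  shows "square_integrable (\<lambda>x. f x + g x)"
proof -
  have [measurable]: "f \<in> borel_measurable lborel" "g \<in> borel_measurable lborel"
    using assms by (auto simp: square_integrable_def)
  have le: "(cmod (a + b))\<^sup>2 \<le> 2 * (cmod a)\<^sup>2 + 2 * (cmod b)\<^sup>2" for a b :: complex
  proof -
    have "(cmod (a + b))\<^sup>2 \<le> (cmod a + cmod b)\<^sup>2"
      by (intro power_mono norm_triangle_ineq) auto
    also have "\<dots> \<le> 2 * (cmod a)\<^sup>2 + 2 * (cmod b)\<^sup>2"
      using sum_squares_bound[of "cmod a" "cmod b"] by (simp add: power2_sum)
    finally show ?thesis .
  qed
  have "integrable lborel (\<lambda>x. 2 * (cmod (f x))\<^sup>2 + 2 * (cmod (g x))\<^sup>2)"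
    using assms by (auto simp: square_integrable_def)
  then have "integrable lborel (\<lambda>x. (cmod (f x + g x))\<^sup>2)"
    by (rule Bochner_Integration.integrable_bound) (auto intro!: AE_I2 simp: le)
  then show ?thesis by (simp add: square_integrable_def)
qed

lemma square_integrable_scale:
  assumes "square_integrable f"
  shows "square_integrable (\<lambda>x. c * f x)"
  using assms by (auto simp: square_integrable_def norm_mult power_mult_distrib)

lemma integrable_mult_cnj:
  assumes "square_integrable f" "square_integrable g"
  shows "integrable lborel (\<lambda>x. f x * cnj (g x))"
proof -
  have [measurable]: "f \<in> borel_measurable lborel" "g \<in> borel_measurable lborel"
    using assms by (auto simp: square_integrable_def)
  have [measurable]: "(\<lambda>x. cnj (g x)) \<in> borel_measurable lborel"
    by (rule borel_measurable_continuous_on[where f = cnj]) (auto intro: continuous_intros)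
  have le: "cmod (a * cnj b) \<le> (cmod a)\<^sup>2 + (cmod b)\<^sup>2" for a b :: complex
  proof -
    have "2 * (cmod a * cmod b) \<le> (cmod a)\<^sup>2 + (cmod b)\<^sup>2"
      using sum_squares_bound[of "cmod a" "cmod b"] by simp
    moreover have "0 \<le> cmod a * cmod b" by simp
    ultimately show ?thesis unfolding norm_mult complex_mod_cnj by linarith
  qed
  have "integrable lborel (\<lambda>x. (cmod (f x))\<^sup>2 + (cmod (g x))\<^sup>2)"
    using assms by (auto simp: square_integrable_def)
  then show ?thesis
    by (rule Bochner_Integration.integrable_bound) (use le in auto)
qed

quotient_type (overloaded) 'a L2 = "'a::euclidean_space \<Rightarrow> complex" / partial: L2_eq
proof (rule part_equivpI)
  show "\<exists>f::'a \<Rightarrow> complex. L2_eq f f"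
    by (rule exI[of _ "\<lambda>_. 0"]) (simp add: L2_eq_def square_integrable_zero)
  show "symp (L2_eq :: ('a \<Rightarrow> complex) \<Rightarrow> _)"
    by (rule sympI) (auto simp: L2_eq_def)
  show "transp (L2_eq :: ('a \<Rightarrow> complex) \<Rightarrow> _)"
    by (rule transpI) (auto simp: L2_eq_def elim: AE_mp)
qed

lift_definition scaleC :: "complex \<Rightarrow> 'a::euclidean_space L2 \<Rightarrow> 'a L2" (infixr "*\<^sub>C" 75)
  is "\<lambda>c f x. c * f x"
  by (auto simp: L2_eq_def square_integrable_scale)

lift_definition cinner :: "'a::euclidean_space L2 \<Rightarrow> 'a L2 \<Rightarrow> complex"
  is "\<lambda>f g. \<integral>x. f x * cnj (g x) \<partial>lborel"
proof -
  fix f1 f2 g1 g2 :: "'a \<Rightarrow> complex"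
  assume f: "L2_eq f1 f2" and g: "L2_eq g1 g2"
  have "AE x in lborel. f1 x * cnj (g1 x) = f2 x * cnj (g2 x)"
    using f g by (auto simp: L2_eq_def elim: AE_mp)
  moreover have "integrable lborel (\<lambda>x. f1 x * cnj (g1 x))" "integrable lborel (\<lambda>x. f2 x * cnj (g2 x))"
    using f g by (auto simp: L2_eq_def integrable_mult_cnj)
  ultimately show "(\<integral>x. f1 x * cnj (g1 x) \<partial>lborel) = (\<integral>x. f2 x * cnj (g2 x) \<partial>lborel)"
    by (intro integral_cong_AE) auto
qed

instantiation L2 :: (euclidean_space) real_inner
begin

lift_definition zero_L2 :: "'a L2" is "\<lambda>_. 0"
  by (simp add: L2_eq_def square_integrable_zero)

lift_definition plus_L2 :: "'a L2 \<Rightarrow> 'a L2 \<Rightarrow> 'a L2" is "\<lambda>f g x. f x + g x"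
  by (auto simp: L2_eq_def square_integrable_add elim: AE_mp)

definition uminus_L2 :: "'a L2 \<Rightarrow> 'a L2" where "uminus_L2 u = (-1) *\<^sub>C u"

definition minus_L2 :: "'a L2 \<Rightarrow> 'a L2 \<Rightarrow> 'a L2" where "minus_L2 u v = u + - v"

definition scaleR_L2 :: "real \<Rightarrow> 'a L2 \<Rightarrow> 'a L2" where "scaleR_L2 r u = complex_of_real r *\<^sub>C u"

definition inner_L2 :: "'a L2 \<Rightarrow> 'a L2 \<Rightarrow> real" where "inner_L2 u v = Re (cinner u v)"

definition norm_L2 :: "'a L2 \<Rightarrow> real" where "norm_L2 u = sqrt (inner u u)"

definition sgn_L2 :: "'a L2 \<Rightarrow> 'a L2" where "sgn_L2 u = inverse (norm u) *\<^sub>R u"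

definition dist_L2 :: "'a L2 \<Rightarrow> 'a L2 \<Rightarrow> real" where "dist_L2 u v = norm (u - v)"

definition uniformity_L2 :: "('a L2 \<times> 'a L2) filter" where
  "uniformity_L2 = (INF e\<in>{0 <..}. principal {(x, y). dist x y < e})"

definition open_L2 :: "'a L2 set \<Rightarrow> bool" where
  "open_L2 S \<longleftrightarrow> (\<forall>x\<in>S. \<forall>\<^sub>F (x', y) in uniformity. x' = x \<longrightarrow> y \<in> S)"

instance
proof
  fix u v w :: "'a L2" and a b :: real
  have eqI: "L2_eq f g" if "square_integrable f" "\<And>x. f x = g x" for f g :: "'a \<Rightarrow> complex"
    using that by (simp add: L2_eq_def ext[of f g])
  show "u + v + w = u + (v + w)"
    by transfer (auto intro!: eqI square_integrable_add simp: L2_eq_def algebra_simps)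
  show "u + v = v + u"
    by transfer (auto intro!: eqI square_integrable_add simp: L2_eq_def algebra_simps)
  show "0 + u = u"
    by transfer (auto simp: L2_eq_def)
  show "- u + u = 0"
    unfolding uminus_L2_def
    by transfer (auto simp: L2_eq_def square_integrable_zero)
  show "u - v = u + - v" by (rule minus_L2_def)
  show "a *\<^sub>R (u + v) = a *\<^sub>R u + a *\<^sub>R v"
    unfolding scaleR_L2_def
    by transfer (auto intro!: eqI square_integrable_add square_integrable_scale
        simp: L2_eq_def distrib_left)
  show "(a + b) *\<^sub>R u = a *\<^sub>R u + b *\<^sub>R u"
    unfolding scaleR_L2_def
    by transfer (auto intro!: eqI square_integrable_add square_integrable_scale
        simp: L2_eq_def distrib_right)
  show "a *\<^sub>R b *\<^sub>R u = (a * b) *\<^sub>R u"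
    unfolding scaleR_L2_def
    by transfer (auto intro!: eqI square_integrable_scale simp: L2_eq_def mult.assoc)
  show "1 *\<^sub>R u = u"
    unfolding scaleR_L2_def by transfer (auto simp: L2_eq_def)
  show "dist u v = norm (u - v)" by (rule dist_L2_def)
  show "sgn u = inverse (norm u) *\<^sub>R u" by (rule sgn_L2_def)
  show "uniformity = (INF e\<in>{0 <..}. principal {(x, y :: 'a L2). dist x y < e})"
    by (rule uniformity_L2_def)
  show "open S \<longleftrightarrow> (\<forall>x\<in>S. \<forall>\<^sub>F (x', y) in uniformity. x' = x \<longrightarrow> y \<in> S)" for S :: "'a L2 set"
    by (rule open_L2_def)
  show "inner u v = inner v u"
  proof -
    have "cinner u v = cnj (cinner v u)"
      by transfer (simp add: mult.commute flip: Bochner_Integration.integral_cnj)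
    then show ?thesis by (simp add: inner_L2_def)
  qed
  show "inner (u + v) w = inner u w + inner v w"
  proof -
    have "cinner (u + v) w = cinner u w + cinner v w"
      by transfer (auto simp: L2_eq_def distrib_right integrable_mult_cnj
          intro!: Bochner_Integration.integral_add)
    then show ?thesis by (simp add: inner_L2_def)
  qed
  show "inner (a *\<^sub>R u) v = a * inner u v"
  proof -
    have "cinner (complex_of_real a *\<^sub>C u) v = complex_of_real a * cinner u v"
      by transfer (simp add: mult.assoc)
    then show ?thesis by (simp add: inner_L2_def scaleR_L2_def)
  qed
  have sq: "(\<integral>x. f x * cnj (f x) \<partial>lborel) = complex_of_real (\<integral>x. (cmod (f x))\<^sup>2 \<partial>lborel)"
    for f :: "'a \<Rightarrow> complex"
    by (simp add: complex_norm_square[symmetric] flip: integral_complex_of_real of_real_power)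
  show "0 \<le> inner u u"
    unfolding inner_L2_def by transfer (simp add: sq)
  show "(inner u u = 0) = (u = 0)"
    unfolding inner_L2_def
  proof transfer
    fix f :: "'a \<Rightarrow> complex" assume "L2_eq f f"
    then have f: "square_integrable f" by (simp add: L2_eq_def)
    then have "(\<integral>x. (cmod (f x))\<^sup>2 \<partial>lborel) = 0 \<longleftrightarrow> (AE x in lborel. (cmod (f x))\<^sup>2 = 0)"
      by (intro integral_nonneg_eq_0_iff_AE) (auto simp: square_integrable_def)
    then show "(Re (\<integral>x. f x * cnj (f x) \<partial>lborel) = 0) = L2_eq f (\<lambda>_. 0)"
      using f by (simp add: sq L2_eq_def square_integrable_zero)
  qed
  show "norm u = sqrt (inner u u)" by (rule norm_L2_def)
qed

end


section \<open>Unbounded operators and functional calculus\<close>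

text \<open>An unbounded operator is given by its graph. The form \<^const>\<open>cinner\<close> is linear in the
  first argument and conjugate-linear in the second.\<close>

type_synonym 'a op_graph = "('a L2 \<times> 'a L2) set"

definition adjoint_graph :: "'a::euclidean_space op_graph \<Rightarrow> 'a op_graph" where
  "adjoint_graph T = {(v, w). \<forall>(u, u')\<in>T. cinner u' v = cinner u w}"

text \<open>Density of the domain makes \<^const>\<open>adjoint_graph\<close> single-valued and linear, so a
  self-adjoint graph is automatically the graph of a linear operator.\<close>

definition self_adjoint :: "'a::euclidean_space op_graph \<Rightarrow> bool" where
  "self_adjoint T \<longleftrightarrow> closure (Domain T) = UNIV \<and> adjoint_graph T = T"

definition sa_extension :: "'a::euclidean_space op_graph \<Rightarrow> 'a op_graph" where
  "sa_extension T = (THE A. T \<subseteq> A \<and> self_adjoint A)"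

text \<open>Projection-valued measures on the Borel subsets of the real line. An everywhere defined map
  that is symmetric for \<^const>\<open>cinner\<close> is linear and bounded, hence each \<open>E B\<close> is an orthogonal
  projection; \<open>E {} = 0\<close> follows from the last clause.\<close>

definition projection_valued_measure :: "(real set \<Rightarrow> 'a::euclidean_space L2 \<Rightarrow> 'a L2) \<Rightarrow> bool" where
  "projection_valued_measure E \<longleftrightarrow>
     (\<forall>B\<in>sets borel. \<forall>u. E B (E B u) = E B u) \<and>
     (\<forall>B\<in>sets borel. \<forall>u v. cinner (E B u) v = cinner u (E B v)) \<and>
     (\<forall>u. E UNIV u = u) \<and>
     (\<forall>B::nat \<Rightarrow> real set. range B \<subseteq> sets borel \<longrightarrow> disjoint_family B \<longrightarrow>
        (\<forall>u. (\<lambda>m. E (B m) u) sums E (\<Union>m. B m) u))"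

definition spectral_distribution ::
    "(real set \<Rightarrow> 'a::euclidean_space L2 \<Rightarrow> 'a L2) \<Rightarrow> 'a L2 \<Rightarrow> real measure" where
  "spectral_distribution E u = measure_of UNIV (sets borel) (\<lambda>B. ennreal ((norm (E B u))\<^sup>2))"

definition spectral_domain ::
    "(real set \<Rightarrow> 'a::euclidean_space L2 \<Rightarrow> 'a L2) \<Rightarrow> (real \<Rightarrow> complex) \<Rightarrow> 'a L2 set" where
  "spectral_domain E F = {u. integrable (spectral_distribution E u) (\<lambda>t. (cmod (F t))\<^sup>2)}"

text \<open>The operator \<open>\<integral> F dE\<close> for a Borel function \<open>F\<close>. The complex measure
  \<open>B \<mapsto> cinner (E B u) w\<close> is expressed through the positive measures
  \<open>B \<mapsto> cinner (E B u) u\<close> by the polarization identity.\<close>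

definition spectral_integral ::
    "(real set \<Rightarrow> 'a::euclidean_space L2 \<Rightarrow> 'a L2) \<Rightarrow> (real \<Rightarrow> complex) \<Rightarrow> 'a op_graph" where
  "spectral_integral E F =
     {(u, v). u \<in> spectral_domain E F \<and>
        (\<forall>w\<in>spectral_domain E F.
           cinner v w = (\<Sum>m<4. \<i> ^ m * (\<integral>t. F t \<partial>spectral_distribution E (u + \<i> ^ m *\<^sub>C w))) / 4)}"

text \<open>By the spectral theorem the projection-valued measure of a self-adjoint \<open>A\<close> exists and is unique.\<close>

definition functional_calculus ::
    "(real \<Rightarrow> complex) \<Rightarrow> 'a::euclidean_space op_graph \<Rightarrow> 'a op_graph" where
  "functional_calculus F A =
     {(u, v). \<exists>E. projection_valued_measure E \<and> spectral_integral E complex_of_real = A \<and>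
        (u, v) \<in> spectral_integral E F}"

text \<open>For bounded \<open>F\<close> the operator \<open>F(A)\<close> is everywhere defined.\<close>

definition bounded_functional_calculus ::
    "(real \<Rightarrow> complex) \<Rightarrow> 'a::euclidean_space op_graph \<Rightarrow> 'a L2 \<Rightarrow> 'a L2" where
  "bounded_functional_calculus F A u = (THE v. (u, v) \<in> functional_calculus F A)"


section \<open>The quantum dilogarithm\<close>

text \<open>The poles of the integrand nearest to the origin, other than the origin itself, have modulus
  \<open>min 1 (1 / h)\<close>. By Cauchy's theorem the value is the same for every radius below that.\<close>

definition qdilog :: "real \<Rightarrow> real \<Rightarrow> complex" where
  "qdilog h z =
     (let r = min 1 (1 / h) / 2;
          F = (\<lambda>p::complex. exp (- \<i> * p * of_real z) /
                 (sinh (of_real pi * p) * sinh (of_real pi * of_real h * p)) / p)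
      in exp (- (1 / 4) *
           ((LINT p:{..-r}|lborel. F (of_real p)) +
            contour_integral (part_circlepath 0 r pi 0) F +
            (LINT p:{r..}|lborel. F (of_real p)))))"


section \<open>Seeds and mutations\<close>

text \<open>The formal cluster variables of a seed do not enter the operators and are omitted. The index
  set \<open>{1, \<dots>, n}\<close> is a finite type.\<close>

record 'n seed =
  exch :: "'n \<Rightarrow> 'n \<Rightarrow> int"
  symm :: "'n \<Rightarrow> nat"

definition D_seed :: "'n::finite seed \<Rightarrow> bool" where
  "D_seed \<Gamma> \<longleftrightarrow> (\<forall>i. symm \<Gamma> i > 0) \<and>
     (\<forall>i j. real_of_int (exch \<Gamma> i j) * inverse (real (symm \<Gamma> j)) =
          - real_of_int (exch \<Gamma> j i) * inverse (real (symm \<Gamma> i)))"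

text \<open>The integer division by 2 is exact, since \<open>\<bar>a\<bar> * b + a * \<bar>b\<bar>\<close> is \<open>0\<close> or \<open>\<plusminus> 2 * a * b\<close>.\<close>

definition mutate :: "'n \<Rightarrow> 'n::finite seed \<Rightarrow> 'n seed" where
  "mutate k \<Gamma> =
     \<lparr> exch = (\<lambda>i j. if i = k \<or> j = k then - exch \<Gamma> i j
          else exch \<Gamma> i j +
            (\<bar>exch \<Gamma> i k\<bar> * exch \<Gamma> k j + exch \<Gamma> i k * \<bar>exch \<Gamma> k j\<bar>) div 2),
       symm = symm \<Gamma> \<rparr>"


section \<open>The position and momentum operators\<close>

definition complex_polynomial :: "(real ^ 'n::finite \<Rightarrow> complex) \<Rightarrow> bool" where
  "complex_polynomial P \<longleftrightarrow>
     (\<exists>(M :: ('n \<Rightarrow> nat) set) c. finite M \<and>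
        P = (\<lambda>a. \<Sum>m\<in>M. c m * (\<Prod>i\<in>UNIV. complex_of_real (a $ i) ^ m i)))"

text \<open>The subspace spanned by the functions in the first rule.\<close>

inductive_set gaussian_domain :: "(real ^ 'n::finite \<Rightarrow> complex) set" where
  gaussian: "(\<And>i. Re (\<alpha> i) > 0) \<Longrightarrow> complex_polynomial P \<Longrightarrow>
     (\<lambda>a. exp (- (\<Sum>i\<in>UNIV. \<alpha> i * (complex_of_real (a $ i))\<^sup>2 + \<beta> i * complex_of_real (a $ i))) * P a)
       \<in> gaussian_domain"
| add: "f \<in> gaussian_domain \<Longrightarrow> g \<in> gaussian_domain \<Longrightarrow> (\<lambda>a. f a + g a) \<in> gaussian_domain"
| scale: "f \<in> gaussian_domain \<Longrightarrow> (\<lambda>a. c * f a) \<in> gaussian_domain"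

definition q_op :: "'n::finite \<Rightarrow> (real ^ 'n \<Rightarrow> complex) \<Rightarrow> (real ^ 'n \<Rightarrow> complex)" where
  "q_op i f = (\<lambda>a. complex_of_real (a $ i) * f a)"

definition p_op :: "real \<Rightarrow> 'n::finite \<Rightarrow> (real ^ 'n \<Rightarrow> complex) \<Rightarrow> (real ^ 'n \<Rightarrow> complex)" where
  "p_op hbar i f = (\<lambda>a. 2 * of_real pi * \<i> * of_real hbar *
     vector_derivative (\<lambda>t. f (a + t *\<^sub>R axis i 1)) (at 0))"

definition x_op :: "real \<Rightarrow> 'n::finite seed \<Rightarrow> 'n \<Rightarrow> (real ^ 'n \<Rightarrow> complex) \<Rightarrow> (real ^ 'n \<Rightarrow> complex)" where
  "x_op hbar \<Gamma> i f = (\<lambda>a. 1 / 2 * inverse (of_nat (symm \<Gamma> i)) * p_op hbar i f a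
     - (\<Sum>j\<in>UNIV. of_int (exch \<Gamma> i j) * q_op j f a))"

definition x_tilde_op :: "real \<Rightarrow> 'n::finite seed \<Rightarrow> 'n \<Rightarrow> (real ^ 'n \<Rightarrow> complex) \<Rightarrow> (real ^ 'n \<Rightarrow> complex)" where
  "x_tilde_op hbar \<Gamma> i f = (\<lambda>a. 1 / 2 * inverse (of_nat (symm \<Gamma> i)) * p_op hbar i f a
     + (\<Sum>j\<in>UNIV. of_int (exch \<Gamma> i j) * q_op j f a))"

text \<open>Passage to the self-adjoint extension. Functions in \<^const>\<open>gaussian_domain\<close> are
  square-integrable, so \<^const>\<open>abs_L2\<close> gives their classes.\<close>

definition sa_operator ::
    "((real ^ 'n::finite \<Rightarrow> complex) \<Rightarrow> (real ^ 'n \<Rightarrow> complex)) \<Rightarrow> (real ^ 'n) op_graph" where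
  "sa_operator T = sa_extension ((\<lambda>f. (abs_L2 f, abs_L2 (T f))) ` gaussian_domain)"


section \<open>The mutation intertwiner\<close>

text \<open>For a seed satisfying \<^const>\<open>D_seed\<close> the diagonal of the exchange matrix vanishes, so the
  linear map \<open>mutate_coords k \<Gamma>\<close> has determinant \<open>-1\<close>. Hence \<open>K_linear\<close> does not depend on the
  representative chosen by \<^const>\<open>rep_L2\<close>.\<close>

definition mutate_coords :: "'n \<Rightarrow> 'n::finite seed \<Rightarrow> real ^ 'n \<Rightarrow> real ^ 'n" where
  "mutate_coords k \<Gamma> a =
     (\<chi> i. if i = k then - (a $ k) + (\<Sum>j\<in>UNIV. real_of_int (max (- exch \<Gamma> k j) 0) * a $ j)
           else a $ i)"

definition K_linear :: "'n \<Rightarrow> 'n::finite seed \<Rightarrow> (real ^ 'n) L2 \<Rightarrow> (real ^ 'n) L2" where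
  "K_linear k \<Gamma> u = abs_L2 (\<lambda>a. rep_L2 u (mutate_coords k \<Gamma> a))"

text \<open>The intertwiner from the Hilbert space of \<open>mutate k \<Gamma>\<close> to that of \<open>\<Gamma>\<close>.\<close>

definition K_intertwiner :: "real \<Rightarrow> 'n \<Rightarrow> 'n::finite seed \<Rightarrow> (real ^ 'n) L2 \<Rightarrow> (real ^ 'n) L2" where
  "K_intertwiner hbar k \<Gamma> =
     (let hk = hbar / real (symm \<Gamma> k)
      in bounded_functional_calculus (qdilog hk) (sa_operator (x_op hbar \<Gamma> k)) \<circ>
         inv (bounded_functional_calculus (qdilog hk) (sa_operator (x_tilde_op hbar \<Gamma> k))) \<circ>
         K_linear k \<Gamma>)"

end

theory Submission
  imports Defs "HOL-Probability.Probability"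
begin

section \<open>The complex Hilbert space L2\<close>

lemma L2_eq_rep: "L2_eq (rep_L2 u) (rep_L2 u)"
  using Quotient3_rep_reflp[OF Quotient3_L2] .

lemma square_integrable_rep [simp]: "square_integrable (rep_L2 u)"
  using L2_eq_rep[of u] by (simp add: L2_eq_def)

lemma measurable_rep_L2 [measurable]: "rep_L2 u \<in> borel_measurable borel"
  using square_integrable_rep[of u] by (simp add: square_integrable_def)

lemma rep_abs_L2: "square_integrable f \<Longrightarrow> AE x in lborel. rep_L2 (abs_L2 f) x = f x"
  using Quotient3_rep_abs[OF Quotient3_L2, of f] by (auto simp: L2_eq_def)

lemma L2_eqI: "AE x in lborel. rep_L2 u x = rep_L2 v x \<Longrightarrow> u = v"
  using Quotient3_rel_rep[OF Quotient3_L2, of u v] by (auto simp: L2_eq_def)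

lemma abs_L2_eq_iff:
  assumes "square_integrable f"
  shows "u = abs_L2 f \<longleftrightarrow> (AE x in lborel. rep_L2 u x = f x)"
proof
  assume "AE x in lborel. rep_L2 u x = f x"
  with rep_abs_L2[OF assms] have "AE x in lborel. rep_L2 u x = rep_L2 (abs_L2 f) x"
    by eventually_elim simp
  then show "u = abs_L2 f" by (rule L2_eqI)
qed (use rep_abs_L2[OF assms] in simp)

lemma abs_rep_L2 [simp]: "abs_L2 (rep_L2 u) = u"
  using abs_L2_eq_iff[of "rep_L2 u" u] by simp

lemma rep_plus: "AE x in lborel. rep_L2 (u + v) x = rep_L2 u x + rep_L2 v x"
proof -
  have "u + v = abs_L2 (\<lambda>x. rep_L2 u x + rep_L2 v x)"
    using plus_L2.abs_eq[OF L2_eq_rep[of u] L2_eq_rep[of v]] by simp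
  then show ?thesis by (subst abs_L2_eq_iff[symmetric]) (auto intro: square_integrable_add)
qed

lemma rep_scaleC: "AE x in lborel. rep_L2 (c *\<^sub>C u) x = c * rep_L2 u x"
proof -
  have "c *\<^sub>C u = abs_L2 (\<lambda>x. c * rep_L2 u x)"
    using scaleC.abs_eq[OF L2_eq_rep[of u], of c] by simp
  then show ?thesis by (subst abs_L2_eq_iff[symmetric]) (auto intro: square_integrable_scale)
qed

lemma rep_zero: "AE x in lborel. rep_L2 0 x = 0"
  unfolding zero_L2.abs_eq by (rule rep_abs_L2[OF square_integrable_zero])

lemma rep_scaleR: "AE x in lborel. rep_L2 (r *\<^sub>R u) x = r *\<^sub>R rep_L2 u x"
  unfolding scaleR_L2_def using rep_scaleC[of "of_real r" u] by (simp add: scaleR_conv_of_real)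

lemma rep_minus: "AE x in lborel. rep_L2 (u - v) x = rep_L2 u x - rep_L2 v x"
proof -
  have "u - v = u + (-1) *\<^sub>C v" by (simp add: minus_L2_def uminus_L2_def)
  moreover have "AE x in lborel. rep_L2 (u + (-1) *\<^sub>C v) x = rep_L2 u x - rep_L2 v x"
    using rep_plus[of u "(-1) *\<^sub>C v"] rep_scaleC[of "-1" v] by eventually_elim simp
  ultimately show ?thesis by (simp only:)
qed

lemma scaleC_add_right: "c *\<^sub>C (u + v) = c *\<^sub>C u + c *\<^sub>C (v :: 'a::euclidean_space L2)"
  by (rule L2_eqI) (use rep_scaleC[of c "u+v"] rep_scaleC[of c u] rep_scaleC[of c v] rep_plus[of u v]
      rep_plus[of "c *\<^sub>C u" "c *\<^sub>C v"] in \<open>eventually_elim; simp add: algebra_simps\<close>)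

lemma scaleC_add_left: "(c + d) *\<^sub>C u = c *\<^sub>C u + d *\<^sub>C (u :: 'a::euclidean_space L2)"
  by (rule L2_eqI) (use rep_scaleC[of c "u"] rep_scaleC[of d u] rep_scaleC[of "c+d" u]
      rep_plus[of "c *\<^sub>C u" "d *\<^sub>C u"] in \<open>eventually_elim; simp add: algebra_simps\<close>)

lemma scaleC_scaleC [simp]: "c *\<^sub>C d *\<^sub>C u = (c * d) *\<^sub>C (u :: 'a::euclidean_space L2)"
  by (rule L2_eqI) (use rep_scaleC[of c "d *\<^sub>C u"] rep_scaleC[of d u] rep_scaleC[of "c*d" u]
      in \<open>eventually_elim; simp add: algebra_simps\<close>)

lemma scaleC_one [simp]: "1 *\<^sub>C u = (u :: 'a::euclidean_space L2)"
  by (rule L2_eqI) (use rep_scaleC[of 1 u] in \<open>eventually_elim; simp\<close>)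

lemma scaleC_zero [simp]: "0 *\<^sub>C u = (0 :: 'a::euclidean_space L2)"
  by (rule L2_eqI) (use rep_scaleC[of 0 u] rep_zero in \<open>eventually_elim; simp\<close>)

lemma scaleC_zero_right [simp]: "c *\<^sub>C 0 = (0 :: 'a::euclidean_space L2)"
  by (rule L2_eqI) (use rep_scaleC[of c 0] rep_zero in \<open>eventually_elim; simp\<close>)

lemma minus_eq_scaleC: "u - v = u + (-1) *\<^sub>C (v :: 'a::euclidean_space L2)"
  by (simp add: minus_L2_def uminus_L2_def)

lemma scaleC_diff_right: "c *\<^sub>C (u - v) = c *\<^sub>C u - c *\<^sub>C (v :: 'a::euclidean_space L2)"
  by (simp add: minus_eq_scaleC scaleC_add_right)

lemma scaleR_eq_scaleC: "r *\<^sub>R u = of_real r *\<^sub>C (u :: 'a::euclidean_space L2)"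
  by (rule scaleR_L2_def)

lemma cinner_eq_integral: "cinner u v = (\<integral>x. rep_L2 u x * cnj (rep_L2 v x) \<partial>lborel)"
  by (rule cinner.rep_eq)

lemma integrable_rep_cnj: "integrable lborel (\<lambda>x. rep_L2 u x * cnj (rep_L2 v x))"
  by (intro integrable_mult_cnj square_integrable_rep)

lemma measurable_cnj [measurable (raw)]:
  "f \<in> borel_measurable M \<Longrightarrow> (\<lambda>x. cnj (f x)) \<in> borel_measurable M"
  by (rule borel_measurable_continuous_on[where f = cnj]) (auto intro: continuous_intros)

lemma cinner_eq_integral_AE:
  assumes [measurable]: "f \<in> borel_measurable borel" "g \<in> borel_measurable borel"
    and "AE x in lborel. rep_L2 u x = f x" "AE x in lborel. rep_L2 v x = g x"
  shows "cinner u v = (\<integral>x. f x * cnj (g x) \<partial>lborel)"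
  unfolding cinner_eq_integral
  by (rule integral_cong_AE) (use assms(3,4) in \<open>auto elim: eventually_elim2\<close>)

lemma cinner_abs_L2:
  assumes "square_integrable f" "square_integrable g"
  shows "cinner (abs_L2 f) (abs_L2 g) = (\<integral>x. f x * cnj (g x) \<partial>lborel)"
  using assms by (intro cinner_eq_integral_AE rep_abs_L2) (auto simp: square_integrable_def)

lemma cinner_commute: "cinner u v = cnj (cinner v u)"
  unfolding cinner_eq_integral by (simp add: mult.commute flip: Bochner_Integration.integral_cnj)

lemma cinner_add_left: "cinner (u + v) w = cinner u w + cinner v w"
proof -
  have "cinner (u + v) w = (\<integral>x. rep_L2 u x * cnj (rep_L2 w x) + rep_L2 v x * cnj (rep_L2 w x) \<partial>lborel)"
    unfolding cinner_eq_integral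
    by (rule integral_cong_AE) (use rep_plus[of u v] in \<open>auto elim!: eventually_mono simp: algebra_simps\<close>)
  also have "\<dots> = cinner u w + cinner v w"
    unfolding cinner_eq_integral by (intro Bochner_Integration.integral_add integrable_rep_cnj)
  finally show ?thesis .
qed

lemma cinner_scaleC_left [simp]: "cinner (c *\<^sub>C u) w = c * cinner u w"
proof -
  have "cinner (c *\<^sub>C u) w = (\<integral>x. c * (rep_L2 u x * cnj (rep_L2 w x)) \<partial>lborel)"
    unfolding cinner_eq_integral
    by (rule integral_cong_AE) (use rep_scaleC[of c u] in \<open>auto elim!: eventually_mono simp: algebra_simps\<close>)
  then show ?thesis unfolding cinner_eq_integral by simp
qed

lemma cinner_add_right: "cinner w (u + v) = cinner w u + cinner w v"
  by (metis cinner_add_left cinner_commute complex_cnj_add)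

lemma cinner_scaleC_right [simp]: "cinner w (c *\<^sub>C u) = cnj c * cinner w u"
  by (metis cinner_scaleC_left cinner_commute complex_cnj_mult)

lemma cinner_diff_left: "cinner (u - v) w = cinner u w - cinner v w"
  by (simp add: minus_eq_scaleC cinner_add_left)

lemma cinner_diff_right: "cinner w (u - v) = cinner w u - cinner w v"
  by (simp add: minus_eq_scaleC cinner_add_right)

lemma cinner_zero_left [simp]: "cinner 0 w = 0"
  using cinner_scaleC_left[of 0 0 w] by simp

lemma cinner_zero_right [simp]: "cinner w 0 = 0"
  using cinner_scaleC_right[of w 0 0] by simp

lemma cinner_self: "cinner u u = of_real ((norm u)\<^sup>2)"
proof -
  have "cnj (cinner u u) = cinner u u" by (metis cinner_commute)
  moreover have "Re (cinner u u) = (norm u)\<^sup>2"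
    by (metis inner_L2_def power2_norm_eq_inner)
  ultimately show ?thesis by (simp add: complex_eq_iff)
qed

lemma norm_scaleC [simp]: "norm (c *\<^sub>C u) = cmod c * norm (u :: 'a::euclidean_space L2)"
proof -
  have "of_real ((norm (c *\<^sub>C u))\<^sup>2) = (of_real ((cmod c * norm u)\<^sup>2) :: complex)"
    using cinner_self[of "c *\<^sub>C u", symmetric] cinner_self[of u] complex_norm_square[of c]
    by (simp add: power_mult_distrib mult_ac)
  then have "(norm (c *\<^sub>C u))\<^sup>2 = (cmod c * norm u)\<^sup>2" unfolding of_real_eq_iff .
  then show ?thesis by (simp add: power2_eq_iff_nonneg)
qed

lemma Cauchy_Schwarz_cinner: "cmod (cinner u v) \<le> norm u * norm v"
proof (cases "cinner u v = 0")
  case False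
  define c where "c = cnj (sgn (cinner u v))"
  have c: "cmod c = 1" using False by (simp add: c_def norm_sgn)
  have "cinner (c *\<^sub>C u) v = of_real (cmod (cinner u v))"
    using False by (simp add: c_def sgn_eq complex_norm_square[symmetric] field_simps power2_eq_square)
  then have "cmod (cinner u v) = inner (c *\<^sub>C u) v" by (simp add: inner_L2_def)
  also have "\<dots> \<le> norm (c *\<^sub>C u) * norm v" by (rule norm_cauchy_schwarz)
  finally show ?thesis by (simp add: c)
qed simp

lemma tendsto_cinner [tendsto_intros]:
  assumes "(f \<longlongrightarrow> u) F" "(g \<longlongrightarrow> v) F"
  shows "((\<lambda>x. cinner (f x) (g x)) \<longlongrightarrow> cinner u (v :: 'a::euclidean_space L2)) F"
proof -
  have "bounded_bilinear (cinner :: 'a L2 \<Rightarrow> 'a L2 \<Rightarrow> complex)"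
    by (standard; (simp add: cinner_add_left cinner_add_right scaleR_eq_scaleC scaleR_conv_of_real)?)
       (rule exI[of _ 1], use Cauchy_Schwarz_cinner in auto)
  then show ?thesis by (rule bounded_bilinear.tendsto) (use assms in auto)
qed

lemma tendsto_scaleC [tendsto_intros]:
  assumes "(g \<longlongrightarrow> v) F"
  shows "((\<lambda>x. c *\<^sub>C g x) \<longlongrightarrow> c *\<^sub>C (v :: 'a::euclidean_space L2)) F"
proof -
  have "((\<lambda>x. norm (c *\<^sub>C g x - c *\<^sub>C v)) \<longlongrightarrow> cmod c * 0) F"
    unfolding scaleC_diff_right[symmetric] norm_scaleC
    by (intro tendsto_mult tendsto_const) (use assms in \<open>simp add: tendsto_norm_zero LIM_zero\<close>)
  then show ?thesis by (simp add: LIM_zero_iff tendsto_norm_zero_iff)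
qed

lemma nn_integral_norm_L2: "(\<integral>\<^sup>+x. ennreal ((cmod (rep_L2 u x))\<^sup>2) \<partial>lborel) = ennreal ((norm u)\<^sup>2)"
proof -
  have int: "integrable lborel (\<lambda>x. (cmod (rep_L2 u x))\<^sup>2)"
    using square_integrable_rep[of u] by (simp add: square_integrable_def)
  have "of_real ((norm u)\<^sup>2) = (of_real (\<integral>x. (cmod (rep_L2 u x))\<^sup>2 \<partial>lborel) :: complex)"
    unfolding cinner_self[symmetric] cinner_eq_integral
    by (simp add: complex_norm_square[symmetric] flip: integral_complex_of_real of_real_power)
  then have "(norm u)\<^sup>2 = (\<integral>x. (cmod (rep_L2 u x))\<^sup>2 \<partial>lborel)" unfolding of_real_eq_iff .
  then show ?thesis using int by (subst nn_integral_eq_integral) auto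
qed

lemma nn_integral_norm_L2_AE:
  assumes "AE x in lborel. rep_L2 u x = f x"
  shows "(\<integral>\<^sup>+x. ennreal ((cmod (f x))\<^sup>2) \<partial>lborel) = ennreal ((norm u)\<^sup>2)"
  unfolding nn_integral_norm_L2[symmetric] by (rule nn_integral_cong_AE) (use assms in auto)

lemma square_integrableI_nn:
  assumes [measurable]: "f \<in> borel_measurable borel"
    and "(\<integral>\<^sup>+x. ennreal ((cmod (f x))\<^sup>2) \<partial>lborel) < \<infinity>"
  shows "square_integrable f"
  unfolding square_integrable_def using assms
  by (auto intro!: integrableI_bounded)

lemma nn_integral_diff_norm:
  assumes "AE x in lborel. rep_L2 u x = f x" "AE x in lborel. rep_L2 v x = g x"
  shows "(\<integral>\<^sup>+x. ennreal ((cmod (f x - g x))\<^sup>2) \<partial>lborel) = ennreal ((norm (u - v))\<^sup>2)"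
  by (rule nn_integral_norm_L2_AE) (use assms rep_minus[of u v] in \<open>eventually_elim; simp\<close>)

lemma nn_integral_diff_norm_rep:
  "(\<integral>\<^sup>+x. ennreal ((cmod (rep_L2 u x - rep_L2 v x))\<^sup>2) \<partial>lborel) = ennreal ((norm (u - v))\<^sup>2)"
  by (rule nn_integral_diff_norm) auto

text \<open>A sequence that converges both in the mean and almost everywhere has one limit, by Fatou.\<close>

lemma L2_limit_AE:
  assumes lim: "X \<longlonglongrightarrow> u" and pt: "AE x in lborel. (\<lambda>n. rep_L2 (X n) x) \<longlonglongrightarrow> f x"
  shows "AE x in lborel. rep_L2 u x = f x"
proof -
  have [measurable]: "(\<lambda>x. liminf (\<lambda>n. ennreal ((cmod (rep_L2 (X n) x - rep_L2 u x))\<^sup>2))) \<in> borel_measurable lborel"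
    by measurable
  have "(\<integral>\<^sup>+x. liminf (\<lambda>n. ennreal ((cmod (rep_L2 (X n) x - rep_L2 u x))\<^sup>2)) \<partial>lborel)
      \<le> liminf (\<lambda>n. (\<integral>\<^sup>+x. ennreal ((cmod (rep_L2 (X n) x - rep_L2 u x))\<^sup>2) \<partial>lborel))"
    by (rule nn_integral_liminf) auto
  also have "\<dots> = liminf (\<lambda>n. ennreal ((norm (X n - u))\<^sup>2))"
    by (simp add: nn_integral_diff_norm_rep)
  also have "(\<lambda>n. ennreal ((norm (X n - u))\<^sup>2)) \<longlonglongrightarrow> ennreal (0\<^sup>2)"
    by (intro tendsto_ennrealI tendsto_power) (use lim in \<open>simp add: tendsto_norm_zero LIM_zero\<close>)
  then have "liminf (\<lambda>n. ennreal ((norm (X n - u))\<^sup>2)) = 0"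
    by (auto dest: lim_imp_Liminf[rotated])
  finally have "AE x in lborel. liminf (\<lambda>n. ennreal ((cmod (rep_L2 (X n) x - rep_L2 u x))\<^sup>2)) = 0"
    by (subst (asm) le_zero_eq, subst (asm) nn_integral_0_iff_AE) auto
  with pt show ?thesis
  proof eventually_elim
    case (elim x)
    have "(\<lambda>n. ennreal ((cmod (rep_L2 (X n) x - rep_L2 u x))\<^sup>2)) \<longlonglongrightarrow> ennreal ((cmod (f x - rep_L2 u x))\<^sup>2)"
      by (intro tendsto_ennrealI tendsto_power tendsto_norm tendsto_diff tendsto_const elim)
    from lim_imp_Liminf[OF _ this] elim show ?case by simp
  qed
qed

text \<open>Riesz--Fischer: if consecutive distances are at most \<open>4 ^ - k\<close>, then \<open>\<Sum> 2 ^ k * \<bar>X (k + 1) - X k\<bar>\<^sup>2\<close>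
  has finite integral, which forces pointwise convergence almost everywhere.\<close>

lemma L2_fast_Cauchy_convergent:
  fixes X :: "nat \<Rightarrow> 'a::euclidean_space L2"
  assumes fast: "\<And>k l. k \<le> l \<Longrightarrow> norm (X l - X k) \<le> (1/2) ^ k"
  shows "convergent X"
proof -
  define d where "d k x = rep_L2 (X (Suc k)) x - rep_L2 (X k) x" for k x
  have [measurable]: "d k \<in> borel_measurable borel" for k unfolding d_def by measurable
  have dk: "(\<integral>\<^sup>+x. ennreal ((cmod (d k x))\<^sup>2) \<partial>lborel) \<le> ennreal ((1/4) ^ k)" for k
  proof -
    have "(\<integral>\<^sup>+x. ennreal ((cmod (d k x))\<^sup>2) \<partial>lborel) = ennreal ((norm (X (Suc k) - X k))\<^sup>2)"
      unfolding d_def by (intro nn_integral_diff_norm) auto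
    also have "(norm (X (Suc k) - X k))\<^sup>2 \<le> ((1/2) ^ k)\<^sup>2"
      by (intro power_mono fast) auto
    also have "((1/2) ^ k)\<^sup>2 = ((1/4 :: real) ^ k)"
      by (simp add: power_divide power2_eq_square flip: power_mult_distrib)
    finally show ?thesis by (simp add: ennreal_leI)
  qed
  have "(\<integral>\<^sup>+x. (\<Sum>k. ennreal (2 ^ k * (cmod (d k x))\<^sup>2)) \<partial>lborel)
      = (\<Sum>k. \<integral>\<^sup>+x. ennreal (2 ^ k * (cmod (d k x))\<^sup>2) \<partial>lborel)"
    by (rule nn_integral_suminf) auto
  also have "\<dots> \<le> (\<Sum>k. ennreal ((1/2) ^ k))"
  proof (rule suminf_le)
    fix k
    have "(\<integral>\<^sup>+x. ennreal (2 ^ k * (cmod (d k x))\<^sup>2) \<partial>lborel) = ennreal (2 ^ k) * (\<integral>\<^sup>+x. ennreal ((cmod (d k x))\<^sup>2) \<partial>lborel)"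
      by (simp add: ennreal_mult' nn_integral_cmult)
    also have "\<dots> \<le> ennreal (2 ^ k) * ennreal ((1/4) ^ k)"
      by (intro mult_left_mono dk) auto
    also have "\<dots> = ennreal ((1/2) ^ k)"
      by (simp add: ennreal_mult'[symmetric] flip: power_mult_distrib)
    finally show "(\<integral>\<^sup>+x. ennreal (2 ^ k * (cmod (d k x))\<^sup>2) \<partial>lborel) \<le> ennreal ((1/2) ^ k)" .
  qed auto
  also have "\<dots> < \<infinity>"
    by (subst suminf_ennreal2) (auto intro!: summable_geometric)
  finally have fin: "(\<integral>\<^sup>+x. (\<Sum>k. ennreal (2 ^ k * (cmod (d k x))\<^sup>2)) \<partial>lborel) \<noteq> \<infinity>" by simp
  have conv: "AE x in lborel. convergent (\<lambda>n. rep_L2 (X n) x)"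
  proof -
    have "AE x in lborel. (\<Sum>k. ennreal (2 ^ k * (cmod (d k x))\<^sup>2)) \<noteq> \<infinity>"
      by (rule nn_integral_PInf_AE[OF _ fin]) auto
    then show ?thesis
    proof eventually_elim
      case (elim x)
      then have "summable (\<lambda>k. 2 ^ k * (cmod (d k x))\<^sup>2)"
        by (intro summable_suminf_not_top) auto
      then have "Bseq (\<lambda>k. 2 ^ k * (cmod (d k x))\<^sup>2)"
        by (intro convergent_imp_Bseq) (auto dest: summable_LIMSEQ_zero simp: convergent_def)
      then obtain K where K: "K > 0" "\<And>k. norm (2 ^ k * (cmod (d k x))\<^sup>2) \<le> K" by (auto simp: Bseq_def)
      have "norm (d k x) \<le> sqrt K * (1 / sqrt 2) ^ k" for k
      proof -
        have "(cmod (d k x))\<^sup>2 \<le> K / 2 ^ k" using K(2)[of k] by (simp add: field_simps)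
        also have "\<dots> = (sqrt K * (1 / sqrt 2) ^ k)\<^sup>2"
          using K(1) by (simp add: power_mult_distrib power_divide flip: power_mult) (simp add: power_mult mult.commute[of k])
        finally show ?thesis using K(1) by (simp add: power2_le_iff_abs_le)
      qed
      moreover have "summable (\<lambda>k. sqrt K * (1 / sqrt 2) ^ k)"
        by (intro summable_mult summable_geometric) auto
      ultimately have "summable (\<lambda>k. d k x)" by (rule summable_comparison_test'[rotated, where N = 0]) 
      then have "convergent (\<lambda>n. (\<Sum>k<n. d k x) + rep_L2 (X 0) x)"
        by (intro convergent_add convergent_const) (auto simp: summable_iff_convergent)
      moreover have "(\<Sum>k<n. d k x) + rep_L2 (X 0) x = rep_L2 (X n) x" for n
        unfolding d_def by (subst sum_lessThan_telescope) simp
      ultimately show ?case by simp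
    qed
  qed
  define f where "f x = lim (\<lambda>n. rep_L2 (X n) x)" for x
  have [measurable]: "f \<in> borel_measurable borel" unfolding f_def by measurable
  have pt: "AE x in lborel. (\<lambda>n. rep_L2 (X n) x) \<longlonglongrightarrow> f x"
    using conv by eventually_elim (simp add: f_def convergent_LIMSEQ_iff)
  have est: "(\<integral>\<^sup>+x. ennreal ((cmod (f x - rep_L2 (X k) x))\<^sup>2) \<partial>lborel) \<le> ennreal ((1/4) ^ k)" for k
  proof -
    have "(\<integral>\<^sup>+x. ennreal ((cmod (f x - rep_L2 (X k) x))\<^sup>2) \<partial>lborel)
       = (\<integral>\<^sup>+x. liminf (\<lambda>n. ennreal ((cmod (rep_L2 (X n) x - rep_L2 (X k) x))\<^sup>2)) \<partial>lborel)"
    proof (rule nn_integral_cong_AE, use pt in eventually_elim)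
      case (elim x)
      then have "(\<lambda>n. ennreal ((cmod (rep_L2 (X n) x - rep_L2 (X k) x))\<^sup>2)) \<longlonglongrightarrow> ennreal ((cmod (f x - rep_L2 (X k) x))\<^sup>2)"
        by (intro tendsto_ennrealI tendsto_power tendsto_norm tendsto_diff tendsto_const elim)
      from lim_imp_Liminf[OF _ this] show ?case by simp
    qed
    also have "\<dots> \<le> liminf (\<lambda>n. \<integral>\<^sup>+x. ennreal ((cmod (rep_L2 (X n) x - rep_L2 (X k) x))\<^sup>2) \<partial>lborel)"
      by (rule nn_integral_liminf) auto
    also have "\<dots> = liminf (\<lambda>n. ennreal ((norm (X n - X k))\<^sup>2))"
      by (simp add: nn_integral_diff_norm_rep)
    also have "\<dots> \<le> liminf (\<lambda>n. ennreal ((1/4) ^ k))"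
    proof (rule Liminf_mono, rule eventually_sequentiallyI[of k])
      fix n assume "k \<le> n"
      have "(norm (X n - X k))\<^sup>2 \<le> ((1/2) ^ k)\<^sup>2" by (intro power_mono fast \<open>k \<le> n\<close>) auto
      also have "((1/2) ^ k)\<^sup>2 = ((1/4 :: real) ^ k)"
        by (simp add: power_divide power2_eq_square flip: power_mult_distrib)
      finally show "ennreal ((norm (X n - X k))\<^sup>2) \<le> ennreal ((1/4) ^ k)" by (simp add: ennreal_leI)
    qed
    also have "\<dots> = ennreal ((1/4) ^ k)" by (simp add: Liminf_const)
    finally show ?thesis .
  qed
  have "square_integrable (\<lambda>x. f x - rep_L2 (X 0) x)"
    by (rule square_integrableI_nn) (use est[of 0] in \<open>auto simp: less_top[symmetric] top_unique\<close>)
  from square_integrable_add[OF this square_integrable_rep[of "X 0"]]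
  have f: "square_integrable f" by simp
  have "norm (abs_L2 f - X k) \<le> (1/2) ^ k" for k
  proof -
    have "ennreal ((norm (abs_L2 f - X k))\<^sup>2) \<le> ennreal ((1/4) ^ k)"
      using est[of k] nn_integral_diff_norm[OF rep_abs_L2[OF f], of "X k" "rep_L2 (X k)"] by simp
    then have "(norm (abs_L2 f - X k))\<^sup>2 \<le> (1/4) ^ k" by simp
    also have "\<dots> = ((1/2) ^ k)\<^sup>2" by (simp add: power_divide power2_eq_square flip: power_mult_distrib)
    finally show ?thesis by (rule power2_le_imp_le) simp
  qed
  then have le: "norm (X k - abs_L2 f) \<le> (1/2) ^ k" for k by (simp add: norm_minus_commute)
  have lim: "(\<lambda>k. (1/2 :: real) ^ k) \<longlonglongrightarrow> 0" by (rule LIMSEQ_power_zero) simp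
  have "(\<lambda>k. X k - abs_L2 f) \<longlonglongrightarrow> 0"
    by (rule Lim_null_comparison[OF always_eventually lim]) (rule allI, rule le)
  then have "X \<longlonglongrightarrow> abs_L2 f" by (rule LIM_zero_cancel)
  then show ?thesis by (rule convergentI)
qed

instance L2 :: (euclidean_space) banach
proof
  fix X :: "nat \<Rightarrow> 'a L2" assume X: "Cauchy X"
  obtain r where r: "strict_mono r" "\<And>k m n. m \<ge> r k \<Longrightarrow> n \<ge> r k \<Longrightarrow> norm (X m - X n) < (1/2) ^ k"
  proof -
    have "\<exists>N. \<forall>m\<ge>N. \<forall>n\<ge>N. norm (X m - X n) < (1/2) ^ k" for k
      using X by (auto simp: Cauchy_iff)
    then obtain N where N: "\<And>k m n. m \<ge> N k \<Longrightarrow> n \<ge> N k \<Longrightarrow> norm (X m - X n) < (1/2) ^ k" by metis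
    define r where "r k = (\<Sum>l\<le>k. N l) + k" for k
    show ?thesis
    proof (rule that)
      show "strict_mono r" by (rule strict_monoI_Suc) (simp add: r_def)
      fix k m n assume "m \<ge> r k" "n \<ge> r k"
      moreover have "N k \<le> r k" unfolding r_def by (rule trans_le_add1) (rule member_le_sum, auto)
      ultimately show "norm (X m - X n) < (1/2) ^ k" using N by auto
    qed
  qed
  have "convergent (X \<circ> r)"
  proof (rule L2_fast_Cauchy_convergent)
    fix k l :: nat assume "k \<le> l"
    then have "r k \<le> r l" using r(1) by (simp add: strict_mono_less_eq)
    then show "norm ((X \<circ> r) l - (X \<circ> r) k) \<le> (1/2) ^ k"
      using r(2)[of k "r l" "r k"] by simp
  qed
  then obtain u where u: "(X \<circ> r) \<longlonglongrightarrow> u" by (auto simp: convergent_def)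
  show "convergent X"
    using Cauchy_converges_subseq[OF X r(1)] u unfolding convergent_def by (metis comp_def)
qed

lemma complex_subspace_dense:
  fixes S :: "'a::euclidean_space L2 set"
  assumes cl: "closed S" and z: "0 \<in> S" and add: "\<And>u v. u \<in> S \<Longrightarrow> v \<in> S \<Longrightarrow> u + v \<in> S"
    and sc: "\<And>c u. u \<in> S \<Longrightarrow> c *\<^sub>C u \<in> S"
    and orth: "\<And>v. (\<And>u. u \<in> S \<Longrightarrow> cinner u v = 0) \<Longrightarrow> v = 0"
  shows "u \<in> S"
proof -
  define d where "d = infdist u S"
  have d_le: "d \<le> norm (u - s)" if "s \<in> S" for s
    using infdist_le[OF that, of u] by (simp add: d_def dist_norm)
  have "\<exists>s\<in>S. norm (u - s) < d + 1 / real (Suc n)" for n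
  proof -
    have "infdist u S < d + 1 / real (Suc n)" by (simp add: d_def)
    moreover have "S \<noteq> {}" using z by auto
    moreover have "bdd_below (dist u ` S)" by (rule bdd_belowI[of _ 0]) auto
    ultimately show ?thesis by (auto simp: infdist_def cINF_less_iff dist_norm)
  qed
  then obtain s where s: "\<And>n. s n \<in> S" "\<And>n. norm (u - s n) < d + 1 / real (Suc n)" by metis
  have "d \<ge> 0" by (simp add: d_def infdist_nonneg)
  have par: "(norm (x - y))\<^sup>2 = 2 * (norm (u - x))\<^sup>2 + 2 * (norm (u - y))\<^sup>2 - 4 * (norm (u - (1/2) *\<^sub>R (x + y)))\<^sup>2" for x y
    by (simp add: power2_norm_eq_inner algebra_simps inner_commute)
  have est: "(norm (s m - s n))\<^sup>2 \<le> (8 * d + 4) * (1 / real (Suc N))" if "m \<ge> N" "n \<ge> N" for m n N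
  proof -
    have mid: "(1/2) *\<^sub>R (s m + s n) \<in> S"
      unfolding scaleR_eq_scaleC by (intro sc add s)
    have b: "(norm (u - s m))\<^sup>2 \<le> d\<^sup>2 + (2 * d + 1) * (1 / real (Suc N))" if "m \<ge> N" for m
    proof -
      have le: "1 / real (Suc m) \<le> 1 / real (Suc N)" using that by (simp add: field_simps)
      have "(norm (u - s m))\<^sup>2 \<le> (d + 1 / real (Suc N))\<^sup>2"
        by (intro power_mono) (use s(2)[of m] le in auto)
      also have "\<dots> = d\<^sup>2 + (2 * d + 1 / real (Suc N)) * (1 / real (Suc N))"
        by (simp add: power2_eq_square algebra_simps)
      also have "\<dots> \<le> d\<^sup>2 + (2 * d + 1) * (1 / real (Suc N))"
        by (intro add_left_mono mult_right_mono) auto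
      finally show ?thesis .
    qed
    have "d\<^sup>2 \<le> (norm (u - (1/2) *\<^sub>R (s m + s n)))\<^sup>2"
      by (intro power_mono d_le mid \<open>d \<ge> 0\<close>)
    then show ?thesis using b[OF that(1)] b[OF that(2)] unfolding par[of "s m" "s n"] by argo
  qed
  have "Cauchy s"
  proof (rule CauchyI)
    fix e :: real assume e: "e > 0"
    obtain N where N: "(8 * d + 4) * (1 / real (Suc N)) < e\<^sup>2"
    proof -
      have "(\<lambda>N. (8 * d + 4) * (1 / real (Suc N))) \<longlonglongrightarrow> (8 * d + 4) * 0"
        by (intro tendsto_intros LIMSEQ_Suc lim_1_over_n)
      from order_tendstoD(2)[OF this, of "e\<^sup>2"] e that show ?thesis
        by (auto simp: eventually_sequentially)
    qed
    show "\<exists>M. \<forall>m\<ge>M. \<forall>n\<ge>M. norm (s m - s n) < e"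
    proof (intro exI[of _ N] allI impI)
      fix m n assume "m \<ge> N" "n \<ge> N"
      from est[OF this] N have "(norm (s m - s n))\<^sup>2 < e\<^sup>2" by linarith
      then show "norm (s m - s n) < e" by (rule power2_less_imp_less) (use e in auto)
    qed
  qed
  then obtain p where p: "s \<longlonglongrightarrow> p" using Cauchy_convergent convergent_def by blast
  have pS: "p \<in> S" using closed_sequentially[OF cl] s(1) p by blast
  have "norm (u - p) \<le> d + 0"
  proof (rule LIMSEQ_le)
    show "(\<lambda>n. norm (u - s n)) \<longlonglongrightarrow> norm (u - p)" by (intro tendsto_intros p)
    show "(\<lambda>n. d + 1 / real (Suc n)) \<longlonglongrightarrow> d + 0" by (intro tendsto_intros LIMSEQ_Suc lim_1_over_n)
  qed (use s(2) in \<open>auto intro!: exI[of _ 0] less_imp_le\<close>)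
  with d_le[OF pS] have up: "norm (u - p) = d" by simp
  have re: "inner (u - p) v = 0" if v: "v \<in> S" for v
  proof (cases "v = 0")
    case False
    define t where "t = inner (u - p) v / (norm v)\<^sup>2"
    have "p + t *\<^sub>R v \<in> S" unfolding scaleR_eq_scaleC by (intro add pS sc v)
    from d_le[OF this] have "(norm (u - p))\<^sup>2 \<le> (norm (u - p - t *\<^sub>R v))\<^sup>2"
      unfolding up by (intro power_mono \<open>d \<ge> 0\<close>) (simp add: algebra_simps)
    also have "\<dots> = (norm (u - p))\<^sup>2 - 2 * t * inner (u - p) v + t\<^sup>2 * (norm v)\<^sup>2"
      by (simp only: power2_norm_eq_inner) (simp add: inner_diff inner_commute power2_eq_square algebra_simps)
    also have "\<dots> = (norm (u - p))\<^sup>2 - (inner (u - p) v)\<^sup>2 / (norm v)\<^sup>2"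
      using False by (simp add: t_def power2_eq_square field_simps)
    finally show ?thesis using False by (simp add: divide_le_0_iff)
  qed simp
  have "cinner v (u - p) = 0" if v: "v \<in> S" for v
  proof -
    have "Re (cinner v (u - p)) = 0" using re[OF v] by (metis inner_L2_def inner_commute)
    moreover have "Re (cinner (\<i> *\<^sub>C v) (u - p)) = 0"
      using re[OF sc[OF v, of \<i>]] by (metis inner_L2_def inner_commute)
    ultimately show ?thesis by (simp add: complex_eq_iff)
  qed
  from orth[OF this] pS show ?thesis by simp
qed

section \<open>Multiplication operators and unitary operators\<close>

definition bounded_borel :: "('a::euclidean_space \<Rightarrow> complex) \<Rightarrow> bool" where
  "bounded_borel \<phi> \<longleftrightarrow> \<phi> \<in> borel_measurable borel \<and> bounded (range \<phi>)"

lemma bounded_borelI: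
  "\<phi> \<in> borel_measurable borel \<Longrightarrow> (\<And>a. cmod (\<phi> a) \<le> C) \<Longrightarrow> bounded_borel \<phi>"
  by (auto simp: bounded_borel_def bounded_iff)

lemma bounded_borelE:
  assumes "bounded_borel \<phi>"
  obtains C where "\<phi> \<in> borel_measurable borel" "C > 0" "\<And>a. cmod (\<phi> a) \<le> C"
proof -
  from assms obtain C where "\<phi> \<in> borel_measurable borel" "C > 0" "\<forall>x\<in>range \<phi>. cmod x \<le> C"
    unfolding bounded_borel_def bounded_pos by blast
  with that show ?thesis by blast
qed

lemma bounded_borel_measurable [measurable_dest]: "bounded_borel \<phi> \<Longrightarrow> \<phi> \<in> borel_measurable borel"
  by (simp add: bounded_borel_def)

lemma square_integrable_bounded:
  assumes [measurable]: "f \<in> borel_measurable borel" and "square_integrable g"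
    and le: "\<And>a. cmod (f a) \<le> C * cmod (g a)"
  shows "square_integrable f"
  unfolding square_integrable_def
proof
  have int: "integrable lborel (\<lambda>x. C\<^sup>2 * (cmod (g x))\<^sup>2)"
    using assms(2) by (simp add: square_integrable_def)
  have bd: "(cmod (f x))\<^sup>2 \<le> C\<^sup>2 * (cmod (g x))\<^sup>2" for x
    using power_mono[OF le[of x], of 2] by (simp add: power_mult_distrib)
  show "integrable lborel (\<lambda>x. (cmod (f x))\<^sup>2)"
    by (rule Bochner_Integration.integrable_bound[OF int]) (use bd in \<open>auto intro!: AE_I2 simp: abs_mult\<close>)
qed simp

lemma square_integrable_mult_rep:
  assumes "bounded_borel \<phi>" shows "square_integrable (\<lambda>a. \<phi> a * rep_L2 u a)"
proof -
  obtain C where [measurable]: "\<phi> \<in> borel_measurable borel" and C: "C > 0" "\<And>a. cmod (\<phi> a) \<le> C"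
    using bounded_borelE[OF assms] by metis
  show ?thesis
    by (rule square_integrable_bounded[OF _ square_integrable_rep[of u], where C = C])
       (auto simp: norm_mult C mult_right_mono)
qed

definition mult_L2 :: "('a::euclidean_space \<Rightarrow> complex) \<Rightarrow> 'a L2 \<Rightarrow> 'a L2" where
  "mult_L2 \<phi> u = abs_L2 (\<lambda>a. \<phi> a * rep_L2 u a)"

lemma rep_mult_L2: "bounded_borel \<phi> \<Longrightarrow> AE a in lborel. rep_L2 (mult_L2 \<phi> u) a = \<phi> a * rep_L2 u a"
  unfolding mult_L2_def by (rule rep_abs_L2[OF square_integrable_mult_rep])

lemma mult_L2_mult_L2:
  assumes "bounded_borel \<phi>" "bounded_borel \<psi>" "bounded_borel (\<lambda>a. \<phi> a * \<psi> a)"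
  shows "mult_L2 \<phi> (mult_L2 \<psi> u) = mult_L2 (\<lambda>a. \<phi> a * \<psi> a) u"
  by (rule L2_eqI) (use rep_mult_L2[OF assms(1), of "mult_L2 \<psi> u"] rep_mult_L2[OF assms(2), of u]
      rep_mult_L2[OF assms(3), of u] in \<open>eventually_elim; simp add: mult.assoc\<close>)

lemma mult_L2_one [simp]: "mult_L2 (\<lambda>_. 1) u = u"
  by (simp add: mult_L2_def)

lemma cinner_mult_L2:
  assumes "bounded_borel \<phi>"
  shows "cinner (mult_L2 \<phi> u) v = (\<integral>a. \<phi> a * rep_L2 u a * cnj (rep_L2 v a) \<partial>lborel)"
  using assms by (intro cinner_eq_integral_AE rep_mult_L2) auto

lemma cinner_mult_L2_cnj:
  assumes "bounded_borel \<phi>" "bounded_borel (\<lambda>a. cnj (\<phi> a))"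
  shows "cinner (mult_L2 \<phi> u) v = cinner u (mult_L2 (\<lambda>a. cnj (\<phi> a)) v)"
proof -
  note [measurable] = bounded_borel_measurable[OF assms(1)]
  have "cinner u (mult_L2 (\<lambda>a. cnj (\<phi> a)) v) = (\<integral>a. rep_L2 u a * cnj (cnj (\<phi> a) * rep_L2 v a) \<partial>lborel)"
    by (intro cinner_eq_integral_AE rep_mult_L2 assms) auto
  then show ?thesis by (simp add: cinner_mult_L2[OF assms(1)] mult_ac)
qed

lemma mult_L2_add:
  assumes "bounded_borel \<phi>" "bounded_borel \<psi>" "bounded_borel (\<lambda>a. \<phi> a + \<psi> a)"
  shows "mult_L2 (\<lambda>a. \<phi> a + \<psi> a) u = mult_L2 \<phi> u + mult_L2 \<psi> u"
  by (rule L2_eqI) (use rep_mult_L2[OF assms(1), of u] rep_mult_L2[OF assms(2), of u]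
      rep_mult_L2[OF assms(3), of u] rep_plus[of "mult_L2 \<phi> u" "mult_L2 \<psi> u"]
      in \<open>eventually_elim; simp add: algebra_simps\<close>)

lemma mult_L2_scale:
  assumes "bounded_borel \<phi>" "bounded_borel (\<lambda>a. c * \<phi> a)"
  shows "mult_L2 (\<lambda>a. c * \<phi> a) u = c *\<^sub>C mult_L2 \<phi> u"
  by (rule L2_eqI) (use rep_mult_L2[OF assms(1), of u] rep_mult_L2[OF assms(2), of u]
      rep_scaleC[of c "mult_L2 \<phi> u"] in \<open>eventually_elim; simp add: algebra_simps\<close>)

text \<open>Dominated convergence for multiplication operators.\<close>

lemma mult_L2_tendsto:
  assumes \<phi>: "\<And>n. bounded_borel (\<phi> n)" and \<psi>: "bounded_borel \<psi>"
    and C: "\<And>n a. cmod (\<phi> n a) \<le> C" and lim: "\<And>a. (\<lambda>n. \<phi> n a) \<longlonglongrightarrow> \<psi> a"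
  shows "(\<lambda>n. mult_L2 (\<phi> n) u) \<longlonglongrightarrow> mult_L2 \<psi> u"
proof -
  note [measurable] = bounded_borel_measurable[OF \<phi>] bounded_borel_measurable[OF \<psi>]
  have C\<psi>: "cmod (\<psi> a) \<le> C" for a
    by (rule LIMSEQ_le_const2[OF tendsto_norm[OF lim]]) (use C in auto)
  let ?d = "\<lambda>n a. (cmod (\<phi> n a - \<psi> a))\<^sup>2 * (cmod (rep_L2 u a))\<^sup>2"
  have "(\<lambda>n. \<integral>\<^sup>+a. ennreal (?d n a) \<partial>lborel) \<longlonglongrightarrow> (\<integral>\<^sup>+a. 0 \<partial>(lborel :: 'a measure))" (is "?I \<longlonglongrightarrow> _")
  proof (rule nn_integral_dominated_convergence[where w = "\<lambda>a. ennreal ((2 * C)\<^sup>2 * (cmod (rep_L2 u a))\<^sup>2)"])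
    show "AE a in lborel. ennreal (?d n a) \<le> ennreal ((2 * C)\<^sup>2 * (cmod (rep_L2 u a))\<^sup>2)" for n
    proof (intro AE_I2 ennreal_leI mult_right_mono power_mono)
      fix a show "cmod (\<phi> n a - \<psi> a) \<le> 2 * C"
        using norm_triangle_ineq4[of "\<phi> n a" "\<psi> a"] C[of n a] C\<psi>[of a] by linarith
    qed auto
    show "(\<integral>\<^sup>+a. ennreal ((2 * C)\<^sup>2 * (cmod (rep_L2 u a))\<^sup>2) \<partial>lborel) < \<infinity>"
      by (simp add: ennreal_mult nn_integral_cmult nn_integral_norm_L2 ennreal_mult_less_top)
    show "AE a in lborel. (\<lambda>n. ennreal (?d n a)) \<longlonglongrightarrow> 0"
    proof (rule AE_I2)
      fix a
      have "(\<lambda>n. ?d n a) \<longlonglongrightarrow> 0\<^sup>2 * (cmod (rep_L2 u a))\<^sup>2"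
        by (intro tendsto_intros tendsto_power) (use lim[of a] in \<open>simp add: LIM_zero tendsto_norm_zero\<close>)
      then show "(\<lambda>n. ennreal (?d n a)) \<longlonglongrightarrow> 0" using tendsto_ennrealI by fastforce
    qed
  qed auto
  then have "?I \<longlonglongrightarrow> ennreal 0" by simp
  moreover have "(\<integral>\<^sup>+a. ennreal (?d n a) \<partial>lborel) = ennreal ((norm (mult_L2 (\<phi> n) u - mult_L2 \<psi> u))\<^sup>2)" for n
    unfolding nn_integral_diff_norm[OF rep_mult_L2[OF \<phi>] rep_mult_L2[OF \<psi>], symmetric]
    by (simp add: norm_mult power_mult_distrib flip: left_diff_distrib)
  ultimately have "(\<lambda>n. (norm (mult_L2 (\<phi> n) u - mult_L2 \<psi> u))\<^sup>2) \<longlonglongrightarrow> 0"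
    by (simp del: ennreal_0)
  then have "(\<lambda>n. sqrt ((norm (mult_L2 (\<phi> n) u - mult_L2 \<psi> u))\<^sup>2)) \<longlonglongrightarrow> sqrt 0"
    by (rule tendsto_real_sqrt)
  then show ?thesis by (simp add: LIM_zero_iff tendsto_norm_zero_iff)
qed

definition unitary :: "('a::euclidean_space L2 \<Rightarrow> 'b::euclidean_space L2) \<Rightarrow> bool" where
  "unitary V \<longleftrightarrow> surj V \<and> (\<forall>u v. cinner (V u) (V v) = cinner u v)"

lemma unitary_cinner: "unitary V \<Longrightarrow> cinner (V u) (V v) = cinner u v"
  by (simp add: unitary_def)

lemma cinner_self_eq_0: "cinner u u = 0 \<Longrightarrow> u = 0"
  by (simp add: cinner_self)

lemma unitary_add:
  assumes "unitary V" shows "V (u + v) = V u + V v"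
proof -
  let ?d = "V (u + v) - (V u + V v)"
  have "cinner ?d ?d = 0"
    by (simp add: cinner_diff_left cinner_diff_right cinner_add_left cinner_add_right unitary_cinner[OF assms])
  then show ?thesis using cinner_self_eq_0 by fastforce
qed

lemma unitary_scaleC:
  assumes "unitary V" shows "V (c *\<^sub>C u) = c *\<^sub>C V u"
proof -
  let ?d = "V (c *\<^sub>C u) - c *\<^sub>C V u"
  have "cinner ?d ?d = 0"
    by (simp add: cinner_diff_left cinner_diff_right unitary_cinner[OF assms])
  then show ?thesis using cinner_self_eq_0 by fastforce
qed

lemma unitary_diff: "unitary V \<Longrightarrow> V (u - v) = V u - V v"
  by (simp add: minus_eq_scaleC unitary_add unitary_scaleC)

lemma unitary_norm:
  assumes "unitary V" shows "norm (V u) = norm u"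
proof -
  have "complex_of_real ((norm (V u))\<^sup>2) = of_real ((norm u)\<^sup>2)"
    unfolding cinner_self[symmetric] by (rule unitary_cinner[OF assms])
  then show ?thesis unfolding of_real_eq_iff by (simp add: power2_eq_iff_nonneg)
qed

lemma unitary_bij: assumes "unitary V" shows "bij V"
proof -
  have "inj V"
  proof (rule injI)
    fix u v assume "V u = V v"
    then have "norm (V (u - v)) = 0" by (simp add: unitary_diff[OF assms])
    then show "u = v" by (simp add: unitary_norm[OF assms])
  qed
  then show ?thesis using assms by (auto simp: unitary_def bij_def)
qed

lemma unitary_inv: assumes "unitary V" shows "unitary (inv V)"
  unfolding unitary_def
proof (intro conjI allI)
  show "surj (inv V)" using unitary_bij[OF assms] by (simp add: bij_imp_bij_inv bij_is_surj)
  fix u v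
  show "cinner (inv V u) (inv V v) = cinner u v"
    using unitary_cinner[OF assms, of "inv V u" "inv V v"] assms by (simp add: unitary_def surj_f_inv_f)
qed

lemma unitary_inv_f [simp]: "unitary V \<Longrightarrow> inv V (V u) = u"
  using unitary_bij[of V] by (simp add: bij_is_inj)

lemma unitary_f_inv [simp]: "unitary V \<Longrightarrow> V (inv V u) = u"
  by (simp add: unitary_def surj_f_inv_f)

lemma unitary_comp: "unitary V \<Longrightarrow> unitary W \<Longrightarrow> unitary (\<lambda>u. V (W u))"
  unfolding unitary_def by (auto simp: surj_def) metis

lemma unitary_adjoint: "unitary V \<Longrightarrow> cinner (V u) v = cinner u (inv V v)"
  by (metis unitary_cinner unitary_f_inv)

lemma unitary_tendsto [tendsto_intros]:
  assumes "unitary V" "(f \<longlongrightarrow> u) F" shows "((\<lambda>x. V (f x)) \<longlongrightarrow> V u) F"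
proof -
  have "((\<lambda>x. norm (V (f x) - V u)) \<longlongrightarrow> 0) F"
    unfolding unitary_diff[OF assms(1), symmetric] unitary_norm[OF assms(1)]
    using assms(2) by (simp add: LIM_zero tendsto_norm_zero)
  then show ?thesis by (simp add: LIM_zero_iff tendsto_norm_zero_iff)
qed

lemma unitary_mult_L2:
  assumes [measurable]: "\<phi> \<in> borel_measurable borel" and 1: "\<And>a. cmod (\<phi> a) = 1"
  shows "unitary (mult_L2 \<phi>)"
proof -
  have b: "bounded_borel \<phi>" "bounded_borel (\<lambda>a. cnj (\<phi> a))"
    using 1 by (auto intro!: bounded_borelI[where C = 1])
  have c: "\<phi> a * cnj (\<phi> a) = 1" for a using complex_norm_square[of "\<phi> a"] 1[of a] by simp
  have c': "cnj (\<phi> a) * \<phi> a = 1" for a using c[of a] by (simp add: mult.commute)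
  have b1: "bounded_borel (\<lambda>_::'a. 1)" by (rule bounded_borelI[where C = 1]) auto
  have r: "mult_L2 \<phi> (mult_L2 (\<lambda>a. cnj (\<phi> a)) u) = u" "mult_L2 (\<lambda>a. cnj (\<phi> a)) (mult_L2 \<phi> u) = u" for u
    using mult_L2_mult_L2[of \<phi> "\<lambda>a. cnj (\<phi> a)" u] mult_L2_mult_L2[of "\<lambda>a. cnj (\<phi> a)" \<phi> u] b b1 by (simp_all add: c c')
  show ?thesis unfolding unitary_def
    using r by (auto intro!: surjI[of _ "mult_L2 (\<lambda>a. cnj (\<phi> a))"] simp: cinner_mult_L2_cnj b)
qed

text \<open>Two total families with the same Gram matrix are related by a unitary operator: the
  correspondence extends to spans, and by completeness to closures.\<close>

inductive_set gram_graph :: "('i \<Rightarrow> 'a::euclidean_space L2) \<Rightarrow> ('i \<Rightarrow> 'b::euclidean_space L2) \<Rightarrow> ('a L2 \<times> 'b L2) set"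
  for g :: "'i \<Rightarrow> 'a L2" and h :: "'i \<Rightarrow> 'b L2" where
  base: "(g i, h i) \<in> gram_graph g h"
| zero: "(0, 0) \<in> gram_graph g h"
| add: "(u, v) \<in> gram_graph g h \<Longrightarrow> (u', v') \<in> gram_graph g h \<Longrightarrow> (u + u', v + v') \<in> gram_graph g h"
| scale: "(u, v) \<in> gram_graph g h \<Longrightarrow> (c *\<^sub>C u, c *\<^sub>C v) \<in> gram_graph g h"

lemma gram_graph_swap: "(u, v) \<in> gram_graph g h \<Longrightarrow> (v, u) \<in> gram_graph h g"
  by (induction rule: gram_graph.induct) (auto intro: gram_graph.intros)

lemma gram_graph_cinner:
  assumes gram: "\<And>i j. cinner (g i) (g j) = cinner (h i) (h j)"
    and "(u, v) \<in> gram_graph g h" and "(u', v') \<in> gram_graph g h"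
  shows "cinner u u' = cinner v v'"
  using assms(2)
proof (induction rule: gram_graph.induct)
  case (base i)
  from assms(3) show ?case
    by (induction rule: gram_graph.induct) (auto simp: gram cinner_add_right)
qed (auto simp: cinner_add_left)

lemma gram_graph_closure_total:
  fixes g :: "'i \<Rightarrow> 'a::euclidean_space L2" and h :: "'i \<Rightarrow> 'b::euclidean_space L2"
  assumes gram: "\<And>i j. cinner (g i) (g j) = cinner (h i) (h j)"
    and total: "\<And>w. (\<And>i. cinner (g i) w = 0) \<Longrightarrow> w = 0"
  shows "\<exists>v. (u, v) \<in> closure (gram_graph g h)"
proof -
  let ?G = "closure (gram_graph g h)"
  define S where "S = {u. \<exists>v. (u, v) \<in> ?G}"
  have Gseq: "p \<in> ?G \<longleftrightarrow> (\<exists>x. (\<forall>n. x n \<in> gram_graph g h) \<and> x \<longlonglongrightarrow> p)" for p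
    by (rule closure_sequential)
  have Gadd: "(u + u', v + v') \<in> ?G" if "(u, v) \<in> ?G" "(u', v') \<in> ?G" for u v u' v'
  proof -
    from that obtain x y where "\<forall>n. x n \<in> gram_graph g h" "x \<longlonglongrightarrow> (u, v)" "\<forall>n. y n \<in> gram_graph g h" "y \<longlonglongrightarrow> (u', v')"
      unfolding Gseq by blast
    then show ?thesis unfolding Gseq
      by (intro exI[of _ "\<lambda>n. (fst (x n) + fst (y n), snd (x n) + snd (y n))"])
         (use tendsto_Pair[OF tendsto_add[OF tendsto_fst tendsto_fst] tendsto_add[OF tendsto_snd tendsto_snd], of x "(u, v)" sequentially y "(u', v')" x "(u, v)" y "(u', v')"]
           in \<open>auto intro: gram_graph.add\<close>)
  qed
  have Gscale: "(c *\<^sub>C u, c *\<^sub>C v) \<in> ?G" if "(u, v) \<in> ?G" for u v c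
  proof -
    from that obtain x where "\<forall>n. x n \<in> gram_graph g h" "x \<longlonglongrightarrow> (u, v)"
      unfolding Gseq by blast
    then show ?thesis unfolding Gseq
      by (intro exI[of _ "\<lambda>n. (c *\<^sub>C fst (x n), c *\<^sub>C snd (x n))"])
         (use tendsto_Pair[OF tendsto_scaleC[OF tendsto_fst] tendsto_scaleC[OF tendsto_snd], of x "(u, v)" sequentially x "(u, v)" c c]
           in \<open>auto intro: gram_graph.scale\<close>)
  qed
  have nrm: "norm u = norm v" if "(u, v) \<in> ?G" for u v
  proof -
    from that obtain x where x: "\<forall>n. x n \<in> gram_graph g h" "x \<longlonglongrightarrow> (u, v)"
      unfolding Gseq by blast
    have "norm (fst (x n)) = norm (snd (x n))" for n
    proof -
      have "cinner (fst (x n)) (fst (x n)) = cinner (snd (x n)) (snd (x n))"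
        by (rule gram_graph_cinner[OF gram]) (use x in auto)
      then show ?thesis by (simp add: cinner_self power2_eq_iff_nonneg del: of_real_power)
    qed
    moreover have "(\<lambda>n. norm (fst (x n))) \<longlonglongrightarrow> norm u" "(\<lambda>n. norm (snd (x n))) \<longlonglongrightarrow> norm v"
      using tendsto_norm[OF tendsto_fst[OF x(2)]] tendsto_norm[OF tendsto_snd[OF x(2)]] by auto
    ultimately show ?thesis using LIMSEQ_unique by simp
  qed
  have "closed S"
    unfolding closed_sequential_limits
  proof (intro allI impI)
    fix x l assume *: "(\<forall>n. x n \<in> S) \<and> x \<longlonglongrightarrow> l"
    then obtain y where y: "\<And>n. (x n, y n) \<in> ?G" unfolding S_def by (simp add: Bex_def) metis
    have d: "norm (y m - y n) = norm (x m - x n)" for m n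
      using nrm[OF Gadd[OF y[of m] Gscale[OF y[of n], of "-1"]]] by (simp add: minus_eq_scaleC)
    have "Cauchy x" using * LIMSEQ_imp_Cauchy by blast
    then have "Cauchy y" unfolding Cauchy_iff d .
    then obtain m where "y \<longlonglongrightarrow> m" using Cauchy_convergent convergent_def by blast
    then have "(\<lambda>n. (x n, y n)) \<longlonglongrightarrow> (l, m)" using * by (intro tendsto_Pair) auto
    from closed_sequentially[OF closed_closure _ this] y show "l \<in> S" by (auto simp: S_def)
  qed
  moreover have gS: "g i \<in> S" for i
    using gram_graph.base[of g i h] closure_subset by (auto simp: S_def)
  moreover have "0 \<in> S" using gram_graph.zero[of g h] closure_subset by (auto simp: S_def)
  moreover have "x + y \<in> S" if "x \<in> S" "y \<in> S" for x y
    using that Gadd unfolding S_def by blast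
  moreover have "c *\<^sub>C x \<in> S" if "x \<in> S" for c x
    using that Gscale unfolding S_def by blast
  ultimately have "u \<in> S"
    using total by (intro complex_subspace_dense[of S u]) blast+
  then show ?thesis by (simp add: S_def)
qed

lemma unitary_extension:
  fixes g :: "'i \<Rightarrow> 'a::euclidean_space L2" and h :: "'i \<Rightarrow> 'b::euclidean_space L2"
  assumes gram: "\<And>i j. cinner (g i) (g j) = cinner (h i) (h j)"
    and total_g: "\<And>w. (\<And>i. cinner (g i) w = 0) \<Longrightarrow> w = 0"
    and total_h: "\<And>w. (\<And>i. cinner (h i) w = 0) \<Longrightarrow> w = 0"
  obtains V where "unitary V" "\<And>i. V (g i) = h i"
proof -
  let ?G = "closure (gram_graph g h)"
  have G_cinner: "cinner u u' = cinner v v'" if "(u, v) \<in> ?G" "(u', v') \<in> ?G" for u v u' v'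
  proof -
    from that obtain x y where x: "\<forall>n. x n \<in> gram_graph g h" "x \<longlonglongrightarrow> (u, v)"
      and y: "\<forall>n. y n \<in> gram_graph g h" "y \<longlonglongrightarrow> (u', v')"
      unfolding closure_sequential by blast
    have eq: "cinner (fst (x n)) (fst (y n)) = cinner (snd (x n)) (snd (y n))" for n
    proof (rule gram_graph_cinner[OF gram])
      show "(fst (x n), snd (x n)) \<in> gram_graph g h" using x(1) by simp
      show "(fst (y n), snd (y n)) \<in> gram_graph g h" using y(1) by simp
    qed
    have "(\<lambda>n. cinner (fst (x n)) (fst (y n))) \<longlonglongrightarrow> cinner u u'"
      using tendsto_cinner[OF tendsto_fst[OF x(2)] tendsto_fst[OF y(2)]] by simp
    moreover have "(\<lambda>n. cinner (fst (x n)) (fst (y n))) \<longlonglongrightarrow> cinner v v'"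
      unfolding eq using tendsto_cinner[OF tendsto_snd[OF x(2)] tendsto_snd[OF y(2)]] by simp
    ultimately show ?thesis by (rule LIMSEQ_unique)
  qed
  have "\<forall>u. \<exists>v. (u, v) \<in> ?G" by (intro allI gram_graph_closure_total gram total_g)
  then obtain V where "\<forall>u. (u, V u) \<in> ?G" by (rule choice[THEN exE])
  then have V: "(u, V u) \<in> ?G" for u by simp
  have uniq: "v = V u" if "(u, v) \<in> ?G" for u v
  proof -
    have "cinner (v - V u) (v - V u) = 0"
      using G_cinner[OF that that, symmetric] G_cinner[OF that V[of u], symmetric]
        G_cinner[OF V[of u] that, symmetric] G_cinner[OF V[of u] V[of u], symmetric]
      by (simp add: cinner_diff_left cinner_diff_right)
    then show ?thesis using cinner_self_eq_0 by fastforce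
  qed
  have "surj V"
    unfolding surj_def
  proof
    fix v
    have "\<exists>u. (v, u) \<in> closure (gram_graph h g)"
      by (rule gram_graph_closure_total[OF gram[symmetric] total_h])
    then obtain u where "(v, u) \<in> closure (gram_graph h g)" by (rule exE)
    then obtain x where x: "\<forall>n. x n \<in> gram_graph h g" "x \<longlonglongrightarrow> (v, u)"
      unfolding closure_sequential by blast
    have "(u, v) \<in> ?G" unfolding closure_sequential
    proof (intro exI[of _ "\<lambda>n. (snd (x n), fst (x n))"] conjI allI)
      show "(snd (x n), fst (x n)) \<in> gram_graph g h" for n
        by (rule gram_graph_swap) (simp add: x(1))
      show "(\<lambda>n. (snd (x n), fst (x n))) \<longlonglongrightarrow> (u, v)"
        using tendsto_Pair[OF tendsto_snd[OF x(2)] tendsto_fst[OF x(2)]] by simp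
    qed
    then show "\<exists>u. v = V u" using uniq by blast
  qed
  then have "unitary V" unfolding unitary_def using G_cinner[OF V V, symmetric] by simp
  moreover have "V (g i) = h i" for i
    by (rule uniq[symmetric]) (rule subsetD[OF closure_subset gram_graph.base])
  ultimately show ?thesis by (rule that)
qed

section \<open>Projection-valued measures\<close>

lemma L2_eqI_cinner: "(\<And>w. cinner u w = cinner v w) \<Longrightarrow> u = v"
  using cinner_self_eq_0[of "u - v"] by (simp add: cinner_diff_left)

lemma cinner_dense_zero:
  assumes dense: "closure D = UNIV" and 0: "\<And>w. w \<in> D \<Longrightarrow> cinner x w = 0"
  shows "x = 0"
proof -
  have "x \<in> closure D" using dense by simp
  then obtain w where w: "\<And>n. w n \<in> D" "w \<longlonglongrightarrow> x" unfolding closure_sequential by blast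
  have "(\<lambda>n. cinner x (w n)) \<longlonglongrightarrow> cinner x x" by (rule tendsto_cinner[OF tendsto_const w(2)])
  then have "(\<lambda>n::nat. 0) \<longlonglongrightarrow> cinner x x" using 0[OF w(1)] by simp
  then have "cinner x x = 0" using LIMSEQ_unique tendsto_const by blast
  then show ?thesis by (rule cinner_self_eq_0)
qed

lemma cinner_polarization:
  "cinner u v = (\<Sum>m<4. \<i> ^ m * of_real ((norm (u + \<i> ^ m *\<^sub>C v))\<^sup>2)) / 4"
proof -
  have s: "(\<Sum>m<4. f m) = f 0 + f 1 + f 2 + f (3::nat)" for f :: "nat \<Rightarrow> complex"
    by (simp add: numeral_eq_Suc)
  have i3: "\<i> ^ 3 = - \<i>" by (simp add: power3_eq_cube)
  show ?thesis
    unfolding s cinner_self[symmetric] i3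
    by (simp add: cinner_add_left cinner_add_right algebra_simps)
qed

locale pvm =
  fixes E :: "real set \<Rightarrow> 'a::euclidean_space L2 \<Rightarrow> 'a L2"
  assumes pvm: "projection_valued_measure E"
begin

lemma idem: "B \<in> sets borel \<Longrightarrow> E B (E B u) = E B u"
  and sym: "B \<in> sets borel \<Longrightarrow> cinner (E B u) v = cinner u (E B v)"
  and UNIV [simp]: "E UNIV u = u"
  and sums: "range C \<subseteq> sets borel \<Longrightarrow> disjoint_family C \<Longrightarrow> (\<lambda>m. E (C m) u) sums E (\<Union>m. C m) u"
  using pvm by (auto simp: projection_valued_measure_def)

lemma add: "B \<in> sets borel \<Longrightarrow> E B (u + v) = E B u + E B v"
  by (rule L2_eqI_cinner) (simp add: sym cinner_add_left)

lemma scale: "B \<in> sets borel \<Longrightarrow> E B (c *\<^sub>C u) = c *\<^sub>C E B u"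
  by (rule L2_eqI_cinner) (simp add: sym)

lemma diff: "B \<in> sets borel \<Longrightarrow> E B (u - v) = E B u - E B v"
  by (simp add: minus_eq_scaleC add scale)

lemma zero: "B \<in> sets borel \<Longrightarrow> E B 0 = 0"
  using scale[of B 0 0] by simp

lemma empty [simp]: "E {} u = 0"
proof -
  have "(\<lambda>m::nat. E {} u) sums E (\<Union>m::nat. {}) u"
    by (rule sums) (auto simp: disjoint_family_on_def)
  then show ?thesis using summable_const_iff sums_summable by blast
qed

lemma union:
  assumes "B \<in> sets borel" "C \<in> sets borel" "B \<inter> C = {}"
  shows "E (B \<union> C) u = E B u + E C u"
proof -
  have "(\<lambda>m. E (binaryset B C m) u) sums E (\<Union>m. binaryset B C m) u"
    by (rule sums) (use assms in \<open>auto simp: range_binaryset_eq disjoint_family_on_def binaryset_def\<close>)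
  moreover have "(\<lambda>m. E (binaryset B C m) u) sums (E B u + E C u)"
    by (rule binaryset_sums[where f = "\<lambda>B. E B u"]) simp
  ultimately show ?thesis by (metis UN_binaryset_eq sums_unique2)
qed

text \<open>If \<open>P\<close>, \<open>Q\<close> and \<open>P + Q\<close> are projections then \<open>P Q + Q P = 0\<close>, and multiplying by \<open>P\<close>
  on either side gives \<open>P Q = Q P = 0\<close>.\<close>

lemma orth:
  assumes B: "B \<in> sets borel" and C: "C \<in> sets borel" and "B \<inter> C = {}"
  shows "E B (E C u) = 0"
proof -
  note U = union[OF assms]
  have BC: "B \<union> C \<in> sets borel" using B C by simp
  have anti: "E B (E C v) + E C (E B v) = 0" for v
  proof -
    have "(E B v + E B (E C v)) + (E C (E B v) + E C v) = E B v + E C v"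
      using idem[OF BC, of v] unfolding U add[OF B] add[OF C] idem[OF B] idem[OF C] .
    moreover have "E B (E C v) + E C (E B v)
        = ((E B v + E B (E C v)) + (E C (E B v) + E C v)) - (E B v + E C v)"
      by (simp add: algebra_simps)
    ultimately show ?thesis by (simp only: diff_self)
  qed
  have "E B (E C u) + E B (E C (E B u)) = 0"
    using arg_cong[OF anti[of u], of "E B"] by (simp add: add B idem zero)
  moreover have "E B (E C (E B u)) + E C (E B u) = 0"
    using anti[of "E B u"] by (simp add: B idem)
  ultimately have "E B (E C u) = E C (E B u)" by (metis add_left_cancel add.commute)
  with anti[of u] have "2 *\<^sub>R E B (E C u) = 0" by (simp add: scaleR_2)
  then show ?thesis by simp
qed

lemma Int:
  assumes B: "B \<in> sets borel" and C: "C \<in> sets borel"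
  shows "E B (E C u) = E (B \<inter> C) u"
proof -
  have BC: "B \<inter> C \<in> sets borel" "C - B \<in> sets borel" "B - C \<in> sets borel" using B C by auto
  have "E C u = E (B \<inter> C) u + E (C - B) u"
    using union[OF BC(1,2), of u] by (metis Int_Diff_Un Int_Diff_disjoint inf_commute)
  then have "E B (E C u) = E B (E (B \<inter> C) u)"
    using orth[OF B BC(2), of u] by (simp add: add B)
  also have "\<dots> = E (B \<inter> C) (E (B \<inter> C) u) + E (B - C) (E (B \<inter> C) u)"
    using union[OF BC(1,3), of "E (B \<inter> C) u"] by (metis Int_Diff_Un Int_Diff_disjoint)
  also have "\<dots> = E (B \<inter> C) u"
  proof -
    have "(B - C) \<inter> (B \<inter> C) = {}" by auto
    from orth[OF BC(3,1) this, of u] show ?thesis by (simp add: idem BC)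
  qed
  finally show ?thesis .
qed

lemma compl:
  assumes "B \<in> sets borel" shows "E B u + E (- B) u = u"
  using union[of B "- B" u] assms by simp

lemma norm_sq: "B \<in> sets borel \<Longrightarrow> cinner (E B u) u = of_real ((norm (E B u))\<^sup>2)"
  by (metis cinner_self idem sym)

lemma emeasure_spectral:
  assumes "B \<in> sets borel"
  shows "emeasure (spectral_distribution E u) B = ennreal ((norm (E B u))\<^sup>2)"
proof (rule emeasure_measure_of[OF spectral_distribution_def])
  show "countably_additive (sets (spectral_distribution E u)) (\<lambda>B. ennreal ((norm (E B u))\<^sup>2))"
  proof (rule countably_additiveI)
    fix C :: "nat \<Rightarrow> real set"
    assume C: "range C \<subseteq> sets (spectral_distribution E u)" "disjoint_family C"
    then have C': "range C \<subseteq> sets borel"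
      by (simp add: spectral_distribution_def sets.sigma_sets_eq[of borel, simplified])
    then have m: "C m \<in> sets borel" for m by auto
    have sq: "inner (E B u) u = (norm (E B u))\<^sup>2" if "B \<in> sets borel" for B
      using norm_sq[OF that, of u] by (simp add: inner_L2_def)
    have "(\<lambda>m. inner (E (C m) u) u) sums inner (E (\<Union>m. C m) u) u"
      by (rule bounded_linear.sums[OF bounded_linear_inner_left sums[OF C' C(2)]])
    then have "(\<lambda>m. (norm (E (C m) u))\<^sup>2) sums (norm (E (\<Union>m. C m) u))\<^sup>2"
      using m by (simp add: sq)
    then show "(\<Sum>m. ennreal ((norm (E (C m) u))\<^sup>2)) = ennreal ((norm (E (\<Union>m. C m) u))\<^sup>2)"
      by (intro suminf_ennreal_eq) auto
  qed
qed (use assms in \<open>auto simp: positive_def spectral_distribution_def sets.sigma_sets_eq[of borel, simplified]\<close>)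

lemma sets_spectral [simp, measurable_cong]: "sets (spectral_distribution E u) = sets borel"
  by (simp add: spectral_distribution_def sets.sigma_sets_eq[of borel, simplified])

lemma space_spectral [simp]: "space (spectral_distribution E u) = UNIV"
  by (simp add: spectral_distribution_def)

lemma finite_spectral: "finite_measure (spectral_distribution E u)"
  by (rule finite_measureI) (simp add: emeasure_spectral)

lemma spectral_restrict:
  assumes "I \<in> sets borel"
  shows "spectral_distribution E (E I u) = density (spectral_distribution E u) (\<lambda>t. ennreal (indicator I t))"
proof (rule measure_eqI)
  fix B assume "B \<in> sets (spectral_distribution E (E I u))"
  then have B: "B \<in> sets borel" by simp
  have "emeasure (density (spectral_distribution E u) (\<lambda>t. ennreal (indicator I t))) B
     = (\<integral>\<^sup>+t. indicator (I \<inter> B) t \<partial>spectral_distribution E u)"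
  proof -
    have "ennreal (indicator I t) * indicator B t = indicator (I \<inter> B) t" for t
      by (auto split: split_indicator)
    then show ?thesis using assms B by (subst emeasure_density) simp_all
  qed
  also have "\<dots> = ennreal ((norm (E (I \<inter> B) u))\<^sup>2)"
    using assms B by (simp add: emeasure_spectral)
  finally show "emeasure (spectral_distribution E (E I u)) B
     = emeasure (density (spectral_distribution E u) (\<lambda>t. ennreal (indicator I t))) B"
    using assms B by (simp add: emeasure_spectral Int Int_commute)
qed simp

lemma integrable_restrict_iff:
  fixes f :: "real \<Rightarrow> complex"
  assumes "I \<in> sets borel" "f \<in> borel_measurable borel"
  shows "integrable (spectral_distribution E (E I u)) f
    \<longleftrightarrow> integrable (spectral_distribution E u) (\<lambda>t. indicator I t *\<^sub>R f t)"
  unfolding spectral_restrict[OF assms(1)]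
  using assms by (subst integrable_density) auto

lemma integral_restrict:
  fixes f :: "real \<Rightarrow> complex"
  assumes "I \<in> sets borel" "f \<in> borel_measurable borel"
  shows "(\<integral>t. f t \<partial>spectral_distribution E (E I u)) = (\<integral>t. indicator I t *\<^sub>R f t \<partial>spectral_distribution E u)"
  unfolding spectral_restrict[OF assms(1)]
  using assms by (subst integral_density) auto

lemma integral_split:
  fixes f :: "real \<Rightarrow> complex"
  assumes I: "I \<in> sets borel" and f: "f \<in> borel_measurable borel"
    and 1: "integrable (spectral_distribution E (E I u)) f" and 2: "integrable (spectral_distribution E (E (- I) u)) f"
  shows "(\<integral>t. f t \<partial>spectral_distribution E u)
    = (\<integral>t. f t \<partial>spectral_distribution E (E I u)) + (\<integral>t. f t \<partial>spectral_distribution E (E (- I) u))"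
proof -
  have I': "- I \<in> sets borel" using I by simp
  have "(\<integral>t. f t \<partial>spectral_distribution E u)
     = (\<integral>t. indicator I t *\<^sub>R f t + indicator (- I) t *\<^sub>R f t \<partial>spectral_distribution E u)"
    by (rule Bochner_Integration.integral_cong) (auto simp: indicator_def)
  also have "\<dots> = (\<integral>t. indicator I t *\<^sub>R f t \<partial>spectral_distribution E u) + (\<integral>t. indicator (- I) t *\<^sub>R f t \<partial>spectral_distribution E u)"
    using 1 2 by (intro Bochner_Integration.integral_add) (simp_all add: integrable_restrict_iff I I' f)
  finally show ?thesis by (simp add: integral_restrict I I' f)
qed

lemma spectral_distribution_unimodular:
  assumes "cmod c = 1"
  shows "spectral_distribution E (c *\<^sub>C u) = spectral_distribution E u"
  by (rule measure_eqI) (simp_all add: emeasure_spectral scale assms)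

lemma spectral_domain_id: "u \<in> spectral_domain E complex_of_real \<longleftrightarrow> integrable (spectral_distribution E u) (\<lambda>t. t\<^sup>2)"
  by (simp add: spectral_domain_def)

lemma spectral_domain_restrict:
  assumes "u \<in> spectral_domain E complex_of_real" and I: "I \<in> sets borel"
  shows "E I u \<in> spectral_domain E complex_of_real"
proof -
  have "integrable (spectral_distribution E u) (\<lambda>t. indicator I t *\<^sub>R t\<^sup>2)"
    by (rule Bochner_Integration.integrable_bound[OF assms(1)[unfolded spectral_domain_id]])
       (use I in \<open>auto simp: indicator_def\<close>)
  then show ?thesis unfolding spectral_domain_id spectral_restrict[OF I]
    by (subst integrable_density) (use I in auto)
qed

lemma spectral_domain_integrable:
  assumes "u \<in> spectral_domain E complex_of_real"
  shows "integrable (spectral_distribution E u) complex_of_real"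
proof -
  interpret finite_measure "spectral_distribution E u" by (rule finite_spectral)
  have "integrable (spectral_distribution E u) (\<lambda>t. 1 + t\<^sup>2)"
    using assms unfolding spectral_domain_id by (intro Bochner_Integration.integrable_add integrable_const)
  then show ?thesis
  proof (rule Bochner_Integration.integrable_bound)
    have "\<bar>t\<bar> \<le> 1 + t\<^sup>2" for t :: real
      using sum_squares_bound[of "\<bar>t\<bar>" 1] abs_ge_zero[of t] unfolding power2_abs one_power2 by linarith
    then show "AE t in spectral_distribution E u. norm (complex_of_real t) \<le> norm (1 + t\<^sup>2)" by simp
  qed measurable
qed

lemma spectral_domain_bounded_range:
  assumes "E {s-\<delta>..s+\<delta>} w = w"
  shows "w \<in> spectral_domain E complex_of_real"
proof -
  interpret finite_measure "spectral_distribution E w" by (rule finite_spectral)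
  have "integrable (spectral_distribution E w) (\<lambda>t. indicator {s-\<delta>..s+\<delta>} t *\<^sub>R t\<^sup>2)"
  proof (rule integrable_const_bound[where B = "(\<bar>s\<bar> + \<bar>\<delta>\<bar>)\<^sup>2"], rule AE_I2)
    fix t show "norm (indicator {s-\<delta>..s+\<delta>} t *\<^sub>R t\<^sup>2) \<le> (\<bar>s\<bar> + \<bar>\<delta>\<bar>)\<^sup>2"
      by (auto simp: indicator_def abs_le_square_iff[symmetric])
  qed measurable
  then have "integrable (spectral_distribution E (E {s-\<delta>..s+\<delta>} w)) (\<lambda>t. t\<^sup>2)"
    by (subst spectral_restrict, simp, subst integrable_density) auto
  then show ?thesis by (simp add: spectral_domain_id assms)
qed

lemma integral_bounded_range:
  assumes w: "E {s-\<delta>..s+\<delta>} w = w"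
  obtains r :: real where "(\<integral>t. complex_of_real t \<partial>spectral_distribution E w) = of_real r"
    "\<bar>r - s * (norm w)\<^sup>2\<bar> \<le> \<delta> * (norm w)\<^sup>2"
proof
  interpret finite_measure "spectral_distribution E w" by (rule finite_spectral)
  let ?M = "spectral_distribution E w"
  have int: "integrable ?M (\<lambda>t. t)"
    using spectral_domain_integrable[OF spectral_domain_bounded_range[OF w]]
    by (simp only: complex_of_real_integrable_eq)
  show "(\<integral>t. complex_of_real t \<partial>?M) = of_real (\<integral>t. t \<partial>?M)" by simp
  have mu: "measure ?M UNIV = (norm w)\<^sup>2" by (simp add: measure_def emeasure_spectral)
  have "emeasure ?M (- {s-\<delta>..s+\<delta>}) = 0"
    using orth[of "- {s-\<delta>..s+\<delta>}" "{s-\<delta>..s+\<delta>}" w] by (simp add: emeasure_spectral w)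
  then have ae: "AE t in ?M. t \<in> {s-\<delta>..s+\<delta>}"
    by (intro AE_I[where N = "- {s-\<delta>..s+\<delta>}"]) auto
  have "(\<integral>t. t \<partial>?M) \<le> (\<integral>t. s + \<delta> \<partial>?M)"
    by (intro integral_mono_AE int integrable_const) (use ae in auto)
  moreover have "(\<integral>t. s - \<delta> \<partial>?M) \<le> (\<integral>t. t \<partial>?M)"
    by (intro integral_mono_AE int integrable_const) (use ae in auto)
  ultimately show "\<bar>(\<integral>t. t \<partial>?M) - s * (norm w)\<^sup>2\<bar> \<le> \<delta> * (norm w)\<^sup>2"
    by (simp add: mu algebra_simps abs_le_iff)
qed

lemma incseq_tendsto:
  assumes "incseq B" "\<And>n. B n \<in> sets borel"
  shows "(\<lambda>n. E (B n) u) \<longlonglongrightarrow> E (\<Union>n. B n) u"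
proof -
  have "(\<lambda>m. E (disjointed B m) u) sums E (\<Union>m. disjointed B m) u"
    by (rule sums) (use assms sets.range_disjointed_sets[of B borel] in \<open>auto simp: disjoint_family_disjointed\<close>)
  from LIMSEQ_Suc[OF this[unfolded sums_def UN_disjointed_eq]]
  have "(\<lambda>n. \<Sum>m<Suc n. E (disjointed B m) u) \<longlonglongrightarrow> E (\<Union>n. B n) u" .
  moreover have "(\<Sum>m<Suc n. E (disjointed B m) u) = E (B n) u" for n
  proof (induction n)
    case (Suc n)
    have d: "disjointed B (Suc n) = B (Suc n) - B n"
      using assms(1) by (auto simp: disjointed_def incseq_def) (metis less_Suc_eq_le le_refl lessI subsetD)+
    have "B (Suc n) = B n \<union> (B (Suc n) - B n)" using incseq_SucD[OF assms(1), of n] by auto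
    with Suc union[of "B n" "B (Suc n) - B n" u] assms(2) show ?case by (simp add: d)
  qed (simp add: disjointed_def)
  ultimately show ?thesis by (simp only:)
qed

end

section \<open>Functional calculus of a diagonalised operator\<close>

lemma AE_nat_bound:
  assumes "\<And>N::nat. AE x in M. cmod (F x) \<le> real N \<longrightarrow> P x"
  shows "AE x in M. P x"
proof -
  have "AE x in M. \<forall>N::nat. cmod (F x) \<le> real N \<longrightarrow> P x"
    unfolding AE_all_countable by (intro allI assms)
  then show ?thesis
  proof eventually_elim
    case (elim x)
    obtain N :: nat where "cmod (F x) \<le> real N" using real_arch_simple by blast
    with elim show ?case by blast
  qed
qed

locale diagonalization =
  fixes V :: "'a::euclidean_space L2 \<Rightarrow> 'a L2" and \<mu> :: "'a \<Rightarrow> real"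
  assumes V: "unitary V" and \<mu> [measurable]: "\<mu> \<in> borel_measurable borel"
begin

definition graph :: "(real \<Rightarrow> complex) \<Rightarrow> 'a op_graph" where
  "graph F = {(u, v). AE a in lborel. rep_L2 (V v) a = F (\<mu> a) * rep_L2 (V u) a}"

definition fop :: "(real \<Rightarrow> complex) \<Rightarrow> 'a L2 \<Rightarrow> 'a L2" where
  "fop F u = inv V (mult_L2 (\<lambda>a. F (\<mu> a)) (V u))"

definition E :: "real set \<Rightarrow> 'a L2 \<Rightarrow> 'a L2" where
  "E B = fop (indicator B)"

lemma bounded_borel_comp: "bounded_borel F \<Longrightarrow> bounded_borel (\<lambda>a. F (\<mu> a))"
  by (erule bounded_borelE, rule bounded_borelI) auto

lemma bounded_borel_times:
  assumes "bounded_borel F" "bounded_borel G" shows "bounded_borel (\<lambda>t. F t * G t)"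
proof -
  obtain C D where [measurable]: "F \<in> borel_measurable borel" "G \<in> borel_measurable borel"
    and "\<And>a. cmod (F a) \<le> C" "C > 0" "\<And>a. cmod (G a) \<le> D" "D > 0"
    using assms by (metis bounded_borelE)
  then show ?thesis
    by (intro bounded_borelI[where C = "C * D"]) (auto simp: norm_mult less_imp_le intro: mult_mono)
qed

lemma bounded_borel_indicator [simp]: "B \<in> sets borel \<Longrightarrow> bounded_borel (indicator B)"
  by (rule bounded_borelI[where C = 1]) (auto simp: indicator_def)

lemma rep_fop: "bounded_borel F \<Longrightarrow> AE a in lborel. rep_L2 (V (fop F u)) a = F (\<mu> a) * rep_L2 (V u) a"
  unfolding fop_def using rep_mult_L2[OF bounded_borel_comp, of F "V u"] by (simp add: V)

lemma fop_eqI: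
  assumes "bounded_borel F" "AE a in lborel. rep_L2 (V v) a = F (\<mu> a) * rep_L2 (V u) a"
  shows "v = fop F u"
proof -
  have "V v = V (fop F u)"
    by (rule L2_eqI) (use rep_fop[OF assms(1), of u] assms(2) in \<open>eventually_elim; simp\<close>)
  then show ?thesis using unitary_bij[OF V] by (simp add: bij_is_inj inj_eq)
qed

lemma fop_fop:
  assumes "bounded_borel F" "bounded_borel G"
  shows "fop F (fop G u) = fop (\<lambda>t. F t * G t) u"
  by (rule fop_eqI) (use assms bounded_borel_times rep_fop[OF assms(1), of "fop G u"] rep_fop[OF assms(2), of u]
    in \<open>auto elim!: eventually_elim2\<close>)

lemma cinner_fop:
  assumes "bounded_borel F"
  shows "cinner (fop F u) v = (\<integral>a. F (\<mu> a) * rep_L2 (V u) a * cnj (rep_L2 (V v) a) \<partial>lborel)"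
  unfolding fop_def
  using cinner_mult_L2[OF bounded_borel_comp[OF assms], of "V u" "V v"] unitary_adjoint[OF unitary_inv[OF V]]
  by (metis V unitary_cinner unitary_f_inv)

lemma bounded_borel_cnj: "bounded_borel F \<Longrightarrow> bounded_borel (\<lambda>t. cnj (F t))"
  by (erule bounded_borelE, rule bounded_borelI) auto

lemma cinner_fop_cnj:
  assumes "bounded_borel F"
  shows "cinner (fop F u) v = cinner u (fop (\<lambda>t. cnj (F t)) v)"
proof -
  have "cinner u (fop (\<lambda>t. cnj (F t)) v) = cnj (cinner (fop (\<lambda>t. cnj (F t)) v) u)"
    by (rule cinner_commute)
  also have "\<dots> = cinner (fop F u) v"
    unfolding cinner_fop[OF assms] cinner_fop[OF bounded_borel_cnj[OF assms]]
    by (subst Bochner_Integration.integral_cnj[symmetric]) (simp add: mult_ac)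
  finally show ?thesis ..
qed

lemma fop_tendsto:
  assumes "\<And>n. bounded_borel (F n)" "bounded_borel G" "\<And>n t. cmod (F n t) \<le> C" "\<And>t. (\<lambda>n. F n t) \<longlonglongrightarrow> G t"
  shows "(\<lambda>n. fop (F n) u) \<longlonglongrightarrow> fop G u"
  unfolding fop_def
  by (rule unitary_tendsto[OF unitary_inv[OF V] mult_L2_tendsto[where C = C]])
     (simp_all add: bounded_borel_comp assms)

lemma fop_one [simp]: "fop (\<lambda>_. 1) u = u"
  by (simp add: fop_def V)

lemma unitary_fop:
  assumes "F \<in> borel_measurable borel" "\<And>t. cmod (F t) = 1"
  shows "unitary (fop F)"
  unfolding fop_def
  by (rule unitary_comp[OF unitary_inv[OF V] unitary_comp[OF unitary_mult_L2 V]]) (use assms in auto)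

lemma pvm_E: "projection_valued_measure E"
  unfolding projection_valued_measure_def
proof (intro conjI ballI allI impI)
  show "E B (E B u) = E B u" if "B \<in> sets borel" for B u
  proof -
    have "(\<lambda>t. indicator B t * indicator B t) = (indicator B :: real \<Rightarrow> complex)"
      by (auto simp: indicator_def)
    then show ?thesis using that by (simp add: E_def fop_fop)
  qed
  show "cinner (E B u) v = cinner u (E B v)" if "B \<in> sets borel" for B u v
  proof -
    have "(\<lambda>t. cnj (indicator B t)) = (indicator B :: real \<Rightarrow> complex)"
      by (auto simp: indicator_def)
    then show ?thesis using that by (simp add: E_def cinner_fop_cnj)
  qed
  show "E UNIV u = u" for u
    using fop_one by (simp add: E_def indicator_def[abs_def])
  fix B :: "nat \<Rightarrow> real set" and u
  assume B: "range B \<subseteq> sets borel" and dis: "disjoint_family B"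
  have Bm: "B m \<in> sets borel" for m using B by auto
  have part: "(\<Sum>m<n. E (B m) u) = fop (indicator (\<Union>m<n. B m)) u" for n
  proof (induction n)
    case 0
    have "mult_L2 (\<lambda>_. 0) w = 0" for w :: "'a L2" by (simp add: mult_L2_def zero_L2.abs_eq)
    then have "fop (\<lambda>_. 0) u = 0"
      unfolding fop_def using unitary_scaleC[OF unitary_inv[OF V], of 0 0] by simp
    then show ?case by (simp add: indicator_def[abs_def])
  next
    case (Suc n)
    have "AE a in lborel. rep_L2 (V (fop (indicator (\<Union>m<n. B m)) u + E (B n) u)) a = indicator (\<Union>m<Suc n. B m) (\<mu> a) * rep_L2 (V u) a"
    proof -
      have 1: "AE a in lborel. rep_L2 (V (fop (indicator (\<Union>m<n. B m)) u)) a = indicator (\<Union>m<n. B m) (\<mu> a) * rep_L2 (V u) a"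
        using Bm by (intro rep_fop bounded_borel_indicator) auto
      have 2: "AE a in lborel. rep_L2 (V (E (B n) u)) a = indicator (B n) (\<mu> a) * rep_L2 (V u) a"
        unfolding E_def using Bm by (intro rep_fop bounded_borel_indicator) auto
      have 3: "indicator (\<Union>m<n. B m) t + indicator (B n) t = (indicator (\<Union>m<Suc n. B m) t :: complex)" for t
      proof -
        have "t \<notin> B n" if "t \<in> B m" "m < n" for m
          using disjoint_family_onD[OF dis UNIV_I UNIV_I, of m n] that by auto
        then show ?thesis by (auto simp: indicator_def less_Suc_eq)
      qed
      show ?thesis using 1 2 rep_plus[of "V (fop (indicator (\<Union>m<n. B m)) u)" "V (E (B n) u)"]
        unfolding unitary_add[OF V] by eventually_elim (simp only: 3[symmetric] distrib_right)
    qed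
    then have "fop (indicator (\<Union>m<n. B m)) u + E (B n) u = fop (indicator (\<Union>m<Suc n. B m)) u"
      using Bm by (intro fop_eqI bounded_borel_indicator) auto
    with Suc show ?case by simp
  qed
  show "(\<lambda>m. E (B m) u) sums E (\<Union>m. B m) u"
    unfolding sums_def part unfolding E_def
  proof (rule fop_tendsto[where C = 1])
    fix t
    show "(\<lambda>n. indicator (\<Union>m<n. B m) t :: complex) \<longlonglongrightarrow> indicator (\<Union>m. B m) t"
      by (rule LIMSEQ_indicator_UN)
  qed (use Bm in \<open>auto simp: indicator_def\<close>)
qed

sublocale E: pvm E by standard (rule pvm_E)

lemma spectral_distribution_E:
  "spectral_distribution E u = distr (density lborel (\<lambda>a. ennreal ((cmod (rep_L2 (V u) a))\<^sup>2))) borel \<mu>"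
proof (rule measure_eqI)
  fix B assume "B \<in> sets (spectral_distribution E u)"
  then have B [measurable]: "B \<in> sets borel" by simp
  have "ennreal ((norm (E B u))\<^sup>2) = ennreal ((norm (V (E B u)))\<^sup>2)" by (simp add: unitary_norm V)
  also have "\<dots> = (\<integral>\<^sup>+a. ennreal ((cmod (indicator B (\<mu> a) * rep_L2 (V u) a))\<^sup>2) \<partial>lborel)"
    unfolding E_def using B by (intro nn_integral_norm_L2_AE[symmetric] rep_fop) auto
  also have "\<dots> = (\<integral>\<^sup>+a. ennreal ((cmod (rep_L2 (V u) a))\<^sup>2) * indicator (\<mu> -` B) a \<partial>lborel)"
    by (rule nn_integral_cong) (auto simp: indicator_def)
  finally show "emeasure (spectral_distribution E u) B
      = emeasure (distr (density lborel (\<lambda>a. ennreal ((cmod (rep_L2 (V u) a))\<^sup>2))) borel \<mu>) B"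
    using measurable_sets_borel[OF \<mu> B] by (simp add: E.emeasure_spectral emeasure_distr emeasure_density)
qed simp

lemma spectral_domain_E:
  assumes [measurable]: "F \<in> borel_measurable borel"
  shows "u \<in> spectral_domain E F \<longleftrightarrow> square_integrable (\<lambda>a. F (\<mu> a) * rep_L2 (V u) a)"
  unfolding spectral_domain_def spectral_distribution_E square_integrable_def
  by (simp add: integrable_distr_eq integrable_density norm_mult power_mult_distrib mult.commute)

lemma graph_in_domain:
  assumes [measurable]: "F \<in> borel_measurable borel" and "(u, v) \<in> graph F"
  shows "u \<in> spectral_domain E F"
proof -
  have "integrable lborel (\<lambda>a. (cmod (rep_L2 (V v) a))\<^sup>2)"
    using square_integrable_rep[of "V v"] by (simp add: square_integrable_def)
  then have "integrable lborel (\<lambda>a. (cmod (F (\<mu> a) * rep_L2 (V u) a))\<^sup>2)"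
    by (rule integrable_cong_AE_imp) (use assms(2) in \<open>auto simp: graph_def\<close>)
  then show ?thesis by (simp add: spectral_domain_E square_integrable_def)
qed

lemma graphI_domain:
  assumes [measurable]: "F \<in> borel_measurable borel" and "u \<in> spectral_domain E F"
  shows "(u, inv V (abs_L2 (\<lambda>a. F (\<mu> a) * rep_L2 (V u) a))) \<in> graph F"
  using rep_abs_L2[of "\<lambda>a. F (\<mu> a) * rep_L2 (V u) a"] assms(2)
  by (simp add: graph_def V spectral_domain_E)

text \<open>Cutting off in the spectrum gives a core of vectors on which every \<open>F\<close> is bounded.\<close>

definition cut :: "(real \<Rightarrow> complex) \<Rightarrow> nat \<Rightarrow> real \<Rightarrow> complex" where
  "cut F N = indicator {t. cmod (F t) \<le> real N}"

lemma bounded_borel_cut: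
  assumes [measurable]: "F \<in> borel_measurable borel"
  shows "bounded_borel (cut F N)"
  unfolding cut_def by (rule bounded_borel_indicator) measurable

lemma cut_le_1: "cmod (cut F N t) \<le> 1"
  by (simp add: cut_def indicator_def)

lemma bounded_borel_mult_cut:
  assumes [measurable]: "F \<in> borel_measurable borel"
  shows "bounded_borel (\<lambda>t. F t * cut F N t)"
  unfolding cut_def by (rule bounded_borelI[where C = "real N"]) (measurable, auto simp: indicator_def norm_mult)

lemma graph_cut:
  assumes F: "F \<in> borel_measurable borel"
  shows "(fop (cut F N) u, fop (\<lambda>t. F t * cut F N t) u) \<in> graph F"
  using rep_fop[OF bounded_borel_cut[OF F], of N u] rep_fop[OF bounded_borel_mult_cut[OF F], of N u]
  by (auto simp: graph_def elim!: eventually_elim2)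

lemma cut_tendsto:
  assumes F: "F \<in> borel_measurable borel"
  shows "(\<lambda>N. fop (cut F N) u) \<longlonglongrightarrow> u"
proof -
  have "(\<lambda>N. fop (cut F N) u) \<longlonglongrightarrow> fop (\<lambda>_. 1) u"
  proof (rule fop_tendsto[where C = 1])
    fix t
    obtain M :: nat where "cmod (F t) \<le> real M" using real_arch_simple by blast
    then have "eventually (\<lambda>N. cut F N t = 1) sequentially"
      unfolding cut_def by (intro eventually_sequentiallyI[of M]) auto
    then show "(\<lambda>N. cut F N t) \<longlonglongrightarrow> 1" by (rule tendsto_eventually)
  qed (auto simp: bounded_borel_cut F cut_le_1 intro: bounded_borelI[where C = 1])
  then show ?thesis by simp
qed

lemma closure_Domain_graph:
  assumes F: "F \<in> borel_measurable borel"
  shows "closure (Domain (graph F)) = UNIV"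
proof -
  have "u \<in> closure (Domain (graph F))" for u
    unfolding closure_sequential
    by (rule exI[of _ "\<lambda>N. fop (cut F N) u"]) (use cut_tendsto[OF F] graph_cut[OF F] in blast)
  then show ?thesis by auto
qed

lemma polarized_integral:
  assumes [measurable]: "F \<in> borel_measurable borel"
    and u: "u \<in> spectral_domain E F" and w: "w \<in> spectral_domain E F"
  shows "(\<Sum>m<4. \<i> ^ m * (\<integral>t. F t \<partial>spectral_distribution E (u + \<i> ^ m *\<^sub>C w))) / 4
    = (\<integral>a. F (\<mu> a) * rep_L2 (V u) a * cnj (rep_L2 (V w) a) \<partial>lborel)"
proof -
  let ?X = "rep_L2 (V u)" and ?Y = "rep_L2 (V w)"
  define G where "G m a = F (\<mu> a) * (?X a + \<i> ^ m * ?Y a) * cnj (?X a + \<i> ^ m * ?Y a)" for m a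
  have intG: "integrable lborel (G m)" for m
  proof -
    have "integrable lborel (\<lambda>a. (F (\<mu> a) * ?X a + \<i> ^ m * (F (\<mu> a) * ?Y a)) * cnj (?X a + \<i> ^ m * ?Y a))"
      by (intro integrable_mult_cnj square_integrable_add square_integrable_scale square_integrable_rep)
         (use u w in \<open>simp_all add: spectral_domain_E\<close>)
    then show ?thesis by (rule Bochner_Integration.integrable_cong[THEN iffD1, rotated 2]) (auto simp: G_def algebra_simps)
  qed
  have int: "(\<integral>t. F t \<partial>spectral_distribution E (u + \<i> ^ m *\<^sub>C w)) = (\<integral>a. G m a \<partial>lborel)" for m
  proof -
    have ae: "AE a in lborel. rep_L2 (V (u + \<i> ^ m *\<^sub>C w)) a = ?X a + \<i> ^ m * ?Y a"
      unfolding unitary_add[OF V] unitary_scaleC[OF V]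
      using rep_plus[of "V u" "\<i> ^ m *\<^sub>C V w"] rep_scaleC[of "\<i> ^ m" "V w"] by eventually_elim simp
    have "(\<integral>t. F t \<partial>spectral_distribution E (u + \<i> ^ m *\<^sub>C w))
      = (\<integral>a. (cmod (rep_L2 (V (u + \<i> ^ m *\<^sub>C w)) a))\<^sup>2 *\<^sub>R F (\<mu> a) \<partial>lborel)"
      unfolding spectral_distribution_E by (simp add: integral_distr integral_density)
    also have "\<dots> = (\<integral>a. G m a \<partial>lborel)"
      unfolding G_def
      by (rule integral_cong_AE, measurable)
         (use ae in eventually_elim, simp only: scaleR_conv_of_real complex_norm_square mult_ac)
    finally show ?thesis .
  qed
  have "(\<Sum>m<4. \<i> ^ m * (\<integral>a. G m a \<partial>lborel)) = (\<integral>a. (\<Sum>m<4. \<i> ^ m * G m a) \<partial>lborel)"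
    by (simp add: intG)
  also have "(\<lambda>a. (\<Sum>m<4. \<i> ^ m * G m a)) = (\<lambda>a. 4 * (F (\<mu> a) * ?X a * cnj (?Y a)))"
  proof
    fix a
    have s: "(\<Sum>m<4. f m) = f 0 + f 1 + f 2 + f (3::nat)" for f :: "nat \<Rightarrow> complex"
      by (simp add: numeral_eq_Suc)
    have i3: "\<i> ^ 3 = - \<i>" by (simp add: power3_eq_cube)
    show "(\<Sum>m<4. \<i> ^ m * G m a) = 4 * (F (\<mu> a) * ?X a * cnj (?Y a))"
      unfolding s G_def i3 by (simp add: algebra_simps)
  qed
  finally show ?thesis unfolding int by simp
qed

lemma spectral_integral_E:
  assumes F: "F \<in> borel_measurable borel"
  shows "spectral_integral E F = graph F"
proof -
  note [measurable] = F
  have fwd: "cinner v w = (\<integral>a. F (\<mu> a) * rep_L2 (V u) a * cnj (rep_L2 (V w) a) \<partial>lborel)"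
    if "(u, v) \<in> graph F" for u v w
  proof -
    have "cinner v w = cinner (V v) (V w)" by (simp add: unitary_cinner V)
    also have "\<dots> = (\<integral>a. F (\<mu> a) * rep_L2 (V u) a * cnj (rep_L2 (V w) a) \<partial>lborel)"
      by (rule cinner_eq_integral_AE) (use that in \<open>auto simp: graph_def\<close>)
    finally show ?thesis .
  qed
  show ?thesis
  proof (intro equalityI subrelI)
    fix u v assume uv: "(u, v) \<in> graph F"
    have u: "u \<in> spectral_domain E F" by (rule graph_in_domain[OF F uv])
    have "cinner v w = (\<Sum>m<4. \<i> ^ m * (\<integral>t. F t \<partial>spectral_distribution E (u + \<i> ^ m *\<^sub>C w))) / 4"
      if "w \<in> spectral_domain E F" for w
      unfolding polarized_integral[OF F u that] by (rule fwd[OF uv])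
    with u show "(u, v) \<in> spectral_integral E F"
      unfolding spectral_integral_def by blast
  next
    fix u v assume uv: "(u, v) \<in> spectral_integral E F"
    then have u: "u \<in> spectral_domain E F" by (simp add: spectral_integral_def)
    obtain h where h: "(u, h) \<in> graph F" using graphI_domain[OF F u] by blast
    have "v - h = 0"
    proof (rule cinner_dense_zero[OF closure_Domain_graph[OF F]])
      fix w assume "w \<in> Domain (graph F)"
      then have w: "w \<in> spectral_domain E F" using graph_in_domain[OF F] by blast
      then have "cinner v w = (\<Sum>m<4. \<i> ^ m * (\<integral>t. F t \<partial>spectral_distribution E (u + \<i> ^ m *\<^sub>C w))) / 4"
        using uv unfolding spectral_integral_def by blast
      then show "cinner (v - h) w = 0"
        unfolding polarized_integral[OF F u w] cinner_diff_left fwd[OF h] by simp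
    qed
    with h show "(u, v) \<in> graph F" by simp
  qed
qed

abbreviation A :: "'a op_graph" where "A \<equiv> graph complex_of_real"

lemma A_cut_adjoint:
  assumes "\<And>u u'. (u, u') \<in> A \<Longrightarrow> cinner u' v = cinner u w"
  shows "(v, w) \<in> A"
proof -
  have F: "complex_of_real \<in> borel_measurable borel" by measurable
  let ?c = "cut complex_of_real"
  have "AE a in lborel. rep_L2 (V w) a = complex_of_real (\<mu> a) * rep_L2 (V v) a"
  proof (rule AE_nat_bound[where F = "\<lambda>a. complex_of_real (\<mu> a)"])
    fix N
    have r: "(\<lambda>t. cnj (complex_of_real t * ?c N t)) = (\<lambda>t. complex_of_real t * ?c N t)" "(\<lambda>t. cnj (?c N t)) = ?c N"
      by (auto simp: cut_def indicator_def)
    have adj1: "cinner (fop (\<lambda>t. complex_of_real t * ?c N t) x) z = cinner x (fop (\<lambda>t. complex_of_real t * ?c N t) z)" for x z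
      using cinner_fop_cnj[OF bounded_borel_mult_cut[OF F], of N x z] unfolding r .
    have adj2: "cinner (fop (?c N) x) z = cinner x (fop (?c N) z)" for x z
      using cinner_fop_cnj[OF bounded_borel_cut[OF F], of N x z] unfolding r .
    have "fop (\<lambda>t. complex_of_real t * ?c N t) v = fop (?c N) w"
    proof (rule L2_eqI_cinner)
      fix y
      have "cinner (fop (\<lambda>t. complex_of_real t * ?c N t) v) y = cnj (cinner (fop (\<lambda>t. complex_of_real t * ?c N t) y) v)"
        unfolding adj1[of v] by (rule cinner_commute)
      also have "\<dots> = cnj (cinner (fop (?c N) y) w)"
        by (simp add: assms[OF graph_cut[OF F]])
      also have "\<dots> = cinner (fop (?c N) w) y"
        unfolding adj2[of w] by (rule cinner_commute[symmetric])
      finally show "cinner (fop (\<lambda>t. complex_of_real t * ?c N t) v) y = cinner (fop (?c N) w) y" .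
    qed
    with rep_fop[OF bounded_borel_mult_cut[OF F], of N v] rep_fop[OF bounded_borel_cut[OF F], of N w]
    have "AE a in lborel. ?c N (\<mu> a) * rep_L2 (V w) a = complex_of_real (\<mu> a) * ?c N (\<mu> a) * rep_L2 (V v) a"
      by (auto elim!: eventually_elim2)
    then show "AE a in lborel. cmod (complex_of_real (\<mu> a)) \<le> real N \<longrightarrow> rep_L2 (V w) a = complex_of_real (\<mu> a) * rep_L2 (V v) a"
      by eventually_elim (auto simp: cut_def)
  qed
  then show ?thesis by (simp add: graph_def)
qed

lemma A_symmetric:
  assumes "(u, u') \<in> A" "(v, v') \<in> A" shows "cinner u' v = cinner u v'"
proof -
  have "cinner (V u') (V v) = cinner (V u) (V v')"
    unfolding cinner_eq_integral
    by (rule integral_cong_AE) (use assms in \<open>auto simp: graph_def elim!: eventually_elim2\<close>)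
  then show ?thesis by (simp add: unitary_cinner V)
qed

lemma self_adjoint_A: "self_adjoint A"
  unfolding self_adjoint_def
proof
  show "closure (Domain A) = UNIV" by (rule closure_Domain_graph) measurable
  show "adjoint_graph A = A"
  proof (intro equalityI subrelI)
    fix v w assume "(v, w) \<in> adjoint_graph A"
    then show "(v, w) \<in> A" by (intro A_cut_adjoint) (auto simp: adjoint_graph_def)
  next
    fix v w assume "(v, w) \<in> A"
    then show "(v, w) \<in> adjoint_graph A" by (auto simp: adjoint_graph_def intro: A_symmetric)
  qed
qed

end

lemma norm_L2_mono:
  assumes "AE a in lborel. cmod (rep_L2 u a) \<le> cmod (rep_L2 v a)"
  shows "norm u \<le> norm v"
proof -
  have "(\<integral>\<^sup>+a. ennreal ((cmod (rep_L2 u a))\<^sup>2) \<partial>lborel) \<le> (\<integral>\<^sup>+a. ennreal ((cmod (rep_L2 v a))\<^sup>2) \<partial>lborel)"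
    by (rule nn_integral_mono_AE) (use assms in \<open>auto intro!: ennreal_leI power_mono\<close>)
  then have "(norm u)\<^sup>2 \<le> (norm v)\<^sup>2" by (simp add: nn_integral_norm_L2)
  then show ?thesis by (rule power2_le_imp_le) simp
qed

context pvm
begin

lemma norm_le: assumes "B \<in> sets borel" shows "norm (E B u) \<le> norm u"
proof (cases "norm (E B u) = 0")
  case False
  have "(norm (E B u))\<^sup>2 = cmod (cinner (E B u) u)" by (simp add: norm_sq assms del: of_real_power)
  also have "\<dots> \<le> norm (E B u) * norm u" by (rule Cauchy_Schwarz_cinner)
  finally show ?thesis using False by (simp add: power2_eq_square)
qed (simp only: norm_ge_zero)

lemma tendsto: assumes "B \<in> sets borel" "(f \<longlongrightarrow> u) F" shows "((\<lambda>x. E B (f x)) \<longlongrightarrow> E B u) F"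
proof -
  have 0: "((\<lambda>x. norm (f x - u)) \<longlongrightarrow> 0) F"
    using assms(2) by (intro tendsto_norm_zero LIM_zero)
  have "((\<lambda>x. E B (f x) - E B u) \<longlongrightarrow> 0) F"
    by (rule Lim_null_comparison[OF always_eventually 0])
       (use norm_le[OF assms(1)] in \<open>simp add: diff[OF assms(1), symmetric]\<close>)
  then show ?thesis by (rule LIM_zero_cancel)
qed

lemma integral_bounded_plus:
  assumes I: "I = {s-\<delta>..s+\<delta>}" and w: "E I w = w" and z: "E (- I) z \<in> spectral_domain E complex_of_real"
    and I': "E I z = w"
  shows "(\<integral>t. complex_of_real t \<partial>spectral_distribution E z)
    = (\<integral>t. complex_of_real t \<partial>spectral_distribution E w)
    + (\<integral>t. complex_of_real t \<partial>spectral_distribution E (E (- I) z))"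
  unfolding I'[symmetric]
proof (rule integral_split)
  show "integrable (spectral_distribution E (E I z)) complex_of_real"
    unfolding I' by (rule spectral_domain_integrable[OF spectral_domain_bounded_range[of s \<delta>]]) (use w I in simp)
  show "integrable (spectral_distribution E (E (- I) z)) complex_of_real"
    by (rule spectral_domain_integrable[OF z])
qed (simp_all add: I)

end

lemma sum_fourth_roots_const:
  "(\<Sum>m<4. \<i> ^ m * (f m + R)) = (\<Sum>m<4. \<i> ^ m * f m)"
proof -
  have "(\<Sum>m<4. \<i> ^ m) = 0" by (simp add: numeral_eq_Suc)
  then show ?thesis by (simp add: distrib_left sum.distrib flip: sum_distrib_right)
qed

text \<open>A second projection-valued measure \<open>P\<close> of the same operator.\<close>

locale diagonalization_pvm = diagonalization V \<mu> + P: pvm P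
  for V :: "'a::euclidean_space L2 \<Rightarrow> 'a L2" and \<mu> :: "'a \<Rightarrow> real" and P :: "real set \<Rightarrow> 'a L2 \<Rightarrow> 'a L2" +
  assumes P_A: "spectral_integral P complex_of_real = A"
begin

lemma P_domain: "(x, x') \<in> A \<Longrightarrow> x \<in> spectral_domain P complex_of_real"
  unfolding P_A[symmetric] by (simp add: spectral_integral_def)

lemma P_form:
  "(x, x') \<in> A \<Longrightarrow> w \<in> spectral_domain P complex_of_real \<Longrightarrow>
    cinner x' w = (\<Sum>m<4. \<i> ^ m * (\<integral>t. complex_of_real t \<partial>spectral_distribution P (x + \<i> ^ m *\<^sub>C w))) / 4"
  unfolding P_A[symmetric] spectral_integral_def by blast

lemma form_bound:
  assumes \<delta>: "\<delta> \<ge> 0" and I: "I = {s-\<delta>..s+\<delta>}" and w: "P I w = w" and xA: "(x, x') \<in> A"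
  shows "Re (cinner x' w - of_real s * cinner x w) \<le> \<delta> * ((norm x)\<^sup>2 + (norm w)\<^sup>2) / 2"
proof -
  have B [simp]: "I \<in> sets borel" "- I \<in> sets borel" by (simp_all add: I)
  define y where "y m = P I x + \<i> ^ m *\<^sub>C w" for m
  define R where "R = (\<integral>t. complex_of_real t \<partial>spectral_distribution P (P (- I) x))"
  have Iy: "P I (y m) = y m" for m by (simp add: y_def P.add P.scale P.idem w)
  have w': "P (- I) w = 0" using P.orth[of "- I" I w] by (simp add: w)
  have wd: "w \<in> spectral_domain P complex_of_real"
    by (rule P.spectral_domain_bounded_range[of s \<delta>]) (use w I in simp)
  have "\<exists>r. (\<integral>t. complex_of_real t \<partial>spectral_distribution P (y m)) = of_real r
      \<and> \<bar>r - s * (norm (y m))\<^sup>2\<bar> \<le> \<delta> * (norm (y m))\<^sup>2" for m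
    by (rule P.integral_bounded_range[of s \<delta> "y m"]) (use Iy[of m] I in auto)
  then obtain r where r: "\<And>m. (\<integral>t. complex_of_real t \<partial>spectral_distribution P (y m)) = of_real (r m)"
    "\<And>m. \<bar>r m - s * (norm (y m))\<^sup>2\<bar> \<le> \<delta> * (norm (y m))\<^sup>2" by metis
  have int: "(\<integral>t. complex_of_real t \<partial>spectral_distribution P (x + \<i> ^ m *\<^sub>C w)) = of_real (r m) + R" for m
  proof -
    have c: "P (- I) (x + \<i> ^ m *\<^sub>C w) = P (- I) x" by (simp add: P.add P.scale w')
    have d: "P (- I) x \<in> spectral_domain P complex_of_real"
      by (rule P.spectral_domain_restrict[OF P_domain[OF xA]]) simp
    show ?thesis
      using P.integral_bounded_plus[OF I Iy[of m], of "x + \<i> ^ m *\<^sub>C w"] d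
      unfolding c R_def r(1)[symmetric] by (simp add: y_def P.add P.scale w)
  qed
  have "cinner x' w = (\<Sum>m<4. \<i> ^ m * of_real (r m)) / 4"
    unfolding P_form[OF xA wd] int sum_fourth_roots_const ..
  moreover have "cinner x w = (\<Sum>m<4. \<i> ^ m * of_real ((norm (y m))\<^sup>2)) / 4"
  proof -
    have "cinner x w = cinner (P I x) w" by (metis B(1) P.sym w)
    then show ?thesis unfolding y_def using cinner_polarization[of "P I x" w] by simp
  qed
  ultimately have "Re (cinner x' w - of_real s * cinner x w)
      = ((r 0 - s * (norm (y 0))\<^sup>2) - (r 2 - s * (norm (y 2))\<^sup>2)) / 4"
  proof -
    have S: "(\<Sum>m<4. f m) = f 0 + f 1 + f 2 + f (3::nat)" for f :: "nat \<Rightarrow> complex"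
      by (simp add: numeral_eq_Suc)
    have i3: "\<i> ^ 3 = - \<i>" by (simp add: power3_eq_cube)
    assume *: "cinner x' w = (\<Sum>m<4. \<i> ^ m * of_real (r m)) / 4"
      "cinner x w = (\<Sum>m<4. \<i> ^ m * of_real ((norm (y m))\<^sup>2)) / 4"
    show ?thesis unfolding * S i3 by (simp add: algebra_simps diff_divide_distrib add_divide_distrib)
  qed
  also have "\<dots> \<le> (\<delta> * (norm (y 0))\<^sup>2 + \<delta> * (norm (y 2))\<^sup>2) / 4"
    using r(2)[of 0] r(2)[of 2] by (simp add: abs_le_iff)
  also have "\<dots> = \<delta> * ((norm (P I x))\<^sup>2 + (norm w)\<^sup>2) / 2"
  proof -
    have "(norm (P I x + w))\<^sup>2 + (norm (P I x - w))\<^sup>2 = 2 * (norm (P I x))\<^sup>2 + 2 * (norm w)\<^sup>2"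
      by (simp add: power2_norm_eq_inner inner_add inner_diff inner_commute)
    moreover have "y 0 = P I x + w" "y 2 = P I x - w" by (simp_all add: y_def minus_eq_scaleC)
    ultimately have "(norm (y 0))\<^sup>2 + (norm (y 2))\<^sup>2 = 2 * ((norm (P I x))\<^sup>2 + (norm w)\<^sup>2)" by simp
    then show ?thesis unfolding distrib_left[symmetric, of \<delta>] by simp
  qed
  also have "\<dots> \<le> \<delta> * ((norm x)\<^sup>2 + (norm w)\<^sup>2) / 2"
    using \<delta> by (intro divide_right_mono mult_left_mono add_right_mono power_mono P.norm_le) auto
  finally show ?thesis .
qed

text \<open>One step of the iteration: \<open>A - s\<close> maps the range of \<open>P {s-\<delta>..s+\<delta>}\<close> into itself with norm at
  most \<open>\<delta>\<close>. Test vectors \<open>(A - s) w / \<delta>\<close>, cut off to lie in the domain, turn the bound on the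
  form into the bound on the norm.\<close>

lemma range_step:
  assumes \<delta>: "\<delta> > 0" and I: "I = {s-\<delta>..s+\<delta>}" and w: "P I w = w"
  obtains y where "P I y = y" "AE a in lborel. rep_L2 (V y) a = of_real (\<mu> a - s) * rep_L2 (V w) a"
    "norm y \<le> \<delta> * norm w"
proof -
  define F where "F t = complex_of_real (t - s)" for t
  have F [measurable]: "F \<in> borel_measurable borel" unfolding F_def by measurable
  have B [simp]: "I \<in> sets borel" "- I \<in> sets borel" by (simp_all add: I)
  define G where "G N t = F t * cut F N t" for N t
  have G: "bounded_borel (G N)" for N unfolding G_def by (rule bounded_borel_mult_cut[OF F])
  have Greal: "cnj (G N t) = G N t" for N t by (simp add: G_def F_def cut_def indicator_def)
  have GG: "G N t * G N t + of_real s * G N t = of_real t * G N t" for N t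
    by (simp add: G_def F_def cut_def indicator_def algebra_simps)
  have bound: "norm (fop (G N) w) \<le> \<delta> * norm w" for N
  proof -
    define z where "z = fop (G N) w"
    define z' where "z' = fop (G N) z + of_real s *\<^sub>C z"
    have ae: "AE a in lborel. rep_L2 (V z') a = of_real (\<mu> a) * rep_L2 (V z) a"
      unfolding z'_def unitary_add[OF V] unitary_scaleC[OF V]
      using rep_plus[of "V (fop (G N) z)" "of_real s *\<^sub>C V z"] rep_scaleC[of "of_real s" "V z"]
        rep_fop[OF G, of N z] rep_fop[OF G, of N w, folded z_def]
    proof eventually_elim
      case (elim a)
      then have "rep_L2 (V (fop (G N) z) + complex_of_real s *\<^sub>C V z) a
        = (G N (\<mu> a) * G N (\<mu> a) + of_real s * G N (\<mu> a)) * rep_L2 (V w) a"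
        by (simp add: algebra_simps)
      then show ?case using elim by (simp only: GG mult.assoc)
    qed
    have zA: "((1/\<delta>) *\<^sub>C z, (1/\<delta>) *\<^sub>C z') \<in> A"
      unfolding graph_def mem_Collect_eq prod.case unitary_scaleC[OF V]
      using rep_scaleC[of "1/\<delta>" "V z"] rep_scaleC[of "1/\<delta>" "V z'"] ae
      by eventually_elim simp
    have "cinner (fop (G N) z) w = cinner z z"
      using cinner_fop_cnj[OF G, of N z w] by (simp add: Greal z_def)
    then have "cinner z' w - of_real s * cinner z w = of_real ((norm z)\<^sup>2)"
      unfolding z'_def cinner_add_left cinner_scaleC_left cinner_self[symmetric] by simp
    moreover have "cinner ((1/\<delta>) *\<^sub>C z') w - of_real s * cinner ((1/\<delta>) *\<^sub>C z) w
        = (cinner z' w - of_real s * cinner z w) / of_real \<delta>"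
      by (simp add: diff_divide_distrib)
    ultimately have eq: "cinner ((1/\<delta>) *\<^sub>C z') w - of_real s * cinner ((1/\<delta>) *\<^sub>C z) w = of_real ((norm z)\<^sup>2 / \<delta>)"
      by simp
    have "Re (cinner ((1/\<delta>) *\<^sub>C z') w - of_real s * cinner ((1/\<delta>) *\<^sub>C z) w)
        \<le> \<delta> * ((norm ((1/\<delta>) *\<^sub>C z))\<^sup>2 + (norm w)\<^sup>2) / 2"
      by (rule form_bound[OF _ I w zA]) (use \<delta> in simp)
    moreover have "norm ((1/\<delta>) *\<^sub>C z) = norm z / \<delta>" using \<delta> by (simp add: norm_divide)
    ultimately have "(norm z)\<^sup>2 / \<delta> \<le> \<delta> * ((norm z / \<delta>)\<^sup>2 + (norm w)\<^sup>2) / 2"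
      unfolding eq Re_complex_of_real by (simp only:)
    then have "(norm z)\<^sup>2 \<le> (\<delta> * norm w)\<^sup>2"
      using \<delta> by (simp add: field_simps power2_eq_square)
    then show ?thesis unfolding z_def by (rule power2_le_imp_le) (use \<delta> in simp)
  qed
  have lim: "(\<lambda>N. G N t) \<longlonglongrightarrow> F t" for t
  proof -
    obtain M :: nat where "cmod (F t) \<le> real M" using real_arch_simple by blast
    then have "eventually (\<lambda>N. G N t = F t) sequentially"
      unfolding G_def cut_def by (intro eventually_sequentiallyI[of M]) auto
    then show ?thesis by (rule tendsto_eventually)
  qed
  note [measurable] = bounded_borel_measurable[OF G]
  have est: "(\<integral>\<^sup>+a. ennreal ((cmod (F (\<mu> a) * rep_L2 (V w) a))\<^sup>2) \<partial>lborel) \<le> ennreal ((\<delta> * norm w)\<^sup>2)"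
  proof -
    have "(\<integral>\<^sup>+a. ennreal ((cmod (F (\<mu> a) * rep_L2 (V w) a))\<^sup>2) \<partial>lborel)
      = (\<integral>\<^sup>+a. liminf (\<lambda>N. ennreal ((cmod (G N (\<mu> a) * rep_L2 (V w) a))\<^sup>2)) \<partial>lborel)"
    proof (rule nn_integral_cong)
      fix a
      have "(\<lambda>N. ennreal ((cmod (G N (\<mu> a) * rep_L2 (V w) a))\<^sup>2)) \<longlonglongrightarrow> ennreal ((cmod (F (\<mu> a) * rep_L2 (V w) a))\<^sup>2)"
        by (intro tendsto_ennrealI tendsto_power tendsto_norm tendsto_mult tendsto_const lim)
      from lim_imp_Liminf[OF _ this] show "ennreal ((cmod (F (\<mu> a) * rep_L2 (V w) a))\<^sup>2)
        = liminf (\<lambda>N. ennreal ((cmod (G N (\<mu> a) * rep_L2 (V w) a))\<^sup>2))" by simp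
    qed
    also have "\<dots> \<le> liminf (\<lambda>N. \<integral>\<^sup>+a. ennreal ((cmod (G N (\<mu> a) * rep_L2 (V w) a))\<^sup>2) \<partial>lborel)"
      by (rule nn_integral_liminf) measurable
    also have "\<dots> = liminf (\<lambda>N. ennreal ((norm (fop (G N) w))\<^sup>2))"
      by (simp add: nn_integral_norm_L2_AE[OF rep_fop[OF G]] unitary_norm V)
    also have "\<dots> \<le> liminf (\<lambda>N::nat. ennreal ((\<delta> * norm w)\<^sup>2))"
      by (intro Liminf_mono always_eventually allI ennreal_leI power_mono bound) simp
    also have "\<dots> = ennreal ((\<delta> * norm w)\<^sup>2)" by (simp add: Liminf_const)
    finally show ?thesis .
  qed
  have sq: "square_integrable (\<lambda>a. F (\<mu> a) * rep_L2 (V w) a)"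
    by (rule square_integrableI_nn) (use le_less_trans[OF est ennreal_less_top] in auto)
  define y where "y = inv V (abs_L2 (\<lambda>a. F (\<mu> a) * rep_L2 (V w) a))"
  have Vy: "AE a in lborel. rep_L2 (V y) a = F (\<mu> a) * rep_L2 (V w) a"
    unfolding y_def using rep_abs_L2[OF sq] by (simp add: V)
  have ny: "norm y \<le> \<delta> * norm w"
  proof -
    have "ennreal ((norm y)\<^sup>2) \<le> ennreal ((\<delta> * norm w)\<^sup>2)"
      using est unfolding nn_integral_norm_L2_AE[OF Vy] by (simp add: unitary_norm V)
    then have "(norm y)\<^sup>2 \<le> (\<delta> * norm w)\<^sup>2" by simp
    then show ?thesis by (rule power2_le_imp_le) (use \<delta> in simp)
  qed
  define v where "v = y + of_real s *\<^sub>C w"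
  have wvA: "(w, v) \<in> A"
    unfolding graph_def mem_Collect_eq prod.case v_def unitary_add[OF V] unitary_scaleC[OF V]
    using rep_plus[of "V y" "of_real s *\<^sub>C V w"] rep_scaleC[of "of_real s" "V w"] Vy
    by eventually_elim (simp add: F_def algebra_simps)
  have inv: "cinner (v - P I v) x = 0" if "x \<in> Domain A" for x
  proof -
    have xd: "x \<in> spectral_domain P complex_of_real" using that P_domain by blast
    have xI: "P I x \<in> spectral_domain P complex_of_real" "P (- I) x \<in> spectral_domain P complex_of_real"
      using P.spectral_domain_restrict[OF xd, of I] P.spectral_domain_restrict[OF xd, of "- I"] by simp_all
    have w': "P (- I) w = 0" using P.orth[of "- I" I w] by (simp add: w)
    have "(\<integral>t. complex_of_real t \<partial>spectral_distribution P (w + \<i> ^ m *\<^sub>C x))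
      = (\<integral>t. complex_of_real t \<partial>spectral_distribution P (w + \<i> ^ m *\<^sub>C P I x))
      + (\<integral>t. complex_of_real t \<partial>spectral_distribution P (P (- I) x))" for m
    proof -
      have 1: "P I (w + \<i> ^ m *\<^sub>C P I x) = w + \<i> ^ m *\<^sub>C P I x"
        by (simp add: P.add P.scale w P.idem)
      have 2: "P I (w + \<i> ^ m *\<^sub>C x) = w + \<i> ^ m *\<^sub>C P I x"
        by (simp add: P.add P.scale w)
      have 3: "P (- I) (w + \<i> ^ m *\<^sub>C x) = \<i> ^ m *\<^sub>C P (- I) x"
        by (simp add: P.add P.scale w')
      have 4: "spectral_distribution P (\<i> ^ m *\<^sub>C P (- I) x) = spectral_distribution P (P (- I) x)"
        by (rule P.spectral_distribution_unimodular) (simp add: norm_power)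
      have 5: "P (- I) (w + \<i> ^ m *\<^sub>C x) \<in> spectral_domain P complex_of_real"
        using xI(2) unfolding 3 P.spectral_domain_id 4 .
      show ?thesis using P.integral_bounded_plus[OF I 1 5 2] unfolding 3 4 .
    qed
    then have "cinner v x = cinner v (P I x)"
      unfolding P_form[OF wvA xd] P_form[OF wvA xI(1)] by (simp only: sum_fourth_roots_const)
    then show ?thesis by (simp add: cinner_diff_left P.sym)
  qed
  have "v - P I v = 0"
    by (rule cinner_dense_zero[OF closure_Domain_graph inv]) simp_all
  then have "P I y = y" by (simp add: v_def P.add P.scale w)
  with ny Vy show ?thesis by (intro that) (auto simp: F_def)
qed

lemma range_iterate:
  assumes \<delta>: "\<delta> > 0" and I: "I = {s-\<delta>..s+\<delta>}" and w: "P I w = w"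
  shows "\<exists>y. P I y = y \<and> (AE a in lborel. rep_L2 (V y) a = of_real (\<mu> a - s) ^ n * rep_L2 (V w) a)
    \<and> norm y \<le> \<delta> ^ n * norm w"
proof (induction n)
  case 0
  then show ?case using w by (intro exI[of _ w]) auto
next
  case (Suc n)
  then obtain y where y: "P I y = y" "AE a in lborel. rep_L2 (V y) a = of_real (\<mu> a - s) ^ n * rep_L2 (V w) a"
    "norm y \<le> \<delta> ^ n * norm w" by blast
  obtain y' where y': "P I y' = y'" "AE a in lborel. rep_L2 (V y') a = of_real (\<mu> a - s) * rep_L2 (V y) a"
    "norm y' \<le> \<delta> * norm y" using range_step[OF \<delta> I y(1)] by blast
  have "norm y' \<le> \<delta> * (\<delta> ^ n * norm w)"
    using y'(3) mult_left_mono[OF y(3), of \<delta>] \<delta> by linarith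
  moreover have "AE a in lborel. rep_L2 (V y') a = of_real (\<mu> a - s) ^ Suc n * rep_L2 (V w) a"
    using y(2) y'(2) by eventually_elim simp
  ultimately show ?case using y'(1) by (intro exI[of _ y']) (simp add: mult.assoc)
qed

text \<open>Since all powers of \<open>(A - s) / \<delta>\<close> stay bounded on \<open>w\<close>, the function \<open>V w\<close> vanishes where
  \<open>\<bar>\<mu> - s\<bar> > \<delta>\<close>.\<close>

lemma range_le_interval:
  assumes \<delta>: "\<delta> > 0" and I: "I = {s-\<delta>..s+\<delta>}" and w: "P I w = w"
  shows "E I w = w"
proof -
  have vanish: "AE a in lborel. \<bar>\<mu> a - s\<bar> \<ge> \<delta> + \<eta> \<longrightarrow> rep_L2 (V w) a = 0" if \<eta>: "\<eta> > 0" for \<eta>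
  proof -
    define S where "S = {t. \<bar>t - s\<bar> \<ge> \<delta> + \<eta>}"
    have S: "S \<in> sets borel" unfolding S_def by measurable
    define u where "u = E S w"
    have Vu: "AE a in lborel. rep_L2 (V u) a = indicator S (\<mu> a) * rep_L2 (V w) a"
      unfolding u_def E_def by (intro rep_fop bounded_borel_indicator S)
    have "norm u \<le> (\<delta> / (\<delta> + \<eta>)) ^ n * norm w" for n
    proof -
      obtain y where y: "AE a in lborel. rep_L2 (V y) a = of_real (\<mu> a - s) ^ n * rep_L2 (V w) a"
        "norm y \<le> \<delta> ^ n * norm w" using range_iterate[OF \<delta> I w] by blast
      have "norm (of_real ((\<delta> + \<eta>) ^ n) *\<^sub>C V u) \<le> norm (V y)"
      proof (rule norm_L2_mono)
        show "AE a in lborel. cmod (rep_L2 (of_real ((\<delta> + \<eta>) ^ n) *\<^sub>C V u) a) \<le> cmod (rep_L2 (V y) a)"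
          using rep_scaleC[of "of_real ((\<delta> + \<eta>) ^ n)" "V u"] Vu y(1)
        proof eventually_elim
          case (elim a)
          show ?case
          proof (cases "\<mu> a \<in> S")
            case True
            then have "(\<delta> + \<eta>) ^ n \<le> \<bar>\<mu> a - s\<bar> ^ n" using \<delta> \<eta> by (intro power_mono) (auto simp: S_def)
            moreover have "cmod (complex_of_real (\<mu> a - s)) = \<bar>\<mu> a - s\<bar>" by (rule norm_of_real)
            ultimately show ?thesis using elim True \<delta> \<eta>
              by (simp add: norm_mult norm_power mult_right_mono del: of_real_diff of_real_power of_real_add)
          qed (use elim in simp)
        qed
      qed
      then have "(\<delta> + \<eta>) ^ n * norm u \<le> \<delta> ^ n * norm w"
        using y(2) \<delta> \<eta> by (simp add: unitary_norm V del: of_real_power of_real_add)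
      then show ?thesis using \<delta> \<eta> by (simp add: field_simps power_divide)
    qed
    moreover have "(\<lambda>n. (\<delta> / (\<delta> + \<eta>)) ^ n * norm w) \<longlonglongrightarrow> 0 * norm w"
      by (intro tendsto_mult LIMSEQ_power_zero tendsto_const) (use \<delta> \<eta> in auto)
    ultimately have "norm u \<le> 0 * norm w" by (intro LIMSEQ_le_const) auto
    then have "V u = 0" using unitary_scaleC[OF V, of 0 0] by simp
    then have "AE a in lborel. indicator S (\<mu> a) * rep_L2 (V w) a = 0"
      using Vu rep_zero by (auto elim!: eventually_elim2)
    then show ?thesis by eventually_elim (auto simp: S_def indicator_def)
  qed
  have "AE a in lborel. \<forall>k. \<bar>\<mu> a - s\<bar> \<ge> \<delta> + 1 / real (Suc k) \<longrightarrow> rep_L2 (V w) a = 0"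
    unfolding AE_all_countable by (intro allI vanish) simp
  then have "AE a in lborel. rep_L2 (V w) a = indicator I (\<mu> a) * rep_L2 (V w) a"
  proof eventually_elim
    case (elim a)
    show ?case
    proof (cases "\<mu> a \<in> I")
      case False
      then have "\<bar>\<mu> a - s\<bar> - \<delta> > 0" by (auto simp: I abs_real_def)
      then obtain k where "1 / real (Suc k) < \<bar>\<mu> a - s\<bar> - \<delta>" using nat_approx_posE by metis
      with elim[rule_format, of k] show ?thesis by simp
    qed simp
  qed
  then have "w = fop (indicator I) w" by (intro fop_eqI bounded_borel_indicator) (simp_all add: I)
  then show ?thesis by (simp add: E_def)
qed

lemma range_le_incseq:
  assumes inc: "incseq B" and B: "\<And>n. B n \<in> sets borel" and le: "\<And>n u. E (B n) (P (B n) u) = P (B n) u"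
  shows "E (\<Union>n. B n) (P (\<Union>n. B n) u) = P (\<Union>n. B n) u"
proof -
  have U: "(\<Union>n. B n) \<in> sets borel" using B by auto
  have "(\<lambda>n. P (B n) u) \<longlonglongrightarrow> P (\<Union>n. B n) u" by (rule P.incseq_tendsto[OF inc B])
  moreover have "(\<lambda>n. E (\<Union>n. B n) (P (B n) u)) \<longlonglongrightarrow> E (\<Union>n. B n) (P (\<Union>n. B n) u)"
    by (rule E.tendsto[OF U P.incseq_tendsto[OF inc B]])
  moreover have "E (\<Union>n. B n) (P (B n) u) = P (B n) u" for n
  proof -
    have "(\<Union>n. B n) \<inter> B n = B n" by auto
    then show ?thesis using E.Int[OF U B, of n "P (B n) u"] by (simp add: le)
  qed
  ultimately show ?thesis using LIMSEQ_unique by simp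
qed

lemma range_le_Icc:
  assumes "a < b" shows "E {a..b} (P {a..b} u) = P {a..b} u"
  by (rule range_le_interval[of "(b - a) / 2" _ "(a + b) / 2"])
     (use assms in \<open>auto simp: P.idem field_simps\<close>)

lemma pvm_unique_atMost: "E {..a} u = P {..a} u"
proof -
  have 1: "E {..a} (P {..a} u) = P {..a} u"
  proof -
    have "(\<Union>n. {a - real (Suc n)..a}) = {..a}"
    proof (intro equalityI subsetI)
      fix t assume "t \<in> {..a}"
      moreover obtain n where "a - t \<le> real n" using real_arch_simple by blast
      ultimately show "t \<in> (\<Union>n. {a - real (Suc n)..a})" by (auto intro!: exI[of _ n])
    qed auto
    moreover have "incseq (\<lambda>n. {a - real (Suc n)..a})" by (auto simp: incseq_def)
    ultimately show ?thesis
      using range_le_incseq[of "\<lambda>n. {a - real (Suc n)..a}" u] range_le_Icc by simp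
  qed
  have 2: "E {a<..} (P {a<..} u) = P {a<..} u"
  proof -
    have "(\<Union>n. {a + 1 / real (Suc n)..a + 2 + real n}) = {a<..}"
    proof (intro equalityI subsetI)
      fix t assume "t \<in> {a<..}"
      then have "t - a > 0" by simp
      then obtain k where k: "1 / real (Suc k) < t - a" using nat_approx_posE by metis
      obtain l :: nat where l: "t - a \<le> real l" using real_arch_simple by blast
      have "1 / real (Suc (max k l)) \<le> 1 / real (Suc k)" by (simp add: field_simps)
      then show "t \<in> (\<Union>n. {a + 1 / real (Suc n)..a + 2 + real n})"
        using k l by (intro UN_I[of "max k l"]) auto
    next
      fix t assume "t \<in> (\<Union>n. {a + 1 / real (Suc n)..a + 2 + real n})"
      then obtain n where "a + 1 / real (Suc n) \<le> t" by auto
      moreover have "1 / real (Suc n) > 0" by simp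
      ultimately show "t \<in> {a<..}" by (simp only: greaterThan_iff)
    qed
    moreover have "incseq (\<lambda>n. {a + 1 / real (Suc n)..a + 2 + real n})"
      by (rule incseq_SucI) (auto simp: field_simps)
    moreover have "a + 1 / real (Suc n) < a + 2 + real n" for n
      by (simp add: field_simps add_pos_nonneg)
    ultimately show ?thesis
      using range_le_incseq[of "\<lambda>n. {a + 1 / real (Suc n)..a + 2 + real n}" u] range_le_Icc by simp
  qed
  have c: "- {..a} = {a<..}" by auto
  have "E {..a} u = E {..a} (P {..a} u) + E {..a} (P {a<..} u)"
    using P.compl[of "{..a}" u] by (simp add: E.add[symmetric] c)
  also have "E {..a} (P {a<..} u) = E {..a} (E {a<..} (P {a<..} u))" by (simp add: 2)
  also have "\<dots> = 0" by (rule E.orth) auto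
  finally show ?thesis by (simp add: 1)
qed

lemma pvm_unique:
  assumes "B \<in> sets borel" shows "E B u = P B u"
proof -
  have "Int_stable (range (atMost :: real \<Rightarrow> real set))"
    by (auto simp: Int_stable_def)
  moreover have "range (atMost :: real \<Rightarrow> real set) \<subseteq> Pow UNIV" by simp
  moreover have "B \<in> sigma_sets UNIV (range atMost)"
    using assms by (simp add: borel_eq_atMost)
  ultimately show ?thesis
  proof (induction arbitrary: u rule: sigma_sets_induct_disjoint)
    case (basic B)
    then show ?case using pvm_unique_atMost by auto
  next
    case empty
    show ?case by simp
  next
    case (compl B)
    have B: "B \<in> sets borel" using compl(1) by (simp add: borel_eq_atMost)
    have "E (- B) u = P (- B) u"
      using E.compl[OF B, of u] P.compl[OF B, of u] compl(2)[of u] by (metis add_left_cancel)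
    then show ?case by (simp add: Compl_eq_Diff_UNIV)
  next
    case (union B)
    have "range B \<subseteq> sets borel" using union(2) by (simp add: borel_eq_atMost)
    from E.sums[OF this union(1), of u] P.sums[OF this union(1), of u] show ?case
      unfolding union(3) by (rule sums_unique2)
  qed
qed

lemma spectral_integral_unique: "spectral_integral P F = spectral_integral E F"
proof -
  have "spectral_distribution P u = spectral_distribution E u" for u
    by (rule measure_eqI) (simp_all add: P.emeasure_spectral E.emeasure_spectral pvm_unique)
  then show ?thesis by (simp add: spectral_integral_def spectral_domain_def)
qed

end

context diagonalization
begin

theorem functional_calculus_A:
  assumes "F \<in> borel_measurable borel"
  shows "functional_calculus F A = graph F"
proof -
  have "(u, v) \<in> functional_calculus F A \<longleftrightarrow> (u, v) \<in> spectral_integral E F" for u v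
  proof
    assume "(u, v) \<in> functional_calculus F A"
    then obtain P where P: "projection_valued_measure P" "spectral_integral P complex_of_real = A"
      "(u, v) \<in> spectral_integral P F" by (auto simp: functional_calculus_def)
    interpret diagonalization_pvm V \<mu> P by standard (use P in auto)
    show "(u, v) \<in> spectral_integral E F" using P(3) by (simp add: spectral_integral_unique)
  next
    have "spectral_integral E complex_of_real = A" by (rule spectral_integral_E) measurable
    then show "(u, v) \<in> spectral_integral E F \<Longrightarrow> (u, v) \<in> functional_calculus F A"
      using pvm_E by (auto simp: functional_calculus_def)
  qed
  then show ?thesis by (auto simp: spectral_integral_E[OF assms])
qed

theorem bounded_functional_calculus_A:
  assumes "bounded_borel F"
  shows "bounded_functional_calculus F A = fop F"
proof
  fix u
  have F: "F \<in> borel_measurable borel" by (rule bounded_borel_measurable[OF assms])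
  show "bounded_functional_calculus F A u = fop F u"
    unfolding bounded_functional_calculus_def functional_calculus_A[OF F]
  proof (rule the_equality)
    show "(u, fop F u) \<in> graph F" using rep_fop[OF assms] by (simp add: graph_def)
    show "v = fop F u" if "(u, v) \<in> graph F" for v
      using that by (intro fop_eqI assms) (simp add: graph_def)
  qed
qed

end

section \<open>Gaussian integrals and uniqueness of Fourier transforms\<close>

lemma integral_lborel_prod:
  fixes f :: "'a::euclidean_space \<Rightarrow> real \<Rightarrow> complex"
  assumes f: "\<And>b. b \<in> Basis \<Longrightarrow> integrable lborel (f b)"
  shows "integrable lborel (\<lambda>x::'a. \<Prod>b\<in>Basis. f b (x \<bullet> b))"
    and "(\<integral>x. (\<Prod>b\<in>Basis. f b (x \<bullet> b)) \<partial>(lborel :: 'a measure)) = (\<Prod>b\<in>Basis. \<integral>t. f b t \<partial>lborel)"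
proof -
  interpret product_sigma_finite "\<lambda>b::'a. lborel :: real measure" by standard
  have [measurable]: "b \<in> Basis \<Longrightarrow> f b \<in> borel_measurable borel" for b
    using f[of b] by auto
  have m: "(\<lambda>x::'a. \<Prod>b\<in>Basis. f b (x \<bullet> b)) \<in> borel_measurable borel" by measurable
  have "(\<lambda>f. f b) \<in> borel_measurable (\<Pi>\<^sub>M b\<in>(Basis::'a set). lborel :: real measure)" if "b \<in> Basis" for b
    using measurable_component_singleton[OF that, of "\<lambda>_. lborel :: real measure"] by simp
  then have d: "(\<lambda>f. \<Sum>b\<in>Basis. f b *\<^sub>R b) \<in> measurable (\<Pi>\<^sub>M b\<in>(Basis::'a set). lborel) (borel :: 'a measure)"
    by (intro borel_measurable_sum borel_measurable_scaleR borel_measurable_const)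
  show "integrable lborel (\<lambda>x::'a. \<Prod>b\<in>Basis. f b (x \<bullet> b))"
    by (subst lborel_eq, subst integrable_distr_eq[OF d m])
       (use product_integrable_prod[OF finite_Basis f] in \<open>simp cong: prod.cong\<close>)
  show "(\<integral>x. (\<Prod>b\<in>Basis. f b (x \<bullet> b)) \<partial>(lborel :: 'a measure)) = (\<Prod>b\<in>Basis. \<integral>t. f b t \<partial>lborel)"
    by (subst lborel_eq, subst integral_distr[OF d m])
       (use product_integral_prod[OF finite_Basis f] in \<open>simp cong: prod.cong\<close>)
qed

lemma gauss_fourier_real:
  fixes t y :: real assumes t: "t > 0"
  shows "integrable lborel (\<lambda>x. exp (of_real (- (t\<^sup>2 * x\<^sup>2) / 2) + \<i> * of_real (y * x)))"
    and "(\<integral>x. exp (of_real (- (t\<^sup>2 * x\<^sup>2) / 2) + \<i> * of_real (y * x)) \<partial>lborel)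
      = of_real (sqrt (2 * pi) / t * exp (- (y\<^sup>2) / (2 * t\<^sup>2)))"
proof -
  define g where "g z x = exp (of_real (- (x\<^sup>2) / 2) + \<i> * of_real (z * x))" for z x :: real
  have n: "cmod (g z x) = sqrt (2 * pi) * std_normal_density x" for z x
    by (simp add: g_def std_normal_density_def)
  have [measurable]: "g z \<in> borel_measurable borel" for z unfolding g_def by measurable
  have gi: "integrable lborel (g z)" for z
    by (rule Bochner_Integration.integrable_bound[of lborel "\<lambda>x. sqrt (2 * pi) * std_normal_density x"])
       (auto simp: n)
  have gI: "(\<integral>x. g z x \<partial>lborel) = of_real (sqrt (2 * pi) * exp (- (z\<^sup>2) / 2))" for z
  proof -
    have "of_real (exp (- (z\<^sup>2) / 2)) = (\<integral>x. iexp (z * x) \<partial>std_normal_distribution)"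
      using fun_cong[OF char_std_normal_distribution, of z] by (simp add: char_def)
    also have "\<dots> = (\<integral>x. std_normal_density x *\<^sub>R iexp (z * x) \<partial>lborel)"
      by (subst integral_density) auto
    also have "\<dots> = (\<integral>x. of_real (1 / sqrt (2 * pi)) * g z x \<partial>lborel)"
      unfolding g_def exp_add exp_of_real std_normal_density_def scaleR_conv_of_real
      by (simp only: of_real_mult mult.assoc)
    also have "\<dots> = of_real (1 / sqrt (2 * pi)) * (\<integral>x. g z x \<partial>lborel)"
      by (rule integral_mult_right_zero)
    finally show ?thesis by (simp add: field_simps)
  qed
  have eq: "exp (of_real (- (t\<^sup>2 * x\<^sup>2) / 2) + \<i> * of_real (y * x)) = g (y / t) (0 + t * x)" for x
    using t by (simp add: g_def power_mult_distrib)
  show "integrable lborel (\<lambda>x. exp (of_real (- (t\<^sup>2 * x\<^sup>2) / 2) + \<i> * of_real (y * x)))"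
    unfolding eq by (rule lborel_integrable_real_affine[OF gi]) (use t in simp)
  have "(\<integral>x. g (y / t) (0 + t * x) \<partial>lborel) = of_real (1 / t) * (\<integral>x. g (y / t) x \<partial>lborel)"
    using lborel_integral_real_affine[of t "g (y / t)" 0] t by (simp add: scaleR_conv_of_real)
  then show "(\<integral>x. exp (of_real (- (t\<^sup>2 * x\<^sup>2) / 2) + \<i> * of_real (y * x)) \<partial>lborel)
      = of_real (sqrt (2 * pi) / t * exp (- (y\<^sup>2) / (2 * t\<^sup>2)))"
    unfolding eq gI by (simp add: power_divide)
qed

lemma gauss_fourier:
  fixes Y :: "'a::euclidean_space" assumes t: "t > 0"
  shows "integrable lborel (\<lambda>a::'a. exp (of_real (- (t\<^sup>2 * (a \<bullet> a)) / 2) + \<i> * of_real (Y \<bullet> a)))"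
    and "(\<integral>a. exp (of_real (- (t\<^sup>2 * (a \<bullet> a)) / 2) + \<i> * of_real (Y \<bullet> a)) \<partial>lborel)
      = of_real ((sqrt (2 * pi) / t) ^ DIM('a) * exp (- (Y \<bullet> Y) / (2 * t\<^sup>2)))"
proof -
  define f where "f b x = exp (of_real (- (t\<^sup>2 * x\<^sup>2) / 2) + \<i> * of_real ((Y \<bullet> b) * x))" for b :: 'a and x :: real
  have eq: "exp (of_real (- (t\<^sup>2 * (a \<bullet> a)) / 2) + \<i> * of_real (Y \<bullet> a)) = (\<Prod>b\<in>Basis. f b (a \<bullet> b))" for a
  proof -
    have "of_real (- (t\<^sup>2 * (a \<bullet> a)) / 2) + \<i> * of_real (Y \<bullet> a)
      = (\<Sum>b\<in>Basis. (of_real (- (t\<^sup>2 * (a \<bullet> b)\<^sup>2) / 2) + \<i> * of_real ((Y \<bullet> b) * (a \<bullet> b)) :: complex))"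
      unfolding euclidean_inner[of a a] euclidean_inner[of Y a]
      by (simp add: sum.distrib sum_subtractf sum_distrib_left sum_negf sum_divide_distrib power2_eq_square)
    then show ?thesis by (simp only: f_def exp_sum[OF finite_Basis])
  qed
  have fi: "integrable lborel (f b)" for b unfolding f_def by (rule gauss_fourier_real(1)[OF t])
  show "integrable lborel (\<lambda>a::'a. exp (of_real (- (t\<^sup>2 * (a \<bullet> a)) / 2) + \<i> * of_real (Y \<bullet> a)))"
    unfolding eq by (rule integral_lborel_prod(1)[OF fi])
  have "(\<integral>a. (\<Prod>b\<in>Basis. f b (a \<bullet> b)) \<partial>lborel) = (\<Prod>b\<in>Basis. of_real (sqrt (2 * pi) / t * exp (- ((Y \<bullet> b)\<^sup>2) / (2 * t\<^sup>2))))"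
    unfolding integral_lborel_prod(2)[OF fi] unfolding f_def gauss_fourier_real(2)[OF t] ..
  also have "\<dots> = of_real ((sqrt (2 * pi) / t) ^ DIM('a) * (\<Prod>b\<in>Basis. exp (- ((Y \<bullet> b)\<^sup>2) / (2 * t\<^sup>2))))"
    by (simp only: of_real_prod[symmetric] prod.distrib prod_constant)
  also have "(\<Prod>b\<in>Basis. exp (- ((Y \<bullet> b)\<^sup>2) / (2 * t\<^sup>2))) = exp (- (Y \<bullet> Y) / (2 * t\<^sup>2))"
    unfolding exp_sum[OF finite_Basis, symmetric] euclidean_inner[of Y Y]
    by (simp add: sum_negf sum_divide_distrib power2_eq_square)
  finally show "(\<integral>a. exp (of_real (- (t\<^sup>2 * (a \<bullet> a)) / 2) + \<i> * of_real (Y \<bullet> a)) \<partial>lborel)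
      = of_real ((sqrt (2 * pi) / t) ^ DIM('a) * exp (- (Y \<bullet> Y) / (2 * t\<^sup>2)))"
    unfolding eq .
qed

lemma gauss_integrable:
  assumes t: "t > 0"
  shows "integrable lborel (\<lambda>a::'a::euclidean_space. exp (- (t\<^sup>2 * (a \<bullet> a)) / 2))"
  using integrable_norm[OF gauss_fourier(1)[OF t, of 0]] by simp

lemma integral_lborel_shift:
  fixes f :: "'a::euclidean_space \<Rightarrow> complex"
  assumes [measurable]: "f \<in> borel_measurable borel"
  shows "(\<integral>a. f (c + a) \<partial>lborel) = (\<integral>a. f a \<partial>lborel)"
proof -
  have "(\<integral>a. f a \<partial>lborel) = (\<integral>a. f a \<partial>distr lborel borel ((+) c))" by (simp add: lborel_distr_plus)
  also have "\<dots> = (\<integral>a. f (c + a) \<partial>lborel)" by (rule integral_distr) auto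
  finally show ?thesis ..
qed

lemma integrable_lborel_shift:
  fixes f :: "'a::euclidean_space \<Rightarrow> complex"
  assumes [measurable]: "f \<in> borel_measurable borel"
  shows "integrable lborel (\<lambda>a. f (c + a)) \<longleftrightarrow> integrable lborel f"
proof -
  have "integrable lborel f \<longleftrightarrow> integrable (distr lborel borel ((+) c)) f" by (simp add: lborel_distr_plus)
  also have "\<dots> \<longleftrightarrow> integrable lborel (\<lambda>a. f (c + a))" by (rule integrable_distr_eq) auto
  finally show ?thesis ..
qed

lemma integral_lborel_scale:
  fixes f :: "'a::euclidean_space \<Rightarrow> complex"
  assumes [measurable]: "f \<in> borel_measurable borel" and c: "c \<noteq> 0"
  shows "(\<integral>a. f a \<partial>lborel) = of_real (\<bar>c\<bar> ^ DIM('a)) * (\<integral>a. f (c *\<^sub>R a) \<partial>lborel)"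
  by (subst lborel_affine[OF c, of 0])
     (simp add: integral_density integral_distr scaleR_conv_of_real prod_constant)

context
  fixes H :: "'a::euclidean_space \<Rightarrow> complex"
  assumes H: "integrable lborel H" and 0: "\<And>Y. (\<integral>a. H a * exp (\<i> * of_real (Y \<bullet> a)) \<partial>lborel) = 0"
begin

private lemma H_measurable: "H \<in> borel_measurable borel"
  using borel_measurable_integrable[OF H] by simp

private lemma Hn: "integrable lborel (\<lambda>a. cmod (H a))"
  using H by (rule integrable_norm)

private lemma prod_int:
  fixes F :: "'a \<times> 'a \<Rightarrow> complex"
  assumes [measurable]: "F \<in> borel_measurable (lborel \<Otimes>\<^sub>M lborel)"
    and le: "\<And>a y. cmod (F (a, y)) \<le> C * G a y" and G: "\<And>a. (\<integral>y. G a y \<partial>lborel) = D"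
    and Gi: "\<And>a. integrable lborel (G a)"
  shows "integrable (lborel \<Otimes>\<^sub>M lborel) (\<lambda>(a, y). H a * F (a, y))"
  supply [measurable] = H_measurable
  proof (rule lborel_pair.Fubini_integrable)
    have i: "integrable lborel (\<lambda>y. F (a, y))" for a
      by (rule Bochner_Integration.integrable_bound[of lborel "\<lambda>y. C * G a y"])
         (use Gi[of a] le order_trans[OF le abs_ge_self] in auto)
    have bound: "norm (\<integral>y. cmod (H a * F (a, y)) \<partial>lborel) \<le> norm (of_real (C * D) * H a)" for a
    proof -
      have "(\<integral>y. cmod (F (a, y)) \<partial>lborel) \<le> (\<integral>y. C * G a y \<partial>lborel)"
        by (intro integral_mono integrable_norm i) (use Gi le in auto)
      also have "\<dots> = C * D" by (simp add: G)
      finally have le': "(\<integral>y. cmod (F (a, y)) \<partial>lborel) \<le> C * D" .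
      have nn: "0 \<le> (\<integral>y. cmod (F (a, y)) \<partial>lborel)" by (rule integral_nonneg_AE) simp
      have "(\<integral>y. cmod (H a * F (a, y)) \<partial>lborel) = cmod (H a) * (\<integral>y. cmod (F (a, y)) \<partial>lborel)"
        unfolding norm_mult by (rule integral_mult_right_zero)
      moreover have "cmod (H a) * (\<integral>y. cmod (F (a, y)) \<partial>lborel) \<le> cmod (H a) * (C * D)"
        by (rule mult_left_mono[OF le']) simp
      moreover have "norm (of_real (C * D) * H a) = cmod (H a) * (C * D)"
        using order_trans[OF nn le'] unfolding norm_mult norm_of_real by simp
      moreover have "0 \<le> cmod (H a) * (\<integral>y. cmod (F (a, y)) \<partial>lborel)"
        by (rule mult_nonneg_nonneg[OF _ nn]) simp
      ultimately show ?thesis by (simp only: real_norm_def abs_of_nonneg)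
    qed
    have "integrable lborel (\<lambda>a. of_real (C * D) * H a)" using H by (rule integrable_mult_right)
    then have "integrable lborel (\<lambda>a. \<integral>y. norm (H a * F (a, y)) \<partial>lborel)"
      by (rule Bochner_Integration.integrable_bound) (measurable, use bound in blast)
    then show "integrable lborel (\<lambda>a. \<integral>y. norm (case (a, y) of (a, y) \<Rightarrow> H a * F (a, y)) \<partial>lborel)" by simp
    show "AE a in lborel. integrable lborel (\<lambda>y. case (a, y) of (a, y) \<Rightarrow> H a * F (a, y))"
      using i by simp
  qed simp

private lemma pull: "(\<integral>a. H a * (\<kappa> * g a) \<partial>lborel) = \<kappa> * (\<integral>a. H a * g a \<partial>lborel)"
    by (subst integral_mult_right_zero[symmetric]) (simp only: mult.left_commute)

private lemma conv:
  assumes t: "t > 0"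
  shows "(\<integral>a. H a * of_real (exp (- (t\<^sup>2 * ((a - b) \<bullet> (a - b))) / 2)) \<partial>lborel) = 0"
  supply [measurable] = H_measurable
  proof -
    define G where "G y = exp (- ((1/t)\<^sup>2 * (y \<bullet> y)) / 2)" for y :: 'a
    define F where "F = (\<lambda>(a, y). exp (of_real (- ((1/t)\<^sup>2 * (y \<bullet> y)) / 2) + \<i> * of_real ((a - b) \<bullet> y)))"
    have [measurable]: "F \<in> borel_measurable (lborel \<Otimes>\<^sub>M lborel)"
      unfolding F_def by measurable
    have "integrable (lborel \<Otimes>\<^sub>M lborel) (\<lambda>(a, y). H a * F (a, y))"
    proof (rule prod_int[where C = 1 and G = "\<lambda>a. G" and D = "\<integral>y. G y \<partial>lborel"])
      show "cmod (F (a, y)) \<le> 1 * G y" for a y by (simp add: F_def G_def)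
      show "integrable lborel G" unfolding G_def by (rule gauss_integrable) (use t in simp)
    qed simp_all
    from lborel_pair.Fubini_integral[OF this]
    have "(\<integral>a. (\<integral>y. H a * F (a, y) \<partial>lborel) \<partial>lborel) = (\<integral>y. (\<integral>a. H a * F (a, y) \<partial>lborel) \<partial>lborel)" by simp
    also have "(\<lambda>y. (\<integral>a. H a * F (a, y) \<partial>lborel)) = (\<lambda>y. 0)"
    proof
      fix y
      have "(\<integral>a. H a * F (a, y) \<partial>lborel)
        = (\<integral>a. exp (of_real (- ((1/t)\<^sup>2 * (y \<bullet> y)) / 2) - \<i> * of_real (b \<bullet> y)) * (H a * exp (\<i> * of_real (y \<bullet> a))) \<partial>lborel)"
      proof (rule Bochner_Integration.integral_cong[OF refl])
        fix a
        have "exp (of_real (- ((1/t)\<^sup>2 * (y \<bullet> y)) / 2) - \<i> * of_real (b \<bullet> y)) * exp (\<i> * of_real (y \<bullet> a)) = F (a, y)"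
          unfolding exp_add[symmetric] F_def by (simp add: inner_diff_left inner_diff_right inner_commute algebra_simps)
        then show "H a * F (a, y) = exp (of_real (- ((1/t)\<^sup>2 * (y \<bullet> y)) / 2) - \<i> * of_real (b \<bullet> y)) * (H a * exp (\<i> * of_real (y \<bullet> a)))"
          by (metis mult.left_commute)
      qed
      also have "\<dots> = 0" by (simp add: 0)
      finally show "(\<integral>a. H a * F (a, y) \<partial>lborel) = 0" .
    qed
    finally have "(\<integral>a. H a * (\<integral>y. F (a, y) \<partial>lborel) \<partial>lborel) = 0" by simp
    moreover have "(\<integral>y. F (a, y) \<partial>lborel) = of_real ((sqrt (2 * pi) * t) ^ DIM('a)) * of_real (exp (- (t\<^sup>2 * ((a - b) \<bullet> (a - b))) / 2))" for a
      using gauss_fourier(2)[of "1/t" "a - b"] t by (simp add: F_def exp_of_real power_divide mult.commute)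
    ultimately have "of_real ((sqrt (2 * pi) * t) ^ DIM('a)) * (\<integral>a. H a * of_real (exp (- (t\<^sup>2 * ((a - b) \<bullet> (a - b))) / 2)) \<partial>lborel) = 0"
      by (simp only: pull)
    then show ?thesis using t by simp
  qed

private lemma test:
  fixes \<psi> :: "'a \<Rightarrow> real"
  assumes \<psi>: "continuous_on UNIV \<psi>" "\<And>a. \<bar>\<psi> a\<bar> \<le> 1"
  shows "(\<integral>a. H a * of_real (\<psi> a) \<partial>lborel) = 0"
  supply [measurable] = H_measurable
  proof -
    have [measurable]: "\<psi> \<in> borel_measurable borel" by (rule borel_measurable_continuous_onI[OF \<psi>(1)])
    define K where "K = (\<integral>v. complex_of_real (exp (- (v \<bullet> v) / 2)) \<partial>(lborel :: 'a measure))"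
    have "K = (\<integral>v. exp (of_real (- (1\<^sup>2 * (v \<bullet> v)) / 2) + \<i> * of_real (0 \<bullet> v)) \<partial>(lborel :: 'a measure))"
      unfolding K_def by (rule Bochner_Integration.integral_cong) (simp_all flip: exp_of_real)
    then have K: "K \<noteq> 0" using gauss_fourier(2)[of 1 "0::'a"] by simp
    define \<Psi> where "\<Psi> t a = (\<integral>v. complex_of_real (\<psi> (a + (1/t) *\<^sub>R v) * exp (- (v \<bullet> v) / 2)) \<partial>lborel)" for t a
    have gi: "integrable lborel (\<lambda>v::'a. exp (- (v \<bullet> v) / 2))" using gauss_integrable[of 1] by simp
    have \<Psi>0: "(\<integral>a. H a * \<Psi> t a \<partial>lborel) = 0" if t: "t > 0" for t
    proof -
      define F where "F = (\<lambda>(a, b). of_real (\<psi> b) * of_real (exp (- (t\<^sup>2 * ((a - b) \<bullet> (a - b))) / 2)) :: complex)"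
      define G where "G a b = exp (- (t\<^sup>2 * ((a - b) \<bullet> (a - b))) / 2)" for a b :: 'a
      have [measurable]: "F \<in> borel_measurable (lborel \<Otimes>\<^sub>M lborel)"
        unfolding F_def by measurable
      have sh: "G a b = exp (- (t\<^sup>2 * ((- a + b) \<bullet> (- a + b))) / 2)" for a b
        by (simp add: G_def inner_diff inner_add algebra_simps)
      have Gi: "integrable lborel (G a)" for a
      proof -
        have "integrable lborel (\<lambda>b. complex_of_real (G a b))"
          unfolding sh
          by (subst integrable_lborel_shift[where f = "\<lambda>b. complex_of_real (exp (- (t\<^sup>2 * (b \<bullet> b)) / 2))"])
             (use gauss_integrable[OF t] in \<open>auto simp: complex_of_real_integrable_eq\<close>)
        then show ?thesis by (simp only: complex_of_real_integrable_eq)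
      qed
      have GD: "(\<integral>b. G a b \<partial>lborel) = Re (\<integral>b. complex_of_real (exp (- (t\<^sup>2 * (b \<bullet> b)) / 2)) \<partial>(lborel :: 'a measure))" for a
      proof -
        have "complex_of_real (\<integral>b. G a b \<partial>lborel) = (\<integral>b. complex_of_real (exp (- (t\<^sup>2 * ((- a + b) \<bullet> (- a + b))) / 2)) \<partial>lborel)"
          unfolding sh by simp
        also have "\<dots> = (\<integral>b. complex_of_real (exp (- (t\<^sup>2 * (b \<bullet> b)) / 2)) \<partial>(lborel :: 'a measure))"
          by (rule integral_lborel_shift[where f = "\<lambda>b. complex_of_real (exp (- (t\<^sup>2 * (b \<bullet> b)) / 2))"]) measurable
        finally show ?thesis by (metis Re_complex_of_real)
      qed
      have "integrable (lborel \<Otimes>\<^sub>M lborel) (\<lambda>(a, b). H a * F (a, b))"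
      proof (rule prod_int[where C = 1 and G = G, OF _ _ GD Gi])
        show "cmod (F (a, b)) \<le> 1 * G a b" for a b
          using \<psi>(2)[of b] by (simp add: F_def G_def norm_mult)
      qed measurable
      from lborel_pair.Fubini_integral[OF this]
      have "(\<integral>a. (\<integral>b. H a * F (a, b) \<partial>lborel) \<partial>lborel) = (\<integral>b. (\<integral>a. H a * F (a, b) \<partial>lborel) \<partial>lborel)" by simp
      also have "(\<lambda>b. (\<integral>a. H a * F (a, b) \<partial>lborel)) = (\<lambda>b. 0)"
        unfolding F_def prod.case pull conv[OF t] by simp
      finally have "(\<integral>a. H a * (\<integral>b. F (a, b) \<partial>lborel) \<partial>lborel) = 0" by simp
      moreover have "(\<integral>b. F (a, b) \<partial>lborel) = of_real ((1/t) ^ DIM('a)) * \<Psi> t a" for a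
      proof -
        have "(\<integral>b. F (a, b) \<partial>lborel) = (\<integral>b. F (a, a + b) \<partial>lborel)"
          by (rule integral_lborel_shift[symmetric]) (simp add: F_def)
        also have "\<dots> = of_real (\<bar>1/t\<bar> ^ DIM('a)) * (\<integral>v. F (a, a + (1/t) *\<^sub>R v) \<partial>lborel)"
          by (rule integral_lborel_scale) (use t in \<open>auto simp: F_def\<close>)
        also have "(\<lambda>v. F (a, a + (1/t) *\<^sub>R v)) = (\<lambda>v. of_real (\<psi> (a + (1/t) *\<^sub>R v) * exp (- (v \<bullet> v) / 2)))"
          using t by (auto simp: F_def exp_of_real power2_eq_square)
        finally show ?thesis using t by (simp add: \<Psi>_def)
      qed
      ultimately have "of_real ((1/t) ^ DIM('a)) * (\<integral>a. H a * \<Psi> t a \<partial>lborel) = 0"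
        by (simp only: pull)
      then show ?thesis using t by simp
    qed
    have \<Psi>m [measurable]: "\<Psi> t \<in> borel_measurable borel" for t
      unfolding \<Psi>_def by measurable
    have bd: "cmod (complex_of_real (\<psi> x * exp r)) \<le> exp r" for x r
      using mult_right_mono[OF \<psi>(2)[of x], of "exp r"] unfolding norm_of_real abs_mult by simp
    have \<Psi>b: "cmod (\<Psi> t a) \<le> cmod K" for t a
    proof -
      have "cmod (\<Psi> t a) \<le> (\<integral>v. exp (- (v \<bullet> v) / 2) \<partial>(lborel :: 'a measure))"
        unfolding \<Psi>_def
      proof (rule order_trans[OF integral_norm_bound integral_mono])
        have "integrable lborel (\<lambda>v. complex_of_real (\<psi> (a + (1/t) *\<^sub>R v) * exp (- (v \<bullet> v) / 2)))"
          by (rule Bochner_Integration.integrable_bound[OF gi]) (measurable, use bd in \<open>simp del: of_real_mult\<close>)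
        then show "integrable lborel (\<lambda>v. cmod (complex_of_real (\<psi> (a + (1/t) *\<^sub>R v) * exp (- (v \<bullet> v) / 2))))"
          by (rule integrable_norm)
      qed (rule gi, rule bd)
      also have "\<dots> \<le> cmod K" by (simp add: K_def)
      finally show ?thesis .
    qed
    have \<Psi>lim: "(\<lambda>n. \<Psi> (real (Suc n)) a) \<longlonglongrightarrow> of_real (\<psi> a) * K" for a
    proof -
      have "(\<lambda>n. \<Psi> (real (Suc n)) a) \<longlonglongrightarrow> (\<integral>v. complex_of_real (\<psi> a * exp (- (v \<bullet> v) / 2)) \<partial>(lborel :: 'a measure))"
        unfolding \<Psi>_def
      proof (rule integral_dominated_convergence[where w = "\<lambda>v. exp (- (v \<bullet> v) / 2)"])
        show "AE v in lborel. (\<lambda>n. complex_of_real (\<psi> (a + (1 / real (Suc n)) *\<^sub>R v) * exp (- (v \<bullet> v) / 2)))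
            \<longlonglongrightarrow> of_real (\<psi> a * exp (- (v \<bullet> v) / 2))"
        proof (intro AE_I2 tendsto_of_real tendsto_mult tendsto_const)
          fix v
          have "(\<lambda>n. a + (1 / real (Suc n)) *\<^sub>R v) \<longlonglongrightarrow> a + 0 *\<^sub>R v"
            by (intro tendsto_add tendsto_const tendsto_scaleR LIMSEQ_Suc lim_1_over_n)
          then show "(\<lambda>n. \<psi> (a + (1 / real (Suc n)) *\<^sub>R v)) \<longlonglongrightarrow> \<psi> a"
            using continuous_on_tendsto_compose[OF \<psi>(1), of _ a] by simp
        qed
      qed (use bd gi in \<open>auto simp del: of_real_mult\<close>)
      then show ?thesis by (simp add: K_def)
    qed
    have z: "(\<integral>a. H a * \<Psi> (real (Suc n)) a \<partial>lborel) = 0" for n by (rule \<Psi>0) simp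
    have "(\<lambda>n. \<integral>a. H a * \<Psi> (real (Suc n)) a \<partial>lborel) \<longlonglongrightarrow> (\<integral>a. H a * (of_real (\<psi> a) * K) \<partial>lborel)"
    proof (rule integral_dominated_convergence[where w = "\<lambda>a. cmod (H a) * cmod K"])
      show "AE a in lborel. (\<lambda>n. H a * \<Psi> (real (Suc n)) a) \<longlonglongrightarrow> H a * (of_real (\<psi> a) * K)"
        by (intro AE_I2 tendsto_mult tendsto_const \<Psi>lim)
    qed (use Hn \<Psi>b in \<open>auto simp: norm_mult intro!: mult_left_mono\<close>)
    then have "(\<lambda>n::nat. 0) \<longlonglongrightarrow> (\<integral>a. H a * (of_real (\<psi> a) * K) \<partial>lborel)" unfolding z .
    then have "(\<integral>a. H a * (of_real (\<psi> a) * K) \<partial>lborel) = 0" by (rule LIMSEQ_unique[OF _ tendsto_const])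
    then have "K * (\<integral>a. H a * of_real (\<psi> a) \<partial>lborel) = 0"
      unfolding pull[symmetric] by (simp only: mult.commute[of K])
    then show ?thesis using K by simp
  qed

private lemma op:
  assumes U: "open U"
  shows "(\<integral>a. indicator U a *\<^sub>R H a \<partial>lborel) = 0"
  supply [measurable] = H_measurable
  proof (cases "U = UNIV")
    case True
    then show ?thesis using 0[of 0] by simp
  next
    case False
    have [measurable]: "U \<in> sets borel" using U by simp
    define \<psi> where "\<psi> n a = min 1 (real n * infdist a (- U))" for n a
    have "(\<lambda>n. \<integral>a. H a * of_real (\<psi> n a) \<partial>lborel) \<longlonglongrightarrow> (\<integral>a. H a * indicator U a \<partial>lborel)"
    proof (rule integral_dominated_convergence[where w = "\<lambda>a. cmod (H a)"])
      show "AE a in lborel. (\<lambda>n. H a * of_real (\<psi> n a)) \<longlonglongrightarrow> H a * indicator U a"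
      proof (intro AE_I2 tendsto_mult tendsto_const)
        fix a
        have "eventually (\<lambda>n. complex_of_real (\<psi> n a) = indicator U a) sequentially"
        proof (cases "a \<in> U")
          case True
          have "infdist a (- U) > 0"
            using True False U by (subst infdist_pos_not_in_closed) auto
          then obtain N where N: "1 \<le> real N * infdist a (- U)"
            by (metis reals_Archimedean3 less_imp_le)
          show ?thesis
          proof (rule eventually_sequentiallyI[of N])
            fix n assume "N \<le> n"
            then have "real N * infdist a (- U) \<le> real n * infdist a (- U)"
              by (intro mult_right_mono infdist_nonneg) auto
            with N True show "complex_of_real (\<psi> n a) = indicator U a" by (simp add: \<psi>_def)
          qed
        next
          case False
          then show ?thesis by (simp add: \<psi>_def)
        qed
        then show "(\<lambda>n. complex_of_real (\<psi> n a)) \<longlonglongrightarrow> indicator U a" by (rule tendsto_eventually)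
      qed
      show "AE a in lborel. norm (H a * complex_of_real (\<psi> n a)) \<le> cmod (H a)" for n
      proof (rule AE_I2)
        fix a
        have "0 \<le> \<psi> n a" "\<psi> n a \<le> 1" by (auto simp: \<psi>_def infdist_nonneg)
        then show "norm (H a * complex_of_real (\<psi> n a)) \<le> cmod (H a)"
          by (simp add: norm_mult mult_left_le)
      qed
      show "(\<lambda>a. H a * complex_of_real (\<psi> n a)) \<in> borel_measurable lborel" for n
        unfolding \<psi>_def by (intro borel_measurable_times borel_measurable_of_real) (auto intro!: borel_measurable_continuous_onI continuous_intros)
      show "(\<lambda>a. H a * indicator U a) \<in> borel_measurable lborel" by measurable
      show "integrable lborel (\<lambda>a. cmod (H a))" by (rule Hn)
    qed
    moreover have z: "(\<integral>a. H a * of_real (\<psi> n a) \<partial>lborel) = 0" for n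
      by (rule test) (auto simp: \<psi>_def infdist_nonneg abs_le_iff intro!: continuous_intros)
    ultimately have "(\<lambda>n::nat. 0) \<longlonglongrightarrow> (\<integral>a. H a * indicator U a \<partial>lborel)" by (simp only: z)
    then have "(\<integral>a. H a * indicator U a \<partial>lborel) = 0" by (rule LIMSEQ_unique[OF _ tendsto_const])
    moreover have "(\<lambda>a. H a * indicator U a) = (\<lambda>a. indicator U a *\<^sub>R H a)"
      by (auto simp: indicator_def)
    ultimately show ?thesis by simp
  qed

text \<open>The convolution of \<open>H\<close> with every Gaussian vanishes, being a superposition of values of the
  Fourier transform. Narrow Gaussians approximate the identity.\<close>

lemma fourier_unique: "AE a in lborel. H a = 0"
  supply [measurable] = H_measurable
proof (rule sigma_finite_measure.density_zero[OF lborel.sigma_finite_measure_axioms H])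
    fix A assume "A \<in> sets (lborel :: 'a measure)"
    then have A: "A \<in> sigma_sets UNIV {S::'a set. open S}" by (simp add: sets_borel)
    have "Int_stable {S::'a set. open S}" by (auto simp: Int_stable_def)
    moreover have "{S::'a set. open S} \<subseteq> Pow UNIV" by simp
    ultimately have "A \<in> sets borel \<and> set_lebesgue_integral lborel A H = 0"
      using A
    proof (induction rule: sigma_sets_induct_disjoint)
      case (basic A)
      then show ?case using op by (auto simp: set_lebesgue_integral_def)
    next
      case empty
      show ?case by (simp add: set_lebesgue_integral_def)
    next
      case (compl A)
      have i: "integrable lborel (\<lambda>a. indicator A a *\<^sub>R H a)"
        by (rule integrable_mult_indicator) (use compl H in auto)
      have "set_lebesgue_integral lborel (UNIV - A) H = (\<integral>a. H a - indicator A a *\<^sub>R H a \<partial>lborel)"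
        unfolding set_lebesgue_integral_def
        by (rule Bochner_Integration.integral_cong) (auto simp: indicator_def)
      also have "\<dots> = (\<integral>a. H a \<partial>lborel) - (\<integral>a. indicator A a *\<^sub>R H a \<partial>lborel)"
        by (rule Bochner_Integration.integral_diff[OF H i])
      finally show ?case using compl 0[of 0] sets.compl_sets[of A borel] by (simp add: set_lebesgue_integral_def)
    next
      case (union A)
      have "set_lebesgue_integral lborel (\<Union>i. A i) H = (\<Sum>i. set_lebesgue_integral lborel (A i) H)"
      proof (rule lebesgue_integral_countable_add)
        show "set_integrable lborel (\<Union>i. A i) H"
          unfolding set_integrable_def by (rule integrable_mult_indicator) (use union H in auto)
      qed (use union in \<open>auto simp: disjoint_family_on_def\<close>)
      with union show ?case by auto
    qed
    then show "set_lebesgue_integral lborel A H = 0" ..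
  qed

end

section \<open>Coherent states\<close>

definition cohf :: "'a::euclidean_space \<Rightarrow> 'a \<Rightarrow> 'a \<Rightarrow> complex" where
  "cohf x y a = exp (of_real (x \<bullet> a - (a \<bullet> a) / 2) + \<i> * of_real (y \<bullet> a))"

definition coh :: "'a::euclidean_space \<Rightarrow> 'a \<Rightarrow> 'a L2" where
  "coh x y = abs_L2 (cohf x y)"

lemma measurable_cohf [measurable]: "cohf x y \<in> borel_measurable borel"
  unfolding cohf_def[abs_def] by measurable

lemma gauss_coherent_integral:
  fixes X Y :: "'a::euclidean_space"
  defines "f \<equiv> \<lambda>a. exp (of_real (X \<bullet> a - a \<bullet> a) + \<i> * of_real (Y \<bullet> a))"
  shows "integrable lborel f"
    and "(\<integral>a. f a \<partial>lborel) = of_real (sqrt pi ^ DIM('a)) * exp (of_real ((X \<bullet> X - Y \<bullet> Y) / 4) + \<i> * of_real (X \<bullet> Y / 2))"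
proof -
  define g where "g a = exp (of_real (- ((sqrt 2)\<^sup>2 * (a \<bullet> a)) / 2) + \<i> * of_real (Y \<bullet> a))" for a :: 'a
  define c where "c = exp (of_real (X \<bullet> X / 4) + \<i> * of_real (X \<bullet> Y / 2))"
  have [measurable]: "f \<in> borel_measurable borel" unfolding f_def by measurable
  have eq: "f ((1/2) *\<^sub>R X + a) = c * g a" for a
    unfolding f_def c_def g_def exp_add[symmetric]
    by (rule arg_cong[where f = exp])
       (simp add: inner_add_left inner_add_right inner_commute algebra_simps add_divide_distrib diff_divide_distrib)
  have s: "sqrt 2 > 0" by simp
  have gi: "integrable lborel g" unfolding g_def by (rule gauss_fourier(1)[OF s])
  have "integrable lborel (\<lambda>a. f ((1/2) *\<^sub>R X + a))" unfolding eq using gi by (rule integrable_mult_right)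
  then show "integrable lborel f" by (subst (asm) integrable_lborel_shift) auto
  have "(\<integral>a. f a \<partial>lborel) = (\<integral>a. c * g a \<partial>lborel)"
    unfolding eq[symmetric] by (rule integral_lborel_shift[symmetric]) simp
  also have "\<dots> = c * of_real ((sqrt (2 * pi) / sqrt 2) ^ DIM('a) * exp (- (Y \<bullet> Y) / (2 * (sqrt 2)\<^sup>2)))"
    unfolding g_def integral_mult_right_zero gauss_fourier(2)[OF s] ..
  also have "\<dots> = of_real (sqrt pi ^ DIM('a)) * (c * exp (of_real (- (Y \<bullet> Y) / 4)))"
    by (simp add: real_sqrt_mult exp_of_real[symmetric])
  also have "c * exp (of_real (- (Y \<bullet> Y) / 4)) = exp (of_real ((X \<bullet> X - Y \<bullet> Y) / 4) + \<i> * of_real (X \<bullet> Y / 2))"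
    unfolding c_def exp_add[symmetric] by (rule arg_cong[where f = exp]) (simp add: diff_divide_distrib)
  finally show "(\<integral>a. f a \<partial>lborel) = of_real (sqrt pi ^ DIM('a)) * exp (of_real ((X \<bullet> X - Y \<bullet> Y) / 4) + \<i> * of_real (X \<bullet> Y / 2))" .
qed

lemma cohf_mult_cnj:
  "cohf x y a * cnj (cohf x' y' a) = exp (of_real ((x + x') \<bullet> a - a \<bullet> a) + \<i> * of_real ((y - y') \<bullet> a))"
  unfolding cohf_def exp_cnj exp_add[symmetric]
  by (rule arg_cong[where f = exp]) (simp add: inner_add_left inner_diff_left algebra_simps)

lemma square_integrable_cohf: "square_integrable (cohf x y)"
  unfolding square_integrable_def
proof
  have "integrable lborel (\<lambda>a. cohf x y a * cnj (cohf x y a))"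
    unfolding cohf_mult_cnj by (rule gauss_coherent_integral(1))
  then have "integrable lborel (\<lambda>a. complex_of_real ((cmod (cohf x y a))\<^sup>2))"
    by (simp only: complex_norm_square)
  then show "integrable lborel (\<lambda>a. (cmod (cohf x y a))\<^sup>2)"
    by (simp only: complex_of_real_integrable_eq)
qed simp

lemma rep_coh: "AE a in lborel. rep_L2 (coh x y) a = cohf x y a"
  unfolding coh_def by (rule rep_abs_L2[OF square_integrable_cohf])

lemma coh_gram:
  fixes x y x' y' :: "'a::euclidean_space"
  shows "cinner (coh x y) (coh x' y') = of_real (sqrt pi ^ DIM('a))
    * exp (of_real (((x + x') \<bullet> (x + x') - (y - y') \<bullet> (y - y')) / 4) + \<i> * of_real ((x + x') \<bullet> (y - y') / 2))"
  unfolding coh_def cinner_abs_L2[OF square_integrable_cohf square_integrable_cohf] cohf_mult_cnj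
  by (rule gauss_coherent_integral(2))

text \<open>Multiplication by \<open>cohf 0 0\<close> makes \<open>h\<close> integrable, and pairing with \<open>cohf 0 y\<close> reads off the
  Fourier transform of the product.\<close>

lemma coherent_unique:
  fixes h :: "'a::euclidean_space \<Rightarrow> complex"
  assumes int: "integrable lborel (\<lambda>a. cohf 0 0 a * h a)"
    and 0: "\<And>y. (\<integral>a. cohf 0 y a * h a \<partial>lborel) = 0"
  shows "AE a in lborel. h a = 0"
proof -
  have eq: "cohf 0 y a = cohf 0 0 a * exp (\<i> * of_real (y \<bullet> a))" for y a :: 'a
    unfolding cohf_def exp_add[symmetric] by simp
  have "AE a in lborel. cohf 0 0 a * h a = 0"
  proof (rule fourier_unique[OF int])
    fix Y :: 'a
    show "(\<integral>a. cohf 0 0 a * h a * exp (\<i> * of_real (Y \<bullet> a)) \<partial>lborel) = 0"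
      using 0[of Y] unfolding eq[of Y] by (simp only: mult_ac)
  qed
  then show ?thesis by eventually_elim (simp add: cohf_def)
qed

lemma coh_total:
  assumes "\<And>x y. cinner (coh x y) w = 0"
  shows "w = 0"
proof -
  have i: "integrable lborel (\<lambda>a. cohf x y a * cnj (rep_L2 w a))" for x y
    by (rule integrable_mult_cnj[OF square_integrable_cohf square_integrable_rep])
  have c: "cinner (coh x y) w = (\<integral>a. cohf x y a * cnj (rep_L2 w a) \<partial>lborel)" for x y
    by (rule cinner_eq_integral_AE) (use rep_coh in auto)
  have "AE a in lborel. cnj (rep_L2 w a) = 0"
    by (rule coherent_unique[OF i]) (use assms c in simp)
  then have "AE a in lborel. rep_L2 w a = rep_L2 0 a"
    using rep_zero by eventually_elim simp
  then show ?thesis by (rule L2_eqI)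
qed

lemma coh_induct [case_names coh zero add scale closed]:
  fixes u :: "'a::euclidean_space L2"
  assumes coh: "\<And>x y. P (coh x y)" and zero: "P 0" and add: "\<And>u v. P u \<Longrightarrow> P v \<Longrightarrow> P (u + v)"
    and scale: "\<And>c u. P u \<Longrightarrow> P (c *\<^sub>C u)"
    and lim: "\<And>X u. (\<And>n. P (X n)) \<Longrightarrow> X \<longlonglongrightarrow> u \<Longrightarrow> P u"
  shows "P u"
proof -
  have "closed {u. P u}" unfolding closed_sequential_limits using lim by blast
  then have "u \<in> {u. P u}"
  proof (rule complex_subspace_dense)
    fix v :: "'a L2" assume *: "\<And>u. u \<in> {u. P u} \<Longrightarrow> cinner u v = 0"
    show "v = 0" by (rule coh_total) (use * coh in auto)
  qed (auto intro: zero add scale)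
  then show ?thesis by simp
qed

section \<open>Weyl operators\<close>

lemma AE_lborel_shift:
  fixes b :: "'a::euclidean_space"
  assumes "AE a in lborel. P a" shows "AE a in lborel. P (a - b)"
proof -
  obtain N where N: "N \<in> null_sets lborel" "{a. \<not> P a} \<subseteq> N" using assms by (auto simp: eventually_ae_filter)
  have "AE a in lborel. a \<notin> N" using N(1) by (rule AE_not_in)
  then have "AE a in distr lborel borel ((+) (- b)). a \<notin> N" unfolding lborel_distr_plus .
  then have "AE a in lborel. - b + a \<notin> N"
    by (subst (asm) AE_distr_iff) (use N(1) in auto)
  then show ?thesis by eventually_elim (use N(2) in \<open>auto simp: algebra_simps\<close>)
qed

lemma square_integrable_shift:
  assumes "square_integrable f" shows "square_integrable (\<lambda>a. exp (- (\<i> * of_real (l \<bullet> a))) * f (a - b))"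
proof -
  have [measurable]: "f \<in> borel_measurable borel" using assms by (simp add: square_integrable_def)
  have "integrable lborel (\<lambda>a. complex_of_real ((cmod (f a))\<^sup>2))"
    using assms unfolding complex_of_real_integrable_eq by (simp add: square_integrable_def)
  then have "integrable lborel (\<lambda>a. complex_of_real ((cmod (f (- b + a)))\<^sup>2))"
    by (subst integrable_lborel_shift[where f = "\<lambda>a. complex_of_real ((cmod (f a))\<^sup>2)"]) auto
  then have "integrable lborel (\<lambda>a. (cmod (f (- b + a)))\<^sup>2)"
    unfolding complex_of_real_integrable_eq .
  then show ?thesis by (simp add: square_integrable_def norm_mult)
qed

text \<open>Multiplication by a character after a translation. The two Weyl systems of a seed, its
  linear coordinate changes and their spectral transforms are all of this form.\<close>

definition weyl :: "'a::euclidean_space \<Rightarrow> 'a \<Rightarrow> 'a L2 \<Rightarrow> 'a L2" where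
  "weyl b l u = abs_L2 (\<lambda>a. exp (- (\<i> * of_real (l \<bullet> a))) * rep_L2 u (a - b))"

lemma rep_weyl: "AE a in lborel. rep_L2 (weyl b l u) a = exp (- (\<i> * of_real (l \<bullet> a))) * rep_L2 u (a - b)"
  unfolding weyl_def by (rule rep_abs_L2[OF square_integrable_shift]) simp

lemma weylI:
  assumes "AE a in lborel. rep_L2 u a = f a" "AE a in lborel. rep_L2 v a = exp (- (\<i> * of_real (l \<bullet> a))) * f (a - b)"
  shows "weyl b l u = v"
  by (rule L2_eqI) (use rep_weyl[of b l u] AE_lborel_shift[OF assms(1), of b] assms(2) in \<open>eventually_elim; simp\<close>)

lemma weyl_scaleC: "weyl b l (c *\<^sub>C u) = c *\<^sub>C weyl b l u"
  by (rule weylI[OF rep_scaleC])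
     (use rep_scaleC[of c "weyl b l u"] rep_weyl[of b l u] in \<open>eventually_elim; simp\<close>)

lemma weyl_weyl: "weyl b l (weyl b' l' u) = exp (\<i> * of_real (l' \<bullet> b)) *\<^sub>C weyl (b + b') (l + l') u"
proof (rule weylI[OF rep_weyl])
  show "AE a in lborel. rep_L2 (exp (\<i> * of_real (l' \<bullet> b)) *\<^sub>C weyl (b + b') (l + l') u) a
      = exp (- (\<i> * of_real (l \<bullet> a))) * (exp (- (\<i> * of_real (l' \<bullet> (a - b)))) * rep_L2 u (a - b - b'))"
    using rep_scaleC[of "exp (\<i> * of_real (l' \<bullet> b))" "weyl (b + b') (l + l') u"] rep_weyl[of "b + b'" "l + l'" u]
  proof eventually_elim
    case (elim a)
    have "exp (\<i> * of_real (l' \<bullet> b)) * exp (- (\<i> * of_real ((l + l') \<bullet> a)))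
        = exp (- (\<i> * of_real (l \<bullet> a))) * exp (- (\<i> * of_real (l' \<bullet> (a - b))))"
      unfolding exp_add[symmetric]
      by (rule arg_cong[where f = exp]) (simp add: inner_add_left inner_diff_right algebra_simps)
    then show ?case using elim by (simp add: mult.assoc[symmetric] diff_diff_eq)
  qed
qed

lemma weyl_0 [simp]: "weyl 0 0 u = u"
  by (simp add: weyl_def)

lemma unitary_weyl: "unitary (weyl b l)"
  unfolding unitary_def
proof (intro conjI allI)
  show "surj (weyl b l)"
  proof (rule surjI)
    fix u :: "'a L2"
    show "weyl b l (exp (\<i> * of_real (l \<bullet> b)) *\<^sub>C weyl (- b) (- l) u) = u"
      by (simp add: weyl_scaleC weyl_weyl exp_add[symmetric])
  qed
  fix u v :: "'a L2"
  let ?f = "\<lambda>a. rep_L2 u a * cnj (rep_L2 v a)"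
  have "cinner (weyl b l u) (weyl b l v)
    = (\<integral>a. (exp (- (\<i> * of_real (l \<bullet> a))) * rep_L2 u (a - b)) * cnj (exp (- (\<i> * of_real (l \<bullet> a))) * rep_L2 v (a - b)) \<partial>lborel)"
    by (rule cinner_eq_integral_AE[OF _ _ rep_weyl rep_weyl]) measurable
  also have "\<dots> = (\<integral>a. ?f (- b + a) \<partial>lborel)"
  proof (rule Bochner_Integration.integral_cong[OF refl])
    fix a
    have "exp (- (\<i> * of_real (l \<bullet> a))) * cnj (exp (- (\<i> * of_real (l \<bullet> a)))) = 1"
      by (simp add: exp_cnj exp_add[symmetric])
    then show "(exp (- (\<i> * of_real (l \<bullet> a))) * rep_L2 u (a - b)) * cnj (exp (- (\<i> * of_real (l \<bullet> a))) * rep_L2 v (a - b)) = ?f (- b + a)"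
      by (simp add: algebra_simps)
  qed
  also have "\<dots> = (\<integral>a. ?f a \<partial>lborel)" by (rule integral_lborel_shift) measurable
  finally show "cinner (weyl b l u) (weyl b l v) = cinner u v" by (simp add: cinner_eq_integral)
qed

lemma weyl_coh:
  "weyl b l (coh x y) = exp (of_real (- (b \<bullet> b) / 2 - x \<bullet> b) - \<i> * of_real (y \<bullet> b)) *\<^sub>C coh (x + b) (y - l)"
proof (rule weylI[OF rep_coh])
  let ?c = "exp (of_real (- (b \<bullet> b) / 2 - x \<bullet> b) - \<i> * of_real (y \<bullet> b))"
  show "AE a in lborel. rep_L2 (?c *\<^sub>C coh (x + b) (y - l)) a = exp (- (\<i> * of_real (l \<bullet> a))) * cohf x y (a - b)"
    using rep_scaleC[of ?c "coh (x + b) (y - l)"] rep_coh[of "x + b" "y - l"]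
  proof eventually_elim
    case (elim a)
    have "?c * cohf (x + b) (y - l) a = exp (- (\<i> * of_real (l \<bullet> a))) * cohf x y (a - b)"
      unfolding cohf_def exp_add[symmetric]
      by (rule arg_cong[where f = exp])
         (simp add: inner_add_left inner_add_right inner_diff_left inner_diff_right inner_commute algebra_simps add_divide_distrib diff_divide_distrib)
    then show ?case using elim by simp
  qed
qed

lemma mult_L2_character: "mult_L2 (\<lambda>a. exp (- (\<i> * of_real (l \<bullet> a)))) u = weyl 0 l u"
  by (simp add: mult_L2_def weyl_def)

section \<open>The partial Fourier transform\<close>

text \<open>The Fourier transform in the direction of a unit vector \<open>k\<close> acts on the parameter
  \<open>z = x + \<i> y\<close> of a coherent state by \<open>z\<^sub>k \<mapsto> - \<i> z\<^sub>k\<close>, with the scalar factor \<open>exp (z\<^sub>k\<^sup>2 / 2)\<close>. Since this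
  preserves all inner products it defines a unitary operator.\<close>

definition rotx :: "'a::euclidean_space \<Rightarrow> 'a \<Rightarrow> 'a \<Rightarrow> 'a" where
  "rotx k x y = x + (y \<bullet> k - x \<bullet> k) *\<^sub>R k"

definition roty :: "'a::euclidean_space \<Rightarrow> 'a \<Rightarrow> 'a \<Rightarrow> 'a" where
  "roty k x y = y - (y \<bullet> k + x \<bullet> k) *\<^sub>R k"

definition rotc :: "'a::euclidean_space \<Rightarrow> 'a \<Rightarrow> 'a \<Rightarrow> complex" where
  "rotc k x y = exp (of_real (((x \<bullet> k)\<^sup>2 - (y \<bullet> k)\<^sup>2) / 2) + \<i> * of_real ((x \<bullet> k) * (y \<bullet> k)))"

lemma rot_surj:
  assumes "k \<bullet> k = 1"
  obtains x y where "rotx k x y = x'" "roty k x y = y'"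
proof
  show "rotx k (x' - (y' \<bullet> k + x' \<bullet> k) *\<^sub>R k) (y' + (x' \<bullet> k - y' \<bullet> k) *\<^sub>R k) = x'"
    "roty k (x' - (y' \<bullet> k + x' \<bullet> k) *\<^sub>R k) (y' + (x' \<bullet> k - y' \<bullet> k) *\<^sub>R k) = y'"
    using assms by (simp_all add: rotx_def roty_def inner_add_left inner_diff_left algebra_simps)
qed

lemma rot_gram:
  assumes k: "k \<bullet> k = 1"
  shows "cinner (rotc k x y *\<^sub>C coh (rotx k x y) (roty k x y)) (rotc k x' y' *\<^sub>C coh (rotx k x' y') (roty k x' y'))
    = cinner (coh x y) (coh x' y')"
proof -
  define X Y where "X = x + x'" and "Y = y - y'"
  define p q where "p = y \<bullet> k + y' \<bullet> k" and "q = x \<bullet> k - x' \<bullet> k"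
  have X': "rotx k x y + rotx k x' y' = X + (p - X \<bullet> k) *\<^sub>R k"
    by (simp add: rotx_def X_def p_def inner_add_left algebra_simps)
  have Y': "roty k x y - roty k x' y' = Y - (Y \<bullet> k + q) *\<^sub>R k"
    by (simp add: roty_def Y_def q_def inner_diff_left algebra_simps)
  have XX: "(X + (p - X \<bullet> k) *\<^sub>R k) \<bullet> (X + (p - X \<bullet> k) *\<^sub>R k) = X \<bullet> X - (X \<bullet> k)\<^sup>2 + p\<^sup>2"
    using k by (simp add: inner_add_left inner_add_right inner_commute power2_eq_square algebra_simps)
  have YY: "(Y - (Y \<bullet> k + q) *\<^sub>R k) \<bullet> (Y - (Y \<bullet> k + q) *\<^sub>R k) = Y \<bullet> Y - (Y \<bullet> k)\<^sup>2 + q\<^sup>2"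
    using k by (simp add: inner_diff_left inner_diff_right inner_commute power2_eq_square algebra_simps)
  have XY: "(X + (p - X \<bullet> k) *\<^sub>R k) \<bullet> (Y - (Y \<bullet> k + q) *\<^sub>R k) = X \<bullet> Y - (X \<bullet> k) * (Y \<bullet> k) - p * q"
    using k by (simp add: inner_add_left inner_diff_right inner_commute algebra_simps)
  have Xk: "X \<bullet> k = x \<bullet> k + x' \<bullet> k" "Y \<bullet> k = y \<bullet> k - y' \<bullet> k"
    by (simp_all add: X_def Y_def inner_add_left inner_diff_left)
  have *: "rotc k x y * cnj (rotc k x' y') * exp (of_real ((X \<bullet> X - (X \<bullet> k)\<^sup>2 + p\<^sup>2 - (Y \<bullet> Y - (Y \<bullet> k)\<^sup>2 + q\<^sup>2)) / 4)
      + \<i> * of_real ((X \<bullet> Y - (X \<bullet> k) * (Y \<bullet> k) - p * q) / 2))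
    = exp (of_real ((X \<bullet> X - Y \<bullet> Y) / 4) + \<i> * of_real (X \<bullet> Y / 2))"
    unfolding rotc_def exp_cnj exp_add[symmetric]
  proof (rule arg_cong[where f = exp], rule complex_eqI)
    have "((x \<bullet> k)\<^sup>2 - (y \<bullet> k)\<^sup>2) / 2 + ((x' \<bullet> k)\<^sup>2 - (y' \<bullet> k)\<^sup>2) / 2
      + (X \<bullet> X - (X \<bullet> k)\<^sup>2 + p\<^sup>2 - (Y \<bullet> Y - (Y \<bullet> k)\<^sup>2 + q\<^sup>2)) / 4 = (X \<bullet> X - Y \<bullet> Y) / 4"
      unfolding Xk p_def q_def by (simp add: power2_eq_square field_simps)
    then show "Re (of_real (((x \<bullet> k)\<^sup>2 - (y \<bullet> k)\<^sup>2) / 2) + \<i> * of_real ((x \<bullet> k) * (y \<bullet> k))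
        + cnj (of_real (((x' \<bullet> k)\<^sup>2 - (y' \<bullet> k)\<^sup>2) / 2) + \<i> * of_real ((x' \<bullet> k) * (y' \<bullet> k)))
        + (of_real ((X \<bullet> X - (X \<bullet> k)\<^sup>2 + p\<^sup>2 - (Y \<bullet> Y - (Y \<bullet> k)\<^sup>2 + q\<^sup>2)) / 4)
        + \<i> * of_real ((X \<bullet> Y - (X \<bullet> k) * (Y \<bullet> k) - p * q) / 2)))
      = Re (of_real ((X \<bullet> X - Y \<bullet> Y) / 4) + \<i> * of_real (X \<bullet> Y / 2))" by simp
    have "(x \<bullet> k) * (y \<bullet> k) - (x' \<bullet> k) * (y' \<bullet> k) + (X \<bullet> Y - (X \<bullet> k) * (Y \<bullet> k) - p * q) / 2 = X \<bullet> Y / 2"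
      unfolding Xk p_def q_def by (simp add: field_simps)
    then show "Im (of_real (((x \<bullet> k)\<^sup>2 - (y \<bullet> k)\<^sup>2) / 2) + \<i> * of_real ((x \<bullet> k) * (y \<bullet> k))
        + cnj (of_real (((x' \<bullet> k)\<^sup>2 - (y' \<bullet> k)\<^sup>2) / 2) + \<i> * of_real ((x' \<bullet> k) * (y' \<bullet> k)))
        + (of_real ((X \<bullet> X - (X \<bullet> k)\<^sup>2 + p\<^sup>2 - (Y \<bullet> Y - (Y \<bullet> k)\<^sup>2 + q\<^sup>2)) / 4)
        + \<i> * of_real ((X \<bullet> Y - (X \<bullet> k) * (Y \<bullet> k) - p * q) / 2)))
      = Im (of_real ((X \<bullet> X - Y \<bullet> Y) / 4) + \<i> * of_real (X \<bullet> Y / 2))" by simp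
  qed
  show ?thesis
    unfolding cinner_scaleC_left cinner_scaleC_right coh_gram X' Y' XX YY XY X_def[symmetric] Y_def[symmetric] *[symmetric]
    by (simp only: mult_ac)
qed

lemma partial_fourier_exists:
  fixes k :: "'a::euclidean_space"
  assumes k: "k \<bullet> k = 1"
  shows "\<exists>V :: 'a L2 \<Rightarrow> 'a L2. unitary V \<and> (\<forall>x y. V (coh x y) = rotc k x y *\<^sub>C coh (rotx k x y) (roty k x y))"
proof -
  define g where "g i = coh (fst i) (snd i :: 'a)" for i
  define h where "h i = rotc k (fst i) (snd i) *\<^sub>C coh (rotx k (fst i) (snd i)) (roty k (fst i) (snd i))" for i
  have 1: "cinner (g i) (g j) = cinner (h i) (h j)" for i j
    unfolding g_def h_def by (rule rot_gram[OF k, symmetric])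
  have 2: "w = 0" if *: "\<And>i. cinner (g i) w = 0" for w :: "'a L2"
  proof (rule coh_total)
    show "cinner (coh x y) w = 0" for x y using *[of "(x, y)"] by (simp add: g_def)
  qed
  have 3: "w = 0" if *: "\<And>i. cinner (h i) w = 0" for w :: "'a L2"
  proof (rule coh_total)
    fix x' y' :: 'a
    obtain x y where "rotx k x y = x'" "roty k x y = y'" using rot_surj[OF k] .
    then show "cinner (coh x' y') w = 0" using *[of "(x, y)"] by (simp add: h_def rotc_def)
  qed
  obtain V where V: "unitary V" "\<And>i. V (g i) = h i"
    using unitary_extension[of g h, OF 1 2 3] by blast
  have "V (coh x y) = rotc k x y *\<^sub>C coh (rotx k x y) (roty k x y)" for x y
    using V(2)[of "(x, y)"] by (simp add: g_def h_def)
  with V(1) show ?thesis by blast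
qed

definition pft :: "'a::euclidean_space \<Rightarrow> 'a L2 \<Rightarrow> 'a L2" where
  "pft k = (SOME V. unitary V \<and> (\<forall>x y. V (coh x y) = rotc k x y *\<^sub>C coh (rotx k x y) (roty k x y)))"

lemma pft:
  assumes "k \<bullet> k = 1"
  shows unitary_pft: "unitary (pft k)"
    and pft_coh: "pft k (coh x y) = rotc k x y *\<^sub>C coh (rotx k x y) (roty k x y)"
  using someI_ex[OF partial_fourier_exists[OF assms]] unfolding pft_def by auto

lemma pft_weyl:
  assumes k: "k \<bullet> k = 1" and l: "l \<bullet> k = 0"
  shows "pft k (weyl (s *\<^sub>R k) l u) = weyl 0 (s *\<^sub>R k + l) (pft k u)"
proof (induction u rule: coh_induct)
  case (coh x y)
  have r: "rotx k (x + s *\<^sub>R k) (y - l) = rotx k x y" "roty k (x + s *\<^sub>R k) (y - l) = roty k x y - (s *\<^sub>R k + l)"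
    using k l by (simp_all add: rotx_def roty_def inner_add_left inner_diff_left algebra_simps)
  have "exp (of_real (- ((s *\<^sub>R k) \<bullet> (s *\<^sub>R k)) / 2 - x \<bullet> (s *\<^sub>R k)) - \<i> * of_real (y \<bullet> (s *\<^sub>R k))) * rotc k (x + s *\<^sub>R k) (y - l) = rotc k x y"
    unfolding rotc_def exp_add[symmetric]
    by (rule arg_cong[where f = exp], rule complex_eqI)
       (use k l in \<open>simp_all add: inner_add_left inner_diff_left power2_eq_square field_simps\<close>)
  then show ?case
    by (simp add: weyl_coh unitary_scaleC[OF unitary_pft[OF k]] pft_coh[OF k] weyl_scaleC r)
next
  case zero
  have z: "weyl b l (0 :: 'a L2) = 0" for b l :: 'a using weyl_scaleC[of b l 0 0] by simp
  have "pft k 0 = 0" using unitary_scaleC[OF unitary_pft[OF k], of 0 0] by simp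
  then show ?case by (simp add: z)
next
  case (add u v)
  then show ?case by (simp add: unitary_add[OF unitary_weyl] unitary_add[OF unitary_pft[OF k]])
next
  case (scale c u)
  then show ?case by (simp add: weyl_scaleC unitary_scaleC[OF unitary_pft[OF k]])
next
  case (closed X u)
  have 1: "(\<lambda>n. pft k (weyl (s *\<^sub>R k) l (X n))) \<longlonglongrightarrow> pft k (weyl (s *\<^sub>R k) l u)"
    by (rule unitary_tendsto[OF unitary_pft[OF k] unitary_tendsto[OF unitary_weyl closed(2)]])
  have 2: "(\<lambda>n. weyl 0 (s *\<^sub>R k + l) (pft k (X n))) \<longlonglongrightarrow> weyl 0 (s *\<^sub>R k + l) (pft k u)"
    by (rule unitary_tendsto[OF unitary_weyl unitary_tendsto[OF unitary_pft[OF k] closed(2)]])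
  show ?case by (rule LIMSEQ_unique[OF 1]) (use 2 closed(1) in simp)
qed

section \<open>Diagonalising i s d/dk - l\<close>

lemma has_vector_derivative_sequentially:
  fixes f :: "real \<Rightarrow> complex"
  assumes f: "(f has_vector_derivative D) (at 0)" and \<tau>: "\<tau> \<longlonglongrightarrow> 0" "\<And>n. \<tau> n \<noteq> 0"
  shows "(\<lambda>n. (f (\<tau> n) - f 0) / of_real (\<tau> n)) \<longlonglongrightarrow> D"
proof -
  have "((\<lambda>h. norm (f (0 + h) - f 0 - h *\<^sub>R D) / norm h) \<longlongrightarrow> 0) (at 0)"
    using f unfolding has_vector_derivative_def has_derivative_at by blast
  moreover have "filterlim \<tau> (at 0) sequentially"
    using \<tau> by (simp add: filterlim_at)
  ultimately have "(\<lambda>n. norm (f (0 + \<tau> n) - f 0 - \<tau> n *\<^sub>R D) / norm (\<tau> n)) \<longlonglongrightarrow> 0"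
    by (rule filterlim_compose)
  moreover have "norm (f (0 + \<tau> n) - f 0 - \<tau> n *\<^sub>R D) / norm (\<tau> n) = norm ((f (\<tau> n) - f 0) / of_real (\<tau> n) - D)" for n
  proof -
    have "(f (\<tau> n) - f 0) / of_real (\<tau> n) - D = (f (0 + \<tau> n) - f 0 - \<tau> n *\<^sub>R D) / of_real (\<tau> n)"
      using \<tau>(2)[of n] by (simp add: field_simps scaleR_conv_of_real)
    then show ?thesis by (simp only: norm_divide norm_of_real real_norm_def)
  qed
  ultimately have "(\<lambda>n. norm ((f (\<tau> n) - f 0) / of_real (\<tau> n) - D)) \<longlonglongrightarrow> 0" by (simp only:)
  then show ?thesis by (simp only: tendsto_norm_zero_iff LIM_zero_iff)
qed

lemma linear_cohf_bound:
  "cmod (of_real (m \<bullet> a) * cohf x y a) \<le> cmod (cohf (x + m) 0 a + cohf (x - m) 0 a)"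
proof -
  let ?e = "exp (x \<bullet> a - (a \<bullet> a) / 2)"
  have "?e * (exp (m \<bullet> a) + exp (- (m \<bullet> a))) = exp ((x + m) \<bullet> a - (a \<bullet> a) / 2) + exp ((x - m) \<bullet> a - (a \<bullet> a) / 2)"
    unfolding distrib_left exp_add[symmetric] by (simp add: inner_add_left inner_diff_left algebra_simps)
  then have pos: "cohf (x + m) 0 a + cohf (x - m) 0 a = of_real (?e * (exp (m \<bullet> a) + exp (- (m \<bullet> a))))"
    unfolding cohf_def inner_zero_left of_real_0 mult_zero_right add_0_right exp_of_real by (simp only: of_real_add)
  have "\<bar>m \<bullet> a\<bar> \<le> exp (m \<bullet> a) + exp (- (m \<bullet> a))"
    using exp_ge_add_one_self[of "m \<bullet> a"] exp_ge_add_one_self[of "- (m \<bullet> a)"] exp_gt_zero[of "m \<bullet> a"] exp_gt_zero[of "- (m \<bullet> a)"] by linarith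
  then have "\<bar>m \<bullet> a\<bar> * ?e \<le> ?e * (exp (m \<bullet> a) + exp (- (m \<bullet> a)))" by (simp add: mult.commute)
  moreover have "cmod (cohf x y a) = ?e" by (simp add: cohf_def)
  moreover have "cmod (cohf (x + m) 0 a + cohf (x - m) 0 a) = ?e * (exp (m \<bullet> a) + exp (- (m \<bullet> a)))"
    unfolding pos norm_of_real by (simp add: add_pos_pos)
  ultimately show ?thesis by (simp add: norm_mult)
qed

lemma square_integrable_linear_cohf:
  "square_integrable (\<lambda>a. of_real (m \<bullet> a) * cohf x y a)"
proof (rule square_integrable_bounded[where C = 1 and g = "\<lambda>a. cohf (x + m) 0 a + cohf (x - m) 0 a"])
  show "square_integrable (\<lambda>a. cohf (x + m) 0 a + cohf (x - m) 0 a)"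
    by (intro square_integrable_add square_integrable_cohf)
qed (measurable, use linear_cohf_bound in simp)

lemma integrable_cohf: "integrable lborel (cohf x y)"
proof -
  have "integrable lborel (\<lambda>a. cohf x y a)"
  proof (subst integrable_lborel_shift[where c = x, symmetric])
    have "integrable lborel (\<lambda>a::'a. exp (x \<bullet> x / 2) * exp (- ((1::real)\<^sup>2 * (a \<bullet> a)) / 2))"
      by (intro integrable_mult_right gauss_integrable) simp
    then show "integrable lborel (\<lambda>a. cohf x y (x + a))"
    proof (rule Bochner_Integration.integrable_bound)
      have "cmod (cohf x y (x + a)) = exp (x \<bullet> x / 2) * exp (- ((1::real)\<^sup>2 * (a \<bullet> a)) / 2)" for a
        unfolding exp_add[symmetric] cohf_def
        by (simp add: inner_add_left inner_add_right inner_commute field_simps)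
      then show "AE a in lborel. norm (cohf x y (x + a)) \<le> norm (exp (x \<bullet> x / 2) * exp (- ((1::real)\<^sup>2 * (a \<bullet> a)) / 2))"
        by simp
    qed measurable
  qed measurable
  then show ?thesis by simp
qed

locale mixed_momentum =
  fixes k l :: "'a::euclidean_space" and s :: real
  assumes k: "k \<bullet> k = 1" and l: "l \<bullet> k = 0"
begin

definition \<mu> :: "'a \<Rightarrow> real" where "\<mu> a = - ((s *\<^sub>R k + l) \<bullet> a)"

abbreviation "V \<equiv> pft k"

sublocale diagonalization V \<mu>
  by standard (use unitary_pft[OF k] in \<open>auto simp: \<mu>_def[abs_def]\<close>)

lemma V_weyl: "V (weyl ((t * s) *\<^sub>R k) (t *\<^sub>R l) u) = mult_L2 (\<lambda>a. exp (\<i> * of_real (t * \<mu> a))) (V u)"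
proof -
  have "V (weyl ((t * s) *\<^sub>R k) (t *\<^sub>R l) u) = weyl 0 ((t * s) *\<^sub>R k + t *\<^sub>R l) (V u)"
    by (rule pft_weyl[OF k]) (simp add: l)
  also have "\<dots> = mult_L2 (\<lambda>a. exp (- (\<i> * of_real (((t * s) *\<^sub>R k + t *\<^sub>R l) \<bullet> a)))) (V u)"
    by (rule mult_L2_character[symmetric])
  also have "(\<lambda>a. exp (- (\<i> * of_real (((t * s) *\<^sub>R k + t *\<^sub>R l) \<bullet> a)))) = (\<lambda>a. exp (\<i> * of_real (t * \<mu> a)))"
    by (rule ext, rule arg_cong[where f = exp]) (simp add: \<mu>_def inner_add_left algebra_simps)
  finally show ?thesis .
qed

lemma fop_character: "fop (\<lambda>r. exp (\<i> * of_real (t * r))) u = weyl ((t * s) *\<^sub>R k) (t *\<^sub>R l) u"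
  unfolding fop_def V_weyl[symmetric] by (simp add: V)

lemma rep_V_coh:
  "AE a in lborel. rep_L2 (V (coh x y)) a = rotc k x y * cohf (rotx k x y) (roty k x y) a"
  unfolding pft_coh[OF k]
  using rep_scaleC[of "rotc k x y" "coh (rotx k x y) (roty k x y)"] rep_coh[of "rotx k x y" "roty k x y"]
  by eventually_elim simp

lemma square_integrable_\<mu>_coh:
  "square_integrable (\<lambda>a. of_real (\<mu> a) * (rotc k x y * cohf (rotx k x y) (roty k x y) a))"
  using square_integrable_scale[OF square_integrable_linear_cohf[of "- (s *\<^sub>R k + l)" "rotx k x y" "roty k x y"], of "rotc k x y"]
  by (simp add: \<mu>_def inner_diff_left inner_add_left algebra_simps)

text \<open>Coherent states determine the generator: pairing with them detects \<open>\<psi> = \<mu> \<phi>\<close>.\<close>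

lemma coherent_test:
  assumes "\<And>x y. (\<integral>a. of_real (\<mu> a) * rep_L2 (V (coh x y)) a * cnj (rep_L2 \<phi> a) \<partial>lborel) = cinner (V (coh x y)) \<psi>"
  shows "AE a in lborel. rep_L2 \<psi> a = of_real (\<mu> a) * rep_L2 \<phi> a"
proof -
  let ?h = "\<lambda>a. cnj (of_real (\<mu> a) * rep_L2 \<phi> a - rep_L2 \<psi> a)"
  have ex: "integrable lborel (\<lambda>a. cohf x' y' a * ?h a) \<and> (\<integral>a. cohf x' y' a * ?h a \<partial>lborel) = 0" for x' y'
  proof -
    obtain x y where xy: "rotx k x y = x'" "roty k x y = y'" using rot_surj[OF k] .
    let ?c = "rotc k x y"
    have c: "?c \<noteq> 0" by (simp add: rotc_def)
    have 1: "integrable lborel (\<lambda>a. (of_real (\<mu> a) * (?c * cohf x' y' a)) * cnj (rep_L2 \<phi> a))"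
      by (rule integrable_mult_cnj[OF _ square_integrable_rep]) (use square_integrable_\<mu>_coh[of x y] xy in simp)
    have 2: "integrable lborel (\<lambda>a. (?c * cohf x' y' a) * cnj (rep_L2 \<psi> a))"
      by (intro integrable_mult_cnj[OF _ square_integrable_rep] square_integrable_scale square_integrable_cohf)
    have i: "integrable lborel (\<lambda>a. ?c * (cohf x' y' a * ?h a))"
      using Bochner_Integration.integrable_diff[OF 1 2] by (simp add: algebra_simps)
    have ae: "AE a in lborel. rep_L2 (V (coh x y)) a = ?c * cohf x' y' a"
      using rep_V_coh[of x y] by (simp add: xy)
    have "(\<integral>a. (of_real (\<mu> a) * (?c * cohf x' y' a)) * cnj (rep_L2 \<phi> a) \<partial>lborel)
        = (\<integral>a. of_real (\<mu> a) * rep_L2 (V (coh x y)) a * cnj (rep_L2 \<phi> a) \<partial>lborel)"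
      by (rule integral_cong_AE) (measurable, use ae in eventually_elim, simp)
    moreover have "cinner (V (coh x y)) \<psi> = (\<integral>a. (?c * cohf x' y' a) * cnj (rep_L2 \<psi> a) \<partial>lborel)"
      by (rule cinner_eq_integral_AE) (use ae in auto)
    ultimately have "(\<integral>a. (of_real (\<mu> a) * (?c * cohf x' y' a)) * cnj (rep_L2 \<phi> a) \<partial>lborel)
        - (\<integral>a. (?c * cohf x' y' a) * cnj (rep_L2 \<psi> a) \<partial>lborel) = 0"
      using assms[of x y] by simp
    then have "(\<integral>a. ?c * (cohf x' y' a * ?h a) \<partial>lborel) = 0"
      unfolding Bochner_Integration.integral_diff[OF 1 2, symmetric] by (simp add: algebra_simps)
    then have "(\<integral>a. cohf x' y' a * ?h a \<partial>lborel) = 0" using c by simp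
    moreover have "integrable lborel (\<lambda>a. (1 / ?c) * (?c * (cohf x' y' a * ?h a)))"
      using i by (rule integrable_mult_right)
    moreover have "(\<lambda>a. (1 / ?c) * (?c * (cohf x' y' a * ?h a))) = (\<lambda>a. cohf x' y' a * ?h a)"
      using c by simp
    ultimately show ?thesis by (simp only:)
  qed
  have "AE a in lborel. ?h a = 0"
    by (rule coherent_unique) (use ex in auto)
  then show ?thesis
  proof eventually_elim
    case (elim a)
    then have "of_real (\<mu> a) * rep_L2 \<phi> a - rep_L2 \<psi> a = 0" by (simp only: complex_cnj_zero_iff)
    then show ?case by simp
  qed
qed

text \<open>The derivative of the one-parameter group at \<open>0\<close>, tested weakly against coherent states, lies
  in the graph of the generator.\<close>

lemma weak_generator:
  assumes lim: "\<And>x y. (\<lambda>n. cinner (weyl ((1 / real (Suc n) * s) *\<^sub>R k) ((1 / real (Suc n)) *\<^sub>R l) u - u) (coh x y)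
      / of_real (1 / real (Suc n))) \<longlonglongrightarrow> \<i> * cinner v (coh x y)"
  shows "(u, v) \<in> A"
proof -
  have "AE a in lborel. rep_L2 (V v) a = of_real (\<mu> a) * rep_L2 (V u) a"
  proof (rule coherent_test)
    fix x y
    let ?t = "\<lambda>n. 1 / real (Suc n)"
    let ?c = "\<lambda>a. rotc k x y * cohf (rotx k x y) (roty k x y) a"
    let ?U = "rep_L2 (V u)"
    note cohm = measurable_cohf[of "rotx k x y" "roty k x y"]
    have sq: "square_integrable ?c" by (intro square_integrable_scale square_integrable_cohf)
    have bb: "bounded_borel (\<lambda>a. exp (\<i> * of_real (t * \<mu> a)))" for t
      by (rule bounded_borelI[where C = 1]) auto
    have pair: "cinner (weyl ((t * s) *\<^sub>R k) (t *\<^sub>R l) u - u) (coh x y)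
        = (\<integral>a. (exp (\<i> * of_real (t * \<mu> a)) - 1) * ?U a * cnj (?c a) \<partial>lborel)" for t
    proof -
      have "cinner (weyl ((t * s) *\<^sub>R k) (t *\<^sub>R l) u - u) (coh x y)
        = cinner (V (weyl ((t * s) *\<^sub>R k) (t *\<^sub>R l) u) - V u) (V (coh x y))"
        by (simp add: unitary_diff[OF V, symmetric] unitary_cinner[OF V])
      also have "\<dots> = (\<integral>a. ((exp (\<i> * of_real (t * \<mu> a)) - 1) * ?U a) * cnj (?c a) \<partial>lborel)"
      proof (rule cinner_eq_integral_AE[OF _ _ _ rep_V_coh])
        show "AE a in lborel. rep_L2 (V (weyl ((t * s) *\<^sub>R k) (t *\<^sub>R l) u) - V u) a = (exp (\<i> * of_real (t * \<mu> a)) - 1) * ?U a"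
          unfolding V_weyl
          using rep_minus[of "mult_L2 (\<lambda>a. exp (\<i> * of_real (t * \<mu> a))) (V u)" "V u"] rep_mult_L2[OF bb, of t "V u"]
          by eventually_elim (simp add: algebra_simps)
      qed measurable
      finally show ?thesis .
    qed
    have e1: "cmod (exp (\<i> * of_real r) - 1) \<le> \<bar>r\<bar>" for r
      using iexp_approx1[of r 0] by simp
    have e2: "cmod (exp (\<i> * of_real r) - 1 - \<i> * of_real r) \<le> r\<^sup>2 / 2" for r
      using iexp_approx1[of r 1] by (simp add: numeral_2_eq_2 diff_diff_eq)
    have wi: "integrable lborel (\<lambda>a. cmod (?U a * cnj (of_real (\<mu> a) * ?c a)))"
      by (intro integrable_norm integrable_mult_cnj square_integrable_rep square_integrable_\<mu>_coh)
    have "(\<lambda>n. \<integral>a. (exp (\<i> * of_real (?t n * \<mu> a)) - 1) / of_real (?t n) * ?U a * cnj (?c a) \<partial>lborel)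
        \<longlonglongrightarrow> (\<integral>a. \<i> * of_real (\<mu> a) * ?U a * cnj (?c a) \<partial>lborel)"
    proof (rule integral_dominated_convergence[OF _ _ wi])
      show "AE a in lborel. (\<lambda>n. (exp (\<i> * of_real (?t n * \<mu> a)) - 1) / of_real (?t n) * ?U a * cnj (?c a))
          \<longlonglongrightarrow> \<i> * of_real (\<mu> a) * ?U a * cnj (?c a)"
      proof (intro AE_I2 tendsto_mult tendsto_const)
        fix a
        have "((\<lambda>t. exp (t *\<^sub>R (\<i> * of_real (\<mu> a)))) has_vector_derivative (\<i> * of_real (\<mu> a)) * exp (0 *\<^sub>R (\<i> * of_real (\<mu> a)))) (at 0)"
          by (rule exp_scaleR_has_vector_derivative_left)
        from has_vector_derivative_sequentially[OF this, of ?t]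
        show "(\<lambda>n. (exp (\<i> * of_real (?t n * \<mu> a)) - 1) / of_real (?t n)) \<longlonglongrightarrow> \<i> * of_real (\<mu> a)"
          using LIMSEQ_Suc[OF lim_1_over_n[where 'a = real]] by (simp add: scaleR_conv_of_real mult_ac)
      qed
      show "AE a in lborel. norm ((exp (\<i> * of_real (?t n * \<mu> a)) - 1) / of_real (?t n) * ?U a * cnj (?c a))
          \<le> cmod (?U a * cnj (of_real (\<mu> a) * ?c a))" for n
      proof (rule AE_I2)
        fix a
        have "cmod ((exp (\<i> * of_real (?t n * \<mu> a)) - 1) / of_real (?t n)) \<le> \<bar>\<mu> a\<bar>"
          using e1[of "?t n * \<mu> a"] unfolding norm_divide norm_of_real abs_mult by (simp add: field_simps)
        from mult_right_mono[OF this norm_ge_zero[of "?U a * cnj (?c a)"]]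
        show "norm ((exp (\<i> * of_real (?t n * \<mu> a)) - 1) / of_real (?t n) * ?U a * cnj (?c a))
          \<le> cmod (?U a * cnj (of_real (\<mu> a) * ?c a))"
          unfolding norm_mult complex_mod_cnj norm_of_real by (simp only: mult_ac)
      qed
    qed (use cohm in measurable)
    moreover have "(\<integral>a. (exp (\<i> * of_real (?t n * \<mu> a)) - 1) / of_real (?t n) * ?U a * cnj (?c a) \<partial>lborel)
        = cinner (weyl ((?t n * s) *\<^sub>R k) (?t n *\<^sub>R l) u - u) (coh x y) / of_real (?t n)" for n
      unfolding pair by (simp only: integral_divide_zero[symmetric] times_divide_eq_left)
    ultimately have "(\<lambda>n. cinner (weyl ((?t n * s) *\<^sub>R k) (?t n *\<^sub>R l) u - u) (coh x y) / of_real (?t n))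
        \<longlonglongrightarrow> (\<integral>a. \<i> * of_real (\<mu> a) * ?U a * cnj (?c a) \<partial>lborel)" by (simp only:)
    from LIMSEQ_unique[OF this lim]
    have "cinner v (coh x y) = (\<integral>a. of_real (\<mu> a) * ?U a * cnj (?c a) \<partial>lborel)"
      by (simp add: mult.assoc)
    then have "cinner (coh x y) v = (\<integral>a. cnj (of_real (\<mu> a) * ?U a * cnj (?c a)) \<partial>lborel)"
      by (metis (no_types) Bochner_Integration.integral_cnj cinner_commute)
    also have "\<dots> = (\<integral>a. of_real (\<mu> a) * rep_L2 (V (coh x y)) a * cnj (?U a) \<partial>lborel)"
      by (rule integral_cong_AE) (use cohm in measurable, use rep_V_coh[of x y] in eventually_elim, simp)
    finally show "(\<integral>a. of_real (\<mu> a) * rep_L2 (V (coh x y)) a * cnj (?U a) \<partial>lborel) = cinner (V (coh x y)) (V v)"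
      by (simp add: unitary_cinner[OF V])
  qed
  then show ?thesis by (simp add: graph_def)
qed

lemma weyl_curve_derivative:
  assumes f': "\<And>a. ((\<lambda>t. f (a + t *\<^sub>R k)) has_vector_derivative g a) (at 0)"
  shows "((\<lambda>t. exp (- (\<i> * of_real (t * (l \<bullet> a)))) * f (a - (t * s) *\<^sub>R k)) has_vector_derivative
    (- (\<i> * of_real (l \<bullet> a)) * f (a - (t * s) *\<^sub>R k) - of_real s * g (a - (t * s) *\<^sub>R k)) * exp (- (\<i> * of_real (t * (l \<bullet> a))))) (at t)"
proof -
  have 1: "((\<lambda>t. exp (t *\<^sub>R (- (\<i> * of_real (l \<bullet> a))))) has_vector_derivative - (\<i> * of_real (l \<bullet> a)) * exp (t *\<^sub>R (- (\<i> * of_real (l \<bullet> a))))) (at t)"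
    by (rule exp_scaleR_has_vector_derivative_left)
  have 2: "((\<lambda>\<tau>. - ((\<tau> - t) * s)) has_vector_derivative - s) (at t)"
    by (auto intro!: derivative_eq_intros simp: has_real_derivative_iff_has_vector_derivative[symmetric])
  have "(((\<lambda>h. f ((a - (t * s) *\<^sub>R k) + h *\<^sub>R k)) \<circ> (\<lambda>\<tau>. - ((\<tau> - t) * s))) has_vector_derivative - s *\<^sub>R g (a - (t * s) *\<^sub>R k)) (at t)"
    by (rule vector_diff_chain_at[OF 2]) (simp add: f')
  moreover have "((\<lambda>h. f ((a - (t * s) *\<^sub>R k) + h *\<^sub>R k)) \<circ> (\<lambda>\<tau>. - ((\<tau> - t) * s))) = (\<lambda>\<tau>. f (a - (\<tau> * s) *\<^sub>R k))"
    by (auto simp: algebra_simps)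
  ultimately have 3: "((\<lambda>\<tau>. f (a - (\<tau> * s) *\<^sub>R k)) has_vector_derivative - s *\<^sub>R g (a - (t * s) *\<^sub>R k)) (at t)" by simp
  have e: "exp (t *\<^sub>R (- (\<i> * of_real (l \<bullet> a)))) = exp (- (\<i> * of_real (t * (l \<bullet> a))))" for t
    by (simp add: scaleR_conv_of_real mult_ac)
  show ?thesis
    by (rule has_vector_derivative_eq_rhs[OF has_vector_derivative_mult[OF 1 3, unfolded e]])
       (simp add: scaleR_conv_of_real algebra_simps)
qed

lemma differentiable_in_graph:
  assumes f: "square_integrable f" and f': "\<And>a. ((\<lambda>t. f (a + t *\<^sub>R k)) has_vector_derivative g a) (at 0)"
    and C: "\<And>a. cmod (f a) \<le> C" "\<And>a. cmod (g a) \<le> C"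
    and X: "square_integrable (\<lambda>a. \<i> * of_real s * g a - of_real (l \<bullet> a) * f a)"
  shows "(abs_L2 f, abs_L2 (\<lambda>a. \<i> * of_real s * g a - of_real (l \<bullet> a) * f a)) \<in> A"
proof (rule weak_generator)
  fix x y
  let ?t = "\<lambda>n. 1 / real (Suc n)"
  let ?X = "\<lambda>a. \<i> * of_real s * g a - of_real (l \<bullet> a) * f a"
  have fm [measurable]: "f \<in> borel_measurable borel" using f by (simp add: square_integrable_def)
  have Xm [measurable]: "?X \<in> borel_measurable borel" using X by (simp add: square_integrable_def)
  define c where "c a t = exp (- (\<i> * of_real (t * (l \<bullet> a)))) * f (a - (t * s) *\<^sub>R k)" for a t
  have cm [measurable]: "(\<lambda>a. c a t) \<in> borel_measurable borel" for t unfolding c_def by measurable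
  have pair: "cinner (weyl ((t * s) *\<^sub>R k) (t *\<^sub>R l) (abs_L2 f) - abs_L2 f) (coh x y)
      = (\<integral>a. (c a t - c a 0) * cnj (cohf x y a) \<partial>lborel)" for t
  proof (rule cinner_eq_integral_AE[OF _ _ _ rep_coh])
    show "AE a in lborel. rep_L2 (weyl ((t * s) *\<^sub>R k) (t *\<^sub>R l) (abs_L2 f) - abs_L2 f) a = c a t - c a 0"
      using rep_minus[of "weyl ((t * s) *\<^sub>R k) (t *\<^sub>R l) (abs_L2 f)" "abs_L2 f"] rep_weyl[of "(t * s) *\<^sub>R k" "t *\<^sub>R l" "abs_L2 f"]
        rep_abs_L2[OF f] AE_lborel_shift[OF rep_abs_L2[OF f], of "(t * s) *\<^sub>R k"]
      by eventually_elim (simp add: c_def)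
  qed measurable
  have C0: "C \<ge> 0" using C(1)[of 0] norm_ge_zero order_trans by blast
  have bound: "cmod (c a t - c a 0) \<le> (\<bar>l \<bullet> a\<bar> * C + \<bar>s\<bar> * C) * \<bar>t\<bar>" for a t
  proof -
    have "norm (c a t - c a 0) \<le> (\<bar>l \<bullet> a\<bar> * C + \<bar>s\<bar> * C) * norm (t - 0)"
    proof (rule differentiable_bound[of UNIV])
      fix \<tau> :: real
      let ?D = "(- (\<i> * of_real (l \<bullet> a)) * f (a - (\<tau> * s) *\<^sub>R k) - of_real s * g (a - (\<tau> * s) *\<^sub>R k)) * exp (- (\<i> * of_real (\<tau> * (l \<bullet> a))))"
      show "(c a has_derivative (\<lambda>h. h *\<^sub>R ?D)) (at \<tau> within UNIV)"
        using weyl_curve_derivative[OF f', of a \<tau>] unfolding c_def[abs_def] has_vector_derivative_def by simp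
      have "norm ?D \<le> \<bar>l \<bullet> a\<bar> * C + \<bar>s\<bar> * C"
      proof -
        have "norm ?D = cmod (- (\<i> * of_real (l \<bullet> a)) * f (a - (\<tau> * s) *\<^sub>R k) - of_real s * g (a - (\<tau> * s) *\<^sub>R k))"
          unfolding norm_mult[of _ "exp _"] by simp
        also have "\<dots> \<le> cmod (- (\<i> * of_real (l \<bullet> a)) * f (a - (\<tau> * s) *\<^sub>R k)) + cmod (of_real s * g (a - (\<tau> * s) *\<^sub>R k))"
          by (rule norm_triangle_ineq4)
        also have "\<dots> \<le> \<bar>l \<bullet> a\<bar> * C + \<bar>s\<bar> * C"
          unfolding norm_mult norm_minus_cancel norm_of_real by (intro add_mono mult_mono C) auto
        finally show ?thesis .
      qed
      then show "onorm (\<lambda>h. h *\<^sub>R ?D) \<le> \<bar>l \<bullet> a\<bar> * C + \<bar>s\<bar> * C"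
        by (intro onorm_le) (simp add: mult.commute mult_left_mono)
    qed auto
    then show ?thesis by simp
  qed
  have wi: "integrable lborel (\<lambda>a. cmod (of_real (l \<bullet> a) * cohf x y a) * C + \<bar>s\<bar> * C * cmod (cohf x y a))"
  proof (intro Bochner_Integration.integrable_add integrable_mult_left integrable_mult_right integrable_norm integrable_cohf)
    have "integrable lborel (\<lambda>a. cohf (x + l) 0 a + cohf (x - l) 0 a)"
      by (intro Bochner_Integration.integrable_add integrable_cohf)
    then show "integrable lborel (\<lambda>a. of_real (l \<bullet> a) * cohf x y a)"
    proof (rule Bochner_Integration.integrable_bound)
      show "AE a in lborel. cmod (of_real (l \<bullet> a) * cohf x y a) \<le> cmod (cohf (x + l) 0 a + cohf (x - l) 0 a)"
        by (rule AE_I2, rule linear_cohf_bound)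
    qed measurable
  qed
  have "(\<lambda>n. \<integral>a. (c a (?t n) - c a 0) / of_real (?t n) * cnj (cohf x y a) \<partial>lborel)
      \<longlonglongrightarrow> (\<integral>a. \<i> * ?X a * cnj (cohf x y a) \<partial>lborel)"
  proof (rule integral_dominated_convergence[OF _ _ wi])
    show "AE a in lborel. (\<lambda>n. (c a (?t n) - c a 0) / of_real (?t n) * cnj (cohf x y a)) \<longlonglongrightarrow> \<i> * ?X a * cnj (cohf x y a)"
    proof (intro AE_I2 tendsto_mult tendsto_const)
      fix a
      have "(c a has_vector_derivative \<i> * ?X a) (at 0)"
        unfolding c_def
        by (rule has_vector_derivative_eq_rhs[OF weyl_curve_derivative[OF f', of a 0]]) (simp add: algebra_simps)
      from has_vector_derivative_sequentially[OF this, of ?t]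
      show "(\<lambda>n. (c a (?t n) - c a 0) / of_real (?t n)) \<longlonglongrightarrow> \<i> * ?X a"
        using LIMSEQ_Suc[OF lim_1_over_n[where 'a = real]] by simp
    qed
    show "AE a in lborel. norm ((c a (?t n) - c a 0) / of_real (?t n) * cnj (cohf x y a))
        \<le> cmod (of_real (l \<bullet> a) * cohf x y a) * C + \<bar>s\<bar> * C * cmod (cohf x y a)" for n
    proof (rule AE_I2)
      fix a
      have "cmod ((c a (?t n) - c a 0) / of_real (?t n)) \<le> \<bar>l \<bullet> a\<bar> * C + \<bar>s\<bar> * C"
        using bound[of a "?t n"] unfolding norm_divide norm_of_real by (simp add: field_simps)
      from mult_right_mono[OF this norm_ge_zero[of "cohf x y a"]]
      show "norm ((c a (?t n) - c a 0) / of_real (?t n) * cnj (cohf x y a))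
        \<le> cmod (of_real (l \<bullet> a) * cohf x y a) * C + \<bar>s\<bar> * C * cmod (cohf x y a)"
        unfolding norm_mult complex_mod_cnj norm_of_real by (simp add: algebra_simps)
    qed
  qed measurable
  moreover have "(\<integral>a. (c a (?t n) - c a 0) / of_real (?t n) * cnj (cohf x y a) \<partial>lborel)
      = cinner (weyl ((?t n * s) *\<^sub>R k) (?t n *\<^sub>R l) (abs_L2 f) - abs_L2 f) (coh x y) / of_real (?t n)" for n
    unfolding pair by (simp only: integral_divide_zero[symmetric] times_divide_eq_left)
  moreover have "(\<integral>a. \<i> * ?X a * cnj (cohf x y a) \<partial>lborel) = \<i> * cinner (abs_L2 ?X) (coh x y)"
  proof -
    have "cinner (abs_L2 ?X) (coh x y) = (\<integral>a. ?X a * cnj (cohf x y a) \<partial>lborel)"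
      by (rule cinner_eq_integral_AE[OF _ _ rep_abs_L2[OF X] rep_coh]) measurable
    then show ?thesis by (simp only: mult.assoc integral_mult_right_zero)
  qed
  ultimately show "(\<lambda>n. cinner (weyl ((?t n * s) *\<^sub>R k) (?t n *\<^sub>R l) (abs_L2 f) - abs_L2 f) (coh x y) / of_real (?t n))
      \<longlonglongrightarrow> \<i> * cinner (abs_L2 ?X) (coh x y)" by (simp only:)
qed

text \<open>An operator contained in \<open>A\<close> whose domain contains the coherent states has \<open>A\<close> as its only
  self-adjoint extension, because its adjoint is already contained in \<open>A\<close>.\<close>

lemma sa_extension_eq_A:
  assumes T: "T \<subseteq> A" and coh: "\<And>x y. coh x y \<in> Domain T"
  shows "sa_extension T = A"
  unfolding sa_extension_def
proof (rule the_equality)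
  show "T \<subseteq> A \<and> self_adjoint A" using T self_adjoint_A by blast
  have adj: "adjoint_graph T \<subseteq> A"
  proof (rule subrelI)
    fix v w assume vw: "(v, w) \<in> adjoint_graph T"
    have "AE a in lborel. rep_L2 (V w) a = of_real (\<mu> a) * rep_L2 (V v) a"
    proof (rule coherent_test)
      fix x y
      obtain u' where u': "(coh x y, u') \<in> T" using coh[of x y] by blast
      have "(\<integral>a. of_real (\<mu> a) * rep_L2 (V (coh x y)) a * cnj (rep_L2 (V v) a) \<partial>lborel) = cinner (V u') (V v)"
        using u' T by (intro cinner_eq_integral_AE[symmetric]) (auto simp: graph_def)
      also have "\<dots> = cinner (V (coh x y)) (V w)"
        using vw u' by (auto simp: adjoint_graph_def unitary_cinner[OF V])
      finally show "(\<integral>a. of_real (\<mu> a) * rep_L2 (V (coh x y)) a * cnj (rep_L2 (V v) a) \<partial>lborel) = cinner (V (coh x y)) (V w)" .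
    qed
    then show "(v, w) \<in> A" by (simp add: graph_def)
  qed
  show "B = A" if B: "T \<subseteq> B \<and> self_adjoint B" for B
  proof -
    have anti: "adjoint_graph S' \<subseteq> adjoint_graph S" if "S \<subseteq> S'" for S S' :: "'a op_graph"
      using that by (auto simp: adjoint_graph_def)
    have "B \<subseteq> A" using anti[of T B] B adj by (auto simp: self_adjoint_def)
    moreover from anti[OF this] have "A \<subseteq> B" using B self_adjoint_A by (auto simp: self_adjoint_def)
    ultimately show ?thesis by blast
  qed
qed

end

section \<open>The operators on Gaussian functions\<close>

inductive_set polys :: "(real ^ 'n::finite \<Rightarrow> complex) set" where
  const: "(\<lambda>_. c) \<in> polys"
| coord: "(\<lambda>a. of_real (a $ i)) \<in> polys"
| add: "p \<in> polys \<Longrightarrow> q \<in> polys \<Longrightarrow> (\<lambda>a. p a + q a) \<in> polys"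
| mult: "p \<in> polys \<Longrightarrow> q \<in> polys \<Longrightarrow> (\<lambda>a. p a * q a) \<in> polys"

lemma polys_sum: "finite S \<Longrightarrow> (\<And>i. i \<in> S \<Longrightarrow> p i \<in> polys) \<Longrightarrow> (\<lambda>a. \<Sum>i\<in>S. p i a) \<in> polys"
  by (induction S rule: finite_induct) (auto intro: polys.intros)

lemma polys_prod: "finite S \<Longrightarrow> (\<And>i. i \<in> S \<Longrightarrow> p i \<in> polys) \<Longrightarrow> (\<lambda>a. \<Prod>i\<in>S. p i a) \<in> polys"
  by (induction S rule: finite_induct) (auto intro: polys.intros)

lemma polys_power: "p \<in> polys \<Longrightarrow> (\<lambda>a. p a ^ m) \<in> polys"
  by (induction m) (auto intro: polys.intros)

lemma complex_polynomial_polys: "complex_polynomial P \<Longrightarrow> P \<in> polys"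
  unfolding complex_polynomial_def
  by (auto intro!: polys_sum polys.mult[OF polys.const] polys_prod polys_power polys.coord)

lemma polys_derivative:
  fixes p :: "real ^ 'n::finite \<Rightarrow> complex"
  assumes "p \<in> polys"
  shows "\<exists>p'\<in>polys. \<forall>a. ((\<lambda>t. p (a + t *\<^sub>R axis k 1)) has_vector_derivative p' a) (at 0)"
  using assms
proof induction
  case (const c)
  show ?case by (rule bexI[of _ "\<lambda>_. 0"]) (auto intro: polys.const)
next
  case (coord i)
  have "((\<lambda>t. complex_of_real ((a + t *\<^sub>R axis k 1) $ i)) has_vector_derivative complex_of_real (axis k 1 $ i)) (at 0)" for a :: "real ^ 'n"
    by (auto intro!: derivative_eq_intros simp: has_real_derivative_iff_has_vector_derivative[symmetric])
  then show ?case by (intro bexI[of _ "\<lambda>_. complex_of_real (axis k 1 $ i)"]) (auto intro: polys.const)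
next
  case (add p q)
  then obtain p' q' where *: "p' \<in> polys" "q' \<in> polys" "\<And>a. ((\<lambda>t. p (a + t *\<^sub>R axis k 1)) has_vector_derivative p' a) (at 0)"
    "\<And>a. ((\<lambda>t. q (a + t *\<^sub>R axis k 1)) has_vector_derivative q' a) (at 0)" by blast
  show ?case
    by (rule bexI[of _ "\<lambda>a. p' a + q' a"]) (use * in \<open>auto intro: polys.add has_vector_derivative_add\<close>)
next
  case (mult p q)
  then obtain p' q' where *: "p' \<in> polys" "q' \<in> polys" "\<And>a. ((\<lambda>t. p (a + t *\<^sub>R axis k 1)) has_vector_derivative p' a) (at 0)"
    "\<And>a. ((\<lambda>t. q (a + t *\<^sub>R axis k 1)) has_vector_derivative q' a) (at 0)" by blast
  have "((\<lambda>t. p (a + t *\<^sub>R axis k 1) * q (a + t *\<^sub>R axis k 1)) has_vector_derivative p a * q' a + p' a * q a) (at 0)" for a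
    using has_vector_derivative_mult[OF *(3)[of a] *(4)[of a]] by simp
  then show ?case using *(1,2) mult(1,2)
    by (intro bexI[of _ "\<lambda>a. p a * q' a + p' a * q a"]) (auto intro: polys.intros)
qed

lemma polys_measurable:
  fixes p :: "real ^ 'n::finite \<Rightarrow> complex"
  shows "p \<in> polys \<Longrightarrow> p \<in> borel_measurable borel"
proof (induction rule: polys.induct)
  case (coord i)
  have "continuous_on UNIV (\<lambda>a::real^'n. complex_of_real (a $ i))" by (intro continuous_intros)
  then show ?case by (rule borel_measurable_continuous_onI)
qed auto

definition decays :: "(real ^ 'n::finite \<Rightarrow> complex) \<Rightarrow> bool" where
  "decays f \<longleftrightarrow> f \<in> borel_measurable borel \<and> (\<exists>C \<delta>. \<delta> > 0 \<and> (\<forall>a. cmod (f a) \<le> C * exp (- (\<delta> * (a \<bullet> a)))))"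

lemma decays_scale: "decays f \<Longrightarrow> decays (\<lambda>a. c * f a)"
proof -
  assume "decays f"
  then obtain C \<delta> where m: "f \<in> borel_measurable borel" and "\<delta> > 0" and b: "\<And>a. cmod (f a) \<le> C * exp (- (\<delta> * (a \<bullet> a)))"
    by (auto simp: decays_def)
  have "cmod (c * f a) \<le> (cmod c * C) * exp (- (\<delta> * (a \<bullet> a)))" for a
    using mult_left_mono[OF b[of a], of "cmod c"] by (simp add: norm_mult mult.assoc)
  with m \<open>\<delta> > 0\<close> show ?thesis unfolding decays_def by (intro conjI exI[of _ "cmod c * C"] exI[of _ \<delta>]) auto
qed

lemma decays_add: assumes "decays f" "decays g" shows "decays (\<lambda>a. f a + g a)"
proof -
  from assms obtain C \<delta> D \<epsilon> where [measurable]: "f \<in> borel_measurable borel" "g \<in> borel_measurable borel"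
    and \<delta>: "\<delta> > 0" and C: "\<And>a. cmod (f a) \<le> C * exp (- (\<delta> * (a \<bullet> a)))"
    and \<epsilon>: "\<epsilon> > 0" and D: "\<And>a. cmod (g a) \<le> D * exp (- (\<epsilon> * (a \<bullet> a)))"
    by (auto simp: decays_def)
  let ?m = "min \<delta> \<epsilon>"
  have "cmod (f a + g a) \<le> (\<bar>C\<bar> + \<bar>D\<bar>) * exp (- (?m * (a \<bullet> a)))" for a
  proof -
    have "?m * (a \<bullet> a) \<le> \<delta> * (a \<bullet> a)" "?m * (a \<bullet> a) \<le> \<epsilon> * (a \<bullet> a)" by (intro mult_right_mono, auto)+
    then have "exp (- (\<delta> * (a \<bullet> a))) \<le> exp (- (?m * (a \<bullet> a)))" "exp (- (\<epsilon> * (a \<bullet> a))) \<le> exp (- (?m * (a \<bullet> a)))" by simp_all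
    then have "C * exp (- (\<delta> * (a \<bullet> a))) \<le> \<bar>C\<bar> * exp (- (?m * (a \<bullet> a)))" "D * exp (- (\<epsilon> * (a \<bullet> a))) \<le> \<bar>D\<bar> * exp (- (?m * (a \<bullet> a)))"
      by (intro mult_mono; simp)+
    with C[of a] D[of a] norm_triangle_ineq[of "f a" "g a"] show ?thesis by (simp add: distrib_right)
  qed
  with \<delta> \<epsilon> show ?thesis unfolding decays_def
    by (intro conjI exI[of _ "\<bar>C\<bar> + \<bar>D\<bar>"] exI[of _ ?m]) auto
qed

lemma decays_coord:
  fixes f :: "real ^ 'a::finite \<Rightarrow> complex"
  assumes "decays f"
  shows "decays (\<lambda>a. of_real (a $ i) * f a)"
proof -
  from assms obtain C \<delta> where [measurable]: "f \<in> borel_measurable borel"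
    and \<delta>: "\<delta> > 0" and C: "\<And>a. cmod (f a) \<le> C * exp (- (\<delta> * (a \<bullet> a)))"
    by (auto simp: decays_def)
  have [measurable]: "(\<lambda>a::real^'a. complex_of_real (a $ i)) \<in> borel_measurable borel"
    by (rule polys_measurable[OF polys.coord])
  have C0: "0 \<le> C" using order_trans[OF norm_ge_zero C[of 0]] by simp
  have "cmod (of_real (a $ i) * f a) \<le> ((1 + 2 / \<delta>) * C) * exp (- (\<delta> / 2 * (a \<bullet> a)))" for a
  proof -
    have "\<bar>a $ i\<bar> \<le> norm a" by (rule component_le_norm_cart)
    also have "norm a \<le> 1 + a \<bullet> a"
    proof -
      have "2 * norm a \<le> a \<bullet> a + 1"
        using sum_squares_bound[of "norm a" 1] unfolding power2_norm_eq_inner by simp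
      then show ?thesis using norm_ge_zero[of a] by linarith
    qed
    also have "a \<bullet> a = 2 / \<delta> * (\<delta> / 2 * (a \<bullet> a))" using \<delta> by simp
    also have "1 + 2 / \<delta> * (\<delta> / 2 * (a \<bullet> a)) \<le> exp (\<delta> / 2 * (a \<bullet> a)) + 2 / \<delta> * exp (\<delta> / 2 * (a \<bullet> a))"
    proof (rule add_mono)
      have nn: "0 \<le> \<delta> / 2 * (a \<bullet> a)" using \<delta> by simp
      show "1 \<le> exp (\<delta> / 2 * (a \<bullet> a))" using nn by simp
      show "2 / \<delta> * (\<delta> / 2 * (a \<bullet> a)) \<le> 2 / \<delta> * exp (\<delta> / 2 * (a \<bullet> a))"
      proof (rule mult_left_mono)
        show "\<delta> / 2 * (a \<bullet> a) \<le> exp (\<delta> / 2 * (a \<bullet> a))"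
          using exp_ge_add_one_self[of "\<delta> / 2 * (a \<bullet> a)"] by linarith
      qed (use \<delta> in simp)
    qed
    finally have 1: "\<bar>a $ i\<bar> \<le> (1 + 2 / \<delta>) * exp (\<delta> / 2 * (a \<bullet> a))" by (simp add: distrib_right)
    have "cmod (of_real (a $ i) * f a) \<le> ((1 + 2 / \<delta>) * exp (\<delta> / 2 * (a \<bullet> a))) * (C * exp (- (\<delta> * (a \<bullet> a))))"
      unfolding norm_mult norm_of_real by (rule mult_mono[OF 1 C]) (use \<delta> in auto)
    also have "\<dots> = ((1 + 2 / \<delta>) * C) * (exp (\<delta> / 2 * (a \<bullet> a)) * exp (- (\<delta> * (a \<bullet> a))))" by (simp only: mult_ac)
    also have "exp (\<delta> / 2 * (a \<bullet> a)) * exp (- (\<delta> * (a \<bullet> a))) = exp (- (\<delta> / 2 * (a \<bullet> a)))"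
      unfolding exp_add[symmetric] by (simp add: field_simps)
    finally show ?thesis .
  qed
  with \<delta> show ?thesis unfolding decays_def
    by (intro conjI exI[of _ "(1 + 2 / \<delta>) * C"] exI[of _ "\<delta> / 2"]) auto
qed

lemma decays_polys: "p \<in> polys \<Longrightarrow> decays f \<Longrightarrow> decays (\<lambda>a. p a * f a)"
proof (induction arbitrary: f rule: polys.induct)
  case (add p q)
  show ?case
    using decays_add[OF add.IH(1)[OF add.prems] add.IH(2)[OF add.prems]] by (simp add: distrib_right)
next
  case (mult p q)
  then show ?case by (simp add: mult.assoc)
qed (auto intro: decays_scale decays_coord)

lemma decays_bounded: assumes "decays f" obtains C where "\<And>a. cmod (f a) \<le> C"
proof -
  from assms obtain C \<delta> where \<delta>: "\<delta> > 0" and C: "\<And>a. cmod (f a) \<le> C * exp (- (\<delta> * (a \<bullet> a)))"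
    by (auto simp: decays_def)
  have C0: "0 \<le> C" using order_trans[OF norm_ge_zero C[of 0]] by simp
  have "cmod (f a) \<le> C" for a
    using C[of a] mult_left_mono[of "exp (- (\<delta> * (a \<bullet> a)))" 1 C] C0 \<delta> by simp
  then show ?thesis by (rule that)
qed

lemma decays_square_integrable:
  fixes f :: "real ^ 'a::finite \<Rightarrow> complex"
  assumes "decays f"
  shows "square_integrable f"
proof -
  from assms obtain C \<delta> where [measurable]: "f \<in> borel_measurable borel"
    and \<delta>: "\<delta> > 0" and C: "\<And>a. cmod (f a) \<le> C * exp (- (\<delta> * (a \<bullet> a)))"
    by (auto simp: decays_def)
  have s: "2 * sqrt \<delta> > 0" using \<delta> by simp
  have "integrable lborel (\<lambda>a::real^'a. C\<^sup>2 * exp (- ((2 * sqrt \<delta>)\<^sup>2 * (a \<bullet> a)) / 2))"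
    by (intro integrable_mult_right gauss_integrable s)
  then have "integrable lborel (\<lambda>a. (cmod (f a))\<^sup>2)"
  proof (rule Bochner_Integration.integrable_bound)
    have "(cmod (f a))\<^sup>2 \<le> C\<^sup>2 * exp (- ((2 * sqrt \<delta>)\<^sup>2 * (a \<bullet> a)) / 2)" for a
    proof -
      have "(cmod (f a))\<^sup>2 \<le> (C * exp (- (\<delta> * (a \<bullet> a))))\<^sup>2" by (intro power_mono C) simp
      also have "\<dots> = C\<^sup>2 * exp (- ((2 * sqrt \<delta>)\<^sup>2 * (a \<bullet> a)) / 2)"
        unfolding power_mult_distrib exp_double[symmetric] using \<delta> by (simp add: exp_double[symmetric])
      finally show ?thesis .
    qed
    then show "AE a in lborel. norm ((cmod (f a))\<^sup>2) \<le> norm (C\<^sup>2 * exp (- ((2 * sqrt \<delta>)\<^sup>2 * (a \<bullet> a)) / 2))" by simp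
  qed measurable
  then show ?thesis by (simp add: square_integrable_def)
qed

definition nice :: "'n \<Rightarrow> (real ^ 'n::finite \<Rightarrow> complex) \<Rightarrow> (real ^ 'n \<Rightarrow> complex) \<Rightarrow> bool" where
  "nice k f g \<longleftrightarrow> decays f \<and> decays g \<and> (\<forall>a. ((\<lambda>t. f (a + t *\<^sub>R axis k 1)) has_vector_derivative g a) (at 0))"

lemma gaussian_decays:
  fixes \<alpha> \<beta> :: "'n::finite \<Rightarrow> complex"
  assumes \<alpha>: "\<And>i. Re (\<alpha> i) > 0"
  shows "decays (\<lambda>a. exp (- (\<Sum>i\<in>UNIV. \<alpha> i * (complex_of_real (a $ i))\<^sup>2 + \<beta> i * complex_of_real (a $ i))))"
proof -
  let ?q = "\<lambda>a. \<Sum>i\<in>UNIV. \<alpha> i * (complex_of_real (a $ i))\<^sup>2 + \<beta> i * complex_of_real (a $ i)"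
  have q: "?q \<in> polys"
    by (rule polys_sum) (simp, rule polys.add[OF polys.mult[OF polys.const polys_power[OF polys.coord]] polys.mult[OF polys.const polys.coord]])
  define \<delta> where "\<delta> = Min (range (\<lambda>i. Re (\<alpha> i) / 2))"
  have \<delta>: "\<delta> > 0" unfolding \<delta>_def using \<alpha> by (subst Min_gr_iff) auto
  have \<delta>le: "\<delta> \<le> Re (\<alpha> i) / 2" for i unfolding \<delta>_def by (intro Min_le) auto
  define C where "C = exp (\<Sum>i\<in>UNIV. (Re (\<beta> i))\<^sup>2 / (2 * Re (\<alpha> i)))"
  have "cmod (exp (- ?q a)) \<le> C * exp (- (\<delta> * (a \<bullet> a)))" for a
  proof -
    have "- Re (?q a) = (\<Sum>i\<in>UNIV. - (Re (\<alpha> i) * (a $ i)\<^sup>2 + Re (\<beta> i) * a $ i))"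
      unfolding sum_negf by (simp flip: of_real_power)
    also have "\<dots> \<le> (\<Sum>i\<in>UNIV. (Re (\<beta> i))\<^sup>2 / (2 * Re (\<alpha> i)) - \<delta> * (a $ i * a $ i))"
    proof (rule sum_mono)
      fix i
      have p: "Re (\<alpha> i) > 0" by (rule \<alpha>)
      have "0 \<le> (Re (\<alpha> i) * a $ i + Re (\<beta> i))\<^sup>2 / (2 * Re (\<alpha> i))" using p by simp
      also have "\<dots> = Re (\<alpha> i) / 2 * (a $ i)\<^sup>2 + Re (\<beta> i) * a $ i + (Re (\<beta> i))\<^sup>2 / (2 * Re (\<alpha> i))"
        using p by (simp add: power2_eq_square field_simps)
      finally have "- (Re (\<alpha> i) * (a $ i)\<^sup>2 + Re (\<beta> i) * a $ i) \<le> (Re (\<beta> i))\<^sup>2 / (2 * Re (\<alpha> i)) - Re (\<alpha> i) / 2 * (a $ i)\<^sup>2"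
        by simp
      moreover have "\<delta> * (a $ i)\<^sup>2 \<le> Re (\<alpha> i) / 2 * (a $ i)\<^sup>2" by (intro mult_right_mono \<delta>le) simp
      ultimately show "- (Re (\<alpha> i) * (a $ i)\<^sup>2 + Re (\<beta> i) * a $ i) \<le> (Re (\<beta> i))\<^sup>2 / (2 * Re (\<alpha> i)) - \<delta> * (a $ i * a $ i)"
        by (simp add: power2_eq_square)
    qed
    also have "\<dots> = (\<Sum>i\<in>UNIV. (Re (\<beta> i))\<^sup>2 / (2 * Re (\<alpha> i))) - \<delta> * (a \<bullet> a)"
      by (simp add: sum_subtractf sum_distrib_left inner_vec_def)
    finally have "- Re (?q a) \<le> (\<Sum>i\<in>UNIV. (Re (\<beta> i))\<^sup>2 / (2 * Re (\<alpha> i))) + - (\<delta> * (a \<bullet> a))"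
      by (simp only: diff_conv_add_uminus)
    then show ?thesis
      unfolding C_def exp_add[symmetric] norm_exp_eq_Re uminus_complex.sel exp_le_cancel_iff .
  qed
  moreover have "(\<lambda>a. exp (- ?q a)) \<in> borel_measurable borel"
    using polys_measurable[OF q] by measurable
  ultimately show ?thesis using \<delta> unfolding decays_def by blast
qed

lemma nice_gaussian:
  fixes \<alpha> \<beta> :: "'n::finite \<Rightarrow> complex"
  assumes \<alpha>: "\<And>i. Re (\<alpha> i) > 0" and P: "P \<in> polys"
  shows "\<exists>g. nice k (\<lambda>a. exp (- (\<Sum>i\<in>UNIV. \<alpha> i * (complex_of_real (a $ i))\<^sup>2 + \<beta> i * complex_of_real (a $ i))) * P a) g"
proof -
  let ?q = "\<lambda>a. \<Sum>i\<in>UNIV. \<alpha> i * (complex_of_real (a $ i))\<^sup>2 + \<beta> i * complex_of_real (a $ i)"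
  have q: "?q \<in> polys"
    by (rule polys_sum) (simp, rule polys.add[OF polys.mult[OF polys.const polys_power[OF polys.coord]] polys.mult[OF polys.const polys.coord]])
  obtain q' where q': "q' \<in> polys" "\<And>a. ((\<lambda>t. ?q (a + t *\<^sub>R axis k 1)) has_vector_derivative q' a) (at 0)"
    using polys_derivative[OF q, of k] by blast
  obtain P' where P': "P' \<in> polys" "\<And>a. ((\<lambda>t. P (a + t *\<^sub>R axis k 1)) has_vector_derivative P' a) (at 0)"
    using polys_derivative[OF P, of k] by blast
  let ?g = "\<lambda>a. (P' a + (-1) * (q' a * P a)) * exp (- ?q a)"
  have "((\<lambda>t. exp (- ?q (a + t *\<^sub>R axis k 1)) * P (a + t *\<^sub>R axis k 1)) has_vector_derivative ?g a) (at 0)" for a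
  proof -
    have "((\<lambda>t. - ?q (a + t *\<^sub>R axis k 1)) has_vector_derivative - q' a) (at 0)"
      by (rule has_vector_derivative_minus[OF q'(2)])
    from field_vector_diff_chain_at[OF this DERIV_exp]
    have "((\<lambda>t. exp (- ?q (a + t *\<^sub>R axis k 1))) has_vector_derivative - q' a * exp (- ?q (a + 0 *\<^sub>R axis k 1))) (at 0)"
      by (simp only: o_def)
    from has_vector_derivative_mult[OF this P'(2)[of a]]
    show ?thesis by (rule has_vector_derivative_eq_rhs) (simp add: algebra_simps)
  qed
  moreover have "decays (\<lambda>a. exp (- ?q a) * P a)"
    using decays_polys[OF P gaussian_decays[of \<alpha> \<beta>, OF \<alpha>]] by (simp add: mult.commute)
  moreover have "decays ?g"
    by (rule decays_polys[OF polys.add[OF P'(1) polys.mult[OF polys.const polys.mult[OF q'(1) P]]] gaussian_decays[of \<alpha> \<beta>, OF \<alpha>]])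
  ultimately show ?thesis unfolding nice_def by blast
qed

lemma gaussian_domain_nice: "f \<in> gaussian_domain \<Longrightarrow> \<exists>g. nice k f g"
proof (induction rule: gaussian_domain.induct)
  case (gaussian \<alpha> P \<beta>)
  then show ?case by (intro nice_gaussian complex_polynomial_polys)
next
  case (add f g)
  then obtain f' g' where "nice k f f'" "nice k g g'" by blast
  then have "nice k (\<lambda>a. f a + g a) (\<lambda>a. f' a + g' a)"
    unfolding nice_def by (auto intro: decays_add has_vector_derivative_add)
  then show ?case by blast
next
  case (scale f c)
  then obtain f' where "nice k f f'" by blast
  then have "nice k (\<lambda>a. c * f a) (\<lambda>a. c * f' a)"
    unfolding nice_def by (auto intro: decays_scale has_vector_derivative_mult_right)
  then show ?case by blast
qed

lemma cohf_gaussian_domain: "cohf x y \<in> (gaussian_domain :: (real ^ 'n::finite \<Rightarrow> complex) set)"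
proof -
  have P: "complex_polynomial (\<lambda>_ :: real ^ 'n. 1)"
    unfolding complex_polynomial_def by (intro exI[of _ "{\<lambda>_. 0}"] exI[of _ "\<lambda>_. 1"]) simp
  have "(\<lambda>a. exp (- (\<Sum>i\<in>UNIV. (1/2) * (complex_of_real (a $ i))\<^sup>2 + - Complex (x $ i) (y $ i) * complex_of_real (a $ i))) * 1) \<in> (gaussian_domain :: (real ^ 'n \<Rightarrow> complex) set)"
    by (rule gaussian_domain.gaussian[OF _ P]) simp
  moreover have "exp (- (\<Sum>i\<in>UNIV. (1/2) * (complex_of_real (a $ i))\<^sup>2 + - Complex (x $ i) (y $ i) * complex_of_real (a $ i))) * 1 = cohf x y a" for a
  proof -
    have "Complex (x $ i) (y $ i) = of_real (x $ i) + \<i> * of_real (y $ i)" for i by (simp add: complex_eq_iff)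
    then show ?thesis unfolding cohf_def inner_vec_def
      by (simp add: sum_subtractf sum.distrib sum_negf sum_distrib_left sum_divide_distrib algebra_simps power2_eq_square)
  qed
  ultimately show ?thesis by simp
qed

locale coordinate_momentum =
  fixes k :: "'n::finite" and l :: "real ^ 'n" and s :: real
  assumes l0: "l $ k = 0"
begin

sublocale mixed_momentum "axis k 1" l s
  by standard (simp_all add: inner_axis l0)

lemma sa_operator_eq_A:
  assumes T: "\<And>f a. T f a = \<i> * of_real s * vector_derivative (\<lambda>t. f (a + t *\<^sub>R axis k 1)) (at 0) - of_real (l \<bullet> a) * f a"
  shows "sa_operator T = A"
  unfolding sa_operator_def
proof (rule sa_extension_eq_A)
  show "(\<lambda>f. (abs_L2 f, abs_L2 (T f))) ` gaussian_domain \<subseteq> A"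
  proof clarify
    fix f :: "real ^ 'n \<Rightarrow> complex" assume "f \<in> gaussian_domain"
    then obtain g where g: "decays f" "decays g" "\<And>a. ((\<lambda>t. f (a + t *\<^sub>R axis k 1)) has_vector_derivative g a) (at 0)"
      using gaussian_domain_nice[of f k] by (auto simp: nice_def)
    have Tf: "T f = (\<lambda>a. \<i> * of_real s * g a - of_real (l \<bullet> a) * f a)"
      by (rule ext) (simp add: T vector_derivative_at[OF g(3)])
    have "(\<lambda>a. - (\<Sum>i\<in>UNIV. of_real (l $ i) * of_real (a $ i))) \<in> polys"
      using polys.mult[OF polys.const[of "-1"] polys_sum[of UNIV "\<lambda>i a. of_real (l $ i) * of_real (a $ i)"]]
      by (simp add: polys.mult polys.const polys.coord)
    from decays_add[OF decays_scale[OF g(2), of "\<i> * of_real s"] decays_polys[OF this g(1)]]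
    have d: "decays (\<lambda>a. \<i> * of_real s * g a - of_real (l \<bullet> a) * f a)"
      by (simp add: inner_vec_def)
    obtain C1 C2 where "\<And>a. cmod (f a) \<le> C1" "\<And>a. cmod (g a) \<le> C2"
      using decays_bounded[OF g(1)] decays_bounded[OF g(2)] by metis
    then have C: "cmod (f a) \<le> max C1 C2" "cmod (g a) \<le> max C1 C2" for a
      by (simp_all add: le_max_iff_disj)
    show "(abs_L2 f, abs_L2 (T f)) \<in> A"
      unfolding Tf
      by (rule differentiable_in_graph[OF decays_square_integrable[OF g(1)] g(3) C decays_square_integrable[OF d]])
  qed
  show "coh x y \<in> Domain ((\<lambda>f. (abs_L2 f, abs_L2 (T f))) ` gaussian_domain)" for x y
    unfolding coh_def using cohf_gaussian_domain by blast
qed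

end

section \<open>Approximation by trigonometric polynomials\<close>

inductive_set trig :: "(real \<Rightarrow> complex) set" where
  character: "(\<lambda>r. exp (\<i> * of_real (t * r))) \<in> trig"
| add: "F \<in> trig \<Longrightarrow> G \<in> trig \<Longrightarrow> (\<lambda>r. F r + G r) \<in> trig"
| scale: "F \<in> trig \<Longrightarrow> (\<lambda>r. c * F r) \<in> trig"

lemma trig_const: "(\<lambda>_. c) \<in> trig"
  using trig.scale[OF trig.character[of 0], of c] by simp

lemma trig_mult: "F \<in> trig \<Longrightarrow> G \<in> trig \<Longrightarrow> (\<lambda>r. F r * G r) \<in> trig"
proof (induction rule: trig.induct)
  case (character t)
  from character show ?case
  proof (induction rule: trig.induct)
    case (character t')
    have "(\<lambda>r. exp (\<i> * of_real (t * r)) * exp (\<i> * of_real (t' * r))) = (\<lambda>r. exp (\<i> * of_real ((t + t') * r)))"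
      unfolding exp_add[symmetric] by (simp add: algebra_simps)
    then show ?case by (simp only: trig.character)
  next
    case (add F G)
    then show ?case using trig.add by (simp only: distrib_left)
  next
    case (scale F c)
    then show ?case using trig.scale by (simp only: mult.left_commute)
  qed
next
  case (add F H)
  then show ?case using trig.add by (simp only: distrib_right)
next
  case (scale F c)
  then show ?case using trig.scale by (simp only: mult.assoc)
qed

lemma trig_bounded_borel: "F \<in> trig \<Longrightarrow> bounded_borel F"
proof (induction rule: trig.induct)
  case (character t)
  show ?case by (rule bounded_borelI[where C = 1]) auto
next
  case (add F G)
  then obtain C D where "F \<in> borel_measurable borel" "\<And>a. cmod (F a) \<le> C" "G \<in> borel_measurable borel" "\<And>a. cmod (G a) \<le> D"
    by (metis bounded_borelE)
  then show ?case
    by (intro bounded_borelI[where C = "C + D"]) (auto intro: order_trans[OF norm_triangle_ineq add_mono])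
next
  case (scale F c)
  then obtain C where "F \<in> borel_measurable borel" "\<And>a. cmod (F a) \<le> C" by (metis bounded_borelE)
  then show ?case
    by (intro bounded_borelI[where C = "cmod c * C"]) (auto simp: norm_mult mult_left_mono)
qed

lemma trig_real_polynomial:
  "real_polynomial_function p \<Longrightarrow> (\<lambda>r. complex_of_real (p (exp (\<i> * of_real (t * r))))) \<in> trig"
proof (induction rule: real_polynomial_function.induct)
  case (linear f)
  have f: "f z = Re z * f 1 + Im z * f \<i>" for z
  proof -
    have "f z = f (Re z *\<^sub>R 1 + Im z *\<^sub>R \<i>)" by (rule arg_cong[where f = f]) (simp add: complex_eq_iff)
    also have "\<dots> = Re z * f 1 + Im z * f \<i>"
      using linear by (simp add: linear_add linear_scale bounded_linear.linear)
    finally show ?thesis .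
  qed
  let ?a = "complex_of_real (f 1) / 2 + complex_of_real (f \<i>) / (2 * \<i>)"
  let ?b = "complex_of_real (f 1) / 2 - complex_of_real (f \<i>) / (2 * \<i>)"
  have "(\<lambda>r. complex_of_real (f (exp (\<i> * of_real (t * r))))) = (\<lambda>r. ?a * exp (\<i> * of_real (t * r)) + ?b * exp (\<i> * of_real ((- t) * r)))"
  proof
    fix r
    show "complex_of_real (f (exp (\<i> * of_real (t * r)))) = ?a * exp (\<i> * of_real (t * r)) + ?b * exp (\<i> * of_real ((- t) * r))"
      unfolding f[of "exp (\<i> * of_real (t * r))"]
      by (simp add: complex_eq_iff Re_exp Im_exp algebra_simps Re_divide Im_divide)
  qed
  then show ?case by (simp only:) (intro trig.add trig.scale trig.character)
next
  case (const c)
  show ?case by (rule trig_const)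
next
  case (add f g)
  then show ?case using trig.add by (simp only: of_real_add)
next
  case (mult f g)
  then show ?case using trig_mult by (simp only: of_real_mult)
qed

text \<open>\<open>F\<close> times a cutoff vanishing at \<open>\<plusminus> N\<close> is a continuous function on the circle of circumference \<open>2 N\<close>,
  to which the theorem of Stone and Weierstrass applies.\<close>

lemma trig_approx_on_interval:
  fixes F :: "real \<Rightarrow> complex"
  assumes F: "continuous_on UNIV F" and F1: "\<And>r. cmod (F r) \<le> 1" and N: "N \<ge> (1::real)"
  shows "\<exists>G\<in>trig. (\<forall>r. cmod (G r) \<le> 2) \<and> (\<forall>r. \<bar>r\<bar> \<le> N - 1 \<longrightarrow> cmod (G r - F r) \<le> 1 / N)"
proof -
  define \<tau> where "\<tau> x = max 0 (min 1 (N - x))" for x :: real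
  define c where "c z = complex_of_real (\<tau> (N * arccos (Re z) / pi)) * F (N * Arg z / pi)" for z
  have \<tau>: "0 \<le> \<tau> x" "\<tau> x \<le> 1" for x by (auto simp: \<tau>_def)
  have c_le: "cmod (c z) \<le> \<tau> (N * arccos (Re z) / pi)" for z
    using mult_left_mono[OF F1 \<tau>(1)] \<tau>(1) by (simp add: c_def norm_mult)
  have Re_sphere: "Re z \<in> {-1..1}" if "z \<in> sphere 0 1" for z
    using abs_Re_le_cmod[of z] that by (simp add: abs_le_iff)
  have cont\<tau>: "continuous_on (sphere 0 1) (\<lambda>z. \<tau> (N * arccos (Re z) / pi))"
    unfolding \<tau>_def using Re_sphere by (intro continuous_intros) auto
  have "continuous_on (sphere 0 1) c"
  proof (rule continuous_on_eq_continuous_within[THEN iffD2], rule ballI)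
    fix z :: complex assume z: "z \<in> sphere 0 1"
    show "continuous (at z within sphere 0 1) c"
    proof (cases "z = -1")
      case True
      have "((\<lambda>z. \<tau> (N * arccos (Re z) / pi)) \<longlongrightarrow> \<tau> (N * arccos (Re z) / pi)) (at z within sphere 0 1)"
        using cont\<tau> z by (simp add: continuous_on_def)
      moreover have "\<tau> (N * arccos (Re z) / pi) = 0" using True by (simp add: \<tau>_def)
      ultimately have "(c \<longlongrightarrow> 0) (at z within sphere 0 1)"
        by (intro Lim_null_comparison[where f = c]) (use c_le in auto)
      moreover have "c z = 0" using c_le[of z] \<open>\<tau> (N * arccos (Re z) / pi) = 0\<close> by simp
      ultimately show ?thesis by (simp add: continuous_within)
    next
      case False
      have "z \<notin> \<real>\<^sub>\<le>\<^sub>0"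
      proof
        assume "z \<in> \<real>\<^sub>\<le>\<^sub>0"
        then obtain r where "z = of_real r" "r \<le> 0" by (auto elim: nonpos_Reals_cases)
        with z False show False by simp
      qed
      then have A: "continuous (at z within sphere 0 1) Arg"
        using continuous_at_Arg continuous_at_imp_continuous_at_within by blast
      have "continuous (at z within sphere 0 1) (\<lambda>z. F (N * Arg z / pi))"
        by (rule continuous_within_compose3[where g = F])
           (use F A in \<open>auto intro!: continuous_intros simp: continuous_on_eq_continuous_at\<close>)
      moreover have "continuous (at z within sphere 0 1) (\<lambda>z. complex_of_real (\<tau> (N * arccos (Re z) / pi)))"
        using cont\<tau> z by (intro continuous_of_real) (simp add: continuous_on_eq_continuous_within)
      ultimately show ?thesis unfolding c_def[abs_def] by (intro continuous_mult)
    qed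
  qed
  from Stone_Weierstrass_polynomial_function[OF compact_sphere this, of "1 / N"] N
  obtain g where g: "polynomial_function g" "\<And>z. z \<in> sphere 0 1 \<Longrightarrow> cmod (c z - g z) < 1 / N" by auto
  define G where "G r = g (exp (\<i> * of_real (pi / N * r)))" for r
  have "G = (\<lambda>r. complex_of_real ((Re \<circ> g) (exp (\<i> * of_real (pi / N * r)))) + \<i> * complex_of_real ((Im \<circ> g) (exp (\<i> * of_real (pi / N * r)))))"
    by (auto simp: G_def complex_eq_iff)
  moreover have "real_polynomial_function (Re \<circ> g)" "real_polynomial_function (Im \<circ> g)"
    using g(1) bounded_linear_Re bounded_linear_Im by (auto simp: polynomial_function_def)
  ultimately have Gt: "G \<in> trig"
    by (simp only:) (intro trig.add trig.scale trig_real_polynomial)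
  have e: "exp (\<i> * complex_of_real r) \<in> sphere 0 1" for r by simp
  have G2: "cmod (G r) \<le> 2" for r
  proof -
    let ?z = "exp (\<i> * complex_of_real (pi / N * r))"
    have "cmod (G r) \<le> cmod (c ?z) + cmod (c ?z - g ?z)"
      unfolding G_def using norm_triangle_ineq4[of "c ?z" "c ?z - g ?z"] by simp
    moreover have "cmod (c ?z - g ?z) \<le> 1"
      using g(2)[OF e[of "pi / N * r"]] N order_trans[of "cmod (c ?z - g ?z)" "1 / N" 1] by simp
    moreover have "cmod (c ?z) \<le> 1" using c_le[of ?z] \<tau>(2) order_trans by blast
    ultimately show ?thesis by linarith
  qed
  have "cmod (G r - F r) \<le> 1 / N" if r: "\<bar>r\<bar> \<le> N - 1" for r
  proof -
    let ?z = "exp (\<i> * complex_of_real (pi / N * r))"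
    have b: "\<bar>pi / N * r\<bar> < pi"
    proof -
      have "\<bar>r\<bar> < N" using r by simp
      then have "pi / N * \<bar>r\<bar> < pi / N * N" using N by (intro mult_strict_left_mono) auto
      then show ?thesis using N by (simp add: abs_mult)
    qed
    have A: "Arg ?z = pi / N * r"
    proof (rule Arg_unique[of 1])
      show "- pi < pi / N * r" "pi / N * r \<le> pi" using b unfolding abs_less_iff by linarith+
    qed simp_all
    have "arccos (Re ?z) = \<bar>pi / N * r\<bar>"
    proof -
      have "Re ?z = cos (pi / N * r)" by (simp add: Re_exp)
      then have "Re ?z = cos \<bar>pi / N * r\<bar>" by (simp only: cos_abs_real)
      then show ?thesis using b by (simp only:) (rule arccos_cos, auto)
    qed
    then have "N * arccos (Re ?z) / pi = \<bar>r\<bar>" using N by (simp add: abs_mult)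
    then have \<tau>1: "\<tau> (N * arccos (Re ?z) / pi) = 1" using r by (simp add: \<tau>_def)
    have "N * (pi / N * r) / pi = r" using N by simp
    then have "c ?z = F r" by (simp only: c_def A \<tau>1 of_real_1 mult_1)
    then show ?thesis using g(2)[OF e[of "pi / N * r"]] by (simp add: G_def norm_minus_commute)
  qed
  with Gt G2 show ?thesis by blast
qed

lemma trig_approx:
  fixes F :: "real \<Rightarrow> complex"
  assumes F: "continuous_on UNIV F" and F1: "\<And>r. cmod (F r) \<le> 1"
  obtains G where "\<And>n::nat. G n \<in> trig" "\<And>n r. cmod (G n r) \<le> 2" "\<And>r. (\<lambda>n. G n r) \<longlonglongrightarrow> F r"
proof -
  have "\<exists>G\<in>trig. (\<forall>r. cmod (G r) \<le> 2) \<and> (\<forall>r. \<bar>r\<bar> \<le> real (Suc n) - 1 \<longrightarrow> cmod (G r - F r) \<le> 1 / real (Suc n))" for n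
    by (rule trig_approx_on_interval[OF F F1]) simp
  then obtain G where G: "\<And>n. G n \<in> trig" "\<And>n r. cmod (G n r) \<le> 2"
    "\<And>n r. \<bar>r\<bar> \<le> real (Suc n) - 1 \<Longrightarrow> cmod (G n r - F r) \<le> 1 / real (Suc n)" by metis
  have "(\<lambda>n. G n r) \<longlonglongrightarrow> F r" for r
  proof -
    obtain M :: nat where M: "\<bar>r\<bar> \<le> real M" using real_arch_simple by blast
    have "eventually (\<lambda>n. norm (G n r - F r) \<le> 1 / real (Suc n)) sequentially"
    proof (rule eventually_sequentiallyI[of M])
      fix n assume "M \<le> n"
      then show "norm (G n r - F r) \<le> 1 / real (Suc n)" using M by (intro G(3)) simp
    qed
    from Lim_null_comparison[OF this LIMSEQ_Suc[OF lim_1_over_n]] show ?thesis by (rule LIM_zero_cancel)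
  qed
  with G that show ?thesis by blast
qed

section \<open>Matrix coefficients of the Weyl representation\<close>

text \<open>\<open>u\<close> is the function \<open>a \<mapsto> \<langle>g, W(a) h\<rangle>\<close>, where \<open>W(a) = weyl a (\<Omega> a)\<close> is the left Weyl system of the
  skew form \<open>\<Omega>\<close>.\<close>

definition coefficient :: "('a::euclidean_space \<Rightarrow> 'a) \<Rightarrow> 'a L2 \<Rightarrow> 'a L2 \<Rightarrow> 'a L2 \<Rightarrow> bool" where
  "coefficient \<Omega> u g h \<longleftrightarrow> (AE a in lborel. rep_L2 u a = cinner g (weyl a (\<Omega> a) h))"

definition skew :: "('a::euclidean_space \<Rightarrow> 'a) \<Rightarrow> bool" where
  "skew \<Omega> \<longleftrightarrow> linear \<Omega> \<and> (\<forall>a b. \<Omega> a \<bullet> b = - (\<Omega> b \<bullet> a))"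

lemma skew_diag: "skew \<Omega> \<Longrightarrow> \<Omega> b \<bullet> b = 0"
  unfolding skew_def by (metis eq_neg_iff_add_eq_0 mult_2 mult_eq_0_iff zero_neq_numeral)

lemma coefficient_left_weyl:
  assumes \<Omega>: "skew \<Omega>" and c: "coefficient \<Omega> u g h"
  shows "coefficient \<Omega> (weyl b (\<Omega> b) u) (weyl b (\<Omega> b) g) h"
  unfolding coefficient_def
  using rep_weyl[of b "\<Omega> b" u] AE_lborel_shift[OF c[unfolded coefficient_def], of b]
proof eventually_elim
  case (elim a)
  have lin: "\<Omega> (a - b) = \<Omega> a - \<Omega> b" using \<Omega> by (simp add: skew_def linear_diff)
  have "weyl b (\<Omega> b) (weyl (a - b) (\<Omega> (a - b)) h) = exp (\<i> * of_real (\<Omega> a \<bullet> b)) *\<^sub>C weyl a (\<Omega> a) h"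
    unfolding weyl_weyl by (simp add: lin inner_diff_left skew_diag[OF \<Omega>])
  then have "weyl a (\<Omega> a) h = exp (- (\<i> * of_real (\<Omega> a \<bullet> b))) *\<^sub>C weyl b (\<Omega> b) (weyl (a - b) (\<Omega> (a - b)) h)"
    by (simp add: exp_add[symmetric])
  then have "cinner (weyl b (\<Omega> b) g) (weyl a (\<Omega> a) h) = cnj (exp (- (\<i> * of_real (\<Omega> a \<bullet> b)))) * cinner g (weyl (a - b) (\<Omega> (a - b)) h)"
    by (simp add: unitary_cinner[OF unitary_weyl])
  also have "cnj (exp (- (\<i> * of_real (\<Omega> a \<bullet> b)))) = exp (- (\<i> * of_real (\<Omega> b \<bullet> a)))"
    using \<Omega> unfolding skew_def exp_cnj by (metis complex_cnj_complex_of_real complex_cnj_i complex_cnj_minus complex_cnj_mult minus_mult_left minus_mult_right of_real_minus)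
  finally show ?case using elim by simp
qed

lemma coefficient_right_weyl:
  assumes \<Omega>: "skew \<Omega>" and c: "coefficient \<Omega> u g h"
  shows "coefficient \<Omega> (weyl (- b) (\<Omega> b) u) g (weyl b (\<Omega> b) h)"
  unfolding coefficient_def
  using rep_weyl[of "- b" "\<Omega> b" u] AE_lborel_shift[OF c[unfolded coefficient_def], of "- b"]
proof eventually_elim
  case (elim a)
  have lin: "\<Omega> (a + b) = \<Omega> a + \<Omega> b" using \<Omega> by (simp add: skew_def linear_add)
  have "cinner g (weyl a (\<Omega> a) (weyl b (\<Omega> b) h)) = cnj (exp (\<i> * of_real (\<Omega> b \<bullet> a))) * cinner g (weyl (a + b) (\<Omega> (a + b)) h)"
    unfolding weyl_weyl lin by simp
  also have "cnj (exp (\<i> * of_real (\<Omega> b \<bullet> a))) = exp (- (\<i> * of_real (\<Omega> b \<bullet> a)))"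
    by (simp add: exp_cnj)
  finally show ?case using elim by simp
qed

lemma coefficient_add_left:
  assumes "coefficient \<Omega> u g h" "coefficient \<Omega> u' g' h"
  shows "coefficient \<Omega> (u + u') (g + g') h"
  using assms rep_plus[of u u'] unfolding coefficient_def
  by (auto simp: cinner_add_left elim!: eventually_elim2 eventually_rev_mp)

lemma coefficient_scale_left:
  assumes "coefficient \<Omega> u g h" shows "coefficient \<Omega> (c *\<^sub>C u) (c *\<^sub>C g) h"
  using assms rep_scaleC[of c u] unfolding coefficient_def by (auto elim!: eventually_elim2)

lemma coefficient_add_right:
  assumes "coefficient \<Omega> u g h" "coefficient \<Omega> u' g h'"
  shows "coefficient \<Omega> (u + u') g (h + h')"
  using assms(1)[unfolded coefficient_def] assms(2)[unfolded coefficient_def] rep_plus[of u u'] unfolding coefficient_def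
  by eventually_elim (simp add: cinner_add_right unitary_add[OF unitary_weyl])

lemma coefficient_scale_right:
  assumes "coefficient \<Omega> u g h" shows "coefficient \<Omega> (cnj c *\<^sub>C u) g (c *\<^sub>C h)"
  using assms[unfolded coefficient_def] rep_scaleC[of "cnj c" u] unfolding coefficient_def
  by eventually_elim (simp add: weyl_scaleC)

lemma coefficient_tendsto:
  assumes c: "\<And>n. coefficient \<Omega> (u n) (g n) (h n)" and u: "u \<longlonglongrightarrow> u'" and g: "g \<longlonglongrightarrow> g'" and h: "h \<longlonglongrightarrow> h'"
  shows "coefficient \<Omega> u' g' h'"
  unfolding coefficient_def
proof (rule L2_limit_AE[OF u])
  have "AE a in lborel. \<forall>n. rep_L2 (u n) a = cinner (g n) (weyl a (\<Omega> a) (h n))"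
    unfolding AE_all_countable using c by (simp add: coefficient_def)
  then show "AE a in lborel. (\<lambda>n. rep_L2 (u n) a) \<longlonglongrightarrow> cinner g' (weyl a (\<Omega> a) h')"
  proof eventually_elim
    case (elim a)
    have "(\<lambda>n. cinner (g n) (weyl a (\<Omega> a) (h n))) \<longlonglongrightarrow> cinner g' (weyl a (\<Omega> a) h')"
      by (rule tendsto_cinner[OF g unitary_tendsto[OF unitary_weyl h]])
    then show ?case using elim by simp
  qed
qed

lemma continuous_coefficient:
  assumes \<Omega>: "linear \<Omega>"
  shows "continuous_on UNIV (\<lambda>a. cinner g (weyl a (\<Omega> a) h))"
proof -
  have lim: "continuous_on UNIV (\<lambda>a. cinner g (weyl a (\<Omega> a) h))"
    if g: "\<And>n. continuous_on UNIV (\<lambda>a. cinner (X n) (weyl a (\<Omega> a) (Y n)))" "X \<longlonglongrightarrow> g" "Y \<longlonglongrightarrow> h" for X Y g h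
  proof (rule uniform_limit_theorem[OF always_eventually])
    show "\<forall>n. continuous_on UNIV (\<lambda>a. cinner (X n) (weyl a (\<Omega> a) (Y n)))" using g(1) by simp
    show "uniform_limit UNIV (\<lambda>n a. cinner (X n) (weyl a (\<Omega> a) (Y n))) (\<lambda>a. cinner g (weyl a (\<Omega> a) h)) sequentially"
    proof (rule uniform_limitI)
      fix e :: real assume e: "e > 0"
      have "(\<lambda>n. norm (X n - g) * norm (Y n) + norm g * norm (Y n - h)) \<longlonglongrightarrow> norm (g - g) * norm h + norm g * norm (h - h)"
        by (intro tendsto_add tendsto_mult tendsto_norm tendsto_diff tendsto_const g)
      then have "eventually (\<lambda>n. norm (X n - g) * norm (Y n) + norm g * norm (Y n - h) < e) sequentially"
        by (rule order_tendstoD(2)) (use e in simp)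
      then show "eventually (\<lambda>n. \<forall>a\<in>UNIV. dist (cinner (X n) (weyl a (\<Omega> a) (Y n))) (cinner g (weyl a (\<Omega> a) h)) < e) sequentially"
      proof eventually_elim
        case (elim n)
        show ?case
        proof
          fix a
          let ?W = "weyl a (\<Omega> a)"
          have "cinner (X n) (?W (Y n)) - cinner g (?W h) = cinner (X n - g) (?W (Y n)) + cinner g (?W (Y n - h))"
            by (simp add: cinner_diff_left cinner_diff_right unitary_diff[OF unitary_weyl])
          moreover have "cmod (cinner (X n - g) (?W (Y n)) + cinner g (?W (Y n - h))) \<le> norm (X n - g) * norm (?W (Y n)) + norm g * norm (?W (Y n - h))"
            by (rule norm_triangle_le[OF add_mono[OF Cauchy_Schwarz_cinner Cauchy_Schwarz_cinner]])
          ultimately have "cmod (cinner (X n) (?W (Y n)) - cinner g (?W h)) \<le> norm (X n - g) * norm (?W (Y n)) + norm g * norm (?W (Y n - h))"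
            by (simp only:)
          then show "dist (cinner (X n) (weyl a (\<Omega> a) (Y n))) (cinner g (weyl a (\<Omega> a) h)) < e"
            using elim by (simp add: dist_norm unitary_norm[OF unitary_weyl])
        qed
      qed
    qed
  qed simp
  have \<Omega>c: "continuous_on UNIV \<Omega>" by (rule linear_continuous_on[OF linear_conv_bounded_linear[THEN iffD1, OF \<Omega>]])
  have cc: "continuous_on UNIV (\<lambda>a. cinner (coh x y) (weyl a (\<Omega> a) (coh x' y')))" for x y x' y'
    unfolding weyl_coh cinner_scaleC_right coh_gram
    by (intro continuous_intros \<Omega>c continuous_on_cnj) simp_all
  have z: "weyl a b 0 = 0" for a b :: 'a using weyl_scaleC[of a b 0 0] by simp
  have ch: "continuous_on UNIV (\<lambda>a. cinner (coh x y) (weyl a (\<Omega> a) h))" for x y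
  proof (induction h rule: coh_induct)
    case (coh x' y')
    show ?case by (rule cc)
  next
    case zero
    show ?case unfolding z by simp
  next
    case (add u v)
    show ?case unfolding unitary_add[OF unitary_weyl] cinner_add_right by (rule continuous_on_add[OF add])
  next
    case (scale c u)
    show ?case unfolding weyl_scaleC cinner_scaleC_right by (rule continuous_on_mult_left[OF scale])
  next
    case (closed X h)
    show ?case by (rule lim[where X = "\<lambda>_. coh x y" and Y = X, OF closed(1) tendsto_const closed(2)])
  qed
  show ?thesis
  proof (induction g rule: coh_induct)
    case (coh x y)
    show ?case by (rule ch)
  next
    case zero
    show ?case by simp
  next
    case (add u v)
    show ?case unfolding cinner_add_left by (rule continuous_on_add[OF add])
  next
    case (scale c u)
    show ?case unfolding cinner_scaleC_left by (rule continuous_on_mult_left[OF scale])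
  next
    case (closed X g)
    show ?case by (rule lim[where X = X and Y = "\<lambda>_. h", OF closed(1) closed(2) tendsto_const])
  qed
qed

lemma continuous_AE_eq:
  fixes f g :: "'a::euclidean_space \<Rightarrow> complex"
  assumes f: "continuous_on UNIV f" and g: "continuous_on UNIV g" and ae: "AE a in lborel. f a = g a"
  shows "f a = g a"
proof -
  let ?S = "{a. f a \<noteq> g a}"
  have "open ?S"
    using f g by (intro open_Collect_neq)
  moreover have "negligible ?S"
  proof -
    have "?S \<in> null_sets lborel"
      using ae \<open>open ?S\<close> AE_iff_null[of lborel "\<lambda>a. f a = g a"] by simp
    then show ?thesis by (simp add: negligible_iff_null_sets null_sets_completionI)
  qed
  ultimately have "?S = {}" using open_not_negligible by blast
  then show ?thesis by auto
qed

text \<open>The value at the origin of a matrix coefficient is \<open>\<langle>g, h\<rangle>\<close>.\<close>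

lemma coefficient_proportional:
  assumes \<Omega>: "linear \<Omega>" and 1: "coefficient \<Omega> (c *\<^sub>C u) g h" and 2: "coefficient \<Omega> u g' h'"
  shows "cinner g h = c * cinner g' h'"
proof -
  have "AE a in lborel. cinner g (weyl a (\<Omega> a) h) = c * cinner g' (weyl a (\<Omega> a) h')"
    using 1[unfolded coefficient_def] 2[unfolded coefficient_def] rep_scaleC[of c u]
    by eventually_elim simp
  from continuous_AE_eq[OF continuous_coefficient[OF \<Omega>] continuous_on_mult_left[OF continuous_coefficient[OF \<Omega>]] this, of 0]
  show ?thesis using linear_0[OF \<Omega>] by simp
qed

lemma gaussian_coefficient:
  assumes \<Omega>: "linear \<Omega>"
  obtains u :: "(real ^ 'n::finite) L2" where "coefficient \<Omega> u (coh 0 0) (coh 0 0)"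
proof
  let ?f = "\<lambda>a. cinner (coh 0 0) (weyl a (\<Omega> a) (coh 0 0))"
  have [measurable]: "?f \<in> borel_measurable borel"
    by (rule borel_measurable_continuous_onI[OF continuous_coefficient[OF \<Omega>]])
  have "cmod (?f a) \<le> sqrt pi ^ DIM(real ^ 'n) * exp (- (1/4 * (a \<bullet> a)))" for a :: "real ^ 'n"
  proof -
    have "cmod (?f a) = sqrt pi ^ DIM(real ^ 'n) * (exp (- (a \<bullet> a) / 2) * exp ((a \<bullet> a - \<Omega> a \<bullet> \<Omega> a) / 4))"
      unfolding weyl_coh cinner_scaleC_right coh_gram norm_mult
      by (simp add: norm_mult norm_power)
    also have "exp (- (a \<bullet> a) / 2) * exp ((a \<bullet> a - \<Omega> a \<bullet> \<Omega> a) / 4) \<le> exp (- (1/4 * (a \<bullet> a)))"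
      unfolding exp_add[symmetric] by (simp add: field_simps)
    finally show ?thesis by simp
  qed
  then have "decays ?f" unfolding decays_def by (intro conjI exI[of _ "sqrt pi ^ DIM(real ^ 'n)"] exI[of _ "1/4"]) auto
  from rep_abs_L2[OF decays_square_integrable[OF this]]
  show "coefficient \<Omega> (abs_L2 ?f) (coh 0 0) (coh 0 0)" by (simp add: coefficient_def)
qed

lemma coh_0_norm: "cinner (coh 0 0) (coh 0 (0 :: 'a::euclidean_space)) \<noteq> 0"
  by (simp add: coh_gram)

context diagonalization
begin

lemma fop_add:
  assumes "bounded_borel F" "bounded_borel G" "bounded_borel (\<lambda>r. F r + G r)"
  shows "fop (\<lambda>r. F r + G r) u = fop F u + fop G u"
  unfolding fop_def
  by (simp add: mult_L2_add bounded_borel_comp assms unitary_add[OF unitary_inv[OF V]]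
      bounded_borel_comp[OF assms(3), simplified])

lemma fop_scale:
  assumes "bounded_borel F" "bounded_borel (\<lambda>r. c * F r)"
  shows "fop (\<lambda>r. c * F r) u = c *\<^sub>C fop F u"
  unfolding fop_def
  by (simp add: mult_L2_scale bounded_borel_comp assms unitary_scaleC[OF unitary_inv[OF V]]
      bounded_borel_comp[OF assms(2), simplified])

end

text \<open>Functions of \<open>x\<^sub>k\<close> act on the first vector of a matrix coefficient. For characters this is the
  composition law of the Weyl system, and trigonometric polynomials approximate.\<close>

lemma (in mixed_momentum) coefficient_left_fop:
  assumes \<Omega>: "skew \<Omega>" and \<Omega>k: "\<Omega> (s *\<^sub>R k) = l" and c: "coefficient \<Omega> u g h"
    and F: "continuous_on UNIV F" "\<And>r. cmod (F r) \<le> 1"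
  shows "coefficient \<Omega> (fop F u) (fop F g) h"
proof -
  have \<Omega>t: "\<Omega> ((t * s) *\<^sub>R k) = t *\<^sub>R l" for t
    using \<Omega> \<Omega>k linear_scale[of \<Omega> t "s *\<^sub>R k"] by (simp add: skew_def)
  have trig: "coefficient \<Omega> (fop G u) (fop G g) h" if "G \<in> trig" for G
    using that
  proof (induction rule: trig.induct)
    case (character t)
    show ?case unfolding fop_character using coefficient_left_weyl[OF \<Omega> c, of "(t * s) *\<^sub>R k"] by (simp add: \<Omega>t)
  next
    case (add F G)
    then show ?case
      by (simp add: fop_add trig_bounded_borel trig.add coefficient_add_left)
  next
    case (scale F c)
    then show ?case by (simp add: fop_scale trig_bounded_borel trig.scale coefficient_scale_left)
  qed
  obtain G where G: "\<And>n::nat. G n \<in> trig" "\<And>n r. cmod (G n r) \<le> 2" "\<And>r. (\<lambda>n. G n r) \<longlonglongrightarrow> F r"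
    using trig_approx[OF F] by blast
  have bF: "bounded_borel F"
    by (rule bounded_borelI[OF borel_measurable_continuous_onI[OF F(1)] F(2)])
  have l: "(\<lambda>n. fop (G n) v) \<longlonglongrightarrow> fop F v" for v
    by (rule fop_tendsto[OF trig_bounded_borel[OF G(1)] bF G(2,3)])
  show ?thesis by (rule coefficient_tendsto[OF trig[OF G(1)] l l tendsto_const])
qed

lemma coefficient_right_fop:
  assumes X: "mixed_momentum k l" and X': "mixed_momentum k (- l)"
    and \<Omega>: "skew \<Omega>" and \<Omega>k: "\<Omega> (s *\<^sub>R k) = l" and c: "coefficient \<Omega> u g h"
    and F: "continuous_on UNIV F" "\<And>r. cmod (F r) \<le> 1"
  shows "coefficient \<Omega> (diagonalization.fop (pft k) (mixed_momentum.\<mu> k (- l) s) (\<lambda>r. cnj (F r)) u) g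
    (diagonalization.fop (pft k) (mixed_momentum.\<mu> k l s) F h)"
proof -
  interpret X: mixed_momentum k l s by (rule X)
  interpret X': mixed_momentum k "- l" s by (rule X')
  have \<Omega>t: "\<Omega> ((t * s) *\<^sub>R k) = t *\<^sub>R l" for t
    using \<Omega> \<Omega>k linear_scale[of \<Omega> t "s *\<^sub>R k"] by (simp add: skew_def)
  have cb: "bounded_borel (\<lambda>r. cnj (G r))" if "bounded_borel G" for G :: "real \<Rightarrow> complex"
    by (rule bounded_borelE[OF that], rule bounded_borelI) auto
  have trig: "coefficient \<Omega> (X'.fop (\<lambda>r. cnj (G r)) u) g (X.fop G h)" if "G \<in> trig" for G
    using that
  proof (induction rule: trig.induct)
    case (character t)
    have "(\<lambda>r. cnj (exp (\<i> * of_real (t * r)))) = (\<lambda>r. exp (\<i> * of_real ((- t) * r)))"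
      by (simp add: exp_cnj)
    then show ?case unfolding X.fop_character
      using coefficient_right_weyl[OF \<Omega> c, of "(t * s) *\<^sub>R k"] X'.fop_character[of "- t" u] by (simp add: \<Omega>t)
  next
    case (add F G)
    have b: "bounded_borel (\<lambda>r. cnj (F r) + cnj (G r))"
      using cb[OF trig_bounded_borel[OF trig.add[OF add(1,2)]]] by simp
    show ?case
      using coefficient_add_right[OF add(3,4)] add(1,2)
      by (simp add: X.fop_add X'.fop_add trig_bounded_borel trig.add b cb)
  next
    case (scale F c)
    have b: "bounded_borel (\<lambda>r. cnj c * cnj (F r))"
      using cb[OF trig_bounded_borel[OF trig.scale[OF scale(1), of c]]] by simp
    show ?case using coefficient_scale_right[OF scale(2), of c] scale(1)
      by (simp add: X.fop_scale X'.fop_scale trig_bounded_borel trig.scale b cb)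
  qed
  obtain G where G: "\<And>n::nat. G n \<in> trig" "\<And>n r. cmod (G n r) \<le> 2" "\<And>r. (\<lambda>n. G n r) \<longlonglongrightarrow> F r"
    using trig_approx[OF F] by blast
  have bF: "bounded_borel F"
    by (rule bounded_borelI[OF borel_measurable_continuous_onI[OF F(1)] F(2)])
  have l: "(\<lambda>n. X.fop (G n) v) \<longlonglongrightarrow> X.fop F v" for v
    by (rule X.fop_tendsto[OF trig_bounded_borel[OF G(1)] bF G(2,3)])
  have l': "(\<lambda>n. X'.fop (\<lambda>r. cnj (G n r)) v) \<longlonglongrightarrow> X'.fop (\<lambda>r. cnj (F r)) v" for v
    by (rule X'.fop_tendsto[OF cb[OF trig_bounded_borel[OF G(1)]] cb[OF bF], where C = 2])
       (simp_all add: G(2) tendsto_cnj[OF G(3)])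
  show ?thesis by (rule coefficient_tendsto[OF trig[OF G(1)] l' tendsto_const l])
qed

section \<open>The quantum dilogarithm on the real line\<close>

definition qd_radius :: "real \<Rightarrow> real" where "qd_radius h = min 1 (1 / h) / 2"

definition qd_integrand :: "real \<Rightarrow> real \<Rightarrow> complex \<Rightarrow> complex" where
  "qd_integrand h z p = exp (- \<i> * p * of_real z) / (sinh (of_real pi * p) * sinh (of_real pi * of_real h * p)) / p"

definition qd_tail :: "real \<Rightarrow> real \<Rightarrow> complex" where
  "qd_tail h z = (LINT p:{qd_radius h..}|lborel. qd_integrand h z (of_real p))"

definition qd_arc :: "real \<Rightarrow> real \<Rightarrow> complex" where
  "qd_arc h z = contour_integral (part_circlepath 0 (qd_radius h) pi 0) (qd_integrand h z)"

lemma qd_radius_pos: "h > 0 \<Longrightarrow> qd_radius h > 0"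
  by (simp add: qd_radius_def)

text \<open>The reflection \<open>p \<mapsto> - cnj p\<close> maps the contour to itself with the opposite orientation.\<close>

lemma cnj_sinh: "cnj (sinh p) = sinh (cnj p)"
  by (simp add: sinh_field_def exp_cnj)

lemma qd_integrand_reflect: "qd_integrand h z (- cnj p) = - cnj (qd_integrand h z p)"
  by (simp add: qd_integrand_def cnj_sinh exp_cnj)

lemma qdilog_eq: "qdilog h z = exp (- (1 / 4) * (- cnj (qd_tail h z) + qd_arc h z + qd_tail h z))"
proof -
  have "(LINT p:{..- qd_radius h}|lborel. qd_integrand h z (of_real p)) = (LINT p:{qd_radius h..}|lborel. qd_integrand h z (of_real (- p)))"
    by (subst set_integral_reflect) (rule arg_cong2[where f = "\<lambda>A f. set_lebesgue_integral lborel A f"], auto)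
  also have "\<dots> = (LINT p:{qd_radius h..}|lborel. - cnj (qd_integrand h z (of_real p)))"
    using qd_integrand_reflect[of h z "of_real p" for p] by simp
  also have "\<dots> = - cnj (qd_tail h z)"
    unfolding qd_tail_def set_lebesgue_integral_def
    by (subst Bochner_Integration.integral_cnj[symmetric], subst Bochner_Integration.integral_minus[symmetric])
       (auto intro!: Bochner_Integration.integral_cong simp: indicator_def)
  finally show ?thesis
    unfolding qdilog_def Let_def qd_radius_def[symmetric] qd_integrand_def[symmetric] qd_arc_def qd_tail_def
    by simp
qed

lemma sinh_nonzero:
  assumes "w \<noteq> 0" "cmod w < pi" shows "sinh w \<noteq> (0 :: complex)"
proof
  assume "sinh w = 0"
  then have "exp w = exp (- w)" by (simp add: sinh_field_def)
  then have "exp (2 * w) = 1" by (metis exp_add exp_minus_inverse mult_2)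
  then obtain n :: int where n: "Re (2 * w) = 0" "Im (2 * w) = of_int (2 * n) * pi"
    by (auto simp: exp_eq_1)
  then have w: "Re w = 0" "Im w = of_int n * pi" by auto
  have "n \<noteq> 0" using w assms(1) by (auto simp: complex_eq_iff)
  then have "1 \<le> \<bar>real_of_int n\<bar>" by linarith
  then have "pi \<le> \<bar>real_of_int n\<bar> * pi" by simp
  also have "\<dots> = \<bar>Im w\<bar>" using w by (simp add: abs_mult)
  also have "\<dots> \<le> cmod w" by (rule abs_Im_le_cmod)
  finally show False using assms(2) by simp
qed

lemma qd_denominator_nonzero:
  assumes h: "h > 0" and p: "cmod p = qd_radius h"
  shows "p \<noteq> 0" "sinh (of_real pi * p) \<noteq> 0" "sinh (of_real pi * of_real h * p) \<noteq> 0"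
proof -
  have r: "qd_radius h > 0" using qd_radius_pos[OF h] .
  then show p0: "p \<noteq> 0" using p by auto
  have r1: "qd_radius h < 1" "h * qd_radius h < 1"
    using h by (auto simp: qd_radius_def min_def field_simps)
  show "sinh (of_real pi * p) \<noteq> 0"
    by (rule sinh_nonzero) (use p0 p r1 in \<open>auto simp: norm_mult\<close>)
  have "pi * (h * qd_radius h) < pi * 1" by (rule mult_strict_left_mono[OF r1(2)]) simp
  then show "sinh (of_real pi * of_real h * p) \<noteq> 0"
    by (intro sinh_nonzero) (use p0 p h in \<open>auto simp: norm_mult mult.assoc\<close>)
qed

lemma part_circle_norm: "r > 0 \<Longrightarrow> cmod (part_circlepath 0 r a b x) = r"
  by (simp add: part_circlepath_def norm_mult)

lemma continuous_qd_arc_integrand: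
  assumes h: "h > 0"
  shows "continuous_on (UNIV \<times> cbox 0 1) (\<lambda>(z, x). qd_integrand h z (part_circlepath 0 (qd_radius h) a b x)
    * vector_derivative (part_circlepath 0 (qd_radius h) a b) (at x))"
proof -
  note nz = qd_denominator_nonzero[OF h part_circle_norm[OF qd_radius_pos[OF h]]]
  have c: "continuous_on UNIV (part_circlepath 0 (qd_radius h) a b)"
    unfolding part_circlepath_def linepath_def by (intro continuous_intros)
  have c2: "continuous_on A (\<lambda>p. part_circlepath 0 (qd_radius h) a b (snd p))" for A :: "(real \<times> real) set"
    by (rule continuous_on_compose2[OF c]) (auto intro!: continuous_intros)
  have s: "continuous_on A (\<lambda>p. sinh (f p))" if "continuous_on A f" for A :: "(real \<times> real) set" and f :: "_ \<Rightarrow> complex"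
    unfolding sinh_field_def using that by (intro continuous_intros) auto
  show ?thesis
    unfolding qd_integrand_def vector_derivative_part_circlepath case_prod_beta linepath_def
    by (intro continuous_intros c2 s) (use nz in auto)
qed

lemma continuous_qd_arc: assumes h: "h > 0" shows "continuous_on UNIV (qd_arc h)"
  unfolding qd_arc_def[abs_def] contour_integral_integral
  using integral_continuous_on_param[OF continuous_qd_arc_integrand[OF h, of pi 0]] by simp

lemma qd_arc_imaginary: assumes h: "h > 0" shows "Re (qd_arc h z) = 0"
proof -
  let ?r = "qd_radius h"
  let ?f = "\<lambda>x. qd_integrand h z (part_circlepath 0 ?r pi 0 x) * vector_derivative (part_circlepath 0 ?r pi 0) (at x)"
  have reflected: "qd_integrand h z (part_circlepath 0 ?r 0 pi x) * vector_derivative (part_circlepath 0 ?r 0 pi) (at x) = cnj (?f x)" for x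
  proof -
    define \<gamma> where "\<gamma> = part_circlepath 0 ?r pi 0 x"
    have g: "part_circlepath 0 ?r 0 pi x = - cnj \<gamma>"
    proof -
      have "cnj \<gamma> = of_real ?r * exp (- (\<i> * of_real ((1 - x) * pi)))"
        by (simp add: \<gamma>_def part_circlepath_def linepath_def exp_cnj)
      also have "- (\<i> * of_real ((1 - x) * pi)) = \<i> * of_real (x * pi) + - (\<i> * of_real pi)"
        by (simp add: algebra_simps)
      also have "exp \<dots> = - exp (\<i> * of_real (x * pi))"
        unfolding exp_add by (simp add: exp_minus)
      finally show ?thesis by (simp add: part_circlepath_def linepath_def)
    qed
    have d1: "vector_derivative (part_circlepath 0 ?r pi 0) (at x) = - \<i> * of_real pi * \<gamma>"
      unfolding vector_derivative_part_circlepath by (simp add: \<gamma>_def part_circlepath_def)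
    have d2: "vector_derivative (part_circlepath 0 ?r 0 pi) (at x) = \<i> * of_real pi * (- cnj \<gamma>)"
      unfolding g[symmetric] vector_derivative_part_circlepath by (simp add: part_circlepath_def)
    show ?thesis unfolding d1 d2 unfolding g \<gamma>_def[symmetric] qd_integrand_reflect by simp
  qed
  have "continuous_on {0..1} ?f"
  proof -
    have "continuous_on {0..1} (\<lambda>x. (\<lambda>(z, x). qd_integrand h z (part_circlepath 0 ?r pi 0 x)
      * vector_derivative (part_circlepath 0 ?r pi 0) (at x)) (z, x))"
      by (rule continuous_on_compose2[OF continuous_qd_arc_integrand[OF h, of pi 0]]) (auto intro!: continuous_intros)
    then show ?thesis by simp
  qed
  then have int: "?f integrable_on {0..1}" by (rule integrable_continuous_interval)
  have "- qd_arc h z = contour_integral (reversepath (part_circlepath 0 ?r pi 0)) (qd_integrand h z)"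
    unfolding qd_arc_def by (rule contour_integral_reversepath[symmetric]) simp
  also have "\<dots> = integral {0..1} (cnj \<circ> ?f)"
    unfolding reversepath_part_circlepath contour_integral_integral reflected by (simp add: o_def)
  also have "\<dots> = cnj (integral {0..1} ?f)"
    by (rule integral_linear[OF int bounded_linear_cnj])
  finally have "- qd_arc h z = cnj (qd_arc h z)"
    unfolding qd_arc_def contour_integral_integral .
  then show ?thesis by (simp add: complex_eq_iff)
qed

lemma norm_qdilog: "h > 0 \<Longrightarrow> cmod (qdilog h z) = 1"
  unfolding qdilog_eq by (simp add: qd_arc_imaginary)

lemma continuous_qd_tail: assumes h: "h > 0" shows "continuous_on UNIV (qd_tail h)"
proof -
  let ?r = "qd_radius h"
  have r: "?r > 0" by (rule qd_radius_pos[OF h])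
  define K where "K = 2 / (1 - exp (- 2 * pi * ?r)) / (sinh (pi * h * ?r) * ?r)"
  have K1: "1 - exp (- 2 * pi * ?r) > 0" using r by simp
  have s1: "sinh (pi * h * ?r) > 0" using r h by simp
  have norm_le: "cmod (qd_integrand h z (of_real p)) \<le> K * exp (- (p * pi))" if p: "p \<ge> ?r" for z p
  proof -
    have p0: "p > 0" using p r by simp
    have sr: "cmod (sinh (complex_of_real x)) = sinh x" if "x > 0" for x
    proof -
      have "sinh (complex_of_real x) = of_real (sinh x)" by (simp add: sinh_field_def flip: exp_of_real)
      then show ?thesis using that by simp
    qed
    have e: "cmod (exp (- \<i> * of_real p * of_real z)) = 1" by simp
    have "cmod (qd_integrand h z (of_real p)) = 1 / (sinh (pi * p) * sinh (pi * h * p)) / p"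
      unfolding qd_integrand_def norm_divide norm_mult[of "sinh _"] e
      using sr[of "pi * p"] sr[of "pi * h * p"] p0 h by simp
    also have "\<dots> = 1 / sinh (pi * p) * (1 / (sinh (pi * h * p) * p))" by simp
    also have "\<dots> \<le> (2 / (1 - exp (- 2 * pi * ?r)) * exp (- (p * pi))) * (1 / (sinh (pi * h * ?r) * ?r))"
    proof (rule mult_mono)
      have "sinh (pi * p) = exp (p * pi) * (1 - exp (- 2 * pi * p)) / 2"
        by (simp add: sinh_field_def exp_add[symmetric] algebra_simps)
      moreover have "exp (- 2 * pi * p) \<le> exp (- 2 * pi * ?r)" using p by simp
      ultimately have "exp (p * pi) * (1 - exp (- 2 * pi * ?r)) / 2 \<le> sinh (pi * p)" by simp
      then have "1 / sinh (pi * p) \<le> 1 / (exp (p * pi) * (1 - exp (- 2 * pi * ?r)) / 2)"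
        using K1 by (intro divide_left_mono) (auto intro!: mult_pos_pos simp: p0)
      also have "\<dots> = 2 / (1 - exp (- 2 * pi * ?r)) * exp (- (p * pi))"
        using K1 by (simp add: exp_minus field_simps)
      finally show "1 / sinh (pi * p) \<le> 2 / (1 - exp (- 2 * pi * ?r)) * exp (- (p * pi))" .
      have "sinh (pi * h * ?r) * ?r \<le> sinh (pi * h * p) * p"
        using p r h by (intro mult_mono) auto
      then show "1 / (sinh (pi * h * p) * p) \<le> 1 / (sinh (pi * h * ?r) * ?r)"
        using s1 r by (intro divide_left_mono) (auto intro!: mult_pos_pos simp: p0 h)
    qed (use K1 p0 h in \<open>auto intro!: divide_nonneg_nonneg\<close>)
    also have "\<dots> = K * exp (- (p * pi))" by (simp add: K_def)
    finally show ?thesis .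
  qed
  have wi: "integrable lborel (\<lambda>p. indicator {?r..} p *\<^sub>R (K * exp (- (p * pi))))"
  proof -
    have "set_integrable lborel {?r..} (\<lambda>p. exp (- (p * pi)))"
      by (rule set_integrable_subset[OF integrable_I0i_exp_mscale]) (use r in auto)
    then have "set_integrable lborel {?r..} (\<lambda>p. K * exp (- (p * pi)))" by (rule set_integrable_mult_right)
    then show ?thesis by (simp add: set_integrable_def)
  qed
  show ?thesis
  proof (rule continuous_on_sequentiallyI)
    fix Z z assume Z: "Z \<longlonglongrightarrow> (z :: real)"
    show "(\<lambda>n. qd_tail h (Z n)) \<longlonglongrightarrow> qd_tail h z"
      unfolding qd_tail_def set_lebesgue_integral_def
    proof (rule integral_dominated_convergence[OF _ _ wi])
      show "AE p in lborel. (\<lambda>n. indicat_real {?r..} p *\<^sub>R qd_integrand h (Z n) (of_real p)) \<longlonglongrightarrow> indicat_real {?r..} p *\<^sub>R qd_integrand h z (of_real p)"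
        unfolding qd_integrand_def divide_inverse
        by (intro AE_I2 tendsto_scaleR tendsto_const tendsto_exp tendsto_mult tendsto_of_real Z)
      show "AE p in lborel. norm (indicat_real {?r..} p *\<^sub>R qd_integrand h (Z n) (of_real p)) \<le> indicat_real {?r..} p *\<^sub>R (K * exp (- (p * pi)))" for n
        using norm_le by (intro AE_I2) (auto simp: indicator_def)
    qed (unfold qd_integrand_def sinh_field_def, measurable)
  qed
qed

lemma continuous_qdilog: assumes "h > 0" shows "continuous_on UNIV (qdilog h)"
  unfolding qdilog_eq[abs_def]
  by (intro continuous_intros continuous_qd_tail continuous_qd_arc assms continuous_on_cnj)

section \<open>Mutation of exchange matrices\<close>

definition half_sum :: "int \<Rightarrow> int \<Rightarrow> int" where
  "half_sum x p = (\<bar>x\<bar> * p + x * \<bar>p\<bar>) div 2"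

lemma half_sum_eq: "half_sum x p = max x 0 * p + x * max p 0 - x * p"
proof -
  have "\<bar>x\<bar> * p + x * \<bar>p\<bar> = 2 * (max x 0 * p + x * max p 0 - x * p)"
    by (auto simp: abs_if max_def algebra_simps)
  then show ?thesis by (simp add: half_sum_def)
qed

lemma half_sum_double: "2 * half_sum x p = \<bar>x\<bar> * p + x * \<bar>p\<bar>"
  by (auto simp: half_sum_eq abs_if max_def algebra_simps)

lemma half_sum_minus: "half_sum (- x) (- p) = - half_sum x p"
  by (auto simp: half_sum_eq max_def algebra_simps)

lemma half_sum_simps:
  "half_sum x 3 = 3 * max x 0" "half_sum x (- 3) = - 3 * max (- x) 0"
  "half_sum x 1 = max x 0" "half_sum x (- 1) = - max (- x) 0"
  "half_sum 3 x = 3 * max x 0" "half_sum (- 3) x = - 3 * max (- x) 0"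
  "half_sum 1 x = max x 0" "half_sum (- 1) x = - max (- x) 0"
  by (auto simp: half_sum_eq max_def)

definition mutate_matrix :: "'n \<Rightarrow> ('n \<Rightarrow> 'n \<Rightarrow> int) \<Rightarrow> 'n \<Rightarrow> 'n \<Rightarrow> int" where
  "mutate_matrix k e a b = (if a = k \<or> b = k then - e a b else e a b + half_sum (e a k) (e k b))"

lemma exch_mutate: "exch (mutate k \<Gamma>) = mutate_matrix k (exch \<Gamma>)"
  by (intro ext) (simp add: mutate_def mutate_matrix_def half_sum_def)

lemma symm_mutate [simp]: "symm (mutate k \<Gamma>) = symm \<Gamma>"
  by (simp add: mutate_def)

lemma mutate_matrix_minus: "mutate_matrix k (\<lambda>a b. - e a b) = (\<lambda>a b. - mutate_matrix k e a b)"
  by (intro ext) (simp add: mutate_matrix_def half_sum_minus)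

text \<open>The entries \<open>x, y\<close> of a row in the columns \<open>i, j\<close> change by piecewise linear maps. The plane
  falls into eight cones on which all of these are linear.\<close>

lemma octagon_rows:
  fixes x y :: int
  assumes "y1 = y + 3 * max x 0" "x2 = - x + max y1 0" "y3 = - y1 + 3 * max x2 0"
    and "x1' = x - max (- y) 0" "y2' = - y - 3 * max (- x1') 0" "x3' = - x1' - max (- y2') 0"
  shows "- x2 + max y3 0 = - x3' \<and> - y3 = - y2' - 3 * max (- x3') 0 \<and> 
     [max x 0, max y1 0, max x2 0, max y3 0, max y 0, max x1' 0, max y2' 0, max x3' 0] \<in>
     {[x, 3 * x + y, 2 * x + y, 3 * x + 2 * y, y, x, 0, 0],
      [0, y, - x + y, - 3 * x + 2 * y, y, 0, 0, 0],
      [0, 0, - x, - 3 * x - y, 0, 0, 0, 0],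
      [x, 0, 0, - 3 * x - y, 0, 0, 0, 0],
      [x, 3 * x + y, 0, 0, 0, 0, 0, 0],
      [x, 3 * x + y, 2 * x + y, 0, 0, 0, 0, 2 * x + y],
      [x, 3 * x + y, 2 * x + y, 3 * x + 2 * y, 0, 0, 3 * x + 2 * y, - x - y],
      [x, 3 * x + y, 2 * x + y, 3 * x + 2 * y, 0, x + y, - y, 0]}"
proof -
  consider "0 \<le> y" "0 \<le> x"
      | "0 \<le> - x" "0 \<le> y"
      | "0 \<le> - y" "0 \<le> - x"
      | "0 \<le> x" "0 \<le> - 3 * x - y"
      | "0 \<le> 3 * x + y" "0 \<le> - 2 * x - y"
      | "0 \<le> 2 * x + y" "0 \<le> - 3 * x - 2 * y"
      | "0 \<le> 3 * x + 2 * y" "0 \<le> - x - y"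
      | "0 \<le> x + y" "0 \<le> - y"
    by linarith
  then show ?thesis
    by cases (use assms in \<open>simp_all add: max_absorb1 max_absorb2\<close>)
qed

lemma octagon_columns:
  fixes p q :: int
  assumes "q1 = q - max (- p) 0" "p2 = - p - 3 * max (- q1) 0" "q3 = - q1 - max (- p2) 0"
    and "p1' = p + 3 * max q 0" "q2' = - q + max p1' 0" "p3' = - p1' + 3 * max q2' 0"
  shows "- p2 - 3 * max (- q3) 0 = - p3' \<and> - q3 = - q2' + max p3' 0 \<and>
     [max p 0, max q1 0, max p2 0, max q3 0, max q 0, max p1' 0, max q2' 0, max p3' 0] \<in>
     {[p, q, 0, 0, q, p + 3 * q, p + 2 * q, 2 * p + 3 * q],
      [0, p + q, - p, 0, q, p + 3 * q, p + 2 * q, 2 * p + 3 * q],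
      [0, 0, 2 * p + 3 * q, - p - q, q, p + 3 * q, p + 2 * q, 2 * p + 3 * q],
      [0, 0, 0, p + 2 * q, q, p + 3 * q, p + 2 * q, 0],
      [0, 0, 0, 0, q, p + 3 * q, 0, 0],
      [0, 0, 0, 0, q, 0, 0, - p - 3 * q],
      [0, 0, 0, 0, 0, 0, - q, - p - 3 * q],
      [p, 0, 0, 0, 0, p, p - q, 2 * p - 3 * q]}"
proof -
  consider "0 \<le> q" "0 \<le> p"
      | "0 \<le> - p" "0 \<le> p + q"
      | "0 \<le> - p - q" "0 \<le> 2 * p + 3 * q"
      | "0 \<le> - 2 * p - 3 * q" "0 \<le> p + 2 * q"
      | "0 \<le> - p - 2 * q" "0 \<le> p + 3 * q"
      | "0 \<le> - p - 3 * q" "0 \<le> q"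
      | "0 \<le> - q" "0 \<le> - p"
      | "0 \<le> p" "0 \<le> - q"
    by linarith
  then show ?thesis
    by cases (use assms in \<open>simp_all add: max_absorb1 max_absorb2\<close>)
qed

lemma octagon_entry:
  fixes x y p q w :: int
  assumes x: "y1 = y + 3 * max x 0" "x2 = - x + max y1 0" "y3 = - y1 + 3 * max x2 0"
    "x1' = x - max (- y) 0" "y2' = - y - 3 * max (- x1') 0" "x3' = - x1' - max (- y2') 0"
    and p: "q1 = q - max (- p) 0" "p2 = - p - 3 * max (- q1) 0" "q3 = - q1 - max (- p2) 0"
    "p1' = p + 3 * max q 0" "q2' = - q + max p1' 0" "p3' = - p1' + 3 * max q2' 0"
  shows "half_sum x p + half_sum y1 q1 + half_sum x2 p2 + half_sum y3 q3
    = half_sum y q + half_sum x1' p1' + half_sum y2' q2' + half_sum x3' p3'"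
proof -
  have neg: "max (- t) 0 = max t 0 - t" for t :: int by (simp add: max_def)
  define X0 X1 X2 X3 Y0 Y1 Y2 Y3 where X: "X0 = max x 0" "X1 = max y1 0" "X2 = max x2 0" "X3 = max y3 0"
    "Y0 = max y 0" "Y1 = max x1' 0" "Y2 = max y2' 0" "Y3 = max x3' 0"
  define P0 P1 P2 P3 Q0 Q1 Q2 Q3 where P: "P0 = max p 0" "P1 = max q1 0" "P2 = max p2 0" "P3 = max q3 0"
    "Q0 = max q 0" "Q1 = max p1' 0" "Q2 = max q2' 0" "Q3 = max p3' 0"
  note rows = octagon_rows[OF x, THEN conjunct2, THEN conjunct2, folded X, unfolded insert_iff empty_iff list.inject simp_thms]
  note columns = octagon_columns[OF p, THEN conjunct2, THEN conjunct2, folded P, unfolded insert_iff empty_iff list.inject simp_thms]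
  note X' = x[unfolded neg, folded X] and P' = p[unfolded neg, folded P]
  show ?thesis
    unfolding half_sum_eq X[symmetric] P[symmetric] unfolding X' P'
    using rows columns
    by (elim disjE conjE) (simp_all only: , simp_all add: algebra_simps)
qed

lemma mutate_matrix_octagon:
  assumes ij: "i \<noteq> j" and e: "e i j = 3" "e j i = -1" "e i i = 0" "e j j = 0"
  shows "mutate_matrix j (mutate_matrix i (mutate_matrix j (mutate_matrix i e)))
    = mutate_matrix i (mutate_matrix j (mutate_matrix i (mutate_matrix j e)))"
proof (intro ext)
  fix a b
  define l1 where "l1 = mutate_matrix i e"
  define l2 where "l2 = mutate_matrix j l1"
  define l3 where "l3 = mutate_matrix i l2"
  define l4 where "l4 = mutate_matrix j l3"
  define r1 where "r1 = mutate_matrix j e"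
  define r2 where "r2 = mutate_matrix i r1"
  define r3 where "r3 = mutate_matrix j r2"
  define r4 where "r4 = mutate_matrix i r3"
  note m = l1_def l2_def l3_def l4_def r1_def r2_def r3_def r4_def
  have corner: "l1 i j = -3" "l1 j i = 1" "l2 i j = 3" "l2 j i = -1" "l3 i j = -3" "l3 j i = 1" "l4 i j = 3" "l4 j i = -1"
    "r1 i j = -3" "r1 j i = 1" "r2 i j = 3" "r2 j i = -1" "r3 i j = -3" "r3 j i = 1" "r4 i j = 3" "r4 j i = -1"
    "l4 i i = 0" "l4 j j = 0" "r4 i i = 0" "r4 j j = 0"
    using ij e by (simp_all add: m mutate_matrix_def half_sum_eq)
  define x y y1 x2 y3 x1' y2' x3' where "x = e a i" and "y = e a j" and "y1 = y + 3 * max x 0"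
    and "x2 = - x + max y1 0" and "y3 = - y1 + 3 * max x2 0"
    and "x1' = x - max (- y) 0" and "y2' = - y - 3 * max (- x1') 0" and "x3' = - x1' - max (- y2') 0"
  note row = this
  define p q q1 p2 q3 p1' q2' p3' where "p = e i b" and "q = e j b" and "q1 = q - max (- p) 0"
    and "p2 = - p - 3 * max (- q1) 0" and "q3 = - q1 - max (- p2) 0"
    and "p1' = p + 3 * max q 0" and "q2' = - q + max p1' 0" and "p3' = - p1' + 3 * max q2' 0"
  note column = this
  have rowL: "l1 a i = - x" "l1 a j = y1" "l2 a i = x2" "l2 a j = - y1" "l3 a i = - x2" "l3 a j = y3"
      "l4 a i = - x2 + max y3 0" "l4 a j = - y3"
    and rowR: "r1 a j = - y" "r1 a i = x1'" "r2 a j = y2'" "r2 a i = - x1'" "r3 a j = - y2'" "r3 a i = x3'"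
      "r4 a j = - y2' - 3 * max (- x3') 0" "r4 a i = - x3'"
    if a: "a \<noteq> i" "a \<noteq> j"
  proof -
    note [simp] = mutate_matrix_def half_sum_simps e corner ij ij[symmetric] a
    show 1: "l1 a i = - x" "l1 a j = y1" by (simp_all add: row l1_def)
    show 2: "l2 a i = x2" "l2 a j = - y1" by (simp_all add: row(4) l2_def 1)
    show 3: "l3 a i = - x2" "l3 a j = y3" by (simp_all add: row(5) l3_def 2)
    show 4: "l4 a i = - x2 + max y3 0" "l4 a j = - y3" by (simp_all add: l4_def 3)
    show 5: "r1 a j = - y" "r1 a i = x1'" by (simp_all add: row r1_def)
    show 6: "r2 a j = y2'" "r2 a i = - x1'" by (simp_all add: row(7) r2_def 5)
    show 7: "r3 a j = - y2'" "r3 a i = x3'" by (simp_all add: row(8) r3_def 6)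
    show 8: "r4 a j = - y2' - 3 * max (- x3') 0" "r4 a i = - x3'" by (simp_all add: r4_def 7)
  qed
  have colL: "l1 i b = - p" "l1 j b = q1" "l2 i b = p2" "l2 j b = - q1" "l3 i b = - p2" "l3 j b = q3"
      "l4 i b = - p2 - 3 * max (- q3) 0" "l4 j b = - q3"
    and colR: "r1 j b = - q" "r1 i b = p1'" "r2 j b = q2'" "r2 i b = - p1'" "r3 j b = - q2'" "r3 i b = p3'"
      "r4 j b = - q2' + max p3' 0" "r4 i b = - p3'"
    if b: "b \<noteq> i" "b \<noteq> j"
  proof -
    note [simp] = mutate_matrix_def half_sum_simps e corner ij ij[symmetric] b
    show 1: "l1 i b = - p" "l1 j b = q1" by (simp_all add: column l1_def)
    show 2: "l2 i b = p2" "l2 j b = - q1" by (simp_all add: column(4) l2_def 1)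
    show 3: "l3 i b = - p2" "l3 j b = q3" by (simp_all add: column(5) l3_def 2)
    show 4: "l4 i b = - p2 - 3 * max (- q3) 0" "l4 j b = - q3" by (simp_all add: l4_def 3)
    show 5: "r1 j b = - q" "r1 i b = p1'" by (simp_all add: column r1_def)
    show 6: "r2 j b = q2'" "r2 i b = - p1'" by (simp_all add: column(7) r2_def 5)
    show 7: "r3 j b = - q2'" "r3 i b = p3'" by (simp_all add: column(8) r3_def 6)
    show 8: "r4 j b = - q2' + max p3' 0" "r4 i b = - p3'" by (simp_all add: r4_def 7)
  qed
  note rows = octagon_rows[OF row(3-8), THEN conjunct1] octagon_rows[OF row(3-8), THEN conjunct2, THEN conjunct1]
  note columns = octagon_columns[OF column(3-8), THEN conjunct1] octagon_columns[OF column(3-8), THEN conjunct2, THEN conjunct1]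
  have entry: "l4 a b = r4 a b" if ab: "a \<noteq> i" "a \<noteq> j" "b \<noteq> i" "b \<noteq> j"
  proof -
    have "l1 a b = e a b + half_sum x p" using ab by (simp add: l1_def mutate_matrix_def x_def p_def)
    moreover have "l2 a b = l1 a b + half_sum y1 q1" using ab by (simp add: l2_def mutate_matrix_def rowL colL)
    moreover have "l3 a b = l2 a b + half_sum x2 p2" using ab by (simp add: l3_def mutate_matrix_def rowL colL)
    moreover have "l4 a b = l3 a b + half_sum y3 q3" using ab by (simp add: l4_def mutate_matrix_def rowL colL)
    moreover have "r1 a b = e a b + half_sum y q" using ab by (simp add: r1_def mutate_matrix_def y_def q_def)
    moreover have "r2 a b = r1 a b + half_sum x1' p1'" using ab by (simp add: r2_def mutate_matrix_def rowR colR)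
    moreover have "r3 a b = r2 a b + half_sum y2' q2'" using ab by (simp add: r3_def mutate_matrix_def rowR colR)
    moreover have "r4 a b = r3 a b + half_sum x3' p3'" using ab by (simp add: r4_def mutate_matrix_def rowR colR)
    ultimately show ?thesis using octagon_entry[OF row(3-8) column(3-8)] by simp
  qed
  have "l4 a b = r4 a b"
  proof -
    consider "a \<noteq> i" "a \<noteq> j" "b \<noteq> i" "b \<noteq> j" | "a = i \<or> a = j" "b \<noteq> i" "b \<noteq> j"
      | "a \<noteq> i" "a \<noteq> j" "b = i \<or> b = j" | "a = i \<or> a = j" "b = i \<or> b = j"
      by blast
    then show ?thesis
    proof cases
      case 1 then show ?thesis by (rule entry)
    next
      case 2 then show ?thesis using colL(7,8) colR(7,8) columns by (elim disjE) simp_all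
    next
      case 3 then show ?thesis using rowL(7,8) rowR(7,8) rows by (elim disjE) simp_all
    next
      case 4 then show ?thesis using corner by (elim disjE) simp_all
    qed
  qed
  then show "mutate_matrix j (mutate_matrix i (mutate_matrix j (mutate_matrix i e))) a b
      = mutate_matrix i (mutate_matrix j (mutate_matrix i (mutate_matrix j e))) a b"
    by (simp only: m)
qed

section \<open>The skew form of a seed\<close>

definition skew_exch :: "'n seed \<Rightarrow> 'n \<Rightarrow> 'n \<Rightarrow> real" where
  "skew_exch \<Gamma> i j = real (symm \<Gamma> i) * real_of_int (exch \<Gamma> i j)"

lemma skew_exch_skew:
  assumes "D_seed \<Gamma>" shows "skew_exch \<Gamma> j i = - skew_exch \<Gamma> i j"
proof -
  have "real_of_int (exch \<Gamma> j i) * inverse (real (symm \<Gamma> i)) = - real_of_int (exch \<Gamma> i j) * inverse (real (symm \<Gamma> j))"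
    using assms by (simp only: D_seed_def)
  moreover have "real (symm \<Gamma> i) > 0" "real (symm \<Gamma> j) > 0" using assms by (simp_all add: D_seed_def)
  ultimately show ?thesis unfolding skew_exch_def
    by (simp add: divide_inverse[symmetric] divide_eq_eq)
qed

lemma exch_diag: assumes "D_seed \<Gamma>" shows "exch \<Gamma> k k = 0"
proof -
  have "symm \<Gamma> k > 0" using assms by (simp add: D_seed_def)
  then show ?thesis using skew_exch_skew[OF assms, of k k] by (simp add: skew_exch_def)
qed

lemma real_half_sum: "real_of_int (half_sum x p) = (\<bar>real_of_int x\<bar> * real_of_int p + real_of_int x * \<bar>real_of_int p\<bar>) / 2"
proof -
  have "real_of_int (2 * half_sum x p) = real_of_int (\<bar>x\<bar> * p + x * \<bar>p\<bar>)" by (simp only: half_sum_double)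
  then show ?thesis by simp
qed

lemma skew_exch_mutate:
  assumes D: "D_seed \<Gamma>"
  shows "skew_exch (mutate k \<Gamma>) i j = skew_exch \<Gamma> i j
     + (\<bar>skew_exch \<Gamma> k i\<bar> * skew_exch \<Gamma> k j - skew_exch \<Gamma> k i * \<bar>skew_exch \<Gamma> k j\<bar>) / (2 * real (symm \<Gamma> k))
     - (if i = k then 2 * skew_exch \<Gamma> k j else 0) + (if j = k then 2 * skew_exch \<Gamma> k i else 0)"
proof -
  have d: "real (symm \<Gamma> i) > 0" "real (symm \<Gamma> k) > 0" using D by (simp_all add: D_seed_def)
  have kk: "skew_exch \<Gamma> k k = 0" by (simp add: skew_exch_def exch_diag[OF D])
  show ?thesis
  proof (cases "i = k \<or> j = k")
    case True
    then show ?thesis using kk skew_exch_skew[OF D, of k i]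
      by (auto simp: skew_exch_def exch_mutate mutate_matrix_def)
  next
    case False
    have ik: "real_of_int (exch \<Gamma> i k) = - skew_exch \<Gamma> k i / real (symm \<Gamma> i)"
      using skew_exch_skew[OF D, of i k] d by (simp add: skew_exch_def field_simps)
    have kj: "real_of_int (exch \<Gamma> k j) = skew_exch \<Gamma> k j / real (symm \<Gamma> k)"
      using d by (simp add: skew_exch_def)
    have "skew_exch (mutate k \<Gamma>) i j = skew_exch \<Gamma> i j + real (symm \<Gamma> i) * real_of_int (half_sum (exch \<Gamma> i k) (exch \<Gamma> k j))"
      using False by (simp add: skew_exch_def exch_mutate mutate_matrix_def algebra_simps)
    also have "real (symm \<Gamma> i) * real_of_int (half_sum (exch \<Gamma> i k) (exch \<Gamma> k j))
        = (\<bar>skew_exch \<Gamma> k i\<bar> * skew_exch \<Gamma> k j - skew_exch \<Gamma> k i * \<bar>skew_exch \<Gamma> k j\<bar>) / (2 * real (symm \<Gamma> k))"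
      using d by (simp add: real_half_sum ik kj abs_divide abs_mult field_simps)
    finally show ?thesis using False by simp
  qed
qed

lemma D_seed_mutate: assumes D: "D_seed \<Gamma>" shows "D_seed (mutate k \<Gamma>)"
proof -
  have d: "symm \<Gamma> i > 0" for i using D by (simp add: D_seed_def)
  have "skew_exch (mutate k \<Gamma>) i j = - skew_exch (mutate k \<Gamma>) j i" for i j
  proof -
    have "x' + (A * b - a * B) / c - p + q = - (x + (B * a - b * A) / c - q + p)"
      if "x' = - x" for x x' A b a B c p q :: real
      using that by (simp add: diff_divide_distrib mult.commute)
    note flip = this
    show ?thesis unfolding skew_exch_mutate[OF D] by (rule flip[OF skew_exch_skew[OF D]])
  qed
  note skew = this
  have "real_of_int (exch (mutate k \<Gamma>) i j) * inverse (real (symm \<Gamma> j)) = - real_of_int (exch (mutate k \<Gamma>) j i) * inverse (real (symm \<Gamma> i))" for i j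
  proof -
    have "E * inverse t = - F * inverse r" if "r * E = - (t * F)" "r > 0" "t > 0" for E F r t :: real
    proof -
      have "E = - (t * F) / r" using that by (simp add: field_simps)
      then show ?thesis using that by (simp add: divide_inverse)
    qed
    note divided = this
    show ?thesis by (rule divided[OF skew[unfolded skew_exch_def symm_mutate]]) (rule d[folded of_nat_0_less_iff[where 'a = real]])+
  qed
  then show ?thesis unfolding D_seed_def symm_mutate using d by blast
qed

definition form :: "real \<Rightarrow> 'n::finite seed \<Rightarrow> real ^ 'n \<Rightarrow> real ^ 'n" where
  "form hbar \<Gamma> b = (\<chi> j. (\<Sum>i\<in>UNIV. skew_exch \<Gamma> i j * b $ i) / (pi * hbar))"

lemma form_inner: "form hbar \<Gamma> b \<bullet> a = (\<Sum>j\<in>UNIV. \<Sum>i\<in>UNIV. skew_exch \<Gamma> i j * b $ i * a $ j) / (pi * hbar)"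
  by (simp add: form_def inner_vec_def sum_distrib_right sum_divide_distrib)

lemma form_linear: "linear (form hbar \<Gamma>)"
  by (rule linearI) (simp_all add: form_def vec_eq_iff sum.distrib sum_distrib_left algebra_simps add_divide_distrib)

lemma form_skew: assumes D: "D_seed \<Gamma>" shows "skew (form hbar \<Gamma>)"
proof -
  have "(\<Sum>j\<in>UNIV. \<Sum>i\<in>UNIV. skew_exch \<Gamma> i j * b $ i * a $ j) = - (\<Sum>j\<in>UNIV. \<Sum>i\<in>UNIV. skew_exch \<Gamma> i j * a $ i * b $ j)" for a b
  proof -
    have "(\<Sum>j\<in>UNIV. \<Sum>i\<in>UNIV. skew_exch \<Gamma> i j * b $ i * a $ j) = (\<Sum>i\<in>UNIV. \<Sum>j\<in>UNIV. skew_exch \<Gamma> i j * b $ i * a $ j)"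
      by (rule sum.swap)
    also have "\<dots> = - (\<Sum>i\<in>UNIV. \<Sum>j\<in>UNIV. skew_exch \<Gamma> j i * a $ j * b $ i)"
      unfolding sum_negf[symmetric] using skew_exch_skew[OF D]
      by (intro sum.cong refl) (metis mult.assoc mult.commute mult_minus_left)
    finally show ?thesis .
  qed
  note swap = this
  show ?thesis
    unfolding skew_def
  proof (intro conjI allI form_linear)
    fix a b :: "real ^ 'a"
    show "form hbar \<Gamma> a \<bullet> b = - (form hbar \<Gamma> b \<bullet> a)"
      unfolding form_inner swap[of b a] by simp
  qed
qed

lemma exch_sums:
  fixes k :: "'n::finite" and \<Gamma> :: "'n seed" and a b :: "real ^ 'n"
  assumes D: "D_seed \<Gamma>"
  defines "E \<equiv> \<lambda>a::real^'n. \<Sum>j\<in>UNIV. skew_exch \<Gamma> k j * a $ j"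
    and "S \<equiv> \<lambda>a::real^'n. \<Sum>j\<in>UNIV. \<bar>skew_exch \<Gamma> k j\<bar> * a $ j"
    and "B \<equiv> \<lambda>(\<Gamma>::'n seed) (b::real^'n) (a::real^'n). \<Sum>j\<in>UNIV. \<Sum>i\<in>UNIV. skew_exch \<Gamma> i j * b $ i * a $ j"
  shows "mutate_coords k \<Gamma> a = a + (- 2 * a $ k + (S a - E a) / (2 * real (symm \<Gamma> k))) *\<^sub>R axis k 1"
    and "B (mutate k \<Gamma>) b a = B \<Gamma> b a + (S b * E a - E b * S a) / (2 * real (symm \<Gamma> k)) - 2 * b $ k * E a + 2 * a $ k * E b"
    and "form hbar \<Gamma> (axis k 1) \<bullet> a = E a / (pi * hbar)"
proof -
  have d: "real (symm \<Gamma> k) > 0" using D by (simp add: D_seed_def)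
  have "real_of_int (max (- exch \<Gamma> k j) 0) = (\<bar>skew_exch \<Gamma> k j\<bar> - skew_exch \<Gamma> k j) / (2 * real (symm \<Gamma> k))" for j
    using d by (simp add: skew_exch_def max_def abs_if mult_less_0_iff)
  then have "(\<Sum>j\<in>UNIV. real_of_int (max (- exch \<Gamma> k j) 0) * a $ j) = (\<Sum>j\<in>UNIV. (\<bar>skew_exch \<Gamma> k j\<bar> * a $ j - skew_exch \<Gamma> k j * a $ j) / (2 * real (symm \<Gamma> k)))"
    by (intro sum.cong refl) (simp add: left_diff_distrib)
  also have "\<dots> = (S a - E a) / (2 * real (symm \<Gamma> k))"
    by (simp only: S_def E_def sum_subtractf sum_divide_distrib[symmetric])
  finally have c: "(\<Sum>j\<in>UNIV. real_of_int (max (- exch \<Gamma> k j) 0) * a $ j) = (S a - E a) / (2 * real (symm \<Gamma> k))" .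
  show "mutate_coords k \<Gamma> a = a + (- 2 * a $ k + (S a - E a) / (2 * real (symm \<Gamma> k))) *\<^sub>R axis k 1"
    unfolding mutate_coords_def c by (auto simp: vec_eq_iff axis_def)
  have "B (mutate k \<Gamma>) b a = (\<Sum>j\<in>UNIV. \<Sum>i\<in>UNIV. skew_exch \<Gamma> i j * b $ i * a $ j
      + (\<bar>skew_exch \<Gamma> k i\<bar> * b $ i * (skew_exch \<Gamma> k j * a $ j) - skew_exch \<Gamma> k i * b $ i * (\<bar>skew_exch \<Gamma> k j\<bar> * a $ j)) / (2 * real (symm \<Gamma> k))
      - (if i = k then 2 * b $ k * (skew_exch \<Gamma> k j * a $ j) else 0) + (if j = k then 2 * a $ k * (skew_exch \<Gamma> k i * b $ i) else 0))"
    unfolding B_def skew_exch_mutate[OF D]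
    by (intro sum.cong refl) (simp add: algebra_simps add_divide_distrib diff_divide_distrib)
  also have "\<dots> = B \<Gamma> b a + (S b * E a - E b * S a) / (2 * real (symm \<Gamma> k)) - 2 * b $ k * E a + 2 * a $ k * E b"
  proof -
    have "(\<Sum>j\<in>UNIV. \<Sum>i\<in>UNIV. F i * G j) = sum F UNIV * sum G UNIV" for F G :: "'n \<Rightarrow> real"
      by (simp add: sum_product sum.swap[of "\<lambda>i j. F i * G j"])
    moreover have "(\<Sum>j\<in>UNIV. \<Sum>i\<in>UNIV. (if i = k then 2 * b $ k * (skew_exch \<Gamma> k j * a $ j) else 0)) = 2 * b $ k * E a"
      by (simp add: E_def sum_distrib_left)
    moreover have "(\<Sum>j\<in>UNIV. \<Sum>i\<in>UNIV. (if j = k then 2 * a $ k * (skew_exch \<Gamma> k i * b $ i) else 0)) = 2 * a $ k * E b"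
      by (subst sum.swap) (simp add: E_def sum_distrib_left)
    ultimately show ?thesis
      by (simp only: sum.distrib sum_subtractf sum_divide_distrib[symmetric] B_def E_def S_def)
  qed
  finally show "B (mutate k \<Gamma>) b a = B \<Gamma> b a + (S b * E a - E b * S a) / (2 * real (symm \<Gamma> k)) - 2 * b $ k * E a + 2 * a $ k * E b" .
  have "(\<Sum>i\<in>UNIV. skew_exch \<Gamma> i j * axis k 1 $ i * a $ j) = skew_exch \<Gamma> k j * a $ j" for j
  proof -
    have "(\<Sum>i\<in>UNIV. skew_exch \<Gamma> i j * axis k 1 $ i * a $ j) = (\<Sum>i\<in>UNIV. if i = k then skew_exch \<Gamma> k j * a $ j else 0)"
      by (rule sum.cong) (auto simp: axis_def)
    then show ?thesis by simp
  qed
  then show "form hbar \<Gamma> (axis k 1) \<bullet> a = E a / (pi * hbar)"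
    by (simp add: form_inner E_def)
qed

text \<open>Mutation preserves the skew form.\<close>

lemma form_mutate:
  fixes k :: "'n::finite" and \<Gamma> :: "'n seed" and a b :: "real ^ 'n"
  assumes D: "D_seed \<Gamma>"
  shows "form hbar (mutate k \<Gamma>) (mutate_coords k \<Gamma> b) \<bullet> mutate_coords k \<Gamma> a = form hbar \<Gamma> b \<bullet> a"
proof -
  define E where "E a = (\<Sum>j\<in>UNIV. skew_exch \<Gamma> k j * a $ j)" for a :: "real ^ 'n"
  define S where "S a = (\<Sum>j\<in>UNIV. \<bar>skew_exch \<Gamma> k j\<bar> * a $ j)" for a :: "real ^ 'n"
  define t where "t a = - (2 * a $ k) + (S a - E a) / (2 * real (symm \<Gamma> k))" for a :: "real ^ 'n"
  let ?f = "form hbar (mutate k \<Gamma>)" and ?e = "axis k 1 :: real ^ 'n"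
  note sums = exch_sums[OF D, where k = k, folded E_def S_def]
  have phi: "mutate_coords k \<Gamma> a = a + t a *\<^sub>R ?e" for a by (simp add: sums(1) t_def)
  have sk: "skew ?f" by (rule form_skew[OF D_seed_mutate[OF D]])
  have ek: "?f ?e \<bullet> a = - E a / (pi * hbar)" for a
  proof -
    have "skew_exch (mutate k \<Gamma>) k j = - skew_exch \<Gamma> k j" for j by (simp add: skew_exch_def exch_mutate mutate_matrix_def)
    then show ?thesis using exch_sums(3)[OF D_seed_mutate[OF D], where hbar = hbar and k = k and a = a] by (simp add: E_def sum_negf)
  qed
  have ke: "?f b \<bullet> ?e = E b / (pi * hbar)" for b
  proof -
    have "?f b \<bullet> ?e = - (?f ?e \<bullet> b)" using sk unfolding skew_def by blast
    then show ?thesis by (simp add: ek)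
  qed
  have "?f (mutate_coords k \<Gamma> b) \<bullet> mutate_coords k \<Gamma> a = ?f b \<bullet> a + t a * (?f b \<bullet> ?e) + t b * (?f ?e \<bullet> a)"
    using linear_add[OF form_linear[of hbar "mutate k \<Gamma>"]] linear_scale[OF form_linear[of hbar "mutate k \<Gamma>"]] skew_diag[OF sk, of ?e]
    by (simp add: phi inner_add_left inner_add_right)
  also have "\<dots> = (form hbar \<Gamma> b \<bullet> a) + (S b * E a - E b * S a) / (2 * real (symm \<Gamma> k)) / (pi * hbar)
      - 2 * b $ k * E a / (pi * hbar) + 2 * a $ k * E b / (pi * hbar) + t a * E b / (pi * hbar) - t b * E a / (pi * hbar)"
    unfolding ek ke unfolding form_inner sums(2) by (simp add: add_divide_distrib diff_divide_distrib)
  also have "\<dots> = form hbar \<Gamma> b \<bullet> a"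
    unfolding t_def by (simp add: add_divide_distrib diff_divide_distrib algebra_simps)
  finally show ?thesis .
qed

lemma mutate_coords_linear: "linear (mutate_coords k \<Gamma>)"
  by (rule linearI) (auto simp: mutate_coords_def vec_eq_iff sum.distrib sum_distrib_left algebra_simps)

lemma mutate_coords_involution:
  assumes D: "D_seed \<Gamma>" shows "mutate_coords k \<Gamma> (mutate_coords k \<Gamma> a) = a"
proof -
  have "(\<Sum>j\<in>UNIV. real_of_int (max (- exch \<Gamma> k j) 0) * mutate_coords k \<Gamma> a $ j) = (\<Sum>j\<in>UNIV. real_of_int (max (- exch \<Gamma> k j) 0) * a $ j)"
    by (rule sum.cong[OF refl]) (simp add: mutate_coords_def exch_diag[OF D])
  then show ?thesis unfolding mutate_coords_def[of k \<Gamma> "mutate_coords k \<Gamma> a"]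
    by (auto simp: vec_eq_iff) (auto simp: mutate_coords_def)
qed

section \<open>Linear changes of coordinates\<close>

definition pullback :: "('a::euclidean_space \<Rightarrow> 'a) \<Rightarrow> 'a L2 \<Rightarrow> 'a L2" where
  "pullback \<phi> u = abs_L2 (\<lambda>a. rep_L2 u (\<phi> a))"

locale linear_involution =
  fixes \<phi> :: "'a::euclidean_space \<Rightarrow> 'a"
  assumes lin: "linear \<phi>" and inv: "\<phi> (\<phi> a) = a"
begin

lemma borel_\<phi>: "\<phi> \<in> borel_measurable borel"
  using lin by (intro borel_measurable_continuous_onI linear_continuous_on linear_conv_bounded_linear[THEN iffD1])

text \<open>The image of Lebesgue measure is translation invariant, hence a multiple of Lebesgue measure
  by the usual double integral. The factor squares to one because \<open>\<phi>\<close> is an involution.\<close>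

lemma distr_lborel: "distr lborel borel \<phi> = lborel"
proof -
  note [measurable] = borel_\<phi>
  have shift: "(\<integral>\<^sup>+x. f (b + x) \<partial>lborel) = (\<integral>\<^sup>+x. f x \<partial>lborel)" if [measurable]: "f \<in> borel_measurable borel" for f :: "'a \<Rightarrow> ennreal" and b
    using nn_integral_distr[of "(+) b" lborel borel f] by (simp add: lborel_distr_plus)
  have reflect: "(\<integral>\<^sup>+x. f (b - x) \<partial>lborel) = (\<integral>\<^sup>+x. f x \<partial>lborel)" if [measurable]: "f \<in> borel_measurable borel" for f :: "'a \<Rightarrow> ennreal" and b
  proof -
    have "lborel = distr lborel borel (\<lambda>x. b - x)"
      using lborel_affine[of "-1" b] by (simp add: density_1)
    then have "(\<integral>\<^sup>+x. f x \<partial>lborel) = (\<integral>\<^sup>+x. f x \<partial>distr lborel borel (\<lambda>x. b - x))" by (rule arg_cong)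
    then show ?thesis by (simp add: nn_integral_distr)
  qed
  have swap: "(\<integral>\<^sup>+x. f (\<phi> x) \<partial>lborel) * (\<integral>\<^sup>+x. g x \<partial>lborel) = (\<integral>\<^sup>+x. g (\<phi> x) \<partial>lborel) * (\<integral>\<^sup>+x. f x \<partial>lborel)"
    if [measurable]: "f \<in> borel_measurable borel" "g \<in> borel_measurable borel" for f g :: "'a \<Rightarrow> ennreal"
  proof -
    have "(\<integral>\<^sup>+x. f (\<phi> x) \<partial>lborel) * (\<integral>\<^sup>+x. g x \<partial>lborel) = (\<integral>\<^sup>+x. f (\<phi> x) * (\<integral>\<^sup>+y. g (\<phi> x + y) \<partial>lborel) \<partial>lborel)"
      by (simp add: shift nn_integral_multc)
    also have "\<dots> = (\<integral>\<^sup>+x. (\<integral>\<^sup>+y. f (\<phi> x) * g (\<phi> x + y) \<partial>lborel) \<partial>lborel)"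
      by (simp add: nn_integral_cmult)
    also have "\<dots> = (\<integral>\<^sup>+y. (\<integral>\<^sup>+x. f (\<phi> x) * g (\<phi> x + y) \<partial>lborel) \<partial>lborel)"
      by (rule lborel_pair.Fubini') measurable
    also have "\<dots> = (\<integral>\<^sup>+y. (\<integral>\<^sup>+x. f (\<phi> (- \<phi> y + x)) * g (\<phi> (- \<phi> y + x) + y) \<partial>lborel) \<partial>lborel)"
      by (rule nn_integral_cong, rule shift[symmetric]) measurable
    also have "\<dots> = (\<integral>\<^sup>+y. (\<integral>\<^sup>+x. f (\<phi> x - y) * g (\<phi> x) \<partial>lborel) \<partial>lborel)"
      by (simp add: linear_diff[OF lin] inv)
    also have "\<dots> = (\<integral>\<^sup>+x. (\<integral>\<^sup>+y. f (\<phi> x - y) * g (\<phi> x) \<partial>lborel) \<partial>lborel)"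
      by (rule lborel_pair.Fubini') measurable
    also have "\<dots> = (\<integral>\<^sup>+x. g (\<phi> x) \<partial>lborel) * (\<integral>\<^sup>+x. f x \<partial>lborel)"
      by (simp add: mult.commute[of "f _"] nn_integral_cmult nn_integral_multc reflect)
    finally show ?thesis .
  qed
  define B where "B = (box 0 (\<Sum>Basis) :: 'a set)"
  have B [measurable]: "B \<in> sets borel" by (simp add: B_def)
  have B1: "(\<integral>\<^sup>+x. indicator B x \<partial>lborel) = 1"
    by (simp add: B_def emeasure_lborel_box_eq inner_sum_left inner_Basis)
  define c where "c = (\<integral>\<^sup>+x. indicator B (\<phi> x) \<partial>lborel)"
  have f: "(\<integral>\<^sup>+x. f (\<phi> x) \<partial>lborel) = c * (\<integral>\<^sup>+x. f x \<partial>lborel)" if "f \<in> borel_measurable borel" for f :: "'a \<Rightarrow> ennreal"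
    using swap[OF that, of "indicator B"] by (simp add: B1 c_def)
  have "c * c = 1" using f[of "\<lambda>x. indicator B (\<phi> x)"] by (simp add: inv B1 c_def[symmetric])
  then have "c = 1"
    by (cases c) (auto simp: ennreal_mult[symmetric] ennreal_1[symmetric] square_eq_1_iff simp del: ennreal_1)
  show ?thesis
  proof (rule measure_eqI)
    fix A assume "A \<in> sets (distr lborel borel \<phi>)"
    then have A [measurable]: "A \<in> sets borel" by simp
    have "emeasure (distr lborel borel \<phi>) A = (\<integral>\<^sup>+x. indicator A x \<partial>distr lborel borel \<phi>)" by simp
    also have "\<dots> = (\<integral>\<^sup>+x. indicator A (\<phi> x) \<partial>lborel)" by (rule nn_integral_distr) measurable
    also have "\<dots> = emeasure lborel A" using f[of "indicator A"] \<open>c = 1\<close> by simp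
    finally show "emeasure (distr lborel borel \<phi>) A = emeasure lborel A" .
  qed simp
qed

lemma AE_\<phi>:
  assumes "AE a in lborel. P a" shows "AE a in lborel. P (\<phi> a)"
proof -
  obtain N where N: "N \<in> null_sets lborel" "{a. \<not> P a} \<subseteq> N" using assms by (auto simp: eventually_ae_filter)
  have "AE a in lborel. a \<notin> N" using N(1) by (rule AE_not_in)
  then have "AE a in distr lborel borel \<phi>. a \<notin> N" unfolding distr_lborel .
  then have "AE a in lborel. \<phi> a \<notin> N"
    by (subst (asm) AE_distr_iff) (use N(1) borel_\<phi> in auto)
  then show ?thesis by eventually_elim (use N(2) in auto)
qed

lemma integral_\<phi>:
  fixes f :: "'a \<Rightarrow> complex"
  assumes "f \<in> borel_measurable borel" shows "(\<integral>a. f (\<phi> a) \<partial>lborel) = (\<integral>a. f a \<partial>lborel)"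
proof -
  have "(\<integral>a. f (\<phi> a) \<partial>lborel) = (\<integral>a. f a \<partial>distr lborel borel \<phi>)"
    by (rule integral_distr[symmetric]) (use assms borel_\<phi> in auto)
  then show ?thesis by (simp only: distr_lborel)
qed

lemma square_integrable_\<phi>:
  assumes "square_integrable f" shows "square_integrable (\<lambda>a. f (\<phi> a))"
proof -
  have f: "f \<in> borel_measurable borel" "integrable lborel (\<lambda>a. (cmod (f a))\<^sup>2)" using assms by (auto simp: square_integrable_def)
  have "integrable (distr lborel borel \<phi>) (\<lambda>a. (cmod (f a))\<^sup>2)"
    using f(2) by (simp only: distr_lborel)
  then have "integrable lborel (\<lambda>a. (cmod (f (\<phi> a)))\<^sup>2)"
    by (rule integrable_distr[rotated]) (use borel_\<phi> in auto)
  moreover have "(\<lambda>a. f (\<phi> a)) \<in> borel_measurable borel" by (rule measurable_compose[OF borel_\<phi> f(1)])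
  ultimately show ?thesis by (simp add: square_integrable_def)
qed

lemma rep_pullback: "AE a in lborel. rep_L2 (pullback \<phi> u) a = rep_L2 u (\<phi> a)"
  unfolding pullback_def by (rule rep_abs_L2[OF square_integrable_\<phi>[OF square_integrable_rep]])

lemma cinner_pullback: "cinner (pullback \<phi> u) (pullback \<phi> v) = cinner u v"
proof -
  have m: "(\<lambda>a. rep_L2 u (\<phi> a)) \<in> borel_measurable borel" for u :: "'a L2"
    by (rule measurable_compose[OF borel_\<phi> measurable_rep_L2])
  have "cinner (pullback \<phi> u) (pullback \<phi> v) = (\<integral>a. rep_L2 u (\<phi> a) * cnj (rep_L2 v (\<phi> a)) \<partial>lborel)"
    by (rule cinner_eq_integral_AE[OF m m rep_pullback rep_pullback])
  also have "\<dots> = (\<integral>a. rep_L2 u a * cnj (rep_L2 v a) \<partial>lborel)"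
    by (rule integral_\<phi>) (intro borel_measurable_times measurable_rep_L2 measurable_compose[OF measurable_rep_L2 borel_measurable_continuous_onI[OF continuous_on_cnj[OF continuous_on_id]]])
  finally show ?thesis by (simp only: cinner_eq_integral)
qed

text \<open>A linear change of coordinates carrying one form to another carries the Weyl system of the
  first to that of the second, hence matrix coefficients to matrix coefficients.\<close>

lemma coefficient_pullback:
  assumes form: "\<And>a b. \<Omega>' (\<phi> b) \<bullet> \<phi> a = \<Omega> b \<bullet> a" and c: "coefficient \<Omega>' u g h"
  shows "coefficient \<Omega> (pullback \<phi> u) (pullback \<phi> g) (pullback \<phi> h)"
proof -
  have "pullback \<phi> (weyl (\<phi> b) (\<Omega>' (\<phi> b)) h) = weyl b (\<Omega> b) (pullback \<phi> h)" for b
  proof (rule weylI[OF rep_pullback, symmetric])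
    have "AE a in lborel. rep_L2 (weyl (\<phi> b) (\<Omega>' (\<phi> b)) h) (\<phi> a)
        = exp (- (\<i> * of_real (\<Omega>' (\<phi> b) \<bullet> \<phi> a))) * rep_L2 h (\<phi> a - \<phi> b)"
      by (rule AE_\<phi>[OF rep_weyl])
    then show "AE a in lborel. rep_L2 (pullback \<phi> (weyl (\<phi> b) (\<Omega>' (\<phi> b)) h)) a
        = exp (- (\<i> * of_real (\<Omega> b \<bullet> a))) * rep_L2 h (\<phi> (a - b))"
      using rep_pullback[of "weyl (\<phi> b) (\<Omega>' (\<phi> b)) h"] by eventually_elim (simp add: form linear_diff[OF lin])
  qed
  note weyl = this
  show ?thesis
    unfolding coefficient_def
    using rep_pullback[of u] AE_\<phi>[OF c[unfolded coefficient_def]]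
    by eventually_elim (simp add: weyl[symmetric] cinner_pullback)
qed

end

section \<open>The intertwiners preserve matrix coefficients\<close>

lemma K_linear_eq: "K_linear k \<Gamma> = pullback (mutate_coords k \<Gamma>)"
  by (rule ext) (simp add: K_linear_def pullback_def)

lemma form_axis:
  assumes D: "D_seed \<Gamma>" and hbar: "hbar > 0"
  shows "form hbar \<Gamma> ((pi * hbar / real (symm \<Gamma> k)) *\<^sub>R axis k 1) = (\<chi> j. real_of_int (exch \<Gamma> k j))"
proof -
  have d: "real (symm \<Gamma> k) > 0" using D by (simp add: D_seed_def)
  have "form hbar \<Gamma> (axis k 1) \<bullet> axis j 1 = skew_exch \<Gamma> k j / (pi * hbar)" for j
  proof -
    have "(\<Sum>i\<in>UNIV. skew_exch \<Gamma> k i * axis j 1 $ i) = (\<Sum>i\<in>UNIV. if i = j then skew_exch \<Gamma> k j else 0)"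
      by (rule sum.cong) (auto simp: axis_def)
    then show ?thesis using exch_sums(3)[OF D, where hbar = hbar and k = k and a = "axis j 1"] by simp
  qed
  then have "form hbar \<Gamma> (axis k 1) $ j = skew_exch \<Gamma> k j / (pi * hbar)" for j by (simp add: inner_axis)
  then show ?thesis
    using d hbar by (simp add: vec_eq_iff linear_scale[OF form_linear] skew_exch_def)
qed

lemma vector_exch_inner: "(\<chi> j. real_of_int (exch \<Gamma> k j)) \<bullet> a = (\<Sum>j\<in>UNIV. real_of_int (exch \<Gamma> k j) * a $ j)"
  by (simp add: inner_vec_def)

lemma K_intertwiner_coefficient:
  assumes D: "D_seed \<Gamma>" and hbar: "hbar > 0" and c: "coefficient (form hbar (mutate k \<Gamma>)) u g h"
  obtains g' h' where "coefficient (form hbar \<Gamma>) (K_intertwiner hbar k \<Gamma> u) g' h'" "cinner g' h' = cinner g h"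
proof -
  define d where "d = real (symm \<Gamma> k)"
  have d: "d > 0" using D by (simp add: D_seed_def d_def)
  define s where "s = pi * hbar / d"
  define l where "l = (\<chi> j. real_of_int (exch \<Gamma> k j))"
  define \<Phi> where "\<Phi> = qdilog (hbar / d)"
  have hd: "hbar / d > 0" using d hbar by simp
  have \<Phi>: "continuous_on UNIV \<Phi>" "cmod (\<Phi> r) = 1" for r
    unfolding \<Phi>_def using continuous_qdilog[OF hd] norm_qdilog[OF hd] by auto
  have \<Phi>b: "bounded_borel \<Phi>" "bounded_borel (\<lambda>r. cnj (\<Phi> r))"
    by (rule bounded_borelI[OF borel_measurable_continuous_onI, of _ 1]; simp add: \<Phi> continuous_on_cnj)+
  have l0: "l $ k = 0" by (simp add: l_def exch_diag[OF D])
  interpret X: coordinate_momentum k l s by standard (rule l0)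
  interpret XT: coordinate_momentum k "- l" s by standard (simp add: l0)
  have x: "sa_operator (x_op hbar \<Gamma> k) = X.A"
  proof (rule X.sa_operator_eq_A)
    fix f a
    show "x_op hbar \<Gamma> k f a = \<i> * of_real s * vector_derivative (\<lambda>t. f (a + t *\<^sub>R axis k 1)) (at 0) - of_real (l \<bullet> a) * f a"
      unfolding x_op_def p_op_def q_op_def l_def vector_exch_inner s_def d_def
      by (simp add: sum_distrib_left field_simps)
  qed
  have xt: "sa_operator (x_tilde_op hbar \<Gamma> k) = XT.A"
  proof (rule XT.sa_operator_eq_A)
    fix f a
    show "x_tilde_op hbar \<Gamma> k f a = \<i> * of_real s * vector_derivative (\<lambda>t. f (a + t *\<^sub>R axis k 1)) (at 0) - of_real ((- l) \<bullet> a) * f a"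
      unfolding x_tilde_op_def p_op_def q_op_def inner_minus_left l_def vector_exch_inner s_def d_def
      by (simp add: sum_distrib_left field_simps)
  qed
  have "XT.fop (\<lambda>r. cnj (\<Phi> r)) (XT.fop \<Phi> u) = u" "XT.fop \<Phi> (XT.fop (\<lambda>r. cnj (\<Phi> r)) u) = u" for u
    using \<Phi>(2) by (simp_all add: XT.fop_fop \<Phi>b complex_norm_square[symmetric] mult.commute[of "cnj _"])
  then have inv: "inv (XT.fop \<Phi>) = XT.fop (\<lambda>r. cnj (\<Phi> r))"
    by (intro inv_equality)
  have K: "K_intertwiner hbar k \<Gamma> u = X.fop \<Phi> (XT.fop (\<lambda>r. cnj (\<Phi> r)) (pullback (mutate_coords k \<Gamma>) u))"
    unfolding K_intertwiner_def Let_def x xt d_def[symmetric] \<Phi>_def[symmetric] X.bounded_functional_calculus_A[OF \<Phi>b(1)]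
      XT.bounded_functional_calculus_A[OF \<Phi>b(1)] inv K_linear_eq by simp
  interpret L: linear_involution "mutate_coords k \<Gamma>"
    by (rule linear_involution.intro[OF mutate_coords_linear mutate_coords_involution[OF D]])
  let ?L = "pullback (mutate_coords k \<Gamma>)" and ?\<Omega> = "form hbar \<Gamma>"
  have \<Omega>: "skew ?\<Omega>" by (rule form_skew[OF D])
  have \<Omega>k: "?\<Omega> (s *\<^sub>R axis k 1) = l" unfolding s_def d_def l_def by (rule form_axis[OF D hbar])
  have \<Phi>1: "cmod (\<Phi> r) \<le> 1" for r by (simp add: \<Phi>(2))
  have "coefficient ?\<Omega> (?L u) (?L g) (?L h)"
    by (rule L.coefficient_pullback[OF form_mutate[OF D] c])
  from coefficient_right_fop[OF X.mixed_momentum_axioms XT.mixed_momentum_axioms \<Omega> \<Omega>k this \<Phi>(1) \<Phi>1]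
  have "coefficient ?\<Omega> (XT.fop (\<lambda>r. cnj (\<Phi> r)) (?L u)) (?L g) (X.fop \<Phi> (?L h))" .
  from X.coefficient_left_fop[OF \<Omega> \<Omega>k this \<Phi>(1) \<Phi>1]
  have "coefficient ?\<Omega> (K_intertwiner hbar k \<Gamma> u) (X.fop \<Phi> (?L g)) (X.fop \<Phi> (?L h))" unfolding K .
  moreover have "cinner (X.fop \<Phi> (?L g)) (X.fop \<Phi> (?L h)) = cinner g h"
    by (simp add: unitary_cinner[OF X.unitary_fop[OF bounded_borel_measurable[OF \<Phi>b(1)] \<Phi>(2)]] L.cinner_pullback)
  ultimately show thesis by (rule that)
qed

lemma K_intertwiner_word_coefficient:
  assumes hbar: "hbar > 0" and D: "D_seed \<Gamma>" and c: "coefficient (form hbar (mutate m (mutate l (mutate k (mutate j \<Gamma>))))) u g h"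
  obtains g' h' where "coefficient (form hbar \<Gamma>) ((K_intertwiner hbar j \<Gamma> \<circ> K_intertwiner hbar k (mutate j \<Gamma>) \<circ>
      K_intertwiner hbar l (mutate k (mutate j \<Gamma>)) \<circ> K_intertwiner hbar m (mutate l (mutate k (mutate j \<Gamma>)))) u) g' h'"
    "cinner g' h' = cinner g h"
proof -
  note D' = D D_seed_mutate[OF D] D_seed_mutate[OF D_seed_mutate[OF D]] D_seed_mutate[OF D_seed_mutate[OF D_seed_mutate[OF D]]]
  obtain g1 h1 where 1: "coefficient (form hbar (mutate l (mutate k (mutate j \<Gamma>)))) (K_intertwiner hbar m (mutate l (mutate k (mutate j \<Gamma>))) u) g1 h1"
      "cinner g1 h1 = cinner g h"
    by (rule K_intertwiner_coefficient[OF D'(4) hbar c])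
  obtain g2 h2 where 2: "coefficient (form hbar (mutate k (mutate j \<Gamma>))) (K_intertwiner hbar l (mutate k (mutate j \<Gamma>)) (K_intertwiner hbar m (mutate l (mutate k (mutate j \<Gamma>))) u)) g2 h2"
      "cinner g2 h2 = cinner g1 h1"
    by (rule K_intertwiner_coefficient[OF D'(3) hbar 1(1)])
  obtain g3 h3 where 3: "coefficient (form hbar (mutate j \<Gamma>)) (K_intertwiner hbar k (mutate j \<Gamma>) (K_intertwiner hbar l (mutate k (mutate j \<Gamma>)) (K_intertwiner hbar m (mutate l (mutate k (mutate j \<Gamma>))) u))) g3 h3"
      "cinner g3 h3 = cinner g2 h2"
    by (rule K_intertwiner_coefficient[OF D'(2) hbar 2(1)])
  obtain g4 h4 where 4: "coefficient (form hbar \<Gamma>) (K_intertwiner hbar j \<Gamma> (K_intertwiner hbar k (mutate j \<Gamma>) (K_intertwiner hbar l (mutate k (mutate j \<Gamma>)) (K_intertwiner hbar m (mutate l (mutate k (mutate j \<Gamma>))) u)))) g4 h4"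
      "cinner g4 h4 = cinner g3 h3"
    by (rule K_intertwiner_coefficient[OF D'(1) hbar 3(1)])
  show thesis by (rule that[of g4 h4]) (use 1 2 3 4 in simp_all)
qed

lemma mutate_octagon:
  assumes D: "D_seed \<Gamma>" and ij: "exch \<Gamma> i j = - 3 * exch \<Gamma> j i" "\<bar>exch \<Gamma> i j\<bar> = 3"
  shows "exch (mutate j (mutate i (mutate j (mutate i \<Gamma>)))) = exch (mutate i (mutate j (mutate i (mutate j \<Gamma>))))"
proof -
  let ?e = "exch \<Gamma>"
  have neq: "i \<noteq> j" using ij exch_diag[OF D, of i] by auto
  have diag: "?e i i = 0" "?e j j = 0" by (rule exch_diag[OF D])+
  consider "?e i j = 3" "?e j i = -1" | "?e i j = -3" "?e j i = 1" using ij by linarith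
  then have "mutate_matrix j (mutate_matrix i (mutate_matrix j (mutate_matrix i ?e)))
    = mutate_matrix i (mutate_matrix j (mutate_matrix i (mutate_matrix j ?e)))"
  proof cases
    case 1
    then show ?thesis using neq diag by (intro mutate_matrix_octagon)
  next
    case 2
    let ?n = "\<lambda>a b. - ?e a b"
    have "mutate_matrix j (mutate_matrix i (mutate_matrix j (mutate_matrix i ?n)))
      = mutate_matrix i (mutate_matrix j (mutate_matrix i (mutate_matrix j ?n)))"
      by (rule mutate_matrix_octagon) (use 2 neq diag in simp_all)
    then show ?thesis by (simp add: mutate_matrix_minus fun_eq_iff)
  qed
  then show ?thesis by (simp only: exch_mutate)
qed

theorem proposition139:
  fixes hbar :: real
    and \<Gamma>0 \<Gamma>1 \<Gamma>2 \<Gamma>3 \<Gamma>4 \<Gamma>5 \<Gamma>6 \<Gamma>7 :: "'n::finite seed"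
    and i j :: 'n
    and c :: complex
  assumes "hbar > 0" and "hbar \<notin> \<rat>"
    and "D_seed \<Gamma>0"
    and "exch \<Gamma>0 i j = - 3 * exch \<Gamma>0 j i" and "\<bar>exch \<Gamma>0 i j\<bar> = 3"
    and "\<Gamma>1 = mutate i \<Gamma>0" and "\<Gamma>2 = mutate j \<Gamma>1" and "\<Gamma>3 = mutate i \<Gamma>2" and "\<Gamma>4 = mutate j \<Gamma>3"
    and "\<Gamma>5 = mutate j \<Gamma>0" and "\<Gamma>6 = mutate i \<Gamma>5" and "\<Gamma>7 = mutate j \<Gamma>6"
    and "cmod c = 1"
    and "K_intertwiner hbar i \<Gamma>0 \<circ> K_intertwiner hbar j \<Gamma>1 \<circ> K_intertwiner hbar i \<Gamma>2 \<circ> K_intertwiner hbar j \<Gamma>3 =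
         (\<lambda>u. c *\<^sub>C
           (K_intertwiner hbar j \<Gamma>0 \<circ> K_intertwiner hbar i \<Gamma>5 \<circ> K_intertwiner hbar j \<Gamma>6 \<circ> K_intertwiner hbar i \<Gamma>7) u)"
  shows "c = 1"
proof -
  note D = \<open>D_seed \<Gamma>0\<close> and hbar = \<open>hbar > 0\<close>
  let ?g = "coh 0 (0 :: real ^ 'n)"
  let ?L = "mutate j (mutate i (mutate j (mutate i \<Gamma>0)))" and ?R = "mutate i (mutate j (mutate i (mutate j \<Gamma>0)))"
  obtain u where L: "coefficient (form hbar ?L) u ?g ?g"
    by (rule gaussian_coefficient[OF form_linear])
  have "exch ?L = exch ?R" by (rule mutate_octagon[OF D assms(4,5)])
  then have "form hbar ?L = form hbar ?R" by (intro ext) (simp add: form_def skew_exch_def)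
  with L have R: "coefficient (form hbar ?R) u ?g ?g" by simp
  obtain g h where gh: "coefficient (form hbar \<Gamma>0)
      ((K_intertwiner hbar i \<Gamma>0 \<circ> K_intertwiner hbar j \<Gamma>1 \<circ> K_intertwiner hbar i \<Gamma>2 \<circ> K_intertwiner hbar j \<Gamma>3) u) g h"
      "cinner g h = cinner ?g ?g"
    using K_intertwiner_word_coefficient[OF hbar D L] unfolding assms(6-9) by blast
  obtain g' h' where gh': "coefficient (form hbar \<Gamma>0)
      ((K_intertwiner hbar j \<Gamma>0 \<circ> K_intertwiner hbar i \<Gamma>5 \<circ> K_intertwiner hbar j \<Gamma>6 \<circ> K_intertwiner hbar i \<Gamma>7) u) g' h'"
      "cinner g' h' = cinner ?g ?g"
    using K_intertwiner_word_coefficient[OF hbar D R] unfolding assms(10-12) by blast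
  have "cinner ?g ?g = c * cinner ?g ?g"
    using coefficient_proportional[OF form_linear gh(1)[unfolded assms(14)] gh'(1)] gh(2) gh'(2) by simp
  then show "c = 1" using coh_0_norm[where 'a = "real ^ 'n"] by simp
qed

end
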